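(* Let $\beta>0$ be a real number, let $V(x)=|x|^\beta$ on $\mathbb{R}$, and let $q:\mathbb{R}\to\mathbb{R}$ be a compactly supported, piecewise Hölder continuous function (with positive exponent). For $\alpha\in\mathbb{R}$ let $T_\alpha=-\frac{d^2}{dx^2}+|x|^\beta+\alpha q(x)$ on $\mathbb{R}$. Then $q$ is bounded with compact support and, for every $\alpha\in\mathbb{R}$, $T_\alpha$ is bounded from below and has discrete spectrum $\lambda_1(\alpha)<\lambda_2(\alpha)<\dots<\lambda_k(\alpha)<\dots$ satisfying: (i) $\lambda_k(\alpha)=c\,k^{\tau}+o(k^{\tau})$ as $k\to\infty$, for some $c,\tau>0$; (ii) $\dfrac{\lambda_k(\alpha)}{\lambda_k(0)}=1+\mathcal{O}\left(k^{-1-\varepsilon}\right)$ as $k\to\infty$, for some $\varepsilon>0$.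
   Context: $T_\alpha$ is regarded as a self-adjoint operator in $L^2(\mathbb{R})$ (the limit-point case holds at $\pm\infty$). Piecewise Hölder continuous means that there is a finite partition of the (compact) support of $q$ into intervals on each of which $q$ is Hölder continuous with some exponent $>0$. *)

theory Defs
  imports "HOL-Analysis.Analysis" "HOL-Library.Landau_Symbols"
begin

text \<open>
  Elements of \<open>L\<^sup>2(\<real>)\<close> are represented by square integrable functions; two of them represent the
  same element iff they agree almost everywhere.
\<close>

definition L2 :: "(real \<Rightarrow> complex) set" where
  "L2 = {f \<in> borel_measurable lborel. integrable lborel (\<lambda>x. (norm (f x))\<^sup>2)}"

definition L2_inner :: "(real \<Rightarrow> complex) \<Rightarrow> (real \<Rightarrow> complex) \<Rightarrow> complex" where
  "L2_inner f g = (\<integral>x. f x * cnj (g x) \<partial>lborel)"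

definition L2_norm :: "(real \<Rightarrow> complex) \<Rightarrow> real" where
  "L2_norm f = sqrt (\<integral>x. (norm (f x))\<^sup>2 \<partial>lborel)"

text \<open>
  An unbounded operator \<open>T\<close> in \<open>L\<^sup>2(\<real>)\<close> is represented by its graph: \<open>(f, h) \<in> T\<close> means that
  \<open>f\<close> is in the domain of \<open>T\<close> and \<open>T f = h\<close> (almost everywhere).
\<close>

type_synonym L2_operator = "((real \<Rightarrow> complex) \<times> (real \<Rightarrow> complex)) set"

definition L2_adjoint :: "L2_operator \<Rightarrow> L2_operator" where
  "L2_adjoint T = {(g, k). g \<in> L2 \<and> k \<in> L2 \<and> (\<forall>(f, h) \<in> T. L2_inner h g = L2_inner f k)}"

text \<open>
  If \<open>T\<close> is the graph of an operator, i.e. \<open>f = 0\<close> a.e. and \<open>(f, h) \<in> T\<close> imply \<open>h = 0\<close> a.e., then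
  the equality below forces the domain of \<open>T\<close> to be dense: if \<open>g\<close> is orthogonal to the domain,
  then \<open>(0, g)\<close> is in the graph of the adjoint.
\<close>

definition self_adjoint :: "L2_operator \<Rightarrow> bool" where
  "self_adjoint T \<longleftrightarrow> L2_adjoint T = T"

text \<open>The real part is redundant for self-adjoint \<open>T\<close>, whose quadratic form is real.\<close>

definition bounded_from_below :: "L2_operator \<Rightarrow> bool" where
  "bounded_from_below T \<longleftrightarrow>
     (\<exists>m :: real. \<forall>(f, h) \<in> T. Re (L2_inner h f) \<ge> m * (L2_norm f)\<^sup>2)"

text \<open>
  \<open>z\<close> is in the resolvent set iff \<open>T - z\<close> maps the domain of \<open>T\<close> bijectively onto \<open>L\<^sup>2(\<real>)\<close> with
  bounded inverse; injectivity (up to null sets) is contained in the estimate.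
\<close>

definition resolvent_set :: "L2_operator \<Rightarrow> complex set" where
  "resolvent_set T = {z.
     (\<forall>g \<in> L2. \<exists>(f, h) \<in> T. AE x in lborel. h x - z * f x = g x) \<and>
     (\<exists>C :: real. \<forall>(f, h) \<in> T. L2_norm f \<le> C * L2_norm (\<lambda>x. h x - z * f x))}"

definition L2_spectrum :: "L2_operator \<Rightarrow> complex set" where
  "L2_spectrum T = - resolvent_set T"

definition eigenspace :: "L2_operator \<Rightarrow> complex \<Rightarrow> (real \<Rightarrow> complex) set" where
  "eigenspace T z = {f. \<exists>h. (f, h) \<in> T \<and> (AE x in lborel. h x = z * f x)}"

text \<open>
  \<open>has_multiplicity T z n\<close>: the eigenspace has dimension \<open>n\<close> as a subspace of \<open>L\<^sup>2(\<real>)\<close>, i.e. it has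
  a basis \<open>e 0, \<dots>, e (n - 1)\<close> modulo almost everywhere equality.
\<close>

definition has_multiplicity :: "L2_operator \<Rightarrow> complex \<Rightarrow> nat \<Rightarrow> bool" where
  "has_multiplicity T z n \<longleftrightarrow>
     (\<exists>e :: nat \<Rightarrow> real \<Rightarrow> complex.
        (\<forall>i<n. e i \<in> eigenspace T z) \<and>
        (\<forall>c :: nat \<Rightarrow> complex. (AE x in lborel. (\<Sum>i<n. c i * e i x) = 0) \<longrightarrow> (\<forall>i<n. c i = 0)) \<and>
        (\<forall>f \<in> eigenspace T z. \<exists>c :: nat \<Rightarrow> complex. AE x in lborel. f x = (\<Sum>i<n. c i * e i x)))"

definition has_discrete_spectrum :: "L2_operator \<Rightarrow> bool" where
  "has_discrete_spectrum T \<longleftrightarrow>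
     (\<forall>z \<in> L2_spectrum T. z isolated_in L2_spectrum T \<and> (\<exists>n>0. has_multiplicity T z n))"

text \<open>
  The sequence \<open>ev 1, ev 2, \<dots>\<close> lists the spectrum of \<open>T\<close>, every eigenvalue being repeated according
  to its multiplicity. The value \<open>ev 0\<close> is irrelevant.
\<close>

definition enumerates_spectrum :: "L2_operator \<Rightarrow> (nat \<Rightarrow> real) \<Rightarrow> bool" where
  "enumerates_spectrum T ev \<longleftrightarrow>
     L2_spectrum T = (\<lambda>k. complex_of_real (ev k)) ` {1..} \<and>
     (\<forall>k\<ge>1. finite {j \<in> {1..}. ev j = ev k} \<and>
            has_multiplicity T (complex_of_real (ev k)) (card {j \<in> {1..}. ev j = ev k}))"

text \<open>
  \<open>u\<close> is locally absolutely continuous with a.e. derivative \<open>v\<close>, i.e. an indefinite Lebesgue integral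
  of the locally integrable function \<open>v\<close>.
\<close>

definition has_ac_derivative :: "(real \<Rightarrow> complex) \<Rightarrow> (real \<Rightarrow> complex) \<Rightarrow> bool" where
  "has_ac_derivative u v \<longleftrightarrow>
     (\<forall>a b. a \<le> b \<longrightarrow>
        set_integrable lborel {a..b} v \<and> u b - u a = (LINT x:{a..b}|lborel. v x))"

text \<open>
  The maximal realisation of \<open>-d\<^sup>2/dx\<^sup>2 + Q\<close> in \<open>L\<^sup>2(\<real>)\<close>: its domain consists of those \<open>f \<in> L\<^sup>2(\<real>)\<close>
  for which \<open>f\<close> and \<open>f'\<close> are locally absolutely continuous (\<open>u\<close> being the continuous representative
  of \<open>f\<close>) and \<open>-f'' + Q f \<in> L\<^sup>2(\<real>)\<close>. In the limit-point case at both ends this is the unique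
  self-adjoint realisation.
\<close>

definition schroedinger :: "(real \<Rightarrow> real) \<Rightarrow> L2_operator" where
  "schroedinger Q = {(f, h). f \<in> L2 \<and> h \<in> L2 \<and>
     (\<exists>u u' u''. has_ac_derivative u u' \<and> has_ac_derivative u' u'' \<and>
        (AE x in lborel. f x = u x) \<and>
        (AE x in lborel. h x = - u'' x + complex_of_real (Q x) * u x))}"

definition T_op :: "real \<Rightarrow> (real \<Rightarrow> real) \<Rightarrow> real \<Rightarrow> L2_operator" where
  "T_op \<beta> q \<alpha> = schroedinger (\<lambda>x. \<bar>x\<bar> powr \<beta> + \<alpha> * q x)"

definition supp :: "(real \<Rightarrow> real) \<Rightarrow> real set" where
  "supp q = closure {x. q x \<noteq> 0}"

definition hoelder_on :: "real \<Rightarrow> real set \<Rightarrow> (real \<Rightarrow> real) \<Rightarrow> bool" where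
  "hoelder_on \<gamma> I q \<longleftrightarrow> (\<exists>C. \<forall>x\<in>I. \<forall>y\<in>I. \<bar>q x - q y\<bar> \<le> C * \<bar>x - y\<bar> powr \<gamma>)"

text \<open>The intervals may be open, half-open, closed or single points.\<close>

definition piecewise_hoelder :: "(real \<Rightarrow> real) \<Rightarrow> bool" where
  "piecewise_hoelder q \<longleftrightarrow>
     (\<exists>P. finite P \<and> partition_on (supp q) P \<and>
        (\<forall>I\<in>P. is_interval I \<and> (\<exists>\<gamma>>0. hoelder_on \<gamma> I q)))"

end

theory Submission
  imports Defs
begin

text \<open>
  Everything is reduced to the quadratic form of the operator. A solution of \<open>- u'' + Q u = h\<close> with
  \<open>u, h \<in> L\<^sup>2\<close> has finite energy, and variation of constants turns bounded energy into compactness;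
  hence the resolvent exists off the eigenvalues, which are simple and discrete. If \<open>H\<close> is the orthogonal
  complement of the eigenfunctions with eigenvalue at most \<open>\<Lambda>\<close>, the form is bounded below on \<open>H\<close> by a
  number greater than \<open>\<Lambda>\<close>; this yields the min-max principle in counting form. Comparing
  \<open>\<bar>x\<bar>\<^sup>\<beta>\<close> with constants on a grid scaled by \<open>\<Lambda>\<^sup>1\<^sup>/\<^sup>\<beta>\<close>
  gives Weyl's law. For (ii), the difference form of the Feynman-Hellmann formula bounds the
  slope of the \<open>k\<close>-th eigenvalue in \<open>\<alpha>\<close> by the mass of a normalised eigenfunction on the support of \<open>q\<close>, and this
  mass is of order \<open>\<Lambda>\<^sup>-\<^sup>1\<^sup>/\<^sup>\<beta>\<close>, since the eigenfunction spreads over the classically allowed region.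
\<close>

section \<open>Absolutely continuous functions\<close>

text \<open>Boundedness of \<open>q\<close> alone moves every eigenvalue by O(1) and hence changes
  the ratio in (ii) by O(k^(-\<tau>)) with \<tau> = 2\<beta>/(\<beta>+2), which does not suffice for
  \<beta> \<le> 2. The factor \<Lambda>^(-1/\<beta>) from the local mass improves the relative
  change to \<Lambda>^(-1-1/\<beta>); since \<Lambda> grows like k^\<tau> and \<tau>(1+1/\<beta>) =
  1 + \<tau>/2, this is (ii) with \<epsilon> = \<tau>/2. Only an upper bound of the slope enters, so
  differentiability of eigenvalues in \<alpha> is never established: a local Lipschitz estimate,
  with a factor 2 to spare, is patched together between 0 and \<alpha>. This is why the mass
  estimate has to be uniform over all couplings in between. No eigenfunction expansion is used
  either: the lower bound of the form on \<open>H\<close> is pushed upwards by finitely many steps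
  of fixed size. The Weyl constant is not evaluated; upper and lower Riemann sums enclose the ratio
  of k to the power of the eigenvalue in windows of width 3/n, so it is a Cauchy sequence.\<close>

lemma set_integral_Icc_split:
  fixes f :: "real \<Rightarrow> 'a::{banach, second_countable_topology}"
  assumes "set_integrable lborel {a..b} f" "a \<le> c" "c \<le> b"
  shows "(LINT x:{a..b}|lborel. f x) = (LINT x:{a..c}|lborel. f x) + (LINT x:{c..b}|lborel. f x)"
proof -
  have e: "{a..b} = {a..c} \<union> {c..b}" using assms by auto
  have i: "set_integrable lborel {a..c} f" "set_integrable lborel {c..b} f"
    using assms by (auto intro: set_integrable_subset)
  have "AE x in lborel. x \<noteq> c" by (rule AE_lborel_singleton)
  then have ae: "AE x in lborel. \<not> (x \<in> {a..c} \<and> x \<in> {c..b})"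
    by eventually_elim auto
  show ?thesis
    unfolding e by (rule set_integral_Un_AE[OF ae _ _ i]) auto
qed

text \<open>The fundamental theorem of calculus as a relation on one interval: \<open>v\<close> is
  an integrable density of \<open>u\<close>, not a pointwise derivative. For \<open>b < a\<close>
  the relation is trivially true, so \<open>has_ac_derivativeD\<close> needs no order
  assumption.\<close>

definition ac_on :: "real \<Rightarrow> real \<Rightarrow> (real \<Rightarrow> 'a::{banach, second_countable_topology}) \<Rightarrow> (real \<Rightarrow> 'a) \<Rightarrow> bool"
  where "ac_on a b u v \<longleftrightarrow> set_integrable lborel {a..b} v \<and>
    (\<forall>x\<in>{a..b}. (LINT t:{a..x}|lborel. v t) = u x - u a)"

lemma ac_on_integrable: "ac_on a b u v \<Longrightarrow> set_integrable lborel {a..b} v"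
  by (simp add: ac_on_def)

lemma ac_on_integral: "ac_on a b u v \<Longrightarrow> a \<le> b \<Longrightarrow> (LINT t:{a..b}|lborel. v t) = u b - u a"
  by (simp add: ac_on_def)

lemma ac_on_eq: "ac_on a b u v \<Longrightarrow> a \<le> x \<Longrightarrow> x \<le> b \<Longrightarrow> (LINT t:{a..x}|lborel. v t) = u x - u a"
  by (auto simp: ac_on_def)

lemma ac_on_subinterval:
  assumes "ac_on a b u v" "a \<le> c" "d \<le> b"
  shows "ac_on c d u v"
  unfolding ac_on_def
proof (intro conjI ballI)
  show "set_integrable lborel {c..d} v"
    using assms by (intro set_integrable_subset[OF ac_on_integrable[OF assms(1)]]) auto
  fix x assume x: "x \<in> {c..d}"
  have "set_integrable lborel {a..x} v"
    using assms x by (intro set_integrable_subset[OF ac_on_integrable[OF assms(1)]]) auto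
  from set_integral_Icc_split[OF this, of c] x assms ac_on_eq[OF assms(1), of x] ac_on_eq[OF assms(1), of c]
  show "(LINT t:{c..x}|lborel. v t) = u x - u c"
    by (simp add: algebra_simps)
qed

lemma ac_on_join:
  assumes "ac_on a c u v" "ac_on c b u v" "a \<le> c" "c \<le> b"
  shows "ac_on a b u v"
  unfolding ac_on_def
proof (intro conjI ballI)
  have e: "{a..b} = {a..c} \<union> {c..b}" using assms by auto
  show i: "set_integrable lborel {a..b} v"
    unfolding e using assms by (intro set_integrable_Un ac_on_integrable) auto
  fix x assume x: "x \<in> {a..b}"
  show "(LINT t:{a..x}|lborel. v t) = u x - u a"
  proof (cases "x \<le> c")
    case True
    then show ?thesis using assms(1) x by (auto simp: ac_on_def)
  next
    case False
    have "set_integrable lborel {a..x} v"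
      using x by (intro set_integrable_subset[OF i]) auto
    from set_integral_Icc_split[OF this, of c] False assms x
    show ?thesis by (auto simp: ac_on_def)
  qed
qed

lemma has_ac_derivative_iff_ac_on: "has_ac_derivative u v \<longleftrightarrow> (\<forall>a b. a \<le> b \<longrightarrow> ac_on a b u v)"
proof safe
  fix a b :: real
  assume *: "has_ac_derivative u v" and "a \<le> b"
  then show "ac_on a b u v"
    unfolding ac_on_def has_ac_derivative_def by auto
next
  assume *: "\<forall>a b. a \<le> b \<longrightarrow> ac_on a b u v"
  then show "has_ac_derivative u v"
    unfolding has_ac_derivative_def using ac_on_integrable ac_on_integral by metis
qed

lemma ac_on_cong:
  assumes "ac_on a b u v" "\<And>x. x \<in> {a..b} \<Longrightarrow> u x = u' x" "\<And>x. x \<in> {a..b} \<Longrightarrow> v x = v' x"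
  shows "ac_on a b u' v'"
proof (cases "a \<le> b")
  case True
  have "set_integrable lborel {a..b} v' \<longleftrightarrow> set_integrable lborel {a..b} v"
    using assms(3) by (intro set_integrable_cong) auto
  moreover have "(LINT t:{a..x}|lborel. v t) = (LINT t:{a..x}|lborel. v' t)" if "x \<in> {a..b}" for x
    using assms(3) that by (intro set_lebesgue_integral_cong) auto
  ultimately show ?thesis
    using assms(1,2) True by (auto simp: ac_on_def)
next
  case False
  then show ?thesis by (simp add: ac_on_def)
qed

lemma ac_on_bounded_linear:
  assumes "ac_on a b u v" "bounded_linear T"
  shows "ac_on a b (\<lambda>x. T (u x)) (\<lambda>x. T (v x))"
proof -
  interpret T: bounded_linear T by fact
  have i: "set_integrable lborel {a..x} v" if "x \<in> {a..b}" for x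
    using that by (intro set_integrable_subset[OF ac_on_integrable[OF assms(1)]]) auto
  have "set_integrable lborel {a..b} (\<lambda>x. T (v x))"
    using integrable_bounded_linear[OF assms(2), of lborel "\<lambda>x. indicator {a..b} x *\<^sub>R v x"] 
      ac_on_integrable[OF assms(1)] by (simp add: set_integrable_def T.scaleR)
  moreover have "(LINT t:{a..x}|lborel. T (v t)) = T (LINT t:{a..x}|lborel. v t)" if "x \<in> {a..b}" for x
    using integral_bounded_linear[OF assms(2), of lborel "\<lambda>t. indicator {a..x} t *\<^sub>R v t"] i[OF that]
    by (simp add: set_integrable_def set_lebesgue_integral_def T.scaleR)
  ultimately show ?thesis
    using assms(1) by (auto simp: ac_on_def T.diff)
qed

lemma ac_on_add:
  assumes "ac_on a b u v" "ac_on a b u' v'"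
  shows "ac_on a b (\<lambda>x. u x + u' x) (\<lambda>x. v x + v' x)"
proof -
  have "set_integrable lborel {a..x} v" "set_integrable lborel {a..x} v'" if "x \<in> {a..b}" for x
    using that assms by (auto intro: set_integrable_subset[OF ac_on_integrable])
  then show ?thesis
    using assms unfolding ac_on_def by auto
qed

lemma ac_on_minus: "ac_on a b u v \<Longrightarrow> ac_on a b (\<lambda>x. - u x) (\<lambda>x. - v x)"
  by (rule ac_on_bounded_linear) (auto intro: bounded_linear_minus bounded_linear_ident)

lemma ac_on_diff:
  assumes "ac_on a b u v" "ac_on a b u' v'"
  shows "ac_on a b (\<lambda>x. u x - u' x) (\<lambda>x. v x - v' x)"
  using ac_on_add[OF assms(1) ac_on_minus[OF assms(2)]] by simp

lemma ac_on_const: "ac_on a b (\<lambda>x. c) (\<lambda>x. 0)"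
  by (simp add: ac_on_def set_integrable_def)

lemma ac_on_cmult:
  fixes u :: "real \<Rightarrow> 'a::{banach, second_countable_topology, real_normed_algebra}"
  shows "ac_on a b u v \<Longrightarrow> ac_on a b (\<lambda>x. c * u x) (\<lambda>x. c * v x)"
  by (rule ac_on_bounded_linear) (auto intro: bounded_linear_mult_right)

lemma ac_on_cnj: "ac_on a b u v \<Longrightarrow> ac_on a b (\<lambda>x. cnj (u x)) (\<lambda>x. cnj (v x))"
  by (rule ac_on_bounded_linear) (auto intro: bounded_linear_cnj)

lemma ac_on_Re: "ac_on a b u v \<Longrightarrow> ac_on a b (\<lambda>x. Re (u x)) (\<lambda>x. Re (v x))"
  by (rule ac_on_bounded_linear) (auto intro: bounded_linear_Re)

lemma ac_on_of_real: "ac_on a b u v \<Longrightarrow> ac_on a b (\<lambda>x. complex_of_real (u x)) (\<lambda>x. of_real (v x))"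
  by (rule ac_on_bounded_linear) (auto intro: bounded_linear_of_real)

lemma ac_on_continuous:
  fixes u :: "real \<Rightarrow> 'a::euclidean_space"
  assumes "ac_on a b u v"
  shows "continuous_on {a..b} u"
proof -
  have i: "set_integrable lborel {a..x} v" if "x \<in> {a..b}" for x
    using that assms by (auto intro: set_integrable_subset[OF ac_on_integrable])
  have "v integrable_on {a..b}"
    using set_borel_integral_eq_integral(1)[OF ac_on_integrable[OF assms]] .
  then have "continuous_on {a..b} (\<lambda>x. u a + integral {a..x} v)"
    by (intro continuous_intros indefinite_integral_continuous_1)
  moreover have "u a + integral {a..x} v = u x" if "x \<in> {a..b}" for x
    using that set_borel_integral_eq_integral(2)[OF i[OF that]] ac_on_eq[OF assms, of x]
    by (metis add.commute diff_add_cancel atLeastAtMost_iff)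
  ultimately show ?thesis
    by (rule continuous_on_eq)
qed

lemma ac_on_C1:
  fixes F :: "real \<Rightarrow> 'a::euclidean_space"
  assumes "\<And>x. x \<in> {a..b} \<Longrightarrow> (F has_vector_derivative f x) (at x within {a..b})"
    and "continuous_on {a..b} f"
  shows "ac_on a b F f"
  unfolding ac_on_def
proof (intro conjI ballI)
  show "set_integrable lborel {a..b} f"
    using borel_integrable_compact[of "{a..b}" f] assms(2) by (simp add: set_integrable_def)
  fix x assume x: "x \<in> {a..b}"
  have "integral\<^sup>L lborel (\<lambda>t. indicator {a..x} t *\<^sub>R f t) = F x - F a"
  proof (rule integral_FTC_Icc)
    show "a \<le> x" using x by auto
    show "(F has_vector_derivative f t) (at t within {a..x})" if "a \<le> t" "t \<le> x" for t
      using assms(1)[of t] that x by (auto intro: has_vector_derivative_within_subset)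
    show "continuous_on {a..x} f"
      using assms(2) x by (auto intro: continuous_on_subset)
  qed
  then show "(LINT t:{a..x}|lborel. f t) = F x - F a"
    by (simp add: set_lebesgue_integral_def)
qed

lemma ac_on_mono:
  fixes u :: "real \<Rightarrow> real"
  assumes "ac_on a b u v" "a \<le> b" "\<And>x. x \<in> {a..b} \<Longrightarrow> v x \<ge> 0"
  shows "u a \<le> u b"
proof -
  have "0 \<le> (LINT t:{a..b}|lborel. v t)"
    unfolding set_lebesgue_integral_def using assms(3) 
    by (intro Bochner_Integration.integral_nonneg) (auto split: split_indicator)
  then show ?thesis using ac_on_integral[OF assms(1,2)] by simp
qed

section \<open>Products and integration by parts\<close>

lemma set_integrable_mult_continuous:
  fixes k w :: "real \<Rightarrow> 'a::{real_normed_field, euclidean_space}"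
  assumes k: "set_integrable lborel {a..b} k" and w: "continuous_on {a..b} w"
  shows "set_integrable lborel {a..b} (\<lambda>x. k x * w x)"
proof -
  have "compact (w ` {a..b})" using w by (intro compact_continuous_image) auto
  then obtain B where B: "\<And>x. x \<in> {a..b} \<Longrightarrow> norm (w x) \<le> B"
    by (meson compact_imp_bounded bounded_iff image_eqI)
  have m: "(\<lambda>x. indicator {a..b} x *\<^sub>R k x) \<in> borel_measurable lborel"
    using k by (auto simp: set_integrable_def)
  have m2: "(\<lambda>x. indicator {a..b} x *\<^sub>R w x) \<in> borel_measurable lborel"
    using w by (simp add: borel_measurable_continuous_on_indicator)
  have eq: "(\<lambda>x. indicator {a..b} x *\<^sub>R (k x * w x)) = (\<lambda>x. (indicator {a..b} x *\<^sub>R k x) * (indicator {a..b} x *\<^sub>R w x))"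
    by (auto simp: indicator_def)
  have "set_integrable lborel {a..b} (\<lambda>x. B *\<^sub>R k x)" using k by simp
  then show ?thesis
  proof (rule set_integrable_bound)
    show "set_borel_measurable lborel {a..b} (\<lambda>x. k x * w x)"
      unfolding set_borel_measurable_def eq using m m2 by (rule borel_measurable_times)
    show "AE x in lborel. x \<in> {a..b} \<longrightarrow> norm (k x * w x) \<le> norm (B *\<^sub>R k x)"
    proof (intro AE_I2 impI)
      fix x assume "x \<in> {a..b}"
      from B[OF this] show "norm (k x * w x) \<le> norm (B *\<^sub>R k x)"
        by (simp add: norm_mult mult.commute[of "norm (k x)"] mult_right_mono)
    qed
  qed
qed

lemma integrable_pair_mult:
  fixes f g :: "real \<Rightarrow> 'a::{real_normed_field, euclidean_space}"
  assumes f: "integrable lborel f" and g: "integrable lborel g"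
  shows "integrable (lborel \<Otimes>\<^sub>M lborel) (\<lambda>(x, y). f x * g y)"
proof -
  have [measurable]: "f \<in> borel_measurable borel" "g \<in> borel_measurable borel"
    using borel_measurable_integrable[OF f] borel_measurable_integrable[OF g] by simp_all
  show ?thesis
    by (rule lborel_pair.Fubini_integrable)
      (auto simp: norm_mult intro!: integrable_mult_left integrable_mult_right integrable_norm f g)
qed

text \<open>Fubini for \<open>u' x * v' y\<close> on the square [a,b] x [a,b], cut along the
  diagonal: the half \<open>y \<le> x\<close> integrates to that of \<open>u' * (v - v a)\<close>,
  the half \<open>x < y\<close> to that of \<open>(u - u a) * v'\<close>, and the whole square to
  \<open>(u b - u a) * (v b - v a)\<close>.\<close>

lemma ac_on_mult_integral:
  fixes u v :: "real \<Rightarrow> 'a::{real_normed_field, euclidean_space}"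
  assumes u: "ac_on a b u u'" and v: "ac_on a b v v'" and ab: "a \<le> b"
  shows "set_integrable lborel {a..b} (\<lambda>x. u' x * v x + u x * v' x)"
    and "(LINT x:{a..b}|lborel. u' x * v x + u x * v' x) = u b * v b - u a * v a"
proof -
  define f where "f = (\<lambda>x. indicator {a..b} x *\<^sub>R u' x)"
  define g where "g = (\<lambda>x. indicator {a..b} x *\<^sub>R v' x)"
  have f: "integrable lborel f" and g: "integrable lborel g"
    using ac_on_integrable[OF u] ac_on_integrable[OF v] by (auto simp: f_def g_def set_integrable_def)
  have i1: "set_integrable lborel {a..b} (\<lambda>x. u' x * v x)"
    by (rule set_integrable_mult_continuous[OF ac_on_integrable[OF u] ac_on_continuous[OF v]])
  have i2: "set_integrable lborel {a..b} (\<lambda>x. u x * v' x)"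
    using set_integrable_mult_continuous[OF ac_on_integrable[OF v] ac_on_continuous[OF u]] by (simp add: mult.commute)
  show "set_integrable lborel {a..b} (\<lambda>x. u' x * v x + u x * v' x)"
    using i1 i2 by auto
  define F where "F = (\<lambda>(x, y). f x * g y)"
  have F: "integrable (lborel \<Otimes>\<^sub>M lborel) F"
    unfolding F_def by (rule integrable_pair_mult[OF f g])
  define S where "S = {p::real\<times>real. snd p \<le> fst p}"
  have S_sets: "S \<in> sets (lborel \<Otimes>\<^sub>M lborel)"
  proof -
    have "closed S" unfolding S_def by (intro closed_Collect_le continuous_intros)
    then have "S \<in> sets (lborel :: (real\<times>real) measure)" by (simp only: sets_lborel borel_closed)
    then show ?thesis by (metis lborel_prod)
  qed
  have F1: "integrable (lborel \<Otimes>\<^sub>M lborel) (\<lambda>p. indicator S p *\<^sub>R F p)"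
    by (intro integrable_mult_indicator F S_sets)
  have F2: "integrable (lborel \<Otimes>\<^sub>M lborel) (\<lambda>p. indicator (- S) p *\<^sub>R F p)"
  proof -
    have "- S = space (lborel \<Otimes>\<^sub>M lborel) - S" by (auto simp: space_pair_measure)
    then have "- S \<in> sets (lborel \<Otimes>\<^sub>M lborel)" by (metis sets.compl_sets S_sets)
    then show ?thesis by (intro integrable_mult_indicator F) auto
  qed
  have intf: "(\<integral>x. f x \<partial>lborel) = u b - u a" and intg: "(\<integral>x. g x \<partial>lborel) = v b - v a"
    using ac_on_integral[OF u ab] ac_on_integral[OF v ab] 
    by (simp_all add: f_def g_def set_lebesgue_integral_def)
  have tot: "integral\<^sup>L (lborel \<Otimes>\<^sub>M lborel) F = (u b - u a) * (v b - v a)"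
  proof -
    have "integral\<^sup>L (lborel \<Otimes>\<^sub>M lborel) F = (\<integral>x. (\<integral>y. f x * g y \<partial>lborel) \<partial>lborel)"
      using lborel_pair.integral_fst[of "\<lambda>x y. f x * g y"] F by (simp add: F_def)
    then show ?thesis by (simp add: intf intg)
  qed
  have split: "integral\<^sup>L (lborel \<Otimes>\<^sub>M lborel) F = 
     integral\<^sup>L (lborel \<Otimes>\<^sub>M lborel) (\<lambda>p. indicator S p *\<^sub>R F p) + integral\<^sup>L (lborel \<Otimes>\<^sub>M lborel) (\<lambda>p. indicator (- S) p *\<^sub>R F p)"
    by (subst Bochner_Integration.integral_add[OF F1 F2, symmetric])
      (auto intro!: Bochner_Integration.integral_cong split: split_indicator)
  have s1: "integral\<^sup>L (lborel \<Otimes>\<^sub>M lborel) (\<lambda>p. indicator S p *\<^sub>R F p) = (LINT x:{a..b}|lborel. u' x * (v x - v a))"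
  proof -
    have "integral\<^sup>L (lborel \<Otimes>\<^sub>M lborel) (\<lambda>p. indicator S p *\<^sub>R F p) = 
       (\<integral>x. (\<integral>y. indicator S (x, y) *\<^sub>R F (x, y) \<partial>lborel) \<partial>lborel)"
      by (rule lborel_pair.integral_fst'[symmetric, OF F1])
    also have "\<dots> = (\<integral>x. indicator {a..b} x *\<^sub>R (u' x * (v x - v a)) \<partial>lborel)"
    proof (rule Bochner_Integration.integral_cong[OF refl])
      fix x :: real
      show "(\<integral>y. indicator S (x, y) *\<^sub>R F (x, y) \<partial>lborel) = indicator {a..b} x *\<^sub>R (u' x * (v x - v a))"
      proof (cases "x \<in> {a..b}")
        case True
        have "(\<integral>y. indicator S (x, y) *\<^sub>R F (x, y) \<partial>lborel) = (\<integral>y. u' x * (indicator {a..x} y *\<^sub>R v' y) \<partial>lborel)"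
          using True by (intro Bochner_Integration.integral_cong) (auto simp: S_def F_def f_def g_def indicator_def)
        also have "\<dots> = u' x * (LINT t:{a..x}|lborel. v' t)"
          unfolding set_lebesgue_integral_def by (rule integral_mult_right_zero)
        also have "(LINT t:{a..x}|lborel. v' t) = v x - v a"
          using v True by (simp add: ac_on_def)
        finally show ?thesis using True by simp
      next
        case False
        then have "(\<lambda>y. indicator S (x, y) *\<^sub>R F (x, y)) = (\<lambda>y. 0)" by (auto simp: F_def f_def)
        then show ?thesis using False by simp
      qed
    qed
    finally show ?thesis by (simp add: set_lebesgue_integral_def)
  qed
  have s2: "integral\<^sup>L (lborel \<Otimes>\<^sub>M lborel) (\<lambda>p. indicator (- S) p *\<^sub>R F p) = (LINT x:{a..b}|lborel. (u x - u a) * v' x)"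
  proof -
    have "integral\<^sup>L (lborel \<Otimes>\<^sub>M lborel) (\<lambda>p. indicator (- S) p *\<^sub>R F p) = 
       (\<integral>y. (\<integral>x. indicator (- S) (x, y) *\<^sub>R F (x, y) \<partial>lborel) \<partial>lborel)"
      using lborel_pair.integral_snd[of "\<lambda>x y. indicator (- S) (x, y) *\<^sub>R F (x, y)"] F2
      by (simp add: case_prod_beta')
    also have "\<dots> = (\<integral>y. indicator {a..b} y *\<^sub>R ((u y - u a) * v' y) \<partial>lborel)"
    proof (rule Bochner_Integration.integral_cong[OF refl])
      fix y :: real
      show "(\<integral>x. indicator (- S) (x, y) *\<^sub>R F (x, y) \<partial>lborel) = indicator {a..b} y *\<^sub>R ((u y - u a) * v' y)"
      proof (cases "y \<in> {a..b}")
        case True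
        have my: "(\<lambda>x. indicator {a..y} x *\<^sub>R u' x) \<in> borel_measurable lborel"
          using set_integrable_subset[OF ac_on_integrable[OF u], of "{a..y}"] True 
          by (auto simp: set_integrable_def)
        have fm[measurable]: "f \<in> borel_measurable borel"
          using borel_measurable_integrable[OF f] by simp
        have "(\<integral>x. indicator (- S) (x, y) *\<^sub>R F (x, y) \<partial>lborel) = (\<integral>x. indicator {..<y} x *\<^sub>R (f x * v' y) \<partial>lborel)"
          using True by (intro Bochner_Integration.integral_cong) (auto simp: S_def F_def f_def g_def indicator_def)
        \<comment> \<open>The complement of \<open>S\<close> gives the half-open range
          \<open>x < y\<close>; adding the point \<open>y\<close> changes it by a null set.\<close>
        also have "\<dots> = (\<integral>x. (indicator {a..y} x *\<^sub>R u' x) * v' y \<partial>lborel)"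
        proof (rule integral_cong_AE)
          have "AE x in lborel. x \<noteq> y" by (rule AE_lborel_singleton)
          then show "AE x in lborel. indicator {..<y} x *\<^sub>R (f x * v' y) = (indicator {a..y} x *\<^sub>R u' x) * v' y"
            by eventually_elim (use True in \<open>auto simp: f_def indicator_def\<close>)
          show "(\<lambda>x. indicator {a..y} x *\<^sub>R u' x * v' y) \<in> borel_measurable lborel"
            using my by (intro borel_measurable_times) auto
        qed measurable
        also have "\<dots> = (LINT t:{a..y}|lborel. u' t) * v' y"
          unfolding set_lebesgue_integral_def by (rule integral_mult_left_zero)
        also have "(LINT t:{a..y}|lborel. u' t) = u y - u a"
          using u True by (simp add: ac_on_def)
        finally show ?thesis using True by simp
      next
        case False
        then have "(\<lambda>x. indicator (- S) (x, y) *\<^sub>R F (x, y)) = (\<lambda>y. 0)" by (auto simp: F_def g_def)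
        then show ?thesis using False by simp
      qed
    qed
    finally show ?thesis by (simp add: set_lebesgue_integral_def)
  qed
  have e1: "(LINT x:{a..b}|lborel. u' x * (v x - v a)) = (LINT x:{a..b}|lborel. u' x * v x) - (u b - u a) * v a"
    using set_integral_diff(2)[OF i1, of "\<lambda>x. u' x * v a"] ac_on_integrable[OF u] ac_on_integral[OF u ab]
    by (simp add: right_diff_distrib)
  have e2: "(LINT x:{a..b}|lborel. (u x - u a) * v' x) = (LINT x:{a..b}|lborel. u x * v' x) - u a * (v b - v a)"
    using set_integral_diff(2)[OF i2, of "\<lambda>x. u a * v' x"] ac_on_integrable[OF v] ac_on_integral[OF v ab]
    by (simp add: left_diff_distrib)
  have "(LINT x:{a..b}|lborel. u' x * v x + u x * v' x) = (LINT x:{a..b}|lborel. u' x * v x) + (LINT x:{a..b}|lborel. u x * v' x)"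
    using i1 i2 by simp
  also have "\<dots> = ((LINT x:{a..b}|lborel. u' x * v x) - (u b - u a) * v a) + ((LINT x:{a..b}|lborel. u x * v' x) - u a * (v b - v a))
      + (u b - u a) * v a + u a * (v b - v a)" by (simp only: algebra_simps)
  also have "\<dots> = (u b - u a) * (v b - v a) + (u b - u a) * v a + u a * (v b - v a)"
    unfolding tot[unfolded split s1 s2 e1 e2] ..
  also have "\<dots> = u b * v b - u a * v a" by (simp add: algebra_simps)
  finally show "(LINT x:{a..b}|lborel. u' x * v x + u x * v' x) = u b * v b - u a * v a" .
qed

lemma ac_on_mult:
  fixes u v :: "real \<Rightarrow> 'a::{real_normed_field, euclidean_space}"
  assumes u: "ac_on a b u u'" and v: "ac_on a b v v'"
  shows "ac_on a b (\<lambda>x. u x * v x) (\<lambda>x. u' x * v x + u x * v' x)"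
proof (cases "a \<le> b")
  case True
  show ?thesis
    unfolding ac_on_def
  proof (intro conjI ballI)
    show "set_integrable lborel {a..b} (\<lambda>x. u' x * v x + u x * v' x)"
      using ac_on_mult_integral(1)[OF u v True] .
    fix x assume "x \<in> {a..b}"
    then show "(LINT x:{a..x}|lborel. u' x * v x + u x * v' x) = u x * v x - u a * v a"
      using ac_on_mult_integral(2)[OF ac_on_subinterval[OF u, of a x] ac_on_subinterval[OF v, of a x]] by simp
  qed
qed (simp add: ac_on_def set_integrable_def)

section \<open>Absolutely continuous functions on the whole line\<close>

lemma has_ac_derivativeI: "(\<And>a b. a \<le> b \<Longrightarrow> ac_on a b u v) \<Longrightarrow> has_ac_derivative u v"
  by (simp add: has_ac_derivative_iff_ac_on)

lemma has_ac_derivativeD: "has_ac_derivative u v \<Longrightarrow> ac_on a b u v"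
  by (cases "a \<le> b") (simp_all add: has_ac_derivative_iff_ac_on, simp add: ac_on_def set_integrable_def)

lemmas has_ac_derivative_add = has_ac_derivativeI[OF ac_on_add[OF has_ac_derivativeD has_ac_derivativeD]]
lemmas has_ac_derivative_diff = has_ac_derivativeI[OF ac_on_diff[OF has_ac_derivativeD has_ac_derivativeD]]
lemmas has_ac_derivative_cmult = has_ac_derivativeI[OF ac_on_cmult[OF has_ac_derivativeD]]
lemmas has_ac_derivative_cnj = has_ac_derivativeI[OF ac_on_cnj[OF has_ac_derivativeD]]
lemmas has_ac_derivative_mult = has_ac_derivativeI[OF ac_on_mult[OF has_ac_derivativeD has_ac_derivativeD]]
lemmas has_ac_derivative_const = has_ac_derivativeI[OF ac_on_const]

lemma has_ac_derivative_continuous: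
  assumes "has_ac_derivative u v"
  shows "continuous_on UNIV u"
proof (rule continuous_at_imp_continuous_on, intro ballI)
  fix x :: real
  have "continuous_on {x-1..x+1} u" by (rule ac_on_continuous[OF has_ac_derivativeD[OF assms]])
  then show "isCont u x" by (rule continuous_on_interior) (simp add: interior_atLeastAtMost_real)
qed

lemma has_ac_derivative_measurable:
  assumes "has_ac_derivative u v"
  shows "u \<in> borel_measurable borel" "v \<in> borel_measurable borel"
proof -
  show "u \<in> borel_measurable borel"
    using has_ac_derivative_continuous[OF assms] by (rule borel_measurable_continuous_onI)
  have "(\<lambda>x. indicator {- real n..real n} x *\<^sub>R v x) \<in> borel_measurable borel" for n
    using ac_on_integrable[OF has_ac_derivativeD[OF assms]] by (auto simp: set_integrable_def)
  moreover have "(\<lambda>n. indicator {- real n..real n} x *\<^sub>R v x) \<longlonglongrightarrow> v x" for x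
  proof (rule tendsto_eventually)
    obtain N where N: "\<bar>x\<bar> \<le> real N" using real_arch_simple by blast
    show "\<forall>\<^sub>F n in sequentially. indicator {- real n..real n} x *\<^sub>R v x = v x"
      using eventually_ge_at_top[of N] by eventually_elim (use N in \<open>auto simp: indicator_def\<close>)
  qed
  ultimately show "v \<in> borel_measurable borel"
    by (rule borel_measurable_LIMSEQ_metric)
qed

text \<open>Lets a second derivative known only almost everywhere be replaced by the expression
  which the differential equation prescribes.\<close>

lemma has_ac_derivative_cong_AE:
  assumes "has_ac_derivative u v" "w \<in> borel_measurable borel" "AE x in lborel. v x = w x"
  shows "has_ac_derivative u w"
proof -
  have m: "v \<in> borel_measurable lborel" "w \<in> borel_measurable lborel"
    using has_ac_derivative_measurable(2)[OF assms(1)] assms(2) by auto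
  have ae: "AE x\<in>A in lborel. v x = w x" for A using assms(3) by eventually_elim auto
  have "set_integrable lborel {a..b} w" if "set_integrable lborel {a..b} v" for a b
    using set_integrable_cong_AE[OF m ae] that by auto
  moreover have "(LINT x:{a..b}|lborel. v x) = (LINT x:{a..b}|lborel. w x)" for a b
    using set_lebesgue_integral_cong_AE[OF _ m ae] by auto
  ultimately show ?thesis using assms(1) unfolding has_ac_derivative_def by auto
qed

section \<open>Square integrable functions\<close>

definition sqnorm :: "(real \<Rightarrow> complex) \<Rightarrow> real" where
  "sqnorm f = (\<integral>x. (norm (f x))\<^sup>2 \<partial>lborel)"

lemma L2_norm_sqnorm: "L2_norm f = sqrt (sqnorm f)"
  by (simp add: L2_norm_def sqnorm_def)

lemma sqnorm_nonneg [simp]: "0 \<le> sqnorm f"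
  by (simp add: sqnorm_def)

lemma L2_measurable [measurable_dest]: "f \<in> L2 \<Longrightarrow> f \<in> borel_measurable borel"
  by (simp add: L2_def)

lemma L2_integrable_square: "f \<in> L2 \<Longrightarrow> integrable lborel (\<lambda>x. (norm (f x))\<^sup>2)"
  by (simp add: L2_def)

lemma L2I: "f \<in> borel_measurable borel \<Longrightarrow> integrable lborel (\<lambda>x. (norm (f x))\<^sup>2) \<Longrightarrow> f \<in> L2"
  by (simp add: L2_def)

lemma L2_bound:
  assumes "f \<in> borel_measurable borel" "integrable lborel w" "\<And>x. (norm (f x))\<^sup>2 \<le> w x"
  shows "f \<in> L2"
proof (rule L2I[OF assms(1)])
  show "integrable lborel (\<lambda>x. (norm (f x))\<^sup>2)"
    using assms(2) by (rule Bochner_Integration.integrable_bound) 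
      (use assms(1,3) in \<open>auto intro!: AE_I2 intro: order_trans[OF _ abs_ge_self]\<close>)
qed

lemma norm_add_square_le:
  fixes a b :: complex
  shows "(norm (a + b))\<^sup>2 \<le> 2 * (norm a)\<^sup>2 + 2 * (norm b)\<^sup>2"
proof -
  have "(norm (a + b))\<^sup>2 \<le> (norm a + norm b)\<^sup>2" by (intro power_mono norm_triangle_ineq) auto
  also have "\<dots> \<le> 2 * (norm a)\<^sup>2 + 2 * (norm b)\<^sup>2"
    using zero_le_power2[of "norm a - norm b"] by (simp add: power2_eq_square algebra_simps)
  finally show ?thesis .
qed

lemma L2_add [intro]: "f \<in> L2 \<Longrightarrow> g \<in> L2 \<Longrightarrow> (\<lambda>x. f x + g x) \<in> L2"
  by (rule L2_bound[where w = "\<lambda>x. 2 * (norm (f x))\<^sup>2 + 2 * (norm (g x))\<^sup>2"])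
    (auto intro!: norm_add_square_le L2_integrable_square borel_measurable_add L2_measurable)

lemma L2_cmult [intro]: "f \<in> L2 \<Longrightarrow> (\<lambda>x. c * f x) \<in> L2"
  by (rule L2_bound[where w = "\<lambda>x. (norm c)\<^sup>2 * (norm (f x))\<^sup>2"])
    (auto simp: norm_mult power_mult_distrib L2_integrable_square intro!: borel_measurable_times L2_measurable)

lemma L2_minus [intro]: "f \<in> L2 \<Longrightarrow> (\<lambda>x. - f x) \<in> L2"
  using L2_cmult[of f "-1"] by simp

lemma L2_diff [intro]: "f \<in> L2 \<Longrightarrow> g \<in> L2 \<Longrightarrow> (\<lambda>x. f x - g x) \<in> L2"
  using L2_add[OF _ L2_minus, of f g] by simp

lemma L2_zero [intro, simp]: "(\<lambda>x. 0) \<in> L2"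
  by (rule L2I) auto

lemma L2_cnj [intro]: "f \<in> L2 \<Longrightarrow> (\<lambda>x. cnj (f x)) \<in> L2"
proof (rule L2I)
  assume [measurable]: "f \<in> L2"
  have "continuous_on UNIV cnj" by (intro continuous_intros)
  then show "(\<lambda>x. cnj (f x)) \<in> borel_measurable borel" 
    by (intro borel_measurable_continuous_on[of cnj f]) (auto intro: L2_measurable \<open>f \<in> L2\<close>)
qed (simp add: L2_integrable_square)

lemma L2_sum [intro]: "(\<And>i. i \<in> I \<Longrightarrow> f i \<in> L2) \<Longrightarrow> (\<lambda>x. \<Sum>i\<in>I. f i x) \<in> L2"
  by (induction I rule: infinite_finite_induct) auto

lemma L2_mult_bounded:
  assumes f: "f \<in> L2" and b: "b \<in> borel_measurable borel" "\<And>x. norm (b x) \<le> B"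
  shows "(\<lambda>x. b x * f x) \<in> L2"
proof (rule L2_bound[where w = "\<lambda>x. B\<^sup>2 * (norm (f x))\<^sup>2"])
  show "(\<lambda>x. b x * f x) \<in> borel_measurable borel"
    using L2_measurable[OF f] b(1) by (intro borel_measurable_times)
  show "(norm (b x * f x))\<^sup>2 \<le> B\<^sup>2 * (norm (f x))\<^sup>2" for x
    using b(2)[of x] by (auto simp: norm_mult power_mult_distrib intro!: mult_right_mono power_mono)
qed (use L2_integrable_square[OF f] in auto)

lemma L2_cong_AE:
  assumes "f \<in> L2" "g \<in> borel_measurable borel" "AE x in lborel. f x = g x"
  shows "g \<in> L2"
proof (rule L2I[OF assms(2)])
  have [measurable]: "f \<in> borel_measurable borel" "g \<in> borel_measurable borel"
    using assms L2_measurable by auto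
  have "AE x in lborel. (norm (f x))\<^sup>2 = (norm (g x))\<^sup>2" using assms(3) by eventually_elim simp
  with L2_integrable_square[OF assms(1)] show "integrable lborel (\<lambda>x. (norm (g x))\<^sup>2)"
    by (subst integrable_cong_AE[where g = "\<lambda>x. (norm (f x))\<^sup>2"]) auto
qed

lemma sqnorm_cong_AE:
  assumes "f \<in> borel_measurable borel" "g \<in> borel_measurable borel" "AE x in lborel. f x = g x"
  shows "sqnorm f = sqnorm g"
  unfolding sqnorm_def
proof (rule integral_cong_AE)
  show "AE x in lborel. (norm (f x))\<^sup>2 = (norm (g x))\<^sup>2" using assms(3) by eventually_elim simp
qed (use assms in auto)

lemma L2_inner_cong_AE:
  assumes "f \<in> borel_measurable borel" "g \<in> borel_measurable borel" "AE x in lborel. f x = g x"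
    and "f' \<in> borel_measurable borel" "g' \<in> borel_measurable borel" "AE x in lborel. f' x = g' x"
  shows "L2_inner f f' = L2_inner g g'"
  unfolding L2_inner_def
proof (rule integral_cong_AE)
  show "AE x in lborel. f x * cnj (f' x) = g x * cnj (g' x)"
    using assms(3,6) by eventually_elim simp
  have "continuous_on UNIV cnj" by (intro continuous_intros)
  then have c: "(\<lambda>x. cnj (h x)) \<in> borel_measurable borel" if "h \<in> borel_measurable borel" for h :: "real \<Rightarrow> complex"
    by (intro borel_measurable_continuous_on[of cnj h] that)
  show "(\<lambda>x. f x * cnj (f' x)) \<in> borel_measurable lborel" "(\<lambda>x. g x * cnj (g' x)) \<in> borel_measurable lborel"
    using borel_measurable_times[OF assms(1) c[OF assms(4)]] borel_measurable_times[OF assms(2) c[OF assms(5)]]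
    by simp_all
qed

lemma L2_mult_integrable:
  assumes "f \<in> L2" "g \<in> L2"
  shows "integrable lborel (\<lambda>x. f x * g x)"
proof (rule Bochner_Integration.integrable_bound)
  show "integrable lborel (\<lambda>x. (norm (f x))\<^sup>2 + (norm (g x))\<^sup>2)"
    using assms L2_integrable_square by auto
  show "(\<lambda>x. f x * g x) \<in> borel_measurable lborel"
    using assms L2_measurable by auto
  show "AE x in lborel. norm (f x * g x) \<le> norm ((norm (f x))\<^sup>2 + (norm (g x))\<^sup>2)"
  proof (rule AE_I2)
    fix x
    have "2 * (norm (f x) * norm (g x)) \<le> (norm (f x))\<^sup>2 + (norm (g x))\<^sup>2"
      using sum_squares_bound[of "norm (f x)" "norm (g x)"] by simp
    moreover have "0 \<le> norm (f x) * norm (g x)" by simp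
    ultimately show "norm (f x * g x) \<le> norm ((norm (f x))\<^sup>2 + (norm (g x))\<^sup>2)"
      unfolding norm_mult real_norm_def by linarith
  qed
qed

lemma L2_inner_integrable: "f \<in> L2 \<Longrightarrow> g \<in> L2 \<Longrightarrow> integrable lborel (\<lambda>x. f x * cnj (g x))"
  by (intro L2_mult_integrable L2_cnj)

lemma L2_norm_mult_integrable: "f \<in> L2 \<Longrightarrow> g \<in> L2 \<Longrightarrow> integrable lborel (\<lambda>x. norm (f x) * norm (g x))"
  using integrable_norm[OF L2_mult_integrable, of f g] by (simp add: norm_mult)

lemma L2_inner_add_left: "f \<in> L2 \<Longrightarrow> g \<in> L2 \<Longrightarrow> h \<in> L2 \<Longrightarrow> L2_inner (\<lambda>x. f x + g x) h = L2_inner f h + L2_inner g h"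
  unfolding L2_inner_def by (simp add: L2_inner_integrable distrib_right)

lemma L2_inner_cmult_left: "L2_inner (\<lambda>x. c * f x) h = c * L2_inner f h"
  unfolding L2_inner_def by (simp add: mult.assoc)

lemma L2_inner_commute: "L2_inner g f = cnj (L2_inner f g)"
  unfolding L2_inner_def by (subst Bochner_Integration.integral_cnj[symmetric]) (simp add: mult.commute)

lemma L2_inner_add_right: "f \<in> L2 \<Longrightarrow> g \<in> L2 \<Longrightarrow> h \<in> L2 \<Longrightarrow> L2_inner h (\<lambda>x. f x + g x) = L2_inner h f + L2_inner h g"
  by (subst (1 2 3) L2_inner_commute) (simp add: L2_inner_add_left)

lemma L2_inner_cmult_right: "L2_inner h (\<lambda>x. c * f x) = cnj c * L2_inner h f"
  by (subst (1 2) L2_inner_commute) (simp add: L2_inner_cmult_left)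

lemma L2_inner_diff_left: "f \<in> L2 \<Longrightarrow> g \<in> L2 \<Longrightarrow> h \<in> L2 \<Longrightarrow> L2_inner (\<lambda>x. f x - g x) h = L2_inner f h - L2_inner g h"
  unfolding L2_inner_def by (simp add: L2_inner_integrable left_diff_distrib)

lemma L2_inner_diff_right: "f \<in> L2 \<Longrightarrow> g \<in> L2 \<Longrightarrow> h \<in> L2 \<Longrightarrow> L2_inner h (\<lambda>x. f x - g x) = L2_inner h f - L2_inner h g"
  by (subst (1 2 3) L2_inner_commute) (simp add: L2_inner_diff_left)

lemma L2_inner_zero_left [simp]: "L2_inner (\<lambda>x. 0) h = 0"
  by (simp add: L2_inner_def)

lemma L2_inner_sum_left:
  "(\<And>i. i \<in> I \<Longrightarrow> f i \<in> L2) \<Longrightarrow> h \<in> L2 \<Longrightarrow> L2_inner (\<lambda>x. \<Sum>i\<in>I. f i x) h = (\<Sum>i\<in>I. L2_inner (f i) h)"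
  by (induction I rule: infinite_finite_induct) (simp_all add: L2_inner_add_left L2_sum)

lemma L2_inner_self: "L2_inner f f = of_real (sqnorm f)"
proof -
  have "f x * cnj (f x) = complex_of_real ((norm (f x))\<^sup>2)" for x
    by (simp only: complex_norm_square)
  then show ?thesis unfolding L2_inner_def sqnorm_def by (simp only: integral_complex_of_real)
qed

lemma sqnorm_cmult: "sqnorm (\<lambda>x. c * f x) = (norm c)\<^sup>2 * sqnorm f"
  by (simp add: sqnorm_def norm_mult power_mult_distrib)

lemma sqnorm_eq_0_iff: "f \<in> L2 \<Longrightarrow> sqnorm f = 0 \<longleftrightarrow> (AE x in lborel. f x = 0)"
  unfolding sqnorm_def by (subst integral_nonneg_eq_0_iff_AE) (auto intro: L2_integrable_square)

lemma sqnorm_diff_expand: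
  assumes "f \<in> L2" "g \<in> L2"
  shows "sqnorm (\<lambda>x. f x - g x) = sqnorm f - 2 * Re (L2_inner f g) + sqnorm g"
proof -
  have "L2_inner (\<lambda>x. f x - g x) (\<lambda>x. f x - g x) = L2_inner f f - L2_inner f g - L2_inner g f + L2_inner g g"
    using assms by (simp add: L2_inner_diff_left L2_inner_diff_right L2_diff)
  then have "complex_of_real (sqnorm (\<lambda>x. f x - g x)) = of_real (sqnorm f) - L2_inner f g - L2_inner g f + of_real (sqnorm g)"
    by (simp only: L2_inner_self)
  then have "Re (complex_of_real (sqnorm (\<lambda>x. f x - g x))) = Re (of_real (sqnorm f) - L2_inner f g - L2_inner g f + of_real (sqnorm g))"
    by simp
  then show ?thesis by (simp add: L2_inner_commute[of g f])
qed

lemma sqnorm_add_le: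
  assumes "f \<in> L2" "g \<in> L2"
  shows "sqnorm (\<lambda>x. f x + g x) \<le> 2 * sqnorm f + 2 * sqnorm g"
proof -
  have "sqnorm (\<lambda>x. f x + g x) \<le> (\<integral>x. 2 * (norm (f x))\<^sup>2 + 2 * (norm (g x))\<^sup>2 \<partial>lborel)"
    unfolding sqnorm_def using assms
    by (intro integral_mono) (auto intro!: norm_add_square_le L2_integrable_square L2_add)
  also have "\<dots> = 2 * sqnorm f + 2 * sqnorm g"
    unfolding sqnorm_def using assms by (simp add: L2_integrable_square)
  finally show ?thesis .
qed

lemma sqnorm_diff_le: "f \<in> L2 \<Longrightarrow> g \<in> L2 \<Longrightarrow> sqnorm (\<lambda>x. f x - g x) \<le> 2 * sqnorm f + 2 * sqnorm g"
  using sqnorm_add_le[OF _ L2_minus, of f g] by (simp add: sqnorm_def)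

text \<open>The discriminant argument, applied to the moduli: the sup bound below needs the integral
  of the product of moduli itself, not only the inner product.\<close>

lemma L2_Cauchy_Schwarz_norm:
  assumes "f \<in> L2" "g \<in> L2"
  shows "(\<integral>x. norm (f x) * norm (g x) \<partial>lborel) \<le> sqrt (sqnorm f) * sqrt (sqnorm g)"
proof -
  let ?I = "\<integral>x. norm (f x) * norm (g x) \<partial>lborel"
  have q: "0 \<le> t\<^sup>2 * sqnorm f - 2 * t * ?I + sqnorm g" for t :: real
  proof -
    have "0 \<le> (\<integral>x. (t * norm (f x) - norm (g x))\<^sup>2 \<partial>lborel)" by simp
    also have "\<dots> = (\<integral>x. t\<^sup>2 * (norm (f x))\<^sup>2 - 2 * t * (norm (f x) * norm (g x)) + (norm (g x))\<^sup>2 \<partial>lborel)"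
      by (intro Bochner_Integration.integral_cong) (auto simp: power2_eq_square algebra_simps)
    also have "\<dots> = t\<^sup>2 * sqnorm f - 2 * t * ?I + sqnorm g"
      using L2_integrable_square[OF assms(1)] L2_integrable_square[OF assms(2)] L2_norm_mult_integrable[OF assms]
      by (simp add: sqnorm_def)
    finally show ?thesis .
  qed
  have I: "0 \<le> ?I" by simp
  have "?I\<^sup>2 \<le> sqnorm f * sqnorm g"
  proof (cases "sqnorm f = 0")
    case True
    have "?I = 0"
    proof (rule ccontr)
      assume "?I \<noteq> 0"
      then have "0 < ?I" using I by (metis less_eq_real_def)
      \<comment> \<open>For \<open>sqnorm f = 0\<close> the quadratic in \<open>t\<close>
        degenerates to an affine function of slope -2I; this \<open>t\<close> gives it the value
        -1.\<close>
      then show False using q[of "(sqnorm g + 1) / (2 * ?I)"] True by (simp add: field_simps)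
    qed
    then show ?thesis using True by simp
  next
    case False
    then have "0 < sqnorm f" using sqnorm_nonneg[of f] by (metis less_eq_real_def)
    then show ?thesis using q[of "?I / sqnorm f"] by (simp add: field_simps power2_eq_square)
  qed
  then have "sqrt (?I\<^sup>2) \<le> sqrt (sqnorm f * sqnorm g)" by (rule real_sqrt_le_mono)
  then show ?thesis using I by (simp add: real_sqrt_mult)
qed

lemma L2_Cauchy_Schwarz:
  assumes "f \<in> L2" "g \<in> L2"
  shows "norm (L2_inner f g) \<le> sqrt (sqnorm f) * sqrt (sqnorm g)"
proof -
  have "norm (L2_inner f g) \<le> (\<integral>x. norm (f x * cnj (g x)) \<partial>lborel)"
    unfolding L2_inner_def by (rule integral_norm_bound)
  also have "\<dots> \<le> sqrt (sqnorm f) * sqrt (sqnorm g)"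
    using L2_Cauchy_Schwarz_norm[OF assms] by (simp add: norm_mult)
  finally show ?thesis .
qed

lemma L2_restrict [intro]:
  assumes "f \<in> L2" "A \<in> sets borel"
  shows "(\<lambda>x. indicator A x * f x) \<in> L2"
  by (rule L2_mult_bounded[where B=1, OF assms(1)]) (use assms(2) in \<open>auto simp: indicator_def\<close>)

lemma sqnorm_restrict_le:
  assumes "f \<in> L2" "A \<in> sets borel"
  shows "sqnorm (\<lambda>x. indicator A x * f x) \<le> sqnorm f"
  unfolding sqnorm_def using assms
  by (intro integral_mono L2_integrable_square L2_restrict) (auto simp: indicator_def)

text \<open>Pointwise limits of bounded sequences stay in \<open>L2\<close> with the same bound. It
  places the limit function of the compactness theorem in \<open>L2\<close> before any norm
  convergence is known.\<close>

lemma sqnorm_fatou: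
  assumes f: "\<And>n. f n \<in> L2" "\<And>n. sqnorm (f n) \<le> C" and g: "g \<in> borel_measurable borel"
    and lim: "AE x in lborel. (\<lambda>n. f n x) \<longlonglongrightarrow> g x"
  shows "g \<in> L2" "sqnorm g \<le> C"
proof -
  have C: "0 \<le> C" using f(2)[of 0] sqnorm_nonneg[of "f 0"] by linarith
  have [measurable]: "f n \<in> borel_measurable borel" for n using f(1) L2_measurable by auto
  note [measurable] = g
  have e: "(\<integral>\<^sup>+x. ennreal ((norm (f n x))\<^sup>2) \<partial>lborel) = ennreal (sqnorm (f n))" for n
    unfolding sqnorm_def by (rule nn_integral_eq_integral) (auto intro: L2_integrable_square f)
  have "(\<integral>\<^sup>+x. ennreal ((norm (g x))\<^sup>2) \<partial>lborel) \<le> (\<integral>\<^sup>+x. liminf (\<lambda>n. ennreal ((norm (f n x))\<^sup>2)) \<partial>lborel)"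
  proof (rule nn_integral_mono_AE)
    show "AE x in lborel. ennreal ((norm (g x))\<^sup>2) \<le> liminf (\<lambda>n. ennreal ((norm (f n x))\<^sup>2))"
      using lim
    proof eventually_elim
      case (elim x)
      have "(\<lambda>n. ennreal ((norm (f n x))\<^sup>2)) \<longlonglongrightarrow> ennreal ((norm (g x))\<^sup>2)"
        by (intro tendsto_ennrealI tendsto_power tendsto_norm elim)
      then show ?case using lim_imp_Liminf[of sequentially] by fastforce
    qed
  qed
  also have "\<dots> \<le> liminf (\<lambda>n. (\<integral>\<^sup>+x. ennreal ((norm (f n x))\<^sup>2) \<partial>lborel))"
    by (rule nn_integral_liminf) auto
  also have "\<dots> \<le> ennreal C"
    unfolding e using f(2) by (intro Liminf_le) (auto intro!: always_eventually ennreal_leI)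
  finally have le: "(\<integral>\<^sup>+x. ennreal ((norm (g x))\<^sup>2) \<partial>lborel) \<le> ennreal C" .
  show "g \<in> L2"
  proof (rule L2I[OF g])
    show "integrable lborel (\<lambda>x. (norm (g x))\<^sup>2)"
      by (rule integrableI_nonneg) (use le in \<open>auto simp: less_top[symmetric] top_unique intro: le_less_trans\<close>)
  qed
  then have "ennreal (sqnorm g) \<le> ennreal C"
    unfolding sqnorm_def using le by (subst nn_integral_eq_integral[symmetric]) (auto intro: L2_integrable_square)
  then show "sqnorm g \<le> C" using C by simp
qed

lemma L2_indicator: "(indicator {a..b::real} :: real \<Rightarrow> complex) \<in> L2"
proof (rule L2_bound[where w = "indicator {a..b}"])
  show "integrable lborel (indicat_real {a..b})" by (rule integrable_real_indicator) (auto simp: emeasure_lborel_Icc_eq)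
qed (auto simp: indicator_def)

lemma L2_set_integrable:
  assumes "f \<in> L2"
  shows "set_integrable lborel {a..b::real} f"
proof -
  note i = L2_indicator[of a b]
  have "indicator {a..b} x *\<^sub>R f x = indicator {a..b} x * f x" for x by (auto simp: indicator_def)
  then show ?thesis
    using L2_mult_integrable[OF i assms] by (simp only: set_integrable_def)
qed

section \<open>Second order linear differential equations\<close>

definition prim :: "(real \<Rightarrow> 'a::{banach, second_countable_topology}) \<Rightarrow> real \<Rightarrow> 'a" where
  "prim v x = (if 0 \<le> x then (LINT t:{0..x}|lborel. v t) else - (LINT t:{x..0}|lborel. v t))"

lemma prim_0 [simp]: "prim v 0 = 0"
proof -
  have "(\<lambda>x. indicator {0..0::real} x *\<^sub>R v x) = (\<lambda>x. indicator {0..0} x *\<^sub>R v 0)"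
    by (auto simp: indicator_def)
  then show ?thesis by (simp add: prim_def set_lebesgue_integral_def)
qed

lemma ac_on_prim:
  assumes "\<And>a b. set_integrable lborel {a..b} v"
  shows "ac_on a b (\<lambda>x. c + prim v x) v"
  unfolding ac_on_def
proof (intro conjI ballI assms)
  fix x assume "x \<in> {a..b}"
  then have ax: "a \<le> x" by simp
  consider "0 \<le> a" | "a < 0" "0 \<le> x" | "x < 0" by linarith
  then have "(LINT t:{a..x}|lborel. v t) = prim v x - prim v a"
  proof cases
    case 1
    then show ?thesis using ax set_integral_Icc_split[OF assms, of 0 a x] by (simp add: prim_def)
  next
    case 2
    then show ?thesis using ax set_integral_Icc_split[OF assms, of a 0 x] by (simp add: prim_def)
  next
    case 3
    then show ?thesis using ax set_integral_Icc_split[OF assms, of a x 0] by (simp add: prim_def)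
  qed
  then show "(LINT t:{a..x}|lborel. v t) = c + prim v x - (c + prim v a)" by simp
qed

lemma has_ac_derivative_prim:
  assumes "\<And>a b. set_integrable lborel {a..b} v"
  shows "has_ac_derivative (\<lambda>x. c + prim v x) v"
  by (rule has_ac_derivativeI[OF ac_on_prim[OF assms]])

lemma has_ac_derivative_eq_prim:
  assumes "has_ac_derivative u v"
  shows "u x = u 0 + prim v x"
  using assms[unfolded has_ac_derivative_def, rule_format, of 0 x]
    assms[unfolded has_ac_derivative_def, rule_format, of x 0]
  by (cases "0 \<le> x") (auto simp: prim_def algebra_simps)

lemma has_ac_derivative_0_const:
  assumes "has_ac_derivative u (\<lambda>x. 0)"
  shows "u x = u 0"
proof -
  have "prim (\<lambda>x. 0::complex) x = 0" by (simp add: prim_def)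
  then show ?thesis using has_ac_derivative_eq_prim[OF assms, of x] by simp
qed

lemma norm_set_integral_le:
  fixes v :: "real \<Rightarrow> 'a::{banach, second_countable_topology}"
  assumes "set_integrable lborel A v" "set_integrable lborel A w" "\<And>t. t \<in> A \<Longrightarrow> norm (v t) \<le> w t"
  shows "norm (LINT t:A|lborel. v t) \<le> (LINT t:A|lborel. w t)"
proof -
  have "norm (LINT t:A|lborel. v t) \<le> (LINT t:A|lborel. norm (v t))"
    by (rule set_integral_norm_bound[OF assms(1)])
  also have "\<dots> \<le> (LINT t:A|lborel. w t)"
    using assms by (intro set_integral_mono) (auto simp: set_integrable_norm)
  finally show ?thesis .
qed

text \<open>The weight \<open>exp (2 \<bar>x\<bar> m \<bar>x\<bar>)\<close> makes the Picard operator of a linear system with coefficients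
  bounded by \<open>m \<bar>x\<bar>\<close> a contraction on the whole line.\<close>

lemma norm_prim_le:
  fixes v :: "real \<Rightarrow> 'a::{banach, second_countable_topology}"
  assumes v: "\<And>a b. set_integrable lborel {a..b} v"
    and m: "\<And>s t. 0 \<le> s \<Longrightarrow> s \<le> t \<Longrightarrow> m s \<le> m t" "\<And>t. 0 \<le> t \<Longrightarrow> 1 \<le> m t" and K: "0 \<le> K"
    and le: "\<And>t. norm (v t) \<le> K * m \<bar>t\<bar> * exp (2 * \<bar>t\<bar> * m \<bar>t\<bar>)"
  shows "norm (prim v x) \<le> K / 2 * exp (2 * \<bar>x\<bar> * m \<bar>x\<bar>)"
proof -
  define M where "M = m \<bar>x\<bar>"
  have M: "1 \<le> M" using m(2)[of "\<bar>x\<bar>"] by (simp add: M_def)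
  \<comment> \<open>Freezing \<open>m\<close> at \<open>\<bar>x\<bar>\<close> gives a majorant with
    an explicit antiderivative; the factor 2 in its exponent produces \<open>K / 2\<close>, which
    later is the contraction constant 1/2.\<close>
  have le': "norm (v t) \<le> K * M * exp (2 * \<bar>t\<bar> * M)" if "\<bar>t\<bar> \<le> \<bar>x\<bar>" for t
  proof -
    have mM: "m \<bar>t\<bar> \<le> M" using m(1)[of "\<bar>t\<bar>" "\<bar>x\<bar>"] that by (simp add: M_def)
    have "norm (v t) \<le> K * m \<bar>t\<bar> * exp (2 * \<bar>t\<bar> * m \<bar>t\<bar>)" by (rule le)
    also have "\<dots> \<le> K * M * exp (2 * \<bar>t\<bar> * M)"
      using mM K M m(2)[of "\<bar>t\<bar>"] by (intro mult_mono) (auto intro: mult_left_mono)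
    finally show ?thesis .
  qed
  show ?thesis
  proof (cases "0 \<le> x")
    case True
    have F: "ac_on 0 x (\<lambda>t. K / 2 * exp (2 * t * M)) (\<lambda>t. K * M * exp (2 * t * M))"
      by (rule ac_on_C1) (auto intro!: derivative_eq_intros continuous_intros simp: has_real_derivative_iff_has_vector_derivative[symmetric])
    have "norm (LINT t:{0..x}|lborel. v t) \<le> (LINT t:{0..x}|lborel. K * M * exp (2 * t * M))"
    proof (intro norm_set_integral_le v ac_on_integrable[OF F])
      fix t assume "t \<in> {0..x}"
      then show "norm (v t) \<le> K * M * exp (2 * t * M)" using le'[of t] by simp
    qed
    also have "\<dots> = K / 2 * exp (2 * x * M) - K / 2"
      using ac_on_integral[OF F True] by simp
    finally show ?thesis using True K by (simp add: prim_def M_def)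
  next
    case False
    have F: "ac_on x 0 (\<lambda>t. - (K / 2) * exp (- 2 * t * M)) (\<lambda>t. K * M * exp (- 2 * t * M))"
      by (rule ac_on_C1) (auto intro!: derivative_eq_intros continuous_intros simp: has_real_derivative_iff_has_vector_derivative[symmetric])
    have "norm (LINT t:{x..0}|lborel. v t) \<le> (LINT t:{x..0}|lborel. K * M * exp (- 2 * t * M))"
    proof (intro norm_set_integral_le v ac_on_integrable[OF F])
      fix t assume "t \<in> {x..0}"
      then show "norm (v t) \<le> K * M * exp (- 2 * t * M)" using le'[of t] by simp
    qed
    also have "\<dots> = K / 2 * exp (- 2 * x * M) - K / 2"
      using ac_on_integral[OF F] False by simp
    finally show ?thesis using False K by (simp add: prim_def M_def)
  qed
qed

text \<open>The equation -u'' + q u = g. The derivative is an argument of its own because it is the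
  continuous representative \<open>u'\<close> that supplies Cauchy data and Wronskians.\<close>

definition sol :: "(real \<Rightarrow> complex) \<Rightarrow> (real \<Rightarrow> complex) \<Rightarrow> (real \<Rightarrow> complex) \<Rightarrow> (real \<Rightarrow> complex) \<Rightarrow> bool" where
  "sol q g u u' \<longleftrightarrow> has_ac_derivative u u' \<and> has_ac_derivative u' (\<lambda>x. q x * u x - g x)"

text \<open>The coefficient is complex so that the spectral parameter can be absorbed into it. The
  increasing majorant \<open>m\<close> both expresses local boundedness and defines the weight;
  \<open>m \<ge> 1\<close> lets it dominate also the row \<open>u' = u'\<close> of the first order
  system.\<close>

locale ode_coefficient =
  fixes q :: "real \<Rightarrow> complex" and m :: "real \<Rightarrow> real"
  assumes q_measurable [measurable]: "q \<in> borel_measurable borel"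
    and q_le: "norm (q x) \<le> m \<bar>x\<bar>"
    and m_mono: "0 \<le> s \<Longrightarrow> s \<le> t \<Longrightarrow> m s \<le> m t"
    and m_ge: "0 \<le> t \<Longrightarrow> 1 \<le> m t"
    and m_continuous: "continuous_on UNIV m"
begin

definition "\<omega> x = exp (2 * \<bar>x\<bar> * m \<bar>x\<bar>)"

lemma \<omega>_ge: "1 \<le> \<omega> x"
  using m_ge[of "\<bar>x\<bar>"] by (simp add: \<omega>_def)

lemma \<omega>_continuous: "continuous_on UNIV \<omega>"
  unfolding \<omega>_def
  by (intro continuous_intros continuous_on_compose2[OF m_continuous]) auto

definition rhs :: "real \<Rightarrow> complex \<times> complex \<Rightarrow> complex \<times> complex" where
  "rhs x y = (snd y, q x * fst y)"

lemma rhs_diff: "rhs x y - rhs x z = rhs x (y - z)"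
  by (simp add: rhs_def algebra_simps)

lemma norm_rhs_le: "norm (rhs x y) \<le> m \<bar>x\<bar> * norm y"
proof -
  have m1: "1 \<le> m \<bar>x\<bar>" by (rule m_ge) simp
  have "norm (rhs x y) = sqrt ((norm (snd y))\<^sup>2 + (norm (q x) * norm (fst y))\<^sup>2)"
    by (simp add: rhs_def norm_prod_def norm_mult)
  also have "\<dots> \<le> sqrt ((m \<bar>x\<bar> * norm (snd y))\<^sup>2 + (m \<bar>x\<bar> * norm (fst y))\<^sup>2)"
    using m1 q_le[of x] mult_right_mono[OF m1, of "norm (snd y)"]
    by (intro real_sqrt_le_mono add_mono power_mono mult_right_mono) auto
  also have "\<dots> = m \<bar>x\<bar> * norm y"
    using m1 by (simp add: norm_prod_def power_mult_distrib real_sqrt_mult flip: distrib_left add.commute)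
  finally show ?thesis .
qed

lemma rhs_integrable:
  assumes "continuous_on UNIV y"
  shows "set_integrable lborel {a..b} (\<lambda>t. rhs t (y t))"
proof (rule set_integrable_bound)
  have "continuous_on {a..b} (\<lambda>t. m \<bar>t\<bar> * norm (y t))"
    by (intro continuous_intros continuous_on_compose2[OF m_continuous] continuous_on_subset[OF assms]) auto
  then show "set_integrable lborel {a..b} (\<lambda>t. m \<bar>t\<bar> * norm (y t))"
    unfolding set_integrable_def by (intro borel_integrable_compact) auto
  have y: "y \<in> borel_measurable borel" using assms by (rule borel_measurable_continuous_onI)
  have "continuous_on UNIV (fst :: complex \<times> complex \<Rightarrow> complex)" "continuous_on UNIV (snd :: complex \<times> complex \<Rightarrow> complex)"
    by (intro continuous_intros)+
  then have "(\<lambda>t. fst (y t)) \<in> borel_measurable borel" "(\<lambda>t. snd (y t)) \<in> borel_measurable borel"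
    using borel_measurable_continuous_on y by blast+
  then have "(\<lambda>t. rhs t (y t)) \<in> borel_measurable borel"
    unfolding rhs_def by (intro borel_measurable_Pair borel_measurable_times q_measurable)
  then show "set_borel_measurable lborel {a..b} (\<lambda>t. rhs t (y t))"
    unfolding set_borel_measurable_def by (intro borel_measurable_scaleR) auto
  show "AE t in lborel. t \<in> {a..b} \<longrightarrow> norm (rhs t (y t)) \<le> norm (m \<bar>t\<bar> * norm (y t))"
    by (intro AE_I2 impI) (rule order_trans[OF norm_rhs_le], simp)
qed

text \<open>The unknown is written as \<open>\<omega>\<close> times a bounded continuous function.
  In this space the Picard operator halves distances, so Banach's theorem yields a solution on all
  of \<real> at once, without continuation from local solutions.\<close>

lemma linear_system_exists:
  obtains y where "continuous_on UNIV y" "\<And>x. y x = ini + prim (\<lambda>t. rhs t (y t)) x"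
proof -
  define Y :: "(real \<Rightarrow>\<^sub>C (complex \<times> complex)) \<Rightarrow> real \<Rightarrow> complex \<times> complex" where "Y w t = \<omega> t *\<^sub>R w t" for w t
  have Yc: "continuous_on UNIV (Y w)" for w
    unfolding Y_def by (intro continuous_on_scaleR continuous_on_apply_bcontfun \<omega>_continuous)
  have est: "norm (prim (\<lambda>t. rhs t (Y w t)) x - prim (\<lambda>t. rhs t (Y w' t)) x) \<le> dist w w' / 2 * \<omega> x" for w w' x
  proof -
    have *: "prim (\<lambda>t. rhs t (Y w t)) x - prim (\<lambda>t. rhs t (Y w' t)) x = prim (\<lambda>t. rhs t (Y w t) - rhs t (Y w' t)) x"
      by (simp add: prim_def rhs_integrable[OF Yc])
    have "norm (prim (\<lambda>t. rhs t (Y w t) - rhs t (Y w' t)) x) \<le> dist w w' / 2 * exp (2 * \<bar>x\<bar> * m \<bar>x\<bar>)"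
    proof (rule norm_prim_le)
      show "set_integrable lborel {a..b} (\<lambda>t. rhs t (Y w t) - rhs t (Y w' t))" for a b
        using rhs_integrable[OF Yc] by (intro set_integral_diff)
      fix t
      have "norm (rhs t (Y w t) - rhs t (Y w' t)) \<le> m \<bar>t\<bar> * norm (\<omega> t *\<^sub>R (w t - w' t))"
        unfolding rhs_diff by (rule order_trans[OF norm_rhs_le]) (simp add: Y_def scaleR_diff_right)
      also have "\<dots> = m \<bar>t\<bar> * (\<omega> t * dist (w t) (w' t))"
        using \<omega>_ge[of t] by (simp add: dist_norm)
      also have "\<dots> \<le> m \<bar>t\<bar> * (\<omega> t * dist w w')"
        using m_ge[of "\<bar>t\<bar>"] \<omega>_ge[of t] by (intro mult_left_mono dist_bounded) auto
      finally show "norm (rhs t (Y w t) - rhs t (Y w' t)) \<le> dist w w' * m \<bar>t\<bar> * exp (2 * \<bar>t\<bar> * m \<bar>t\<bar>)"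
        by (simp add: \<omega>_def mult_ac)
    qed (auto intro: m_mono m_ge)
    then show ?thesis unfolding * by (simp add: \<omega>_def)
  qed
  define P where "P w x = (1 / \<omega> x) *\<^sub>R (ini + prim (\<lambda>t. rhs t (Y w t)) x)" for w x
  \<comment> \<open>The zero function is the reference point: \<open>est\<close> against it shows
    that the Picard operator maps into bounded functions.\<close>
  have Y0: "Y 0 = (\<lambda>t. 0)" by (simp add: Y_def fun_eq_iff)
  have P0: "prim (\<lambda>t. rhs t (Y 0 t)) x = 0" for x
    by (simp add: Y0 rhs_def prim_def set_lebesgue_integral_def zero_prod_def[symmetric])
  have Pb: "P w \<in> bcontfun" for w
  proof (rule bcontfun_normI)
    have "continuous_on {a..b} (\<lambda>x. ini + prim (\<lambda>t. rhs t (Y w t)) x)" for a b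
      by (rule ac_on_continuous[OF ac_on_prim[OF rhs_integrable[OF Yc]]])
    then have "isCont (\<lambda>x. ini + prim (\<lambda>t. rhs t (Y w t)) x) x" for x
      by (rule continuous_on_interior[where S = "{x-1..x+1}"]) (simp add: interior_atLeastAtMost_real)
    then have c: "continuous_on UNIV (\<lambda>x. ini + prim (\<lambda>t. rhs t (Y w t)) x)"
      by (simp add: continuous_at_imp_continuous_on)
    have "\<omega> x \<noteq> 0" for x using \<omega>_ge[of x] by auto
    then show "continuous_on UNIV (P w)"
      unfolding P_def by (intro continuous_on_scaleR c continuous_on_divide continuous_on_const \<omega>_continuous) auto
    fix x
    have "norm (ini + prim (\<lambda>t. rhs t (Y w t)) x) \<le> norm ini + dist w 0 / 2 * \<omega> x"
      using est[of w x 0] P0 norm_triangle_ineq[of ini "prim (\<lambda>t. rhs t (Y w t)) x"] by simp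
    also have "\<dots> \<le> (norm ini + dist w 0 / 2) * \<omega> x"
      using \<omega>_ge[of x] mult_left_mono[OF \<omega>_ge[of x], of "norm ini"] by (simp add: distrib_right)
    finally show "norm (P w x) \<le> norm ini + dist w 0 / 2"
      using \<omega>_ge[of x] unfolding P_def norm_scaleR by (simp add: pos_divide_le_eq)
  qed
  define \<Phi> where "\<Phi> w = Bcontfun (P w)" for w
  have \<Phi>: "apply_bcontfun (\<Phi> w) = P w" for w
    unfolding \<Phi>_def using Pb by (rule Bcontfun_inverse)
  have "\<forall>w w'. dist (\<Phi> w) (\<Phi> w') \<le> (1/2) * dist w w'"
  proof (intro allI dist_bound)
    fix w w' x
    have "dist (\<Phi> w x) (\<Phi> w' x) = norm (prim (\<lambda>t. rhs t (Y w t)) x - prim (\<lambda>t. rhs t (Y w' t)) x) / \<omega> x"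
      using \<omega>_ge[of x] by (simp add: \<Phi> P_def dist_norm scaleR_diff_right[symmetric])
    also have "\<dots> \<le> (1/2) * dist w w'"
      using est[of w x w'] \<omega>_ge[of x] by (simp add: field_simps)
    finally show "dist (\<Phi> w x) (\<Phi> w' x) \<le> (1/2) * dist w w'" .
  qed
  then have "\<exists>!w. \<Phi> w = w" by (intro banach_fix_type[of "1/2"]) auto
  then obtain w where w: "\<Phi> w = w" by blast
  show thesis
  proof (rule that[OF Yc[of w]])
    fix x
    have "w x = P w x" using \<Phi>[of w] w by simp
    then show "Y w x = ini + prim (\<lambda>t. rhs t (Y w t)) x"
      using \<omega>_ge[of x] by (simp add: Y_def P_def)
  qed
qed

lemma homogeneous_solution_exists:
  obtains u u' where "sol q (\<lambda>x. 0) u u'" "u 0 = a" "u' 0 = b"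
proof -
  obtain y where y: "continuous_on UNIV y" "\<And>x. y x = (a, b) + prim (\<lambda>t. rhs t (y t)) x"
    using linear_system_exists[where ini = "(a, b)"] by metis
  have "y = (\<lambda>x. (a, b) + prim (\<lambda>t. rhs t (y t)) x)" using y(2) by blast
  then have ac: "ac_on c d y (\<lambda>t. rhs t (y t))" for c d
    using ac_on_prim[OF rhs_integrable[OF y(1)], of c d "(a, b)"] by simp
  show thesis
  proof (rule that)
    show "sol q (\<lambda>x. 0) (\<lambda>x. fst (y x)) (\<lambda>x. snd (y x))"
      unfolding sol_def
      using ac_on_bounded_linear[OF ac bounded_linear_fst] ac_on_bounded_linear[OF ac bounded_linear_snd]
      by (auto simp: rhs_def intro!: has_ac_derivativeI)
    show "fst (y 0) = a" "snd (y 0) = b" using y(2)[of 0] by simp_all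
  qed
qed

end

section \<open>Wronskians and variation of constants\<close>

definition fund_sys :: "(real \<Rightarrow> complex) \<Rightarrow> (real \<Rightarrow> complex) \<Rightarrow> (real \<Rightarrow> complex) \<Rightarrow> (real \<Rightarrow> complex) \<Rightarrow> (real \<Rightarrow> complex) \<Rightarrow> bool"
  where "fund_sys q c c' s s' \<longleftrightarrow> sol q (\<lambda>x. 0) c c' \<and> sol q (\<lambda>x. 0) s s' \<and> c 0 = 1 \<and> c' 0 = 0 \<and> s 0 = 0 \<and> s' 0 = 1"

lemma sol_continuous:
  assumes "sol q g u u'"
  shows "continuous_on A u" "continuous_on A u'"
  using assms has_ac_derivative_continuous continuous_on_subset unfolding sol_def by (metis subset_UNIV)+

text \<open>Lagrange's identity: the terms with the coefficient \<open>q\<close> cancel, so only the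
  inhomogeneities remain.\<close>

lemma wronskian_derivative:
  assumes "sol q f u u'" "sol q g v v'"
  shows "has_ac_derivative (\<lambda>x. u x * v' x - u' x * v x) (\<lambda>x. f x * v x - u x * g x)"
proof -
  have u: "has_ac_derivative u u'" "has_ac_derivative u' (\<lambda>x. q x * u x - f x)"
    and v: "has_ac_derivative v v'" "has_ac_derivative v' (\<lambda>x. q x * v x - g x)"
    using assms by (auto simp: sol_def)
  have "has_ac_derivative (\<lambda>x. u x * v' x - u' x * v x)
    (\<lambda>x. (u' x * v' x + u x * (q x * v x - g x)) - ((q x * u x - f x) * v x + u' x * v' x))"
    by (intro has_ac_derivative_diff has_ac_derivative_mult u v)
  then show ?thesis by (simp add: algebra_simps)
qed

lemma wronskian_const:
  assumes "sol q (\<lambda>x. 0) u u'" "sol q (\<lambda>x. 0) v v'"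
  shows "u x * v' x - u' x * v x = u 0 * v' 0 - u' 0 * v 0"
  using has_ac_derivative_0_const[of "\<lambda>x. u x * v' x - u' x * v x" x] wronskian_derivative[OF assms] by simp

lemma fund_sys_wronskian: "fund_sys q c c' s s' \<Longrightarrow> c x * s' x - c' x * s x = 1"
  using wronskian_const[of q c c' s s' x] by (simp add: fund_sys_def)

lemma (in ode_coefficient) fund_sys_exists: obtains c c' s s' where "fund_sys q c c' s s'"
proof -
  obtain c c' where "sol q (\<lambda>x. 0) c c'" "c 0 = 1" "c' 0 = 0" by (rule homogeneous_solution_exists[where a = 1 and b = 0])
  moreover obtain s s' where "sol q (\<lambda>x. 0) s s'" "s 0 = 0" "s' 0 = 1" by (rule homogeneous_solution_exists[where a = 0 and b = 1])
  ultimately show thesis using that by (simp add: fund_sys_def)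
qed

text \<open>The Wronskians of \<open>u\<close> with \<open>s\<close> and \<open>c\<close> are the
  coordinates of \<open>(u, u')\<close> in the fundamental system, because the Wronskian of
  \<open>c\<close> and \<open>s\<close> is 1; Lagrange's identity integrates them. In particular a
  solution is determined by its Cauchy data at 0.\<close>

lemma sol_variation:
  assumes f: "fund_sys q c c' s s'" and u: "sol q g u u'"
  shows "u x = c x * (u 0 + prim (\<lambda>t. g t * s t) x) + s x * (u' 0 - prim (\<lambda>t. g t * c t) x)"
    and "u' x = c' x * (u 0 + prim (\<lambda>t. g t * s t) x) + s' x * (u' 0 - prim (\<lambda>t. g t * c t) x)"
proof -
  have s: "sol q (\<lambda>x. 0) s s'" and c: "sol q (\<lambda>x. 0) c c'" and i: "c 0 = 1" "c' 0 = 0" "s 0 = 0" "s' 0 = 1"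
    using f by (simp_all add: fund_sys_def)
  have 1: "u x * s' x - u' x * s x = u 0 + prim (\<lambda>t. g t * s t) x"
    using has_ac_derivative_eq_prim[OF wronskian_derivative[OF u s], of x] i by simp
  have 2: "u' x * c x - u x * c' x = u' 0 - prim (\<lambda>t. g t * c t) x"
    using has_ac_derivative_eq_prim[OF wronskian_derivative[OF u c], of x] i by (simp add: algebra_simps)
  have W: "c x * s' x - c' x * s x = 1" by (rule fund_sys_wronskian[OF f])
  have "u x = u x * (c x * s' x - c' x * s x)" using W by simp
  also have "\<dots> = c x * (u x * s' x - u' x * s x) + s x * (u' x * c x - u x * c' x)"
    by (simp add: algebra_simps)
  finally show "u x = c x * (u 0 + prim (\<lambda>t. g t * s t) x) + s x * (u' 0 - prim (\<lambda>t. g t * c t) x)"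
    unfolding 1 2 .
  have "u' x = u' x * (c x * s' x - c' x * s x)" using W by simp
  also have "\<dots> = c' x * (u x * s' x - u' x * s x) + s' x * (u' x * c x - u x * c' x)"
    by (simp add: algebra_simps)
  finally show "u' x = c' x * (u 0 + prim (\<lambda>t. g t * s t) x) + s' x * (u' 0 - prim (\<lambda>t. g t * c t) x)"
    unfolding 1 2 .
qed

lemma sol_variation_exists:
  assumes f: "fund_sys q c c' s s'" and g: "\<And>a b. set_integrable lborel {a..b} g"
  shows "sol q g (\<lambda>x. c x * (a + prim (\<lambda>t. g t * s t) x) + s x * (b - prim (\<lambda>t. g t * c t) x))
    (\<lambda>x. c' x * (a + prim (\<lambda>t. g t * s t) x) + s' x * (b - prim (\<lambda>t. g t * c t) x))"
proof -
  have s: "sol q (\<lambda>x. 0) s s'" and c: "sol q (\<lambda>x. 0) c c'"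
    using f by (simp_all add: fund_sys_def)
  note W = fund_sys_wronskian[OF f]
  define A B where "A x = a + prim (\<lambda>t. g t * s t) x" and "B x = b - prim (\<lambda>t. g t * c t) x" for x
  have A: "has_ac_derivative A (\<lambda>t. g t * s t)"
    unfolding A_def by (intro has_ac_derivative_prim set_integrable_mult_continuous g sol_continuous[OF s])
  have "has_ac_derivative (\<lambda>x. b - (0 + prim (\<lambda>t. g t * c t) x)) (\<lambda>t. 0 - g t * c t)"
    by (intro has_ac_derivative_diff has_ac_derivative_const has_ac_derivative_prim set_integrable_mult_continuous g sol_continuous[OF c])
  then have B: "has_ac_derivative B (\<lambda>t. - (g t * c t))" by (simp add: B_def[abs_def])
  have c': "has_ac_derivative c c'" "has_ac_derivative c' (\<lambda>x. q x * c x)"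
    and s': "has_ac_derivative s s'" "has_ac_derivative s' (\<lambda>x. q x * s x)"
    using s c by (auto simp: sol_def)
  have "has_ac_derivative (\<lambda>x. c x * A x + s x * B x)
    (\<lambda>x. (c' x * A x + c x * (g x * s x)) + (s' x * B x + s x * (- (g x * c x))))"
    by (intro has_ac_derivative_add has_ac_derivative_mult c' s' A B)
  then have 1: "has_ac_derivative (\<lambda>x. c x * A x + s x * B x) (\<lambda>x. c' x * A x + s' x * B x)"
    by (simp add: algebra_simps)
  have "has_ac_derivative (\<lambda>x. c' x * A x + s' x * B x)
    (\<lambda>x. (q x * c x * A x + c' x * (g x * s x)) + (q x * s x * B x + s' x * (- (g x * c x))))"
    by (intro has_ac_derivative_add has_ac_derivative_mult c' s' A B)
  moreover have "(q x * c x * A x + c' x * (g x * s x)) + (q x * s x * B x + s' x * (- (g x * c x)))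
     = q x * (c x * A x + s x * B x) - g x * (c x * s' x - c' x * s x)" for x
    by (simp add: algebra_simps)
  ultimately have 2: "has_ac_derivative (\<lambda>x. c' x * A x + s' x * B x) (\<lambda>x. q x * (c x * A x + s x * B x) - g x)"
    by (simp add: W)
  show ?thesis using 1 2 by (simp add: sol_def A_def B_def)
qed

lemma sol_add: "sol q f u u' \<Longrightarrow> sol q g v v' \<Longrightarrow> sol q (\<lambda>x. f x + g x) (\<lambda>x. u x + v x) (\<lambda>x. u' x + v' x)"
  unfolding sol_def
  using has_ac_derivative_add[of u' "\<lambda>x. q x * u x - f x" v' "\<lambda>x. q x * v x - g x"]
  by (auto intro: has_ac_derivative_add simp: algebra_simps)

lemma sol_cmult: "sol q f u u' \<Longrightarrow> sol q (\<lambda>x. k * f x) (\<lambda>x. k * u x) (\<lambda>x. k * u' x)"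
  unfolding sol_def
  using has_ac_derivative_cmult[of u' "\<lambda>x. q x * u x - f x" k]
  by (auto intro: has_ac_derivative_cmult simp: algebra_simps)

lemma sol_shift:
  "sol q f u u' \<longleftrightarrow> sol (\<lambda>x. q x - z) (\<lambda>x. f x - z * u x) u u'"
  unfolding sol_def by (simp add: algebra_simps)

section \<open>Form domain of a confining potential\<close>

lemma tendsto_symmetric_integral:
  fixes f :: "real \<Rightarrow> 'a::{banach, second_countable_topology}"
  assumes "integrable lborel f"
  shows "((\<lambda>t. LINT x:{-t..t}|lborel. f x) \<longlongrightarrow> (\<integral>x. f x \<partial>lborel)) at_top"
  unfolding set_lebesgue_integral_def
proof (rule integral_dominated_convergence_at_top)
  have [measurable]: "f \<in> borel_measurable lborel" using assms by auto
  show "f \<in> borel_measurable lborel" by fact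
  show "(\<lambda>x. indicator {-t..t} x *\<^sub>R f x) \<in> borel_measurable lborel" for t :: real by measurable
  show "integrable lborel (\<lambda>x. norm (f x))" using assms by simp
  show "AE x in lborel. ((\<lambda>t. indicator {-t..t} x *\<^sub>R f x) \<longlongrightarrow> f x) at_top"
  proof (rule AE_I2, rule tendsto_eventually)
    fix x :: real
    show "\<forall>\<^sub>F t in at_top. indicator {-t..t} x *\<^sub>R f x = f x"
      using eventually_ge_at_top[of "\<bar>x\<bar>"] by eventually_elim (auto simp: indicator_def)
  qed
  show "\<forall>\<^sub>F t in at_top. AE x in lborel. norm (indicator {-t..t} x *\<^sub>R f x) \<le> norm (f x)"
    by (auto intro!: always_eventually AE_I2 simp: indicator_def)
qed

text \<open>The symmetric sum is the natural quantity here: integrals over \<open>{-t..t}\<close>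
  give information on the boundary values at \<open>t\<close> and \<open>-t\<close> only
  jointly.\<close>

lemma not_integrable_of_lower_bound:
  fixes F :: "real \<Rightarrow> real"
  assumes F: "integrable lborel F" and c: "0 < c" and ge: "\<And>t. T \<le> t \<Longrightarrow> c \<le> F t + F (- t)"
  shows False
proof -
  define G where "G t = \<bar>F t + F (- t)\<bar>" for t
  have "integrable lborel (\<lambda>t. F (0 + (-1) * t))" using F by (intro lborel_integrable_real_affine) auto
  then have G: "integrable lborel G" unfolding G_def using F by auto
  have le: "c * real n \<le> (\<integral>x. G x \<partial>lborel)" for n
  proof -
    have "c * real n = (\<integral>x. c * indicator {T..T + real n} x \<partial>lborel)" by simp
    also have "\<dots> \<le> (\<integral>x. G x \<partial>lborel)"
    proof (intro integral_mono G)
      show "integrable lborel (\<lambda>x. c * indicat_real {T..T + real n} x)"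
        by (intro integrable_mult_right integrable_real_indicator) (auto simp: emeasure_lborel_Icc_eq)
      show "c * indicat_real {T..T + real n} x \<le> G x" for x
        using ge[of x] c by (auto simp: G_def indicator_def)
    qed
    finally show ?thesis .
  qed
  obtain n where "(\<integral>x. G x \<partial>lborel) / c < real n" using reals_Archimedean2 by blast
  with le[of n] c show False by (simp add: field_simps)
qed

lemma continuous_AE_eq_0:
  fixes u :: "real \<Rightarrow> complex"
  assumes ae: "AE x in lborel. u x = 0" and c: "continuous_on UNIV u"
  shows "u x = 0"
proof (rule ccontr)
  assume "u x \<noteq> 0"
  moreover have "isCont u x" using c by (simp add: continuous_on_eq_continuous_at)
  ultimately obtain d where d: "0 < d" "\<And>y. dist x y < d \<Longrightarrow> u y \<noteq> 0"
    using continuous_at_avoid[of x u 0] by blast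
  have "AE y in lborel. y \<notin> {x - d / 2..x + d / 2}"
    using ae by eventually_elim (use d in \<open>force simp: dist_real_def\<close>)
  then have "emeasure lborel {x - d / 2..x + d / 2} = 0"
    by (subst (asm) AE_iff_measurable) auto
  then show False using d(1) by (simp add: emeasure_lborel_Icc_eq)
qed

text \<open>No limits of \<open>p\<close> at infinity are taken. A nonzero integral would keep
  \<open>p t - p (- t)\<close> away from 0 for all large \<open>t\<close>, against the integrability
  of \<open>p\<close>.\<close>

lemma integral_ac_derivative_eq_0:
  assumes "has_ac_derivative p p'" "integrable lborel p" "integrable lborel p'"
  shows "(\<integral>x. p' x \<partial>lborel) = 0"
proof (rule ccontr)
  let ?I = "\<integral>x. p' x \<partial>lborel"
  assume "?I \<noteq> 0"
  then have pos: "0 < norm ?I / 2" by simp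
  have lim: "((\<lambda>t. norm (LINT x:{-t..t}|lborel. p' x)) \<longlongrightarrow> norm ?I) at_top"
    by (intro tendsto_norm tendsto_symmetric_integral assms)
  have "\<forall>\<^sub>F t in at_top. norm ?I / 2 < norm (LINT x:{-t..t}|lborel. p' x)"
    by (rule order_tendstoD(1)[OF lim]) (use pos in linarith)
  then obtain T where T: "\<And>t. T \<le> t \<Longrightarrow> norm ?I / 2 < norm (LINT x:{-t..t}|lborel. p' x)"
    unfolding eventually_at_top_linorder by blast
  have "norm ?I / 2 \<le> norm (p t) + norm (p (- t))" if "max T 0 \<le> t" for t
  proof -
    have "(LINT x:{-t..t}|lborel. p' x) = p t - p (- t)"
      using ac_on_integral[OF has_ac_derivativeD[OF assms(1)], of "-t" t] that by simp
    then show ?thesis using T[of t] that norm_triangle_ineq4[of "p t" "p (- t)"] by simp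
  qed
  from not_integrable_of_lower_bound[OF integrable_norm[OF assms(2)] pos this] show False .
qed

lemma has_ac_derivative_continuous_imp_vector_derivative:
  assumes u: "has_ac_derivative u v" and v: "continuous_on UNIV v"
  shows "(u has_vector_derivative v x) (at x)"
proof -
  let ?a = "x - 1" and ?b = "x + 1"
  have vi: "continuous_on {?a..?b} v" using v by (rule continuous_on_subset) simp
  have der: "((\<lambda>y. u ?a + integral {?a..y} v) has_vector_derivative v x) (at x within {?a..?b})"
    using integral_has_vector_derivative[OF vi, of x] by (auto intro!: derivative_eq_intros)
  have eq: "u y = u ?a + integral {?a..y} v" if "y \<in> {?a..?b}" for y
  proof -
    have "set_integrable lborel {?a..y} v" by (rule ac_on_integrable[OF has_ac_derivativeD[OF u]])
    from set_borel_integral_eq_integral(2)[OF this] ac_on_eq[OF has_ac_derivativeD[OF u, of ?a y], of y] that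
    show ?thesis by (metis add.commute diff_add_cancel atLeastAtMost_iff order_refl)
  qed
  have "(u has_vector_derivative v x) (at x within {?a..?b})"
    by (rule has_vector_derivative_transform[OF _ eq der]) auto
  then show ?thesis
    using at_within_Icc_at[of ?a x ?b] by simp
qed

lemma integrable_of_bounded_integrals:
  fixes d :: "real \<Rightarrow> real"
  assumes nn: "\<And>x. 0 \<le> d x" and m: "d \<in> borel_measurable borel"
    and i: "\<And>n::nat. set_integrable lborel {-real n..real n} d"
    and le: "\<And>n::nat. (LINT x:{-real n..real n}|lborel. d x) \<le> C"
  shows "integrable lborel d" "(\<integral>x. d x \<partial>lborel) \<le> C"
proof -
  let ?J = "\<lambda>n::nat. LINT x:{-real n..real n}|lborel. d x"
  have mono: "incseq ?J"
  proof (rule incseq_SucI)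
    fix n
    show "?J n \<le> ?J (Suc n)"
      unfolding set_lebesgue_integral_def using i[of n] i[of "Suc n"] nn
      by (intro integral_mono) (auto simp: set_integrable_def indicator_def)
  qed
  obtain L where L: "?J \<longlonglongrightarrow> L" using incseq_convergent[OF mono] le by metis
  have lim: "(\<lambda>n::nat. indicator {-real n..real n} x *\<^sub>R d x) \<longlonglongrightarrow> d x" for x
  proof (rule tendsto_eventually)
    obtain N where N: "\<bar>x\<bar> \<le> real N" using real_arch_simple by blast
    show "\<forall>\<^sub>F n in sequentially. indicator {- real n..real n} x *\<^sub>R d x = d x"
      using eventually_ge_at_top[of N] by eventually_elim (use N in \<open>auto simp: indicator_def\<close>)
  qed
  have *: "integrable lborel (\<lambda>x. indicator {-real n..real n} x *\<^sub>R d x)" for n :: nat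
    using i[of n] by (simp only: set_integrable_def)
  have m1: "mono (\<lambda>n::nat. indicator {-real n..real n} x *\<^sub>R d x)" for x
    using nn[of x] by (intro monoI) (auto simp: indicator_def)
  have J: "(\<lambda>n. integral\<^sup>L lborel (\<lambda>x. indicator {-real n..real n} x *\<^sub>R d x)) \<longlonglongrightarrow> L"
    using L by (simp only: set_lebesgue_integral_def)
  show "integrable lborel d"
    using * m1 lim J m by (intro integrable_monotone_convergence[of lborel "\<lambda>n::nat. \<lambda>x. indicator {-real n..real n} x *\<^sub>R d x" d L]) auto
  have "integral\<^sup>L lborel d = L"
    using * m1 lim J m by (intro integral_monotone_convergence[of lborel "\<lambda>n::nat. \<lambda>x. indicator {-real n..real n} x *\<^sub>R d x" d L]) auto
  then show "(\<integral>x. d x \<partial>lborel) \<le> C" using LIMSEQ_le_const2[OF L] le by auto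
qed

section \<open>Confining potentials: operator, form domain and energy\<close>

text \<open>\<open>Q_at_infinity\<close> holds for every \<open>K\<close>, so \<open>Q\<close> tends
  to infinity at both ends; this is the source of compactness. \<open>M\<close> is a shift that
  makes the energy density nonnegative, and \<open>m\<close> feeds the existence theory for the
  differential equation.\<close>

locale confining =
  fixes Q :: "real \<Rightarrow> real" and M :: real and m :: "real \<Rightarrow> real"
  assumes Q_measurable [measurable]: "Q \<in> borel_measurable borel"
    and M_nonneg: "0 \<le> M" and Q_ge: "- M \<le> Q x"
    and Q_le: "\<bar>Q x\<bar> \<le> m \<bar>x\<bar>"
    and m_mono: "0 \<le> s \<Longrightarrow> s \<le> t \<Longrightarrow> m s \<le> m t"
    and m_ge: "0 \<le> t \<Longrightarrow> 1 \<le> m t"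
    and m_continuous: "continuous_on UNIV m"
    and Q_at_infinity: "\<exists>X\<ge>0. \<forall>x. X \<le> \<bar>x\<bar> \<longrightarrow> K \<le> Q x"
begin

abbreviation "T \<equiv> schroedinger Q"
abbreviation "Qc \<equiv> (\<lambda>x. complex_of_real (Q x))"

text \<open>The graph of \<open>T\<close> restricted to continuous representatives: T u = h, with
  \<open>u'\<close> the derivative. Eigenfunctions are the case \<open>h = z * u\<close>.\<close>

definition dsol :: "(real \<Rightarrow> complex) \<Rightarrow> (real \<Rightarrow> complex) \<Rightarrow> (real \<Rightarrow> complex) \<Rightarrow> bool" where
  "dsol u u' h \<longleftrightarrow> sol Qc h u u' \<and> u \<in> L2 \<and> h \<in> L2"

definition form_dom :: "(real \<Rightarrow> complex) \<Rightarrow> (real \<Rightarrow> complex) \<Rightarrow> bool" where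
  "form_dom f f' \<longleftrightarrow> has_ac_derivative f f' \<and> f \<in> L2 \<and> f' \<in> L2 \<and> integrable lborel (\<lambda>x. \<bar>Q x\<bar> * (norm (f x))\<^sup>2)"

definition form :: "(real \<Rightarrow> complex) \<Rightarrow> (real \<Rightarrow> complex) \<Rightarrow> (real \<Rightarrow> complex) \<Rightarrow> (real \<Rightarrow> complex) \<Rightarrow> complex" where
  "form w w' f f' = (\<integral>x. w' x * cnj (f' x) + Qc x * (w x * cnj (f x)) \<partial>lborel)"

definition energy :: "(real \<Rightarrow> complex) \<Rightarrow> (real \<Rightarrow> complex) \<Rightarrow> real" where
  "energy f f' = (\<integral>x. (norm (f' x))\<^sup>2 + Q x * (norm (f x))\<^sup>2 \<partial>lborel)"

lemma ode_shift: "ode_coefficient (\<lambda>x. Qc x - z) (\<lambda>t. m t + norm z)"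
proof
  show "(\<lambda>x. Qc x - z) \<in> borel_measurable borel" by measurable
  show "norm (Qc x - z) \<le> m \<bar>x\<bar> + norm z" for x
    using norm_triangle_ineq4[of "Qc x" z] Q_le[of x] by simp
  show "m s + norm z \<le> m t + norm z" if "0 \<le> s" "s \<le> t" for s t using m_mono[OF that] by simp
  show "1 \<le> m t + norm z" if "0 \<le> t" for t using m_ge[OF that] by (simp add: add_increasing2)
  show "continuous_on UNIV (\<lambda>t. m t + norm z)" by (intro continuous_intros m_continuous)
qed

lemma schroedinger_iff: "(f, h) \<in> T \<longleftrightarrow> f \<in> L2 \<and> (\<exists>u u'. dsol u u' h \<and> (AE x in lborel. f x = u x))"
proof
  assume "(f, h) \<in> T"
  then obtain u u' u'' where *: "f \<in> L2" "h \<in> L2" "has_ac_derivative u u'" "has_ac_derivative u' u''"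
    "AE x in lborel. f x = u x" "AE x in lborel. h x = - u'' x + Qc x * u x"
    by (auto simp: schroedinger_def)
  have [measurable]: "u \<in> borel_measurable borel" "h \<in> borel_measurable borel"
    using has_ac_derivative_measurable(1)[OF *(3)] L2_measurable[OF *(2)] by auto
  have "has_ac_derivative u' (\<lambda>x. Qc x * u x - h x)"
  proof (rule has_ac_derivative_cong_AE[OF *(4)])
    show "(\<lambda>x. Qc x * u x - h x) \<in> borel_measurable borel" by measurable
    show "AE x in lborel. u'' x = Qc x * u x - h x" using *(6) by eventually_elim simp
  qed
  moreover have "u \<in> L2" by (rule L2_cong_AE[OF *(1) _ *(5)]) measurable
  ultimately show "f \<in> L2 \<and> (\<exists>u u'. dsol u u' h \<and> (AE x in lborel. f x = u x))"
    using * by (auto simp: dsol_def sol_def)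
next
  assume "f \<in> L2 \<and> (\<exists>u u'. dsol u u' h \<and> (AE x in lborel. f x = u x))"
  then obtain u u' where *: "f \<in> L2" "sol Qc h u u'" "u \<in> L2" "h \<in> L2" "AE x in lborel. f x = u x"
    by (auto simp: dsol_def)
  then show "(f, h) \<in> T"
    unfolding schroedinger_def
    by (intro CollectI case_prodI conjI exI[of _ u] exI[of _ u'] exI[of _ "\<lambda>x. Qc x * u x - h x"]) (auto simp: sol_def)
qed

lemma dsol_in_T: "dsol u u' h \<Longrightarrow> (u, h) \<in> T"
  unfolding schroedinger_iff by (auto simp: dsol_def)

text \<open>Let \<open>\<Phi>\<close> be the real part of \<open>u' * cnj u\<close>; its derivative
  is \<open>d - r\<close> with the nonnegative shifted energy density \<open>d\<close> and an
  integrable \<open>r\<close>. If the integral of \<open>d\<close> over some \<open>{-B..B}\<close>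
  exceeded \<open>C + 1\<close>, then \<Phi>(t) - \<Phi>(-t) would be at least 1 for all
  \<open>t \<ge> B\<close>. This is half the derivative of |u(t)|^2 + |u(-t)|^2, which would then
  grow linearly, contradicting \<open>u \<in> L2\<close>.\<close>

lemma dsol_form_dom:
  assumes "dsol u u' h"
  shows "form_dom u u'"
proof -
  have u: "has_ac_derivative u u'" "has_ac_derivative u' (\<lambda>x. Qc x * u x - h x)" "u \<in> L2" "h \<in> L2"
    using assms by (auto simp: dsol_def sol_def)
  have cu: "continuous_on UNIV u" "continuous_on UNIV u'"
    using has_ac_derivative_continuous u(1,2) by auto
  have [measurable]: "u \<in> borel_measurable borel" "u' \<in> borel_measurable borel" "h \<in> borel_measurable borel"
    using has_ac_derivative_measurable[OF u(1)] L2_measurable[OF u(4)] by auto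
  define \<Phi> where "\<Phi> x = Re (u' x * cnj (u x))" for x
  define d where "d x = (norm (u' x))\<^sup>2 + (Q x + M) * (norm (u x))\<^sup>2" for x
  define r where "r x = Re (h x * cnj (u x)) + M * (norm (u x))\<^sup>2" for x
  have d0: "0 \<le> d x" for x using Q_ge[of x] by (simp add: d_def)
  have r: "integrable lborel r" unfolding r_def
    by (intro Bochner_Integration.integrable_add integrable_Re integrable_mult_right L2_inner_integrable L2_integrable_square u)
  have hu: "integrable lborel (\<lambda>x. norm (h x) * norm (u x))"
    by (rule L2_norm_mult_integrable[OF u(4) u(3)])
  define C where "C = (\<integral>x. norm (h x) * norm (u x) + M * (norm (u x))\<^sup>2 \<partial>lborel)"
  have \<Phi>ac: "ac_on a b \<Phi> (\<lambda>x. d x - r x)" for a b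
  proof -
    have "has_ac_derivative (\<lambda>x. u' x * cnj (u x)) (\<lambda>x. (Qc x * u x - h x) * cnj (u x) + u' x * cnj (u' x))"
      by (intro has_ac_derivative_mult has_ac_derivative_cnj u)
    from ac_on_Re[OF has_ac_derivativeD[OF this]]
    have "ac_on a b \<Phi> (\<lambda>x. Re ((Qc x * u x - h x) * cnj (u x) + u' x * cnj (u' x)))" 
      unfolding \<Phi>_def .
    moreover have "Re ((Qc x * u x - h x) * cnj (u x) + u' x * cnj (u' x)) = d x - r x" for x
      unfolding d_def r_def cmod_power2 by (simp add: power2_eq_square algebra_simps)
    ultimately show ?thesis by simp
  qed
  have ri: "set_integrable lborel {a..b} r" for a b :: real
    unfolding set_integrable_def by (intro integrable_mult_indicator r) auto
  have di: "set_integrable lborel {a..b} d" for a b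
    using set_integral_add(1)[OF ac_on_integrable[OF \<Phi>ac[of a b]] ri[of a b]] by simp
  define J where "J t = (LINT x:{-t..t}|lborel. d x)" for t
  have Jeq: "J t = \<Phi> t - \<Phi> (-t) + (LINT x:{-t..t}|lborel. r x)" if "0 \<le> t" for t
    using ac_on_integral[OF \<Phi>ac[of "-t" t]] that di ri by (simp add: J_def algebra_simps)
  have rC: "(LINT x:{-t..t}|lborel. r x) \<le> C" for t
  proof -
    have "(LINT x:{-t..t}|lborel. r x) \<le> (\<integral>x. norm (h x) * norm (u x) + M * (norm (u x))\<^sup>2 \<partial>lborel)"
      unfolding set_lebesgue_integral_def
    proof (intro integral_mono)
      show "integrable lborel (\<lambda>x. indicat_real {-t..t} x *\<^sub>R r x)" using ri by (simp add: set_integrable_def)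
      show "integrable lborel (\<lambda>x. norm (h x) * norm (u x) + M * (norm (u x))\<^sup>2)"
        using hu L2_integrable_square[OF u(3)] by auto
      fix x
      have "r x \<le> norm (h x) * norm (u x) + M * (norm (u x))\<^sup>2"
        using complex_Re_le_cmod[of "h x * cnj (u x)"] by (simp add: r_def norm_mult)
      moreover have "0 \<le> norm (h x) * norm (u x) + M * (norm (u x))\<^sup>2" using M_nonneg by simp
      ultimately show "indicat_real {-t..t} x *\<^sub>R r x \<le> norm (h x) * norm (u x) + M * (norm (u x))\<^sup>2"
        by (simp add: indicator_def)
    qed
    then show ?thesis by (simp add: C_def)
  qed
  have J_le: "J B \<le> C + 1" if B: "0 \<le> B" for B
  proof (rule ccontr)
    assume "\<not> J B \<le> C + 1"
    then have JB: "C + 1 < J B" by simp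
    have \<Phi>1: "1 \<le> \<Phi> t - \<Phi> (-t)" if "B \<le> t" for t
    proof -
      have "J B \<le> J t"
        unfolding J_def set_lebesgue_integral_def using di[of "-B" B] di[of "-t" t] d0 that
        by (intro integral_mono) (auto simp: set_integrable_def indicator_def)
      then show ?thesis using Jeq[of t] rC[of t] JB B that by simp
    qed
    define S where "S t = (norm (u t))\<^sup>2 + (norm (u (-t)))\<^sup>2" for t
    have du: "((\<lambda>t. (norm (u t))\<^sup>2) has_real_derivative 2 * \<Phi> x) (at x)" for x
    proof -
      have "(u has_vector_derivative u' x) (at x)"
        by (rule has_ac_derivative_continuous_imp_vector_derivative[OF u(1) cu(2)])
      then have "((\<lambda>t. (Re (u t))\<^sup>2 + (Im (u t))\<^sup>2) has_real_derivative 2 * \<Phi> x) (at x)"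
        using has_vector_derivative_complex_iff[of u "u' x"]
        by (auto intro!: derivative_eq_intros simp: \<Phi>_def algebra_simps)
      then show ?thesis by (simp add: cmod_power2)
    qed
    have dS: "(S has_real_derivative 2 * (\<Phi> t - \<Phi> (-t))) (at t)" for t
    proof -
      have "((\<lambda>t. (norm (u (- t)))\<^sup>2) has_real_derivative 2 * \<Phi> (- t) * (- 1)) (at t)"
        by (rule DERIV_chain2[OF du]) (auto intro!: derivative_eq_intros)
      from DERIV_add[OF du this] show ?thesis by (simp add: S_def[abs_def] algebra_simps)
    qed
    have "2 * (t - B) \<le> S t" if "B \<le> t" for t
    proof -
      have "S B - 2 * B \<le> S t - 2 * t"
      proof (rule DERIV_nonneg_imp_nondecreasing[OF that])
        fix x assume "B \<le> x" "x \<le> t"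
        then show "\<exists>y. ((\<lambda>t. S t - 2 * t) has_real_derivative y) (at x) \<and> 0 \<le> y"
          using \<Phi>1[of x] by (intro exI[of _ "2 * (\<Phi> x - \<Phi> (-x)) - 2"]) (auto intro!: derivative_eq_intros dS)
      qed
      moreover have "0 \<le> S B" by (simp add: S_def)
      ultimately have "2 * t - 2 * B \<le> S t" by simp
      then show ?thesis by simp
    qed note S_ge = this
    have ge: "2 \<le> (norm (u t))\<^sup>2 + (norm (u (- t)))\<^sup>2" if "B + 1 \<le> t" for t
    proof -
      have "2 \<le> 2 * (t - B)" using that by simp
      also have "\<dots> \<le> S t" by (rule S_ge) (use that in simp)
      finally show ?thesis by (simp add: S_def)
    qed
    from not_integrable_of_lower_bound[OF L2_integrable_square[OF u(3)] _ ge] show False by simp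
  qed
  have d: "integrable lborel d"
  proof (rule integrable_of_bounded_integrals(1)[OF d0])
    show "d \<in> borel_measurable borel" unfolding d_def by measurable
    show "(LINT x:{- real n..real n}|lborel. d x) \<le> C + 1" for n using J_le[of "real n"] by (simp add: J_def)
  qed (rule di)
  have "u' \<in> L2"
  proof (rule L2_bound[OF _ d])
    fix x
    have "0 \<le> (Q x + M) * (norm (u x))\<^sup>2" using Q_ge[of x] by simp
    then show "(norm (u' x))\<^sup>2 \<le> d x" unfolding d_def by linarith
  qed measurable
  moreover have "integrable lborel (\<lambda>x. \<bar>Q x\<bar> * (norm (u x))\<^sup>2)"
  proof (rule Bochner_Integration.integrable_bound)
    show "integrable lborel (\<lambda>x. d x + 2 * M * (norm (u x))\<^sup>2)"
      using d L2_integrable_square[OF u(3)] by auto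
    show "AE x in lborel. norm (\<bar>Q x\<bar> * (norm (u x))\<^sup>2) \<le> norm (d x + 2 * M * (norm (u x))\<^sup>2)"
    proof (rule AE_I2)
      fix x
      have "\<bar>Q x\<bar> \<le> (Q x + M) + 2 * M" using Q_ge[of x] M_nonneg by simp
      then have "\<bar>Q x\<bar> * (norm (u x))\<^sup>2 \<le> ((Q x + M) + 2 * M) * (norm (u x))\<^sup>2" by (rule mult_right_mono) simp
      also have "\<dots> \<le> d x + 2 * M * (norm (u x))\<^sup>2" by (simp add: d_def algebra_simps)
      also have "\<dots> \<le> norm (d x + 2 * M * (norm (u x))\<^sup>2)" by simp
      finally show "norm (\<bar>Q x\<bar> * (norm (u x))\<^sup>2) \<le> norm (d x + 2 * M * (norm (u x))\<^sup>2)"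
        by (simp add: abs_mult)
    qed
  qed measurable
  ultimately show ?thesis using u by (simp add: form_dom_def)
qed

lemma form_dom_measurable: "form_dom f f' \<Longrightarrow> f \<in> borel_measurable borel" "form_dom f f' \<Longrightarrow> f' \<in> borel_measurable borel"
  using has_ac_derivative_measurable by (auto simp: form_dom_def)

lemma form_dom_Q_integrable: 
  assumes "form_dom w w'" "form_dom f f'"
  shows "integrable lborel (\<lambda>x. Qc x * (w x * cnj (f x)))"
proof (rule Bochner_Integration.integrable_bound)
  have [measurable]: "w \<in> borel_measurable borel" "(\<lambda>x. cnj (f x)) \<in> borel_measurable borel"
    using assms L2_measurable[OF L2_cnj] form_dom_measurable by (auto simp: form_dom_def)
  show "integrable lborel (\<lambda>x. \<bar>Q x\<bar> * (norm (w x))\<^sup>2 + \<bar>Q x\<bar> * (norm (f x))\<^sup>2)"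
    using assms by (auto simp: form_dom_def)
  show "(\<lambda>x. Qc x * (w x * cnj (f x))) \<in> borel_measurable lborel"
    by measurable
  show "AE x in lborel. norm (Qc x * (w x * cnj (f x))) \<le> norm (\<bar>Q x\<bar> * (norm (w x))\<^sup>2 + \<bar>Q x\<bar> * (norm (f x))\<^sup>2)"
  proof (rule AE_I2)
    fix x
    have "2 * (norm (w x) * norm (f x)) \<le> (norm (w x))\<^sup>2 + (norm (f x))\<^sup>2"
      using sum_squares_bound[of "norm (w x)" "norm (f x)"] by simp
    moreover have "0 \<le> norm (w x) * norm (f x)" by simp
    ultimately have "norm (w x) * norm (f x) \<le> (norm (w x))\<^sup>2 + (norm (f x))\<^sup>2" by linarith
    then have "\<bar>Q x\<bar> * (norm (w x) * norm (f x)) \<le> \<bar>Q x\<bar> * ((norm (w x))\<^sup>2 + (norm (f x))\<^sup>2)"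
      by (rule mult_left_mono) simp
    then show "norm (Qc x * (w x * cnj (f x))) \<le> norm (\<bar>Q x\<bar> * (norm (w x))\<^sup>2 + \<bar>Q x\<bar> * (norm (f x))\<^sup>2)"
      by (simp add: norm_mult algebra_simps)
  qed
qed

lemma form_dom_integrable:
  assumes "form_dom w w'" "form_dom f f'"
  shows "integrable lborel (\<lambda>x. w' x * cnj (f' x) + Qc x * (w x * cnj (f x)))"
  using assms form_dom_Q_integrable[OF assms] by (auto simp: form_dom_def intro!: L2_inner_integrable)

lemma form_dom_add:
  assumes "form_dom f f'" "form_dom g g'"
  shows "form_dom (\<lambda>x. f x + g x) (\<lambda>x. f' x + g' x)"
proof -
  note [measurable] = form_dom_measurable[OF assms(1)] form_dom_measurable[OF assms(2)]
  have "integrable lborel (\<lambda>x. \<bar>Q x\<bar> * (norm (f x + g x))\<^sup>2)"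
  proof (rule Bochner_Integration.integrable_bound)
    show "integrable lborel (\<lambda>x. 2 * (\<bar>Q x\<bar> * (norm (f x))\<^sup>2) + 2 * (\<bar>Q x\<bar> * (norm (g x))\<^sup>2))"
      using assms by (auto simp: form_dom_def)
    show "AE x in lborel. norm (\<bar>Q x\<bar> * (norm (f x + g x))\<^sup>2) \<le> norm (2 * (\<bar>Q x\<bar> * (norm (f x))\<^sup>2) + 2 * (\<bar>Q x\<bar> * (norm (g x))\<^sup>2))"
    proof (rule AE_I2)
      fix x
      have "\<bar>Q x\<bar> * (norm (f x + g x))\<^sup>2 \<le> \<bar>Q x\<bar> * (2 * (norm (f x))\<^sup>2 + 2 * (norm (g x))\<^sup>2)"
        by (intro mult_left_mono norm_add_square_le) simp
      then show "norm (\<bar>Q x\<bar> * (norm (f x + g x))\<^sup>2) \<le> norm (2 * (\<bar>Q x\<bar> * (norm (f x))\<^sup>2) + 2 * (\<bar>Q x\<bar> * (norm (g x))\<^sup>2))"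
        by (simp add: algebra_simps abs_mult)
    qed
  qed measurable
  then show ?thesis using assms by (auto simp: form_dom_def intro: has_ac_derivative_add)
qed

lemma form_dom_cmult: "form_dom f f' \<Longrightarrow> form_dom (\<lambda>x. c * f x) (\<lambda>x. c * f' x)"
  using integrable_mult_right[of "(norm c)\<^sup>2" lborel "\<lambda>x. \<bar>Q x\<bar> * (norm (f x))\<^sup>2"]
  by (auto simp: form_dom_def norm_mult power_mult_distrib mult_ac intro: has_ac_derivative_cmult)

lemma form_dom_zero: "form_dom (\<lambda>x. 0) (\<lambda>x. 0)"
  by (auto simp: form_dom_def intro: has_ac_derivative_const)

lemma form_dom_sum: "(\<And>i. i \<in> I \<Longrightarrow> form_dom (f i) (f' i)) \<Longrightarrow> form_dom (\<lambda>x. \<Sum>i\<in>I. f i x) (\<lambda>x. \<Sum>i\<in>I. f' i x)"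
  by (induction I rule: infinite_finite_induct) (auto intro: form_dom_zero form_dom_add)

lemma form_dom_diff: "form_dom f f' \<Longrightarrow> form_dom g g' \<Longrightarrow> form_dom (\<lambda>x. f x - g x) (\<lambda>x. f' x - g' x)"
  using form_dom_add[OF _ form_dom_cmult[of g g' "-1"], of f f'] by simp

text \<open>Green's formula without boundary terms: \<open>w'\<close> and \<open>f\<close> are in
  \<open>L2\<close>, so \<open>w' * cnj f\<close> is integrable, and so is its derivative.\<close>

lemma dsol_form:
  assumes "dsol w w' h" "form_dom f f'"
  shows "L2_inner h f = form w w' f f'"
proof -
  have w: "has_ac_derivative w w'" "has_ac_derivative w' (\<lambda>x. Qc x * w x - h x)" "w \<in> L2" "h \<in> L2"
    using assms(1) by (auto simp: dsol_def sol_def)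
  note w' = dsol_form_dom[OF assms(1)]
  have L: "w' \<in> L2" "f \<in> L2" "has_ac_derivative f f'" using w' assms(2) by (auto simp: form_dom_def)
  have "has_ac_derivative (\<lambda>x. w' x * cnj (f x)) (\<lambda>x. (Qc x * w x - h x) * cnj (f x) + w' x * cnj (f' x))"
    by (intro has_ac_derivative_mult has_ac_derivative_cnj w L)
  moreover have e: "(\<lambda>x. (Qc x * w x - h x) * cnj (f x) + w' x * cnj (f' x)) =
     (\<lambda>x. (w' x * cnj (f' x) + Qc x * (w x * cnj (f x))) - h x * cnj (f x))"
    by (simp add: fun_eq_iff algebra_simps)
  moreover have i: "integrable lborel (\<lambda>x. h x * cnj (f x))" by (rule L2_inner_integrable[OF w(4) L(2)])
  ultimately have "(\<integral>x. (w' x * cnj (f' x) + Qc x * (w x * cnj (f x))) - h x * cnj (f x) \<partial>lborel) = 0"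
    using form_dom_integrable[OF w' assms(2)] L2_inner_integrable[OF L(1,2)]
    by (intro integral_ac_derivative_eq_0[of "\<lambda>x. w' x * cnj (f x)"]) auto
  then show ?thesis
    using form_dom_integrable[OF w' assms(2)] i by (simp add: form_def L2_inner_def)
qed

lemma form_commute: "form f f' w w' = cnj (form w w' f f')"
  unfolding form_def by (subst Bochner_Integration.integral_cnj[symmetric]) (simp add: mult_ac)

lemma form_self: "form f f' f f' = of_real (energy f f')"
proof -
  have "f' x * cnj (f' x) + Qc x * (f x * cnj (f x)) = complex_of_real ((norm (f' x))\<^sup>2 + Q x * (norm (f x))\<^sup>2)" for x
    by (simp only: complex_norm_square of_real_add of_real_mult)
  then show ?thesis unfolding form_def energy_def by (simp only: integral_complex_of_real)
qed

lemma form_dom_energy_integrable: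
  assumes "form_dom f f'"
  shows "integrable lborel (\<lambda>x. Q x * (norm (f x))\<^sup>2)" "integrable lborel (\<lambda>x. (norm (f' x))\<^sup>2 + Q x * (norm (f x))\<^sup>2)"
proof -
  have [measurable]: "f \<in> borel_measurable borel" by (rule form_dom_measurable[OF assms])
  show 1: "integrable lborel (\<lambda>x. Q x * (norm (f x))\<^sup>2)"
  proof (rule Bochner_Integration.integrable_bound)
    show "integrable lborel (\<lambda>x. \<bar>Q x\<bar> * (norm (f x))\<^sup>2)" using assms by (simp add: form_dom_def)
  qed (auto simp: abs_mult)
  show "integrable lborel (\<lambda>x. (norm (f' x))\<^sup>2 + Q x * (norm (f x))\<^sup>2)"
    using 1 assms by (auto simp: form_dom_def intro: L2_integrable_square)
qed

lemma energy_ge: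
  assumes "form_dom f f'"
  shows "- M * sqnorm f \<le> energy f f'"
proof -
  have "- M * sqnorm f = (\<integral>x. - M * (norm (f x))\<^sup>2 \<partial>lborel)" by (simp add: sqnorm_def)
  also have "\<dots> \<le> energy f f'" unfolding energy_def
  proof (intro integral_mono form_dom_energy_integrable[OF assms])
    show "integrable lborel (\<lambda>x. - M * (norm (f x))\<^sup>2)" using assms by (auto simp: form_dom_def intro: L2_integrable_square)
    fix x
    have "- M * (norm (f x))\<^sup>2 \<le> Q x * (norm (f x))\<^sup>2" using Q_ge by (intro mult_right_mono) auto
    then show "- M * (norm (f x))\<^sup>2 \<le> (norm (f' x))\<^sup>2 + Q x * (norm (f x))\<^sup>2" by (simp add: add_increasing)
  qed
  finally show ?thesis .
qed

lemma dsol_energy: "dsol u u' h \<Longrightarrow> L2_inner h u = of_real (energy u u')"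
  using dsol_form[OF _ dsol_form_dom] form_self by metis

lemma dsol_symmetric:
  assumes "dsol u u' h" "dsol v v' k"
  shows "L2_inner h v = L2_inner u k"
proof -
  have "L2_inner h v = form u u' v v'" by (rule dsol_form[OF assms(1) dsol_form_dom[OF assms(2)]])
  moreover have "L2_inner k u = form v v' u u'" by (rule dsol_form[OF assms(2) dsol_form_dom[OF assms(1)]])
  ultimately show ?thesis by (metis form_commute L2_inner_commute)
qed

lemma dsol_add: "dsol u u' h \<Longrightarrow> dsol v v' k \<Longrightarrow> dsol (\<lambda>x. u x + v x) (\<lambda>x. u' x + v' x) (\<lambda>x. h x + k x)"
  unfolding dsol_def by (auto intro: sol_add)

lemma dsol_cmult: "dsol u u' h \<Longrightarrow> dsol (\<lambda>x. c * u x) (\<lambda>x. c * u' x) (\<lambda>x. c * h x)"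
  unfolding dsol_def by (auto intro: sol_cmult)

lemma dsol_diff: "dsol u u' h \<Longrightarrow> dsol v v' k \<Longrightarrow> dsol (\<lambda>x. u x - v x) (\<lambda>x. u' x - v' x) (\<lambda>x. h x - k x)"
  using dsol_add[OF _ dsol_cmult[of v v' k "-1"], of u u' h] by simp

lemma dsol_sqnorm_pos:
  assumes "dsol u u' h" "u x \<noteq> 0"
  shows "0 < sqnorm u"
proof (rule ccontr)
  assume "\<not> 0 < sqnorm u"
  then have "sqnorm u = 0" using sqnorm_nonneg[of u] by (metis less_eq_real_def)
  then have ae: "AE x in lborel. u x = 0" using assms sqnorm_eq_0_iff by (auto simp: dsol_def)
  have c: "continuous_on UNIV u" using assms sol_continuous by (auto simp: dsol_def)
  show False using continuous_AE_eq_0[OF ae c] assms(2) by simp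
qed

end

section \<open>Compactness of the resolvent\<close>

lemma L2_inner_tendsto:
  assumes "\<And>n. g n \<in> L2" "G \<in> L2" "w \<in> L2" "(\<lambda>n. sqnorm (\<lambda>x. g n x - G x)) \<longlonglongrightarrow> 0"
  shows "(\<lambda>n. L2_inner (g n) w) \<longlonglongrightarrow> L2_inner G w"
proof (rule LIM_zero_cancel, rule Lim_null_comparison)
  show "\<forall>\<^sub>F n in sequentially. norm (L2_inner (g n) w - L2_inner G w) \<le> sqrt (sqnorm (\<lambda>x. g n x - G x)) * sqrt (sqnorm w)"
    using L2_Cauchy_Schwarz[OF L2_diff[OF assms(1,2)] assms(3)] assms
    by (intro always_eventually allI) (simp add: L2_inner_diff_left)
  have "(\<lambda>n. sqrt (sqnorm (\<lambda>x. g n x - G x)) * sqrt (sqnorm w)) \<longlonglongrightarrow> sqrt 0 * sqrt (sqnorm w)"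
    by (intro tendsto_intros assms)
  then show "(\<lambda>n. sqrt (sqnorm (\<lambda>x. g n x - G x)) * sqrt (sqnorm w)) \<longlonglongrightarrow> 0" by simp
qed

lemma L2_indicator_mult_continuous:
  assumes "continuous_on UNIV s"
  shows "(\<lambda>x. indicator {a..b::real} x * s x) \<in> L2"
proof -
  have c: "continuous_on {a..b} s" using assms by (rule continuous_on_subset) simp
  have "compact (s ` {a..b})" using c by (intro compact_continuous_image) auto
  then obtain B where B: "\<And>x. x \<in> {a..b} \<Longrightarrow> norm (s x) \<le> B"
    by (meson compact_imp_bounded bounded_iff image_eqI)
  have m: "s \<in> borel_measurable borel" using assms by (rule borel_measurable_continuous_onI)
  have "(\<lambda>x. (indicator {a..b} x * s x) * indicator {a..b} x) \<in> L2"
  proof (rule L2_mult_bounded[OF L2_indicator, where B = "\<bar>B\<bar>"])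
    show "(\<lambda>x. indicator {a..b} x * s x) \<in> borel_measurable borel"
      using m by (intro borel_measurable_times) auto
    show "norm (indicator {a..b} x * s x) \<le> \<bar>B\<bar>" for x
      using B[of x] by (auto simp: indicator_def)
  qed
  moreover have "(\<lambda>x. (indicator {a..b} x * s x) * indicator {a..b} x) = (\<lambda>x. indicator {a..b} x * s x)"
    by (auto simp: indicator_def)
  ultimately show ?thesis by simp
qed

text \<open>Integrals against a continuous function over a compact interval are inner products with
  a truncated function, so norm convergence passes to them.\<close>

lemma prim_L2_tendsto:
  assumes g: "\<And>n. g n \<in> L2" "G \<in> L2" "(\<lambda>n. sqnorm (\<lambda>x. g n x - G x)) \<longlonglongrightarrow> 0" and s: "continuous_on UNIV s"
  shows "(\<lambda>n. prim (\<lambda>t. g n t * s t) x) \<longlonglongrightarrow> prim (\<lambda>t. G t * s t) x"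
proof -
  have L: "(LINT t:{a..b}|lborel. k t * s t) = L2_inner k (\<lambda>t. cnj (indicator {a..b} t * s t))" for k a b
    unfolding set_lebesgue_integral_def L2_inner_def
    by (intro Bochner_Integration.integral_cong) (auto simp: indicator_def)
  have "(\<lambda>n. LINT t:{a..b}|lborel. g n t * s t) \<longlonglongrightarrow> (LINT t:{a..b}|lborel. G t * s t)" for a b
    unfolding L by (intro L2_inner_tendsto g L2_cnj L2_indicator_mult_continuous s)
  then show ?thesis unfolding prim_def by (auto intro: tendsto_minus)
qed

context confining
begin

text \<open>The one-dimensional Sobolev inequality: integrate the derivative of |u|^2 from
  \<open>x\<close> to a point \<open>t\<close> with |u(t)|^2 < e. Such a point exists to the right
  of \<open>x\<close> because \<open>u\<close> is square integrable.\<close>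

lemma form_dom_sup_bound:
  assumes "form_dom u u'"
  shows "(norm (u x))\<^sup>2 \<le> 2 * (sqrt (sqnorm u') * sqrt (sqnorm u))"
proof (rule field_le_epsilon)
  fix e :: real assume e: "0 < e"
  have u: "has_ac_derivative u u'" "u \<in> L2" "u' \<in> L2" using assms by (auto simp: form_dom_def)
  have i: "integrable lborel (\<lambda>x. 2 * (norm (u' x) * norm (u x)))"
    using L2_norm_mult_integrable[OF u(3,2)] by auto
  obtain t where t: "x \<le> t" "(norm (u t))\<^sup>2 < e"
  proof (rule ccontr)
    assume "\<not> thesis"
    then have "e \<le> (norm (u t))\<^sup>2" if "x \<le> t" for t using that \<open>\<And>t. _ \<Longrightarrow> _ \<Longrightarrow> thesis\<close> by (meson not_le)
    then have "e \<le> (norm (u t))\<^sup>2 + (norm (u (-t)))\<^sup>2" if "x \<le> t" for t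
      using that by (simp add: add_increasing2)
    from not_integrable_of_lower_bound[where T = x, OF L2_integrable_square[OF u(2)] e this] show False by simp
  qed
  have ac: "has_ac_derivative (\<lambda>x. u x * cnj (u x)) (\<lambda>x. u' x * cnj (u x) + u x * cnj (u' x))"
    by (intro has_ac_derivative_mult has_ac_derivative_cnj u)
  have sq: "u x * cnj (u x) = of_real ((norm (u x))\<^sup>2)" for x by (simp only: complex_norm_square)
  have "norm (complex_of_real ((norm (u t))\<^sup>2 - (norm (u x))\<^sup>2)) = norm (LINT y:{x..t}|lborel. u' y * cnj (u y) + u y * cnj (u' y))"
    using ac_on_integral[OF has_ac_derivativeD[OF ac] t(1)] unfolding sq by simp
  also have "\<dots> \<le> (LINT y:{x..t}|lborel. 2 * (norm (u' y) * norm (u y)))"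
  proof (rule norm_set_integral_le[OF ac_on_integrable[OF has_ac_derivativeD[OF ac]]])
    show "set_integrable lborel {x..t} (\<lambda>y. 2 * (norm (u' y) * norm (u y)))"
      unfolding set_integrable_def by (intro integrable_mult_indicator i) auto
    show "norm (u' y * cnj (u y) + u y * cnj (u' y)) \<le> 2 * (norm (u' y) * norm (u y))" for y
      using norm_triangle_ineq[of "u' y * cnj (u y)" "u y * cnj (u' y)"] by (simp add: norm_mult mult.commute)
  qed
  also have "\<dots> \<le> (\<integral>y. 2 * (norm (u' y) * norm (u y)) \<partial>lborel)"
    unfolding set_lebesgue_integral_def
    by (intro integral_mono i integrable_mult_indicator) (auto simp: indicator_def)
  also have "\<dots> \<le> 2 * (sqrt (sqnorm u') * sqrt (sqnorm u))"
    using L2_Cauchy_Schwarz_norm[OF u(3,2)] by simp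
  finally have "\<bar>(norm (u t))\<^sup>2 - (norm (u x))\<^sup>2\<bar> \<le> 2 * (sqrt (sqnorm u') * sqrt (sqnorm u))"
    by (simp only: norm_of_real)
  then show "(norm (u x))\<^sup>2 \<le> 2 * (sqrt (sqnorm u') * sqrt (sqnorm u)) + e" using t(2) by linarith
qed

text \<open>The energy equals the inner product of \<open>h\<close> and \<open>u\<close>. After
  adding \<open>M * sqnorm u\<close> its kinetic and potential parts are both nonnegative, so the
  Cauchy-Schwarz bound of the sum bounds each of them.\<close>

lemma dsol_bounds:
  assumes "dsol u u' h"
  shows "sqnorm u' \<le> sqrt (sqnorm h) * sqrt (sqnorm u) + M * sqnorm u"
    and "integrable lborel (\<lambda>x. (Q x + M) * (norm (u x))\<^sup>2)"
    and "(\<integral>x. (Q x + M) * (norm (u x))\<^sup>2 \<partial>lborel) \<le> sqrt (sqnorm h) * sqrt (sqnorm u) + M * sqnorm u"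
proof -
  have u: "u \<in> L2" "h \<in> L2" using assms by (auto simp: dsol_def)
  note form_dom = dsol_form_dom[OF assms]
  have u': "u' \<in> L2" using form_dom by (simp add: form_dom_def)
  have "norm (complex_of_real (energy u u')) \<le> sqrt (sqnorm h) * sqrt (sqnorm u)"
    using L2_Cauchy_Schwarz[OF u(2,1)] by (simp add: dsol_energy[OF assms])
  then have e: "energy u u' \<le> sqrt (sqnorm h) * sqrt (sqnorm u)" by simp
  note iQ = form_dom_energy_integrable[OF form_dom] and iu = L2_integrable_square[OF u(1)] and iu' = L2_integrable_square[OF u']
  show i: "integrable lborel (\<lambda>x. (Q x + M) * (norm (u x))\<^sup>2)"
    using iQ iu by (simp add: distrib_right)
  have s: "energy u u' + M * sqnorm u = sqnorm u' + (\<integral>x. (Q x + M) * (norm (u x))\<^sup>2 \<partial>lborel)"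
    using iQ iu iu' by (simp add: energy_def sqnorm_def distrib_right)
  have p: "0 \<le> (\<integral>x. (Q x + M) * (norm (u x))\<^sup>2 \<partial>lborel)"
  proof (rule Bochner_Integration.integral_nonneg)
    show "0 \<le> (Q x + M) * (norm (u x))\<^sup>2" for x using Q_ge[of x] by simp
  qed
  show "sqnorm u' \<le> sqrt (sqnorm h) * sqrt (sqnorm u) + M * sqnorm u" using s e p by linarith
  show "(\<integral>x. (Q x + M) * (norm (u x))\<^sup>2 \<partial>lborel) \<le> sqrt (sqnorm h) * sqrt (sqnorm u) + M * sqnorm u"
    using s e sqnorm_nonneg[of u'] by linarith
qed

lemma dsol_bounds_uniform:
  assumes "dsol u u' h" "sqnorm u \<le> A" "sqnorm h \<le> B"
  shows "(norm (u x))\<^sup>2 \<le> 2 * (sqrt (sqrt B * sqrt A + M * A) * sqrt A)"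
    and "(\<integral>x. (Q x + M) * (norm (u x))\<^sup>2 \<partial>lborel) \<le> sqrt B * sqrt A + M * A"
proof -
  have AB: "0 \<le> A" "0 \<le> B"
    using order_trans[OF sqnorm_nonneg assms(2)] order_trans[OF sqnorm_nonneg assms(3)] by auto
  have le: "sqrt (sqnorm h) * sqrt (sqnorm u) + M * sqnorm u \<le> sqrt B * sqrt A + M * A"
    using assms(2,3) M_nonneg AB
    by (intro add_mono mult_mono mult_left_mono real_sqrt_le_mono) (auto intro: order_trans)
  show "(\<integral>x. (Q x + M) * (norm (u x))\<^sup>2 \<partial>lborel) \<le> sqrt B * sqrt A + M * A"
    using dsol_bounds(3)[OF assms(1)] le by linarith
  have u'_le: "sqnorm u' \<le> sqrt B * sqrt A + M * A" using dsol_bounds(1)[OF assms(1)] le by linarith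
  then have "2 * (sqrt (sqnorm u') * sqrt (sqnorm u)) \<le> 2 * (sqrt (sqrt B * sqrt A + M * A) * sqrt A)"
    using assms(2) order_trans[OF sqnorm_nonneg u'_le] by (intro mult_left_mono mult_mono real_sqrt_le_mono) auto
  then show "(norm (u x))\<^sup>2 \<le> 2 * (sqrt (sqrt B * sqrt A + M * A) * sqrt A)"
    using form_dom_sup_bound[OF dsol_form_dom[OF assms(1)], of x] by linarith
qed

text \<open>Boundedness of \<open>u n\<close> in the form domain bounds its Cauchy data at
  \<open>0\<close>, so that variation of constants gives locally uniform convergence along a subsequence; the growth
  of \<open>Q\<close> prevents mass from escaping to infinity.\<close>

theorem dsol_compactness:
  assumes u: "\<And>n. dsol (u n) (u' n) (\<lambda>x. g n x + z * u n x)" and C: "\<And>n. sqnorm (u n) \<le> C"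
    and g: "\<And>n. g n \<in> L2" "G \<in> L2" "(\<lambda>n. sqnorm (\<lambda>x. g n x - G x)) \<longlonglongrightarrow> 0"
  obtains r v v' where "strict_mono (r :: nat \<Rightarrow> nat)" "dsol v v' (\<lambda>x. G x + z * v x)"
    "(\<lambda>n. sqnorm (\<lambda>x. u (r n) x - v x)) \<longlonglongrightarrow> 0"
proof -
  interpret ode_coefficient "\<lambda>x. Qc x - z" "\<lambda>t. m t + norm z" by (rule ode_shift)
  obtain c c' s s' where fund_sys: "fund_sys (\<lambda>x. Qc x - z) c c' s s'" by (rule fund_sys_exists)
  then have c: "sol (\<lambda>x. Qc x - z) (\<lambda>x. 0) c c'" and s: "sol (\<lambda>x. Qc x - z) (\<lambda>x. 0) s s'"
    by (auto simp: fund_sys_def)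
  have uL: "u n \<in> L2" for n using u[of n] by (simp add: dsol_def)
  have us: "sol (\<lambda>x. Qc x - z) (g n) (u n) (u' n)" for n
    using u[of n] sol_shift[of Qc "\<lambda>x. g n x + z * u n x" "u n" "u' n" z] by (simp add: dsol_def)
  obtain K where K: "\<And>n. sqnorm (\<lambda>x. g n x - G x) \<le> K"
    using convergent_imp_Bseq[OF convergentI[OF g(3)]] by (auto simp: Bseq_def)
  \<comment> \<open>A bound of the right-hand sides, obtained by applying |a + b|^2 \<le> 2|a|^2 +
    2|b|^2 to (g - G) + G and then to g + z u.\<close>
  define B where "B = 2 * (2 * K + 2 * sqnorm G) + 2 * ((norm z)\<^sup>2 * C)"
  have hB: "sqnorm (\<lambda>x. g n x + z * u n x) \<le> B" for n
  proof -
    have "sqnorm (\<lambda>x. (g n x - G x) + G x) \<le> 2 * sqnorm (\<lambda>x. g n x - G x) + 2 * sqnorm G"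
      by (intro sqnorm_add_le L2_diff g)
    then have "sqnorm (g n) \<le> 2 * K + 2 * sqnorm G" using K[of n] by simp
    moreover have "sqnorm (\<lambda>x. g n x + z * u n x) \<le> 2 * sqnorm (g n) + 2 * sqnorm (\<lambda>x. z * u n x)"
      by (intro sqnorm_add_le L2_cmult g uL)
    moreover have "sqnorm (\<lambda>x. z * u n x) \<le> (norm z)\<^sup>2 * C" unfolding sqnorm_cmult using C by (intro mult_left_mono) auto
    ultimately show ?thesis by (simp add: B_def)
  qed
  define S where "S = 2 * (sqrt (sqrt B * sqrt C + M * C) * sqrt C)"
  have sup: "(norm (u n x))\<^sup>2 \<le> S" for n x
    unfolding S_def by (rule dsol_bounds_uniform(1)[OF u C hB])
  then have sup': "norm (u n x) \<le> sqrt S" for n x using real_le_rsqrt by blast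
  define w where "w k x = c x * prim (\<lambda>t. k t * s t) x - s x * prim (\<lambda>t. k t * c t) x" for k x
  have ueq: "u n x = c x * u n 0 + s x * u' n 0 + w (g n) x" for n x
    using sol_variation(1)[OF fund_sys us[of n], of x] by (simp add: w_def algebra_simps)
  have wlim: "(\<lambda>n. w (g n) x) \<longlonglongrightarrow> w G x" for x
    unfolding w_def by (intro tendsto_intros prim_L2_tendsto g sol_continuous[OF c] sol_continuous[OF s])
  \<comment> \<open>The sup bound controls only values of \<open>u n\<close>. At a point where
    \<open>s\<close> does not vanish, variation of constants can be solved for
    \<open>u' n 0\<close>, which bounds the second half of the Cauchy data.\<close>
  obtain x1 where x1: "s x1 \<noteq> 0"
  proof (rule ccontr)
    assume "\<not> thesis"
    then have "s x = 0" for x using that by blast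
    then have "s = (\<lambda>x. 0)" by auto
    moreover have "(s has_vector_derivative s' 0) (at 0)"
      using s by (intro has_ac_derivative_continuous_imp_vector_derivative sol_continuous[OF s]) (simp add: sol_def)
    ultimately have "s' 0 = 0" using vector_derivative_unique_at[of s "s' 0" 0 0] by simp
    then show False using fund_sys by (simp add: fund_sys_def)
  qed
  have "Bseq (\<lambda>n. w (g n) x1)" by (rule convergent_imp_Bseq[OF convergentI[OF wlim]])
  then obtain K1 where K1: "\<And>n. norm (w (g n) x1) \<le> K1" by (auto simp: Bseq_def)
  have b1: "norm (u' n 0) \<le> (sqrt S + norm (c x1) * sqrt S + K1) / norm (s x1)" for n
  proof -
    have "s x1 * u' n 0 = u n x1 - c x1 * u n 0 - w (g n) x1" using ueq[of n x1] by simp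
    then have "norm (s x1) * norm (u' n 0) = norm (u n x1 - c x1 * u n 0 - w (g n) x1)" by (metis norm_mult)
    also have "\<dots> \<le> norm (u n x1) + norm (c x1 * u n 0) + norm (w (g n) x1)"
      using norm_triangle_ineq4[of "u n x1 - c x1 * u n 0" "w (g n) x1"] norm_triangle_ineq4[of "u n x1" "c x1 * u n 0"] by linarith
    also have "\<dots> \<le> sqrt S + norm (c x1) * sqrt S + K1"
      using sup'[of n x1] mult_left_mono[OF sup'[of n 0], of "norm (c x1)"] K1[of n] by (simp add: norm_mult)
    finally show ?thesis using x1 by (simp add: pos_le_divide_eq mult.commute)
  qed
  have "bounded (range (\<lambda>n. (u n 0, u' n 0)))"
  proof -
    have "norm (u n 0, u' n 0) \<le> sqrt S + (sqrt S + norm (c x1) * sqrt S + K1) / norm (s x1)" for n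
      using norm_Pair_le[of "u n 0" "u' n 0"] sup'[of n 0] b1[of n] by linarith
    then show ?thesis unfolding bounded_iff by blast
  qed
  then obtain l r where r: "strict_mono r" and l: "((\<lambda>n. (u n 0, u' n 0)) \<circ> r) \<longlonglongrightarrow> l"
    using bounded_imp_convergent_subsequence by blast
  have lA: "(\<lambda>n. u (r n) 0) \<longlonglongrightarrow> fst l" and lB: "(\<lambda>n. u' (r n) 0) \<longlonglongrightarrow> snd l"
    using tendsto_fst[OF l] tendsto_snd[OF l] by (simp_all add: o_def)
  define v where "v x = c x * (fst l + prim (\<lambda>t. G t * s t) x) + s x * (snd l - prim (\<lambda>t. G t * c t) x)" for x
  define v' where "v' x = c' x * (fst l + prim (\<lambda>t. G t * s t) x) + s' x * (snd l - prim (\<lambda>t. G t * c t) x)" for x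
  have vs: "sol (\<lambda>x. Qc x - z) G v v'"
    unfolding v_def v'_def by (rule sol_variation_exists[OF fund_sys L2_set_integrable[OF g(2)]])
  have pt: "(\<lambda>n. u (r n) x) \<longlonglongrightarrow> v x" for x
  proof -
    have "(\<lambda>n. w (g (r n)) x) \<longlonglongrightarrow> w G x" using LIMSEQ_subseq_LIMSEQ[OF wlim r] by (simp add: o_def)
    then have "(\<lambda>n. c x * u (r n) 0 + s x * u' (r n) 0 + w (g (r n)) x) \<longlonglongrightarrow> c x * fst l + s x * snd l + w G x"
      by (intro tendsto_intros lA lB)
    then show ?thesis unfolding ueq[symmetric] by (simp add: v_def w_def algebra_simps)
  qed
  have vm: "v \<in> borel_measurable borel" 
    using sol_continuous(1)[OF vs, of UNIV] by (rule borel_measurable_continuous_onI)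
  have vL: "v \<in> L2" and vC: "sqnorm v \<le> C"
    using sqnorm_fatou[of "\<lambda>n. u (r n)" C v, OF uL C vm] pt by auto
  have v: "dsol v v' (\<lambda>x. G x + z * v x)"
    using vs sol_shift[of Qc "\<lambda>x. G x + z * v x" v v' z] vL g(2) by (auto simp: dsol_def)
  \<comment> \<open>The differences solve the equation too, with bounded right-hand sides; hence
    they obey a uniform sup bound, used on compact sets, and a uniform bound of the mass weighted by
    \<open>Q + M\<close>, used for the tails.\<close>
  define d d' e where "d n x = u (r n) x - v x" and "d' n x = u' (r n) x - v' x" 
    and "e n x = (g (r n) x + z * u (r n) x) - (G x + z * v x)" for n x
  have d: "dsol (d n) (d' n) (e n)" for n
    using dsol_diff[OF u[of "r n"] v] by (simp add: d_def[abs_def] d'_def[abs_def] e_def[abs_def])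
  have dL: "d n \<in> L2" for n using d by (simp add: dsol_def)
  have dA: "sqnorm (d n) \<le> 4 * C" for n
    using sqnorm_diff_le[OF uL[of "r n"] vL] C[of "r n"] vC by (simp add: d_def[abs_def])
  define B' where "B' = 2 * B + 2 * sqnorm (\<lambda>x. G x + z * v x)"
  have eB: "sqnorm (e n) \<le> B'" for n
  proof -
    have "sqnorm (e n) \<le> 2 * sqnorm (\<lambda>x. g (r n) x + z * u (r n) x) + 2 * sqnorm (\<lambda>x. G x + z * v x)"
      unfolding e_def by (intro sqnorm_diff_le L2_add L2_cmult g uL vL)
    then show ?thesis using hB[of "r n"] by (simp add: B'_def)
  qed
  define S' where "S' = 2 * (sqrt (sqrt B' * sqrt (4 * C) + M * (4 * C)) * sqrt (4 * C))"
  define E' where "E' = sqrt B' * sqrt (4 * C) + M * (4 * C)"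
  have dsup: "(norm (d n x))\<^sup>2 \<le> S'" for n x
    unfolding S'_def by (rule dsol_bounds_uniform(1)[OF d dA eB])
  have dQ: "(\<integral>x. (Q x + M) * (norm (d n x))\<^sup>2 \<partial>lborel) \<le> E'" for n
    unfolding E'_def by (rule dsol_bounds_uniform(2)[OF d dA eB])
  have "(\<lambda>n. sqnorm (d n)) \<longlonglongrightarrow> 0"
  proof (rule LIMSEQ_I)
    fix \<epsilon> :: real assume \<epsilon>: "0 < \<epsilon>"
    \<comment> \<open>Outside \<open>{-X..X}\<close> the weight \<open>Q + M\<close> is so large
      that the bound \<open>E'\<close> leaves at most \<epsilon>/2 for the tail;
      \<open>\<bar>E'\<bar> + 1\<close> keeps the quotient positive.\<close>
    obtain X where X: "0 \<le> X" "\<And>x. X \<le> \<bar>x\<bar> \<Longrightarrow> 2 * (\<bar>E'\<bar> + 1) / \<epsilon> \<le> Q x"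
      using Q_at_infinity by blast
    have "(\<lambda>n. \<integral>x. indicator {-X..X} x *\<^sub>R (norm (d n x))\<^sup>2 \<partial>lborel) \<longlonglongrightarrow> (\<integral>x. 0 \<partial>(lborel::real measure))"
    proof (rule integral_dominated_convergence[where w = "\<lambda>x. S' * indicator {-X..X} x"])
      show "integrable lborel (\<lambda>x. S' * indicat_real {-X..X} x)"
        by (intro integrable_mult_right integrable_real_indicator) (auto simp: emeasure_lborel_Icc_eq)
      show "(\<lambda>x. indicat_real {-X..X} x *\<^sub>R (norm (d n x))\<^sup>2) \<in> borel_measurable lborel" for n
        using L2_measurable[OF dL] by auto
      show "AE x in lborel. (\<lambda>n. indicat_real {-X..X} x *\<^sub>R (norm (d n x))\<^sup>2) \<longlonglongrightarrow> 0"
      proof (rule AE_I2)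
        fix x
        have "(\<lambda>n. d n x) \<longlonglongrightarrow> 0" unfolding d_def using pt[of x] by (rule LIM_zero)
        then have "(\<lambda>n. indicat_real {-X..X} x *\<^sub>R (norm (d n x))\<^sup>2) \<longlonglongrightarrow> indicat_real {-X..X} x *\<^sub>R (norm (0::complex))\<^sup>2"
          by (intro tendsto_intros)
        then show "(\<lambda>n. indicat_real {-X..X} x *\<^sub>R (norm (d n x))\<^sup>2) \<longlonglongrightarrow> 0" by simp
      qed
      show "AE x in lborel. norm (indicat_real {-X..X} x *\<^sub>R (norm (d n x))\<^sup>2) \<le> S' * indicat_real {-X..X} x" for n
        using dsup by (auto simp: indicator_def)
    qed auto
    then have "(\<lambda>n. \<integral>x. indicator {-X..X} x *\<^sub>R (norm (d n x))\<^sup>2 \<partial>lborel) \<longlonglongrightarrow> 0" by simp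
    then have "\<forall>\<^sub>F n in sequentially. (\<integral>x. indicator {-X..X} x *\<^sub>R (norm (d n x))\<^sup>2 \<partial>lborel) < \<epsilon> / 2"
      using \<epsilon> by (intro order_tendstoD(2)) auto
    then obtain N where N: "\<And>n. N \<le> n \<Longrightarrow> (\<integral>x. indicator {-X..X} x *\<^sub>R (norm (d n x))\<^sup>2 \<partial>lborel) < \<epsilon> / 2"
      unfolding eventually_sequentially by blast
    have "norm (sqnorm (d n) - 0) < \<epsilon>" if n: "N \<le> n" for n
    proof -
      let ?k = "\<epsilon> / (2 * (\<bar>E'\<bar> + 1))"
      have k: "0 < ?k" using \<epsilon> by simp
      have i1: "integrable lborel (\<lambda>x. indicator {-X..X} x *\<^sub>R (norm (d n x))\<^sup>2)"
        by (intro integrable_mult_indicator L2_integrable_square dL) auto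
      have i2: "integrable lborel (\<lambda>x. (Q x + M) * (norm (d n x))\<^sup>2)" by (rule dsol_bounds(2)[OF d])
      have "sqnorm (d n) \<le> (\<integral>x. indicator {-X..X} x *\<^sub>R (norm (d n x))\<^sup>2 + ?k * ((Q x + M) * (norm (d n x))\<^sup>2) \<partial>lborel)"
        unfolding sqnorm_def
      proof (rule integral_mono)
        fix x
        have p: "0 \<le> ?k * ((Q x + M) * (norm (d n x))\<^sup>2)"
          using k Q_ge[of x] by (intro mult_nonneg_nonneg) auto
        show "(norm (d n x))\<^sup>2 \<le> indicator {-X..X} x *\<^sub>R (norm (d n x))\<^sup>2 + ?k * ((Q x + M) * (norm (d n x))\<^sup>2)"
        proof (cases "x \<in> {-X..X}")
          case True then show ?thesis using p by simp
        next
          case False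
          then have "2 * (\<bar>E'\<bar> + 1) / \<epsilon> \<le> Q x" by (intro X(2)) auto
          then have "2 * (\<bar>E'\<bar> + 1) / \<epsilon> \<le> Q x + M" using M_nonneg by linarith
          then have "?k * (2 * (\<bar>E'\<bar> + 1) / \<epsilon>) \<le> ?k * (Q x + M)" using k by (intro mult_left_mono) auto
          moreover have "a / (2 * b) * (2 * b / a) = 1" if "0 < a" "0 < b" for a b :: real using that by simp
          then have "?k * (2 * (\<bar>E'\<bar> + 1) / \<epsilon>) = 1" using \<epsilon> by (smt (verit))
          ultimately have "1 * (norm (d n x))\<^sup>2 \<le> ?k * (Q x + M) * (norm (d n x))\<^sup>2" by (intro mult_right_mono) auto
          then show ?thesis using False by (simp add: mult.assoc)
        qed
      qed (intro L2_integrable_square dL Bochner_Integration.integrable_add i1 integrable_mult_right i2)+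
      also have "\<dots> = (\<integral>x. indicator {-X..X} x *\<^sub>R (norm (d n x))\<^sup>2 \<partial>lborel) + ?k * (\<integral>x. (Q x + M) * (norm (d n x))\<^sup>2 \<partial>lborel)"
        using i1 i2 by (subst Bochner_Integration.integral_add) auto
      also have "\<dots> < \<epsilon> / 2 + ?k * E'"
        using N[OF n] mult_left_mono[OF dQ[of n], of ?k] k by linarith
      also have "?k * E' \<le> \<epsilon> / 2"
      proof -
        have "\<epsilon> * E' \<le> \<epsilon> * (\<bar>E'\<bar> + 1)" using \<epsilon> by (intro mult_left_mono) auto
        then show ?thesis by (simp add: field_simps)
      qed
      finally show ?thesis by simp
    qed
    then show "\<exists>no. \<forall>n\<ge>no. norm (sqnorm (d n) - 0) < \<epsilon>" by blast
  qed
  then show thesis using that[OF r v] by (simp add: d_def[abs_def])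
qed

section \<open>Eigenvalues and resolvent bounds\<close>

definition ev :: "complex \<Rightarrow> bool" where
  "ev z \<longleftrightarrow> (\<exists>u u'. dsol u u' (\<lambda>x. z * u x) \<and> 0 < sqnorm u)"

text \<open>If no constant worked, normalised \<open>u\<close> in \<open>D\<close> with (T - z) u
  tending to 0 would subconverge to a normalised eigenfunction in \<open>D\<close> with eigenvalue
  in \<open>S\<close>. The set \<open>D\<close> is everything for the resolvent itself, and the
  complement of the low eigenfunctions for the lower bound of the form.\<close>

lemma resolvent_bound_uniform:
  assumes S: "compact S"
    and D: "\<And>c f. f \<in> D \<Longrightarrow> (\<lambda>x. c * f x) \<in> D"
      "\<And>f v. (\<And>n::nat. f n \<in> D \<and> f n \<in> L2) \<Longrightarrow> v \<in> L2 \<Longrightarrow> (\<lambda>n. sqnorm (\<lambda>x. f n x - v x)) \<longlonglongrightarrow> 0 \<Longrightarrow> v \<in> D"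
    and no: "\<And>z u u'. z \<in> S \<Longrightarrow> dsol u u' (\<lambda>x. z * u x) \<Longrightarrow> u \<in> D \<Longrightarrow> sqnorm u = 0"
  obtains C where "0 < C" "\<And>z u u' h. z \<in> S \<Longrightarrow> dsol u u' h \<Longrightarrow> u \<in> D \<Longrightarrow> sqnorm u \<le> C * sqnorm (\<lambda>x. h x - z * u x)"
proof (rule ccontr)
  assume "\<not> thesis"
  then have "\<exists>z u u' h. z \<in> S \<and> dsol u u' h \<and> u \<in> D \<and> real (Suc n) * sqnorm (\<lambda>x. h x - z * u x) < sqnorm u" for n
    using that[of "real (Suc n)"] by (meson not_le of_nat_0_less_iff zero_less_Suc)
  then obtain z u u' h where *: "\<And>n. z n \<in> S" "\<And>n. dsol (u n) (u' n) (h n)" "\<And>n. u n \<in> D"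
     "\<And>n. real (Suc n) * sqnorm (\<lambda>x. h n x - z n * u n x) < sqnorm (u n)"
    by metis
  have pos: "0 < sqnorm (u n)" for n
    using *(4)[of n] sqnorm_nonneg[of "\<lambda>x. h n x - z n * u n x"] by (meson le_less_trans mult_nonneg_nonneg of_nat_0_le_iff)
  obtain z0 r0 where z0: "z0 \<in> S" "strict_mono r0" "(z \<circ> r0) \<longlonglongrightarrow> z0"
    using S *(1) unfolding compact_def by blast
  define k where "k n = complex_of_real (1 / sqrt (sqnorm (u n)))" for n
  have k: "(norm (k n))\<^sup>2 = 1 / sqnorm (u n)" for n using pos[of n] by (simp add: k_def power_divide norm_divide)
  define w where "w n x = k (r0 n) * u (r0 n) x" for n x
  define w' where "w' n x = k (r0 n) * u' (r0 n) x" for n x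
  define e where "e n x = k (r0 n) * h (r0 n) x" for n x
  \<comment> \<open>The varying parameters are replaced by their limit \<open>z0\<close>; the
    discrepancy is of size |z - z0| and is put into the right-hand side.\<close>
  define g where "g n x = e n x - z0 * w n x" for n x
  have w: "dsol (w n) (w' n) (e n)" for n
    unfolding w_def w'_def e_def by (rule dsol_cmult[OF *(2)])
  have wL: "w n \<in> L2" "e n \<in> L2" for n using w by (auto simp: dsol_def)
  have w1: "sqnorm (w n) = 1" for n
    using pos[of "r0 n"] unfolding w_def sqnorm_cmult k by simp
  have gL: "g n \<in> L2" for n unfolding g_def by (intro L2_diff L2_cmult wL)
  have g0: "(\<lambda>n. sqnorm (\<lambda>x. g n x - 0)) \<longlonglongrightarrow> 0"
  proof (rule tendsto_sandwich[where f = "\<lambda>n. 0"])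
    show "\<forall>\<^sub>F n in sequentially. sqnorm (\<lambda>x. g n x - 0) \<le> 2 * (1 / real (Suc n)) + 2 * (norm (z (r0 n) - z0))\<^sup>2"
    proof (intro always_eventually allI)
      fix n
      have "g n = (\<lambda>x. k (r0 n) * (h (r0 n) x - z (r0 n) * u (r0 n) x) + (z (r0 n) - z0) * w n x)"
        by (simp add: g_def e_def w_def fun_eq_iff algebra_simps)
      moreover have "sqnorm (\<lambda>x. k (r0 n) * (h (r0 n) x - z (r0 n) * u (r0 n) x) + (z (r0 n) - z0) * w n x)
         \<le> 2 * sqnorm (\<lambda>x. k (r0 n) * (h (r0 n) x - z (r0 n) * u (r0 n) x)) + 2 * sqnorm (\<lambda>x. (z (r0 n) - z0) * w n x)"
        using *(2)[of "r0 n"] wL by (intro sqnorm_add_le L2_cmult L2_diff) (auto simp: dsol_def)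
      moreover have "sqnorm (\<lambda>x. (z (r0 n) - z0) * w n x) = (norm (z (r0 n) - z0))\<^sup>2" by (simp add: sqnorm_cmult w1)
      moreover have "sqnorm (\<lambda>x. k (r0 n) * (h (r0 n) x - z (r0 n) * u (r0 n) x)) \<le> 1 / real (Suc n)"
      proof -
        let ?N = "sqnorm (\<lambda>x. h (r0 n) x - z (r0 n) * u (r0 n) x)"
        have "real (Suc n) * ?N \<le> real (Suc (r0 n)) * ?N"
          using seq_suble[OF z0(2), of n] by (intro mult_right_mono) auto
        also have "\<dots> < sqnorm (u (r0 n))" by (rule *(4))
        finally have "?N / sqnorm (u (r0 n)) < 1 / real (Suc n)" using pos[of "r0 n"] by (simp add: field_simps)
        then show ?thesis unfolding sqnorm_cmult k by simp
      qed
      ultimately show "sqnorm (\<lambda>x. g n x - 0) \<le> 2 * (1 / real (Suc n)) + 2 * (norm (z (r0 n) - z0))\<^sup>2" by simp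
    qed
    have "(\<lambda>n. norm (z (r0 n) - z0)) \<longlonglongrightarrow> 0"
      using z0(3) by (intro tendsto_norm_zero LIM_zero) (simp add: o_def)
    then have "(\<lambda>n. 2 * (1 / real (Suc n)) + 2 * (norm (z (r0 n) - z0))\<^sup>2) \<longlonglongrightarrow> 2 * 0 + 2 * 0\<^sup>2"
      by (intro tendsto_intros) (use LIMSEQ_inverse_real_of_nat in \<open>simp add: inverse_eq_divide\<close>)
    then show "(\<lambda>n. 2 * (1 / real (Suc n)) + 2 * (norm (z (r0 n) - z0))\<^sup>2) \<longlonglongrightarrow> 0" by simp
  qed auto
  have w2: "dsol (w n) (w' n) (\<lambda>x. g n x + z0 * w n x)" for n using w[of n] by (simp add: g_def)
  obtain r v v' where r: "strict_mono r" "dsol v v' (\<lambda>x. 0 + z0 * v x)" "(\<lambda>n. sqnorm (\<lambda>x. w (r n) x - v x)) \<longlonglongrightarrow> 0"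
    by (rule dsol_compactness[OF w2 _ gL L2_zero g0, of 1]) (simp_all add: w1)
  have vL: "v \<in> L2" using r(2) by (simp add: dsol_def)
  have "w (r n) \<in> D \<and> w (r n) \<in> L2" for n using D(1)[OF *(3)] wL by (simp add: w_def[abs_def])
  from D(2)[OF this vL r(3)] have "v \<in> D" .
  with no[OF z0(1)] r(2) have v0: "sqnorm v = 0" by simp
  \<comment> \<open>The limit is zero almost everywhere although all \<open>w n\<close> have norm 1,
    so the distance cannot become small.\<close>
  have ge: "1 \<le> 2 * sqnorm (\<lambda>x. w (r n) x - v x)" for n
    using sqnorm_add_le[OF L2_diff[OF wL(1)[of "r n"] vL] vL] w1[of "r n"] v0 by simp
  have "\<forall>\<^sub>F n in sequentially. sqnorm (\<lambda>x. w (r n) x - v x) < 1 / 2"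
    using r(3) by (intro order_tendstoD(2)) auto
  then obtain n where "sqnorm (\<lambda>x. w (r n) x - v x) < 1 / 2"
    by (auto simp: eventually_sequentially)
  with ge[of n] show False by linarith
qed

lemma resolvent_bound:
  assumes "\<not> ev z"
  obtains C where "0 < C" "\<And>u u' h. dsol u u' h \<Longrightarrow> sqnorm u \<le> C * sqnorm (\<lambda>x. h x - z * u x)"
proof (rule resolvent_bound_uniform[of "{z}" UNIV])
  show "sqnorm u = 0" if "w \<in> {z}" "dsol u u' (\<lambda>x. w * u x)" for w u u'
    using assms that sqnorm_nonneg[of u] unfolding ev_def by (metis less_eq_real_def singletonD)
qed (use that in auto)

end

section \<open>Decaying solutions, resolvent and spectrum\<close>

lemma has_ac_derivative_reflect:
  assumes "has_ac_derivative u v"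
  shows "has_ac_derivative (\<lambda>x. u (- x)) (\<lambda>x. - v (- x))"
  unfolding has_ac_derivative_def
proof (intro allI impI conjI)
  fix a b :: real assume ab: "a \<le> b"
  have "integrable lborel (\<lambda>x. indicator {-b..-a} x *\<^sub>R v x)"
    using ac_on_integrable[OF has_ac_derivativeD[OF assms]] by (simp add: set_integrable_def)
  from lborel_integrable_real_affine[OF this, of "-1" 0]
  have i: "set_integrable lborel {a..b} (\<lambda>x. v (- x))"
    unfolding set_integrable_def
    by (rule back_subst[of "integrable lborel"]) (auto simp: indicator_def fun_eq_iff)
  then show "set_integrable lborel {a..b} (\<lambda>x. - v (- x))"
    by (simp add: set_integrable_def)
  have "(LINT x:{a..b}|lborel. v (- x)) = (LINT x:{x. - x \<in> {a..b}}|lborel. v (- (- x)))"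
    by (rule set_integral_reflect)
  also have "{x. - x \<in> {a..b}} = {-b..-a}" by auto
  finally have "(LINT x:{a..b}|lborel. v (- x)) = u (- a) - u (- b)"
    using ac_on_integral[OF has_ac_derivativeD[OF assms], of "-b" "-a"] ab by simp
  then show "u (- b) - u (- a) = (LINT x:{a..b}|lborel. - v (- x))"
    using set_integral_uminus[OF i] by simp
qed

lemma sol_reflect:
  assumes "sol q g u u'"
  shows "sol (\<lambda>x. q (- x)) (\<lambda>x. g (- x)) (\<lambda>x. u (- x)) (\<lambda>x. - u' (- x))"
proof -
  have u: "has_ac_derivative u u'" "has_ac_derivative u' (\<lambda>x. q x * u x - g x)"
    using assms by (auto simp: sol_def)
  show ?thesis
    unfolding sol_def using has_ac_derivative_reflect[OF u(1)] has_ac_derivative_cmult[OF has_ac_derivative_reflect[OF u(2)], of "-1"]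
    by simp
qed

lemma L2_reflect:
  assumes "f \<in> L2"
  shows "(\<lambda>x. f (- x)) \<in> L2"
proof (rule L2I)
  have [measurable]: "f \<in> borel_measurable borel" by (rule L2_measurable[OF assms])
  show "(\<lambda>x. f (- x)) \<in> borel_measurable borel" by measurable
  show "integrable lborel (\<lambda>x. (norm (f (- x)))\<^sup>2)"
    using lborel_integrable_real_affine[OF L2_integrable_square[OF assms], of "-1" 0] by simp
qed

lemma linear_system_2:
  fixes p q p' q' \<alpha> \<beta> :: complex
  assumes "p * q' - p' * q \<noteq> 0"
  obtains k l where "k * p - l * q = \<alpha>" "k * p' - l * q' = \<beta>"
proof (rule that)
  let ?W = "p * q' - p' * q"
  have "((\<alpha> * q' - \<beta> * q) / ?W) * p - ((\<alpha> * p' - \<beta> * p) / ?W) * q = \<alpha> * ?W / ?W"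
    by (simp add: diff_divide_distrib[symmetric] algebra_simps)
  then show "((\<alpha> * q' - \<beta> * q) / ?W) * p - ((\<alpha> * p' - \<beta> * p) / ?W) * q = \<alpha>" using assms by simp
  have "((\<alpha> * q' - \<beta> * q) / ?W) * p' - ((\<alpha> * p' - \<beta> * p) / ?W) * q' = \<beta> * ?W / ?W"
    by (simp add: diff_divide_distrib[symmetric] algebra_simps)
  then show "((\<alpha> * q' - \<beta> * q) / ?W) * p' - ((\<alpha> * p' - \<beta> * p) / ?W) * q' = \<beta>" using assms by simp
qed

lemma prim_outside_support:
  assumes g: "\<And>a b. set_integrable lborel {a..b} v" and v: "\<And>x. R < \<bar>x\<bar> \<Longrightarrow> v x = 0" and R: "0 \<le> R"
  shows "R \<le> x \<Longrightarrow> prim v x = prim v R" "x \<le> - R \<Longrightarrow> prim v x = prim v (- R)"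
proof -
  have z: "(LINT t:{a..b}|lborel. v t) = 0" if "R \<le> a \<or> b \<le> - R" for a b
  proof -
    have "AE t in lborel. t \<noteq> R" "AE t in lborel. t \<noteq> - R" by (rule AE_lborel_singleton)+
    then have "AE t in lborel. indicator {a..b} t *\<^sub>R v t = 0"
      by eventually_elim (use that v R in \<open>auto simp: indicator_def\<close>)
    then show ?thesis unfolding set_lebesgue_integral_def by (rule integral_eq_zero_AE)
  qed
  show "prim v x = prim v R" if "R \<le> x"
    using set_integral_Icc_split[OF g, of 0 R x] z[of R x] that R by (simp add: prim_def)
  show "prim v x = prim v (- R)" if "x \<le> - R"
  proof (cases "R = 0")
    case True
    then show ?thesis using z[of x 0] z[of 0 0] that by (cases "x = 0") (auto simp: prim_def)
  next
    case False
    then show ?thesis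
      using set_integral_Icc_split[OF g, of x "- R" 0] z[of x "- R"] that R by (simp add: prim_def)
  qed
qed

lemma fund_sys_homogeneous:
  assumes "fund_sys q c c' s s'" "sol q (\<lambda>x. 0) u u'"
  shows "u x = c x * u 0 + s x * u' 0" "u' x = c' x * u 0 + s' x * u' 0"
proof -
  have "prim (\<lambda>t. 0 * f t) x = 0" for f :: "real \<Rightarrow> complex" by (simp add: prim_def)
  then show "u x = c x * u 0 + s x * u' 0" "u' x = c' x * u 0 + s' x * u' 0"
    using sol_variation[OF assms, of x] by simp_all
qed

context confining
begin

lemma fund_sys_obtain:
  obtains c c' s s' where "fund_sys (\<lambda>x. Qc x - z) c c' s s'"
proof -
  interpret ode_coefficient "\<lambda>x. Qc x - z" "\<lambda>t. m t + norm z" by (rule ode_shift)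
  show thesis using fund_sys_exists that .
qed

lemma energy_derivative:
  assumes "sol (\<lambda>x. Qc x - z) (\<lambda>x. 0) u u'"
  shows "ac_on a b (\<lambda>x. Re (u' x * cnj (u x))) (\<lambda>x. (norm (u' x))\<^sup>2 + (Q x - Re z) * (norm (u x))\<^sup>2)"
proof -
  have u: "has_ac_derivative u u'" "has_ac_derivative u' (\<lambda>x. (Qc x - z) * u x - 0)"
    using assms by (auto simp: sol_def)
  have "has_ac_derivative (\<lambda>x. u' x * cnj (u x)) (\<lambda>x. ((Qc x - z) * u x - 0) * cnj (u x) + u' x * cnj (u' x))"
    by (intro has_ac_derivative_mult has_ac_derivative_cnj u)
  from ac_on_Re[OF has_ac_derivativeD[OF this, of a b]]
  show ?thesis
  proof (rule ac_on_cong)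
    fix x
    have "((Qc x - z) * u x - 0) * cnj (u x) + u' x * cnj (u' x) = (Qc x - z) * (u x * cnj (u x)) + u' x * cnj (u' x)"
      by (simp add: mult.assoc)
    also have "\<dots> = (Qc x - z) * of_real ((norm (u x))\<^sup>2) + of_real ((norm (u' x))\<^sup>2)"
      by (simp only: complex_norm_square)
    finally show "Re (((Qc x - z) * u x - 0) * cnj (u x) + u' x * cnj (u' x)) = (norm (u' x))\<^sup>2 + (Q x - Re z) * (norm (u x))\<^sup>2"
      by (simp del: of_real_power)
  qed auto
qed

text \<open>Solutions vanishing at \<open>n\<close>, normalised at \<open>0\<close>, subconverge to a solution along which
  \<open>Re (u' cnj u)\<close> stays nonpositive far out; this forces square integrability at \<open>+\<infinity>\<close>.\<close>

lemma decaying_solution_right: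
  obtains u u' where "sol (\<lambda>x. Qc x - z) (\<lambda>x. 0) u u'" "u 0 \<noteq> 0 \<or> u' 0 \<noteq> 0" "(\<lambda>x. indicator {0..} x * u x) \<in> L2"
proof -
  obtain c c' s s' where fund_sys: "fund_sys (\<lambda>x. Qc x - z) c c' s s'" by (rule fund_sys_obtain)
  then have c: "sol (\<lambda>x. Qc x - z) (\<lambda>x. 0) c c'" and s: "sol (\<lambda>x. Qc x - z) (\<lambda>x. 0) s s'"
    by (auto simp: fund_sys_def)
  have W: "c x * s' x - c' x * s x = 1" for x by (rule fund_sys_wronskian[OF fund_sys])
  \<comment> \<open>Normalised Cauchy data at 0 of the solution that vanishes at \<open>n\<close>:
    the vector (s(n), -c(n)) is orthogonal, as a bilinear pairing, to (c(n), s(n)).\<close>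
  define p where "p n = (1 / norm (s (real n), - c (real n))) *\<^sub>R (s (real n), - c (real n))" for n :: nat
  have nz: "(s x, - c x) \<noteq> 0" for x using W[of x] by (auto simp: zero_prod_def)
  have p1: "norm (p n) = 1" for n
  proof -
    have "norm (s (real n), - c (real n)) \<noteq> 0" using nz[of "real n"] by (simp only: norm_eq_zero not_False_eq_True)
    then show ?thesis unfolding p_def norm_scaleR by simp
  qed
  have "bounded (range p)" using p1 by (auto simp: bounded_iff intro!: exI[of _ 1])
  then obtain l r where r: "strict_mono r" and l: "(p \<circ> r) \<longlonglongrightarrow> l"
    using bounded_imp_convergent_subsequence by blast
  have "(\<lambda>n. norm ((p \<circ> r) n)) \<longlonglongrightarrow> norm l" by (intro tendsto_norm l)
  then have l1: "norm l = 1" using p1 LIMSEQ_unique[of "\<lambda>n. 1" "norm l" 1] by simp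
  define U where "U k x = c x * fst k + s x * snd k" for k :: "complex \<times> complex" and x
  define U' where "U' k x = c' x * fst k + s' x * snd k" for k :: "complex \<times> complex" and x
  have U: "sol (\<lambda>x. Qc x - z) (\<lambda>x. 0) (U k) (U' k)" for k
    using sol_add[OF sol_cmult[OF c, of "fst k"] sol_cmult[OF s, of "snd k"]]
    by (simp add: U_def[abs_def] U'_def[abs_def] mult.commute)
  define \<Phi> where "\<Phi> k x = Re (U' k x * cnj (U k x))" for k x
  have \<Phi>ac: "ac_on a b (\<Phi> k) (\<lambda>x. (norm (U' k x))\<^sup>2 + (Q x - Re z) * (norm (U k x))\<^sup>2)" for a b k
    unfolding \<Phi>_def by (rule energy_derivative[OF U])
  obtain X where X: "0 \<le> X" "\<And>x. X \<le> \<bar>x\<bar> \<Longrightarrow> Re z + 1 \<le> Q x" using Q_at_infinity by blast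
  have "fst (p n) = (1 / norm (s (real n), - c (real n))) *\<^sub>R s (real n)" "snd (p n) = - ((1 / norm (s (real n), - c (real n))) *\<^sub>R c (real n))" for n
    by (simp_all add: p_def)
  then have Un: "U (p n) (real n) = 0" for n by (simp add: U_def mult.commute)
  \<comment> \<open>Beyond \<open>X\<close> the derivative of \<open>\<Phi>\<close> is nonnegative,
    and \<open>\<Phi>\<close> is 0 at \<open>n\<close> where the solution vanishes; hence it is
    nonpositive in between. This sign survives the limit, unlike the zero at
    \<open>n\<close>.\<close>
  have neg: "\<Phi> (p n) N \<le> 0" if "X \<le> N" "N \<le> real n" for n N
  proof -
    have "\<Phi> (p n) N \<le> \<Phi> (p n) (real n)"
    proof (rule ac_on_mono[OF \<Phi>ac that(2)])
      fix x assume "x \<in> {N..real n}"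
      then show "0 \<le> (norm (U' (p n) x))\<^sup>2 + (Q x - Re z) * (norm (U (p n) x))\<^sup>2"
        using X(2)[of x] that X(1) by simp
    qed
    then show ?thesis by (simp add: \<Phi>_def Un)
  qed
  have lf: "(\<lambda>n. fst (p (r n))) \<longlonglongrightarrow> fst l" and ls: "(\<lambda>n. snd (p (r n))) \<longlonglongrightarrow> snd l"
    using tendsto_fst[OF l] tendsto_snd[OF l] by (simp_all add: o_def)
  have neg': "\<Phi> l N \<le> 0" if N: "X \<le> N" for N
  proof (rule LIMSEQ_le_const2)
    show "(\<lambda>n. \<Phi> (p (r n)) N) \<longlonglongrightarrow> \<Phi> l N"
      unfolding \<Phi>_def U_def U'_def by (intro tendsto_intros lf ls)
    obtain n0 where n0: "N \<le> real n0" using real_arch_simple by blast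
    show "\<exists>n0. \<forall>n\<ge>n0. \<Phi> (p (r n)) N \<le> 0"
    proof (intro exI allI impI)
      fix n assume "n0 \<le> n"
      then have "n0 \<le> r n" using seq_suble[OF r, of n] by simp
      then show "\<Phi> (p (r n)) N \<le> 0" using N n0 by (intro neg) linarith+
    qed
  qed
  define d where "d x = indicator {X..} x * (norm (U l x))\<^sup>2" for x
  have cU: "continuous_on A (U l)" for A by (rule sol_continuous[OF U])
  have mU: "U l \<in> borel_measurable borel" by (rule borel_measurable_continuous_onI[OF cU])
  have d: "integrable lborel d"
  proof (rule integrable_of_bounded_integrals(1)[where C = "\<bar>\<Phi> l X\<bar>"])
    show "0 \<le> d x" for x by (simp add: d_def)
    show "d \<in> borel_measurable borel" unfolding d_def[abs_def] using mU by measurable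
    have sq: "set_integrable lborel {a..b} (\<lambda>x. (norm (U l x))\<^sup>2)" for a b
      unfolding set_integrable_def by (intro borel_integrable_compact continuous_intros cU) auto
    fix n :: nat
    show i: "set_integrable lborel {- real n..real n} d"
      unfolding set_integrable_def
    proof (rule Bochner_Integration.integrable_bound[OF sq[of "- real n" "real n", unfolded set_integrable_def]])
      show "(\<lambda>x. indicat_real {- real n..real n} x *\<^sub>R d x) \<in> borel_measurable lborel"
        using \<open>d \<in> borel_measurable borel\<close> by measurable
    qed (auto simp: d_def indicator_def)
    show "(LINT x:{- real n..real n}|lborel. d x) \<le> \<bar>\<Phi> l X\<bar>"
    proof (cases "X \<le> real n")
      \<comment> \<open>As Q - Re z \<ge> 1 here, the mass on \<open>{X..n}\<close> is at most
        \<Phi>(n) - \<Phi>(X), and \<Phi>(n) is nonpositive.\<close>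
      case True
      have "(LINT x:{- real n..real n}|lborel. d x) = (LINT x:{X..real n}|lborel. (norm (U l x))\<^sup>2)"
        unfolding set_lebesgue_integral_def using True X(1)
        by (intro Bochner_Integration.integral_cong) (auto simp: d_def indicator_def)
      also have "\<dots> \<le> (LINT x:{X..real n}|lborel. (norm (U' l x))\<^sup>2 + (Q x - Re z) * (norm (U l x))\<^sup>2)"
      proof (rule set_integral_mono[OF sq ac_on_integrable[OF \<Phi>ac]])
        fix x assume "x \<in> {X..real n}"
        then have "1 * (norm (U l x))\<^sup>2 \<le> (Q x - Re z) * (norm (U l x))\<^sup>2" 
          using X(2)[of x] X(1) by (intro mult_right_mono) auto
        then show "(norm (U l x))\<^sup>2 \<le> (norm (U' l x))\<^sup>2 + (Q x - Re z) * (norm (U l x))\<^sup>2"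
          by (simp add: add_increasing)
      qed
      also have "\<dots> = \<Phi> l (real n) - \<Phi> l X" by (rule ac_on_integral[OF \<Phi>ac True])
      also have "\<dots> \<le> \<bar>\<Phi> l X\<bar>" using neg'[OF True] by simp
      finally show ?thesis .
    next
      case False
      then have "(\<lambda>x. indicator {- real n..real n} x *\<^sub>R d x) = (\<lambda>x. 0)"
        by (auto simp: d_def indicator_def)
      then show ?thesis by (simp add: set_lebesgue_integral_def)
    qed
  qed
  have "(\<lambda>x. indicator {0..} x * U l x) \<in> L2"
  proof (rule L2_bound)
    show "(\<lambda>x. indicator {0..} x * U l x) \<in> borel_measurable borel" using mU by measurable
    show "integrable lborel (\<lambda>x. (norm (indicator {0..X} x * U l x))\<^sup>2 + d x)"
      using d L2_integrable_square[OF L2_indicator_mult_continuous[OF cU, of 0 X]] by auto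
    show "(norm (indicator {0..} x * U l x))\<^sup>2 \<le> (norm (indicator {0..X} x * U l x))\<^sup>2 + d x" for x
      by (auto simp: d_def indicator_def)
  qed
  moreover have "U l 0 \<noteq> 0 \<or> U' l 0 \<noteq> 0"
  proof -
    have "l \<noteq> 0" using l1 by auto
    then show ?thesis using fund_sys by (auto simp: U_def U'_def fund_sys_def prod_eq_iff)
  qed
  ultimately show thesis using that[OF U] by blast
qed

lemma confining_reflect: "confining (\<lambda>x. Q (- x)) M m"
proof
  show "(\<lambda>x. Q (- x)) \<in> borel_measurable borel" by measurable
  show "\<bar>Q (- x)\<bar> \<le> m \<bar>x\<bar>" for x using Q_le[of "- x"] by simp
  show "\<exists>X\<ge>0. \<forall>x. X \<le> \<bar>x\<bar> \<longrightarrow> K \<le> Q (- x)" for K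
    using Q_at_infinity[of K] by (metis abs_minus_cancel)
qed (use M_nonneg Q_ge m_mono m_ge m_continuous in auto)

lemma decaying_solution_left:
  obtains u u' where "sol (\<lambda>x. Qc x - z) (\<lambda>x. 0) u u'" "u 0 \<noteq> 0 \<or> u' 0 \<noteq> 0" "(\<lambda>x. indicator {..0} x * u x) \<in> L2"
proof -
  interpret R: confining "\<lambda>x. Q (- x)" M m by (rule confining_reflect)
  obtain u u' where u: "sol (\<lambda>x. complex_of_real (Q (- x)) - z) (\<lambda>x. 0) u u'" "u 0 \<noteq> 0 \<or> u' 0 \<noteq> 0"
    "(\<lambda>x. indicator {0..} x * u x) \<in> L2"
    by (rule R.decaying_solution_right)
  have "(\<lambda>x. indicator {0..} (- x) * u (- x)) \<in> L2" by (rule L2_reflect[OF u(3)])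
  moreover have "(\<lambda>x. indicator {0..} (- x) * u (- x)) = (\<lambda>x. indicator {..0} x * u (- x))"
    by (auto simp: indicator_def)
  ultimately have "(\<lambda>x. indicator {..0} x * u (- x)) \<in> L2" by simp
  then show thesis
    using that[of "\<lambda>x. u (- x)" "\<lambda>x. - u' (- x)"] sol_reflect[OF u(1)] u(2) by simp
qed

text \<open>Green's function construction. Outside \<open>{-R..R}\<close> a solution of the
  inhomogeneous equation is homogeneous, so its Cauchy data can be tuned to continue it by a
  multiple of the solution decaying at the right end and of the one decaying at the left
  end.\<close>

lemma resolvent_solve_compact_support:
  assumes z: "\<not> ev z" and g: "g \<in> L2" "\<And>x. R < \<bar>x\<bar> \<Longrightarrow> g x = 0" and R: "0 \<le> R"
  obtains u u' where "dsol u u' (\<lambda>x. g x + z * u x)"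
proof -
  let ?q = "\<lambda>x. Qc x - z"
  obtain c c' s s' where fund_sys: "fund_sys ?q c c' s s'" by (rule fund_sys_obtain)
  then have c: "sol ?q (\<lambda>x. 0) c c'" and s: "sol ?q (\<lambda>x. 0) s s'"
    by (auto simp: fund_sys_def)
  obtain p p' where p: "sol ?q (\<lambda>x. 0) p p'" "p 0 \<noteq> 0 \<or> p' 0 \<noteq> 0" "(\<lambda>x. indicator {0..} x * p x) \<in> L2"
    by (rule decaying_solution_right)
  obtain w w' where w: "sol ?q (\<lambda>x. 0) w w'" "w 0 \<noteq> 0 \<or> w' 0 \<noteq> 0" "(\<lambda>x. indicator {..0} x * w x) \<in> L2"
    by (rule decaying_solution_left)
  have mp: "p \<in> borel_measurable borel" "w \<in> borel_measurable borel"
    using sol_continuous(1)[OF p(1)] sol_continuous(1)[OF w(1)] by (auto intro: borel_measurable_continuous_onI)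
  \<comment> \<open>Were the two decaying solutions proportional, \<open>p\<close> would be square
    integrable on the whole line and \<open>z\<close> an eigenvalue.\<close>
  have W: "p 0 * w' 0 - p' 0 * w 0 \<noteq> 0"
  proof
    assume W0: "p 0 * w' 0 - p' 0 * w 0 = 0"
    have "\<exists>k. w 0 = k * p 0 \<and> w' 0 = k * p' 0"
    proof (cases "p 0 = 0")
      case True
      then have "p' 0 \<noteq> 0" using p(2) by simp
      then have "w 0 = 0" using W0 True by simp
      then show ?thesis using True \<open>p' 0 \<noteq> 0\<close> by (intro exI[of _ "w' 0 / p' 0"]) simp
    next
      case False
      then show ?thesis using W0 by (intro exI[of _ "w 0 / p 0"]) (simp add: field_simps)
    qed
    then obtain k where k: "w 0 = k * p 0" "w' 0 = k * p' 0" by blast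
    have k0: "k \<noteq> 0" using k w(2) by auto
    have wk: "w x = k * p x" for x
      using fund_sys_homogeneous(1)[OF fund_sys w(1), of x] fund_sys_homogeneous(1)[OF fund_sys p(1), of x] k by (simp add: algebra_simps)
    have "p \<in> L2"
    proof (rule L2_bound[OF mp(1)])
      show "integrable lborel (\<lambda>x. (norm (indicator {0..} x * p x))\<^sup>2 + (norm (1 / k))\<^sup>2 * (norm (indicator {..0} x * w x))\<^sup>2)"
        using L2_integrable_square[OF p(3)] L2_integrable_square[OF w(3)] by auto
      show "(norm (p x))\<^sup>2 \<le> (norm (indicator {0..} x * p x))\<^sup>2 + (norm (1 / k))\<^sup>2 * (norm (indicator {..0} x * w x))\<^sup>2" for x
      proof (cases "0 \<le> x")
        case False
        have "(norm (1 / k))\<^sup>2 * (norm (w x))\<^sup>2 = (norm (p x))\<^sup>2"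
          using k0 by (simp add: wk norm_mult norm_divide power_mult_distrib power_divide)
        then show ?thesis using False by simp
      qed simp
    qed
    then have "dsol p p' (\<lambda>x. z * p x)"
      using p(1) sol_shift[of Qc "\<lambda>x. z * p x" p p' z] by (auto simp: dsol_def)
    moreover have "0 < sqnorm p"
    proof -
      have "\<exists>x. p x \<noteq> 0"
      proof (rule ccontr)
        assume "\<not> (\<exists>x. p x \<noteq> 0)"
        then have p0: "p = (\<lambda>x. 0)" by auto
        have "(p has_vector_derivative p' 0) (at 0)"
          using p(1) by (intro has_ac_derivative_continuous_imp_vector_derivative sol_continuous[OF p(1)]) (simp add: sol_def)
        then have "p' 0 = 0" using vector_derivative_unique_at[of p "p' 0" 0 0] p0 by simp
        then show False using p(2) p0 by simp
      qed
      then show ?thesis using dsol_sqnorm_pos[OF \<open>dsol p p' (\<lambda>x. z * p x)\<close>] by blast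
    qed
    ultimately show False using z by (auto simp: ev_def)
  qed
  have gi: "set_integrable lborel {a..b} g" for a b by (rule L2_set_integrable[OF g(1)])
  have gis: "set_integrable lborel {a..b} (\<lambda>t. g t * s t)" "set_integrable lborel {a..b} (\<lambda>t. g t * c t)" for a b
    by (intro set_integrable_mult_continuous gi sol_continuous[OF s] sol_continuous[OF c])+
  define P where "P = prim (\<lambda>t. g t * s t)"
  define P' where "P' = prim (\<lambda>t. g t * c t)"
  have PR: "P x = P R" "P' x = P' R" if "R \<le> x" for x
    unfolding P_def P'_def using that g(2) by (auto intro!: prim_outside_support(1) gis R)
  have PL: "P x = P (-R)" "P' x = P' (-R)" if "x \<le> - R" for x
    unfolding P_def P'_def using that g(2) by (auto intro!: prim_outside_support(2) gis R)
  \<comment> \<open>With Cauchy data (A, B), matching at the right end demands A + P(R) = k p(0) and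
    B - P'(R) = k p'(0), and at the left end the same with -R, l and w. Eliminating A and B leaves
    this system, whose determinant is the Wronskian \<open>W\<close>.\<close>
  obtain k l where kl: "k * p 0 - l * w 0 = P R - P (-R)" "k * p' 0 - l * w' 0 = - P' R - (- P' (-R))"
    using linear_system_2[OF W] by blast
  define A B where "A = k * p 0 - P R" and "B = k * p' 0 + P' R"
  have A': "A = l * w 0 - P (-R)" "B = l * w' 0 + P' (-R)" using kl by (simp_all add: A_def B_def algebra_simps)
  define f where "f x = c x * (A + P x) + s x * (B - P' x)" for x
  define f' where "f' x = c' x * (A + P x) + s' x * (B - P' x)" for x
  have f: "sol ?q g f f'"
    unfolding f_def f'_def P_def P'_def by (rule sol_variation_exists[OF fund_sys gi])
  have fR: "f x = k * p x" if "R \<le> x" for x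
    using PR[OF that] fund_sys_homogeneous(1)[OF fund_sys p(1), of x] by (simp add: f_def A_def B_def algebra_simps)
  have fL: "f x = l * w x" if "x \<le> - R" for x
    using PL[OF that] fund_sys_homogeneous(1)[OF fund_sys w(1), of x] by (simp add: f_def A' algebra_simps)
  have "f \<in> L2"
  proof (rule L2_bound)
    show "f \<in> borel_measurable borel" using sol_continuous(1)[OF f] by (rule borel_measurable_continuous_onI)
    show "integrable lborel (\<lambda>x. (norm (indicator {-R..R} x * f x))\<^sup>2 + 
       ((norm k)\<^sup>2 * (norm (indicator {0..} x * p x))\<^sup>2 + (norm l)\<^sup>2 * (norm (indicator {..0} x * w x))\<^sup>2))"
      using L2_integrable_square[OF p(3)] L2_integrable_square[OF w(3)]
        L2_integrable_square[OF L2_indicator_mult_continuous[OF sol_continuous(1)[OF f], of "-R" R]] by auto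
    fix x
    consider "x \<in> {-R..R}" | "R < x" | "x < - R" by fastforce
    then show "(norm (f x))\<^sup>2 \<le> (norm (indicator {-R..R} x * f x))\<^sup>2 + 
       ((norm k)\<^sup>2 * (norm (indicator {0..} x * p x))\<^sup>2 + (norm l)\<^sup>2 * (norm (indicator {..0} x * w x))\<^sup>2)"
    proof cases
      case 1
      then show ?thesis by simp
    next
      case 2
      then show ?thesis using fR[of x] R by (simp add: norm_mult power_mult_distrib)
    next
      case 3
      then show ?thesis using fL[of x] R by (simp add: norm_mult power_mult_distrib)
    qed
  qed
  then have "dsol f f' (\<lambda>x. g x + z * f x)"
    using f g(1) sol_shift[of Qc "\<lambda>x. g x + z * f x" f f' z] by (auto simp: dsol_def)
  then show thesis by (rule that)
qed

lemma L2_truncation_tendsto: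
  assumes "g \<in> L2"
  shows "(\<lambda>n. sqnorm (\<lambda>x. indicator {-real n..real n} x * g x - g x)) \<longlonglongrightarrow> 0"
proof -
  have [measurable]: "g \<in> borel_measurable borel" by (rule L2_measurable[OF assms])
  have "(\<lambda>n. \<integral>x. (norm (indicator {-real n..real n} x * g x - g x))\<^sup>2 \<partial>lborel) \<longlonglongrightarrow> (\<integral>x. 0 \<partial>(lborel :: real measure))"
  proof (rule integral_dominated_convergence[where w = "\<lambda>x. (norm (g x))\<^sup>2"])
    show "AE x in lborel. (\<lambda>n. (norm (indicator {-real n..real n} x * g x - g x))\<^sup>2) \<longlonglongrightarrow> 0"
    proof (rule AE_I2, rule tendsto_eventually)
      fix x :: real
      obtain N where N: "\<bar>x\<bar> \<le> real N" using real_arch_simple by blast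
      show "\<forall>\<^sub>F n in sequentially. (norm (indicator {-real n..real n} x * g x - g x))\<^sup>2 = 0"
        using eventually_ge_at_top[of N] by eventually_elim (use N in \<open>auto simp: indicator_def\<close>)
    qed
    show "AE x in lborel. norm ((norm (indicator {-real n..real n} x * g x - g x))\<^sup>2) \<le> (norm (g x))\<^sup>2" for n
      by (auto simp: indicator_def)
  qed (use L2_integrable_square[OF assms] in auto)
  then show ?thesis by (simp add: sqnorm_def)
qed

text \<open>Solutions for the truncations of \<open>g\<close> are bounded in \<open>L2\<close> by
  the resolvent bound; compactness then provides a limit that solves the equation for
  \<open>g\<close>.\<close>

lemma resolvent_solve:
  assumes z: "\<not> ev z" and g: "g \<in> L2"
  obtains u u' where "dsol u u' (\<lambda>x. g x + z * u x)"
proof -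
  define G where "G n x = indicator {-real n..real n} x * g x" for n x
  have GL: "G n \<in> L2" for n unfolding G_def using g by (intro L2_restrict) auto
  have "\<exists>u u'. dsol u u' (\<lambda>x. G n x + z * u x)" for n
  proof -
    have "G n x = 0" if "real n < \<bar>x\<bar>" for x using that by (auto simp: G_def indicator_def)
    from resolvent_solve_compact_support[OF z GL[of n] this of_nat_0_le_iff] show ?thesis by blast
  qed
  then obtain u u' where u: "\<And>n. dsol (u n) (u' n) (\<lambda>x. G n x + z * u n x)" by metis
  obtain C where C: "0 < C" "\<And>u u' h. dsol u u' h \<Longrightarrow> sqnorm u \<le> C * sqnorm (\<lambda>x. h x - z * u x)"
    using resolvent_bound[OF z] by blast
  have "sqnorm (u n) \<le> C * sqnorm g" for n
  proof -
    have "sqnorm (u n) \<le> C * sqnorm (G n)" using C(2)[OF u[of n]] by simp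
    also have "\<dots> \<le> C * sqnorm g" using C(1) unfolding G_def by (intro mult_left_mono sqnorm_restrict_le g) auto
    finally show ?thesis .
  qed
  from dsol_compactness[OF u this GL g L2_truncation_tendsto[OF g, folded G_def]] show thesis using that by blast
qed

section \<open>Simplicity, self-adjointness and spectrum\<close>

lemma ev_real:
  assumes "ev z"
  shows "Im z = 0" "- M \<le> Re z"
proof -
  obtain u u' where u: "dsol u u' (\<lambda>x. z * u x)" "0 < sqnorm u" using assms by (auto simp: ev_def)
  have "z * of_real (sqnorm u) = of_real (energy u u')"
    using dsol_energy[OF u(1)] by (simp add: L2_inner_cmult_left L2_inner_self)
  then have z: "z = of_real (energy u u' / sqnorm u)" using u(2) by (simp add: field_simps)
  then show "Im z = 0" by (metis Im_complex_of_real)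
  have "- M \<le> energy u u' / sqnorm u" using energy_ge[OF dsol_form_dom[OF u(1)]] u(2) by (simp add: pos_le_divide_eq)
  then show "- M \<le> Re z" unfolding z Re_complex_of_real .
qed

text \<open>The Wronskian of two solutions with the same \<open>z\<close> is constant. As finite
  energy puts the derivatives into \<open>L2\<close>, it is also integrable, hence 0, and the two
  solutions are proportional.\<close>

lemma ev_simple:
  assumes u: "dsol u u' (\<lambda>x. z * u x)" "0 < sqnorm u" and v: "dsol v v' (\<lambda>x. z * v x)"
  obtains k where "v = (\<lambda>x. k * u x)"
proof -
  let ?q = "\<lambda>x. Qc x - z"
  obtain c c' s s' where fund_sys: "fund_sys ?q c c' s s'" by (rule fund_sys_obtain)
  have us: "sol ?q (\<lambda>x. 0) u u'" and vs: "sol ?q (\<lambda>x. 0) v v'"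
    using u(1) v sol_shift[of Qc "\<lambda>x. z * u x" u u' z] sol_shift[of Qc "\<lambda>x. z * v x" v v' z] by (auto simp: dsol_def)
  have L: "u \<in> L2" "u' \<in> L2" "v \<in> L2" "v' \<in> L2" using dsol_form_dom[OF u(1)] dsol_form_dom[OF v] by (auto simp: form_dom_def)
  define W where "W = u 0 * v' 0 - u' 0 * v 0"
  have "u x * v' x - u' x * v x = W" for x using wronskian_const[OF us vs] by (simp add: W_def)
  moreover have "integrable lborel (\<lambda>x. u x * v' x - u' x * v x)" using L by (auto intro: L2_mult_integrable)
  ultimately have "integrable lborel (\<lambda>x::real. W)" by simp
  then have "integrable lborel (\<lambda>x::real. norm W)" by (rule integrable_norm)
  from not_integrable_of_lower_bound[OF this, of "2 * norm W"] have W0: "W = 0" by auto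
  have "u 0 \<noteq> 0 \<or> u' 0 \<noteq> 0"
  proof (rule ccontr)
    assume 0: "\<not> ?thesis"
    have "u x = 0" for x using 0 fund_sys_homogeneous(1)[OF fund_sys us, of x] by simp
    then have "u = (\<lambda>x. 0)" by blast
    then show False using u(2) by (simp add: sqnorm_def)
  qed
  then have "\<exists>k. v 0 = k * u 0 \<and> v' 0 = k * u' 0"
  proof (cases "u 0 = 0")
    case True
    then show ?thesis using W0 \<open>u 0 \<noteq> 0 \<or> u' 0 \<noteq> 0\<close> by (intro exI[of _ "v' 0 / u' 0"]) (simp add: W_def)
  next
    case False
    then show ?thesis using W0 by (intro exI[of _ "v 0 / u 0"]) (simp add: W_def field_simps)
  qed
  then obtain k where k: "v 0 = k * u 0" "v' 0 = k * u' 0" by blast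
  have "v x = k * u x" for x
    using fund_sys_homogeneous(1)[OF fund_sys us, of x] fund_sys_homogeneous(1)[OF fund_sys vs, of x] k by (simp add: algebra_simps)
  then show thesis using that by blast
qed

text \<open>A symmetric operator for which T - z is onto at some real \<open>z\<close> is
  self-adjoint: subtracting from an element of the adjoint graph the solution of the resolvent
  equation leaves a vector orthogonal to the range of T - z, which is everything.\<close>

lemma T_self_adjoint: "self_adjoint T"
  unfolding self_adjoint_def
proof (rule set_eqI, clarify)
  fix g k
  show "(g, k) \<in> L2_adjoint T \<longleftrightarrow> (g, k) \<in> T"
  proof
    assume "(g, k) \<in> T"
    then obtain v v' where v: "g \<in> L2" "dsol v v' k" "AE x in lborel. g x = v x"
      by (auto simp: schroedinger_iff)
    have "L2_inner h g = L2_inner f k" if fh: "(f, h) \<in> T" for f h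
    proof -
      obtain u u' where u: "f \<in> L2" "dsol u u' h" "AE x in lborel. f x = u x"
        using fh by (auto simp: schroedinger_iff)
      have "L2_inner h g = L2_inner h v"
        by (rule L2_inner_cong_AE) (use u v in \<open>auto simp: dsol_def intro: L2_measurable\<close>)
      also have "\<dots> = L2_inner u k" by (rule dsol_symmetric[OF u(2) v(2)])
      also have "\<dots> = L2_inner f k"
        by (rule L2_inner_cong_AE) (use u v in \<open>auto simp: dsol_def intro: L2_measurable\<close>)
      finally show ?thesis .
    qed
    then show "(g, k) \<in> L2_adjoint T" using v by (auto simp: L2_adjoint_def dsol_def)
  next
    assume "(g, k) \<in> L2_adjoint T"
    then have g: "g \<in> L2" "k \<in> L2" and adj: "\<And>f h. (f, h) \<in> T \<Longrightarrow> L2_inner h g = L2_inner f k"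
      by (auto simp: L2_adjoint_def)
    \<comment> \<open>A real point below the form bound \<open>- M\<close>, hence not an
      eigenvalue.\<close>
    define z where "z = complex_of_real (- M - 1)"
    have z: "\<not> ev z" using ev_real(2)[of z] by (auto simp: z_def)
    have cz: "cnj z = z" by (simp add: z_def)
    define r where "r = (\<lambda>x. k x - z * g x)"
    have r: "r \<in> L2" unfolding r_def using g by auto
    obtain u u' where u: "dsol u u' (\<lambda>x. r x + z * u x)"
      by (rule resolvent_solve[OF z r])
    have uL: "u \<in> L2" using u by (simp add: dsol_def)
    define w where "w = (\<lambda>x. g x - u x)"
    have wL: "w \<in> L2" unfolding w_def using g uL by auto
    \<comment> \<open>The defect \<open>w\<close> is itself in the range of T - z; testing with this
      preimage shows that \<open>w\<close> is orthogonal to itself.\<close>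
    obtain v v' where v: "dsol v v' (\<lambda>x. w x + z * v x)"
      by (rule resolvent_solve[OF z wL])
    have vL: "v \<in> L2" using v by (simp add: dsol_def)
    have "L2_inner (\<lambda>x. w x + z * v x) g = L2_inner v k"
      by (rule adj[OF dsol_in_T[OF v]])
    then have 1: "L2_inner w g + z * L2_inner v g = L2_inner v k"
      using L2_inner_add_left[OF wL L2_cmult[OF vL] g(1)] by (simp add: L2_inner_cmult_left)
    have "L2_inner (\<lambda>x. w x + z * v x) u = L2_inner v (\<lambda>x. r x + z * u x)"
      by (rule dsol_symmetric[OF v u])
    then have 2: "L2_inner w u + z * L2_inner v u = L2_inner v r + z * L2_inner v u"
      using L2_inner_add_left[OF wL L2_cmult[OF vL] uL] L2_inner_add_right[OF r L2_cmult[OF uL] vL] cz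
      by (simp add: L2_inner_cmult_left L2_inner_cmult_right)
    have 3: "L2_inner v r = L2_inner v k - z * L2_inner v g"
      unfolding r_def using L2_inner_diff_right[OF g(2) L2_cmult[OF g(1)] vL] cz by (simp add: L2_inner_cmult_right)
    have "L2_inner w u + z * L2_inner v g = L2_inner v k" using 2 3 by (simp add: eq_diff_eq)
    then have "L2_inner w g = L2_inner w u" using 1 by (metis add_right_cancel)
    then have "L2_inner w w = 0"
      using L2_inner_diff_right[OF g(1) uL wL] by (simp add: w_def)
    then have "L2_inner (\<lambda>x. g x - u x) (\<lambda>x. g x - u x) = 0" by (simp only: w_def)
    then have "sqnorm (\<lambda>x. g x - u x) = 0" by (simp add: L2_inner_self)
    then have "AE x in lborel. g x - u x = 0" using sqnorm_eq_0_iff[OF wL] unfolding w_def by blast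
    then have ae: "AE x in lborel. g x = u x" by eventually_elim simp
    have ae': "AE x in lborel. Qc x * u x - (r x + z * u x) = Qc x * u x - k x"
      using ae unfolding r_def by eventually_elim simp
    have m: "(\<lambda>x. Qc x * u x - k x) \<in> borel_measurable borel"
      using L2_measurable[OF uL] L2_measurable[OF g(2)] by measurable
    have "has_ac_derivative u' (\<lambda>x. Qc x * u x - (r x + z * u x))"
      using u by (simp add: dsol_def sol_def)
    from has_ac_derivative_cong_AE[OF this m ae']
    have "has_ac_derivative u' (\<lambda>x. Qc x * u x - k x)" .
    then have "dsol u u' k" using u g by (auto simp: dsol_def sol_def)
    then show "(g, k) \<in> T" using g ae by (auto simp: schroedinger_iff)
  qed
qed

lemma T_bounded_from_below: "bounded_from_below T"
  unfolding bounded_from_below_def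
proof (intro exI[of _ "- M"] ballI, clarify)
  fix f h assume "(f, h) \<in> T"
  then obtain u u' where u: "f \<in> L2" "dsol u u' h" "AE x in lborel. f x = u x"
    by (auto simp: schroedinger_iff)
  have "L2_inner h f = L2_inner h u" "sqnorm f = sqnorm u"
    using u by (auto simp: dsol_def intro!: L2_inner_cong_AE sqnorm_cong_AE L2_measurable)
  then show "- M * (L2_norm f)\<^sup>2 \<le> Re (L2_inner h f)"
    using energy_ge[OF dsol_form_dom[OF u(2)]] by (simp add: L2_norm_sqnorm dsol_energy[OF u(2)])
qed

lemma L2_spectrum_eq: "L2_spectrum T = {z. ev z}"
proof -
  have "z \<in> resolvent_set T" if z: "\<not> ev z" for z
  proof -
    obtain C where C: "0 < C" "\<And>u u' h. dsol u u' h \<Longrightarrow> sqnorm u \<le> C * sqnorm (\<lambda>x. h x - z * u x)"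
      using resolvent_bound[OF z] by blast
    have "\<exists>(f, h)\<in>T. AE x in lborel. h x - z * f x = g x" if gL: "g \<in> L2" for g
    proof -
      obtain u u' where "dsol u u' (\<lambda>x. g x + z * u x)" by (rule resolvent_solve[OF z gL])
      from dsol_in_T[OF this] show ?thesis by (auto intro!: bexI[of _ "(u, \<lambda>x. g x + z * u x)"])
    qed
    moreover have "L2_norm f \<le> sqrt C * L2_norm (\<lambda>x. h x - z * f x)" if fh: "(f, h) \<in> T" for f h
    proof -
      obtain u u' where u: "f \<in> L2" "dsol u u' h" "AE x in lborel. f x = u x"
        using fh by (auto simp: schroedinger_iff)
      have uh: "u \<in> L2" "h \<in> L2" using u by (auto simp: dsol_def)
      have "sqnorm f = sqnorm u" using u uh by (auto intro!: sqnorm_cong_AE L2_measurable)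
      moreover have "sqnorm (\<lambda>x. h x - z * f x) = sqnorm (\<lambda>x. h x - z * u x)"
      proof (rule sqnorm_cong_AE)
        show "AE x in lborel. h x - z * f x = h x - z * u x" using u(3) by eventually_elim simp
      qed (use u uh in \<open>auto intro!: L2_measurable\<close>)
      ultimately have "sqnorm f \<le> C * sqnorm (\<lambda>x. h x - z * f x)" using C(2)[OF u(2)] by simp
      then have "sqrt (sqnorm f) \<le> sqrt (C * sqnorm (\<lambda>x. h x - z * f x))" by (rule real_sqrt_le_mono)
      then show ?thesis by (simp add: L2_norm_sqnorm real_sqrt_mult)
    qed
    ultimately show ?thesis unfolding resolvent_set_def by blast
  qed
  moreover have "z \<notin> resolvent_set T" if z: "ev z" for z
  proof
    assume "z \<in> resolvent_set T"
    then obtain C where C: "\<forall>(f, h)\<in>T. L2_norm f \<le> C * L2_norm (\<lambda>x. h x - z * f x)"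
      by (auto simp: resolvent_set_def)
    obtain u u' where u: "dsol u u' (\<lambda>x. z * u x)" "0 < sqnorm u" using z by (auto simp: ev_def)
    have "L2_norm u \<le> C * L2_norm (\<lambda>x. 0)" using bspec[OF C dsol_in_T[OF u(1)]] by simp
    then show False using u(2) by (simp add: L2_norm_def sqnorm_def)
  qed
  ultimately show ?thesis by (auto simp: L2_spectrum_def)
qed

text \<open>Elements of \<open>eigenspace\<close> satisfy the eigenvalue equation only almost
  everywhere. Changing the second derivative on a null set turns their continuous representatives
  into solutions to which \<open>ev_simple\<close> applies.\<close>

lemma ev_multiplicity:
  assumes "ev z"
  shows "has_multiplicity T z 1"
proof -
  obtain u u' where u: "dsol u u' (\<lambda>x. z * u x)" "0 < sqnorm u" using assms by (auto simp: ev_def)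
  have uL: "u \<in> L2" using u by (simp add: dsol_def)
  show ?thesis
    unfolding has_multiplicity_def
  proof (intro exI[of _ "\<lambda>_. u"] conjI allI ballI impI)
    show "u \<in> eigenspace T z" using dsol_in_T[OF u(1)] by (auto simp: eigenspace_def)
    show "c i = 0" if ae: "AE x in lborel. (\<Sum>i<1. c i * u x) = 0" and "i < 1" for c :: "nat \<Rightarrow> complex" and i
    proof -
      have "AE x in lborel. c 0 * u x = 0" using ae by simp
      then have "sqnorm (\<lambda>x. c 0 * u x) = 0" using sqnorm_eq_0_iff[OF L2_cmult[OF uL]] by blast
      then show ?thesis using u(2) that(2) by (simp add: sqnorm_cmult)
    qed
    fix f assume "f \<in> eigenspace T z"
    then obtain h where h: "(f, h) \<in> T" "AE x in lborel. h x = z * f x" by (auto simp: eigenspace_def)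
    then obtain v v' where v: "f \<in> L2" "dsol v v' h" "AE x in lborel. f x = v x"
      by (auto simp: schroedinger_iff)
    have "has_ac_derivative v' (\<lambda>x. Qc x * v x - z * v x)"
    proof (rule has_ac_derivative_cong_AE)
      show "has_ac_derivative v' (\<lambda>x. Qc x * v x - h x)" using v(2) by (simp add: dsol_def sol_def)
      show "(\<lambda>x. Qc x * v x - z * v x) \<in> borel_measurable borel"
      proof -
        have [measurable]: "v \<in> borel_measurable borel" using v(2) L2_measurable by (auto simp: dsol_def)
        show ?thesis by measurable
      qed
      show "AE x in lborel. Qc x * v x - h x = Qc x * v x - z * v x"
        using h(2) v(3) by eventually_elim simp
    qed
    then have "dsol v v' (\<lambda>x. z * v x)" using v(2) by (auto simp: dsol_def sol_def)
    then obtain k where k: "v = (\<lambda>x. k * u x)" using ev_simple[OF u] by blast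
    have "AE x in lborel. f x = (\<Sum>i<1::nat. (\<lambda>_. k) i * u x)"
      using v(3) by eventually_elim (simp add: k lessThan_Suc)
    then show "\<exists>c. AE x in lborel. f x = (\<Sum>i<1::nat. c i * u x)"
      by (intro exI[of _ "\<lambda>_. k"])
  qed
qed

end

section \<open>Min-max principle in counting form\<close>

text \<open>Gaussian elimination: a pivot in the equation \<open>j\<close> removes one unknown from
  the others, induction solves these, and \<open>t\<close> is the value of the pivot unknown
  obtained by back substitution.\<close>

lemma nontrivial_kernel:
  fixes A :: "'j \<Rightarrow> 'i \<Rightarrow> complex"
  assumes "finite J" "finite I" "card J < card I"
  shows "\<exists>c. (\<exists>i\<in>I. c i \<noteq> 0) \<and> (\<forall>j\<in>J. (\<Sum>i\<in>I. A j i * c i) = 0)"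
  using assms
proof (induction J arbitrary: I A rule: finite_induct)
  case empty
  then have "I \<noteq> {}" by auto
  then show ?case by (intro exI[of _ "\<lambda>_. 1"]) auto
next
  case (insert j J)
  show ?case
  proof (cases "\<forall>i\<in>I. A j i = 0")
    case True
    have "card J < card I" using insert by simp
    then obtain c where "\<exists>i\<in>I. c i \<noteq> 0" "\<forall>j\<in>J. (\<Sum>i\<in>I. A j i * c i) = 0"
      using insert.IH[OF insert.prems(1)] by blast
    then show ?thesis using True by (intro exI[of _ c]) auto
  next
    case False
    then obtain p where p: "p \<in> I" "A j p \<noteq> 0" by blast
    define B where "B l i = A l i - A l p * A j i / A j p" for l i
    have "card J < card (I - {p})" using insert.prems insert.hyps p by simp
    then obtain c where c: "\<exists>i\<in>I - {p}. c i \<noteq> 0" "\<forall>l\<in>J. (\<Sum>i\<in>I - {p}. B l i * c i) = 0"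
      using insert.IH[of "I - {p}" B] insert.prems by auto
    define t where "t = - (\<Sum>i\<in>I - {p}. A j i * c i) / A j p"
    define c' where "c' = c(p := t)"
    have split: "(\<Sum>i\<in>I. A l i * c' i) = A l p * t + (\<Sum>i\<in>I - {p}. A l i * c i)" for l
    proof -
      have "(\<Sum>i\<in>I. A l i * c' i) = A l p * c' p + (\<Sum>i\<in>I - {p}. A l i * c' i)"
        by (rule sum.remove) (use insert.prems p in auto)
      also have "(\<Sum>i\<in>I - {p}. A l i * c' i) = (\<Sum>i\<in>I - {p}. A l i * c i)"
        by (rule sum.cong) (auto simp: c'_def)
      finally show ?thesis by (simp add: c'_def)
    qed
    have "(\<Sum>i\<in>I. A j i * c' i) = 0" unfolding split t_def using p by simp
    moreover have "(\<Sum>i\<in>I. A l i * c' i) = 0" if "l \<in> J" for l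
    proof -
      have "0 = (\<Sum>i\<in>I - {p}. B l i * c i)" using c(2) that by simp
      also have "\<dots> = (\<Sum>i\<in>I - {p}. A l i * c i) - A l p / A j p * (\<Sum>i\<in>I - {p}. A j i * c i)"
      proof -
        have "B l i * c i = A l i * c i - A l p / A j p * (A j i * c i)" for i by (simp add: B_def algebra_simps)
        then show ?thesis by (simp only: sum_subtractf sum_distrib_left)
      qed
      finally show ?thesis unfolding split t_def by simp
    qed
    moreover have "\<exists>i\<in>I. c' i \<noteq> 0" using c(1) by (auto simp: c'_def)
    ultimately show ?thesis by blast
  qed
qed

text \<open>The rank \<open>r s\<close>, the number of elements up to \<open>s\<close>, is a
  strictly increasing bijection from \<open>S\<close> onto the positive integers; its inverse is the
  enumeration.\<close>

lemma enumerate_discrete: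
  fixes S :: "real set"
  assumes inf: "infinite S" and fin: "\<And>x. finite (S \<inter> {..x})"
  obtains e :: "nat \<Rightarrow> real" where "strict_mono_on {1..} e" "e ` {1..} = S"
proof -
  define r where "r s = card (S \<inter> {..s})" for s
  have mono: "r s \<le> r t" if "s \<le> t" for s t
    unfolding r_def using that fin by (intro card_mono) auto
  have smono: "r s < r t" if "s < t" "t \<in> S" for s t
  proof -
    have "t \<in> S \<inter> {..t}" "t \<notin> S \<inter> {..s}" "S \<inter> {..s} \<subseteq> S \<inter> {..t}" using that by auto
    then show ?thesis unfolding r_def by (intro psubset_card_mono fin) blast
  qed
  have inj: "inj_on r S"
    by (intro inj_onI) (metis smono less_irrefl linorder_less_linear)
  have im: "r ` (S \<inter> {..s}) = {1..r s}" for s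
  proof (rule card_subset_eq)
    show "r ` (S \<inter> {..s}) \<subseteq> {1..r s}"
    proof safe
      fix t assume t: "t \<in> S" "t \<le> s"
      then have "card {t} \<le> r t" unfolding r_def using fin by (intro card_mono) auto
      then show "r t \<in> {1..r s}" using mono t by simp
    qed
    show "card (r ` (S \<inter> {..s})) = card {1..r s}"
      using card_image[OF inj_on_subset[OF inj], of "S \<inter> {..s}"] by (simp add: r_def)
  qed auto
  have surj: "\<exists>s\<in>S. r s = n" if "1 \<le> n" for n
  proof -
    have "infinite (r ` S)" using inf inj finite_image_iff by blast
    then obtain k where "n < k" "k \<in> r ` S" unfolding infinite_nat_iff_unbounded by blast
    then obtain s where "s \<in> S" "n < r s" by blast
    then have "n \<in> r ` (S \<inter> {..s})" unfolding im using that by simp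
    then show ?thesis by auto
  qed
  define e where "e = inv_into S r"
  have e: "e n \<in> S" "r (e n) = n" if "1 \<le> n" for n
    using surj[OF that] unfolding e_def by (auto intro: inv_into_into f_inv_into_f)
  show thesis
  proof (rule that)
    show "strict_mono_on {1..} e"
    proof (rule strict_mono_onI)
      fix i j :: nat assume "i \<in> {1..}" "j \<in> {1..}" "i < j"
      then show "e i < e j" using e[of i] e[of j] mono[of "e j" "e i"] by (auto simp: not_less[symmetric])
    qed
    show "e ` {1..} = S"
    proof safe
      fix s assume "s \<in> S"
      then have "1 \<le> r s" using im[of s] by force
      moreover have "e (r s) = s" unfolding e_def by (rule inv_into_f_f[OF inj \<open>s \<in> S\<close>])
      ultimately show "s \<in> e ` {1..}" by (metis atLeast_iff imageI)
    qed (use e in auto)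
  qed
qed

lemma enumeration_card:
  fixes e :: "nat \<Rightarrow> real"
  assumes e: "strict_mono_on {1..} e" "e ` {1..} = S" and k: "1 \<le> k"
  shows "card (S \<inter> {..e k}) = k" "card (S \<inter> {..<e k}) = k - 1"
proof -
  have le: "e i \<le> e k \<longleftrightarrow> i \<le> k" and lt: "e i < e k \<longleftrightarrow> i < k" if "1 \<le> i" for i
    using strict_mono_on_less_eq[OF e(1), of i k] strict_mono_on_less[OF e(1), of i k] that k by auto
  have inj: "inj_on e {1..}" by (rule strict_mono_on_imp_inj_on[OF e(1)])
  have "S \<inter> {..e k} = e ` {1..k}" using le e(2) by auto
  then show "card (S \<inter> {..e k}) = k" using card_image[OF inj_on_subset[OF inj], of "{1..k}"] by simp
  have *: "card (e ` {1..<k}) = card {1..<k}" by (rule card_image, rule inj_on_subset[OF inj]) auto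
  have "S \<inter> {..<e k} = e ` {1..<k}" using lt e(2) by auto
  then show "card (S \<inter> {..<e k}) = k - 1" using * by simp
qed

text \<open>The passage from counting functions to individual eigenvalues: a comparison of counts
  becomes a comparison of the k-th elements.\<close>

lemma enumeration_le:
  fixes e :: "nat \<Rightarrow> real"
  assumes e: "strict_mono_on {1..} e" "e ` {1..} = S" and k: "1 \<le> k" "k \<le> card (S \<inter> {..x})"
  shows "e k \<le> x"
proof (rule ccontr)
  assume "\<not> e k \<le> x"
  then have "S \<inter> {..x} \<subseteq> S \<inter> {..<e k}" by auto
  moreover have "finite (S \<inter> {..<e k})"
  proof -
    have "S \<inter> {..<e k} \<subseteq> e ` {1..k}"
      using strict_mono_on_less[OF e(1), of _ k] k e(2) by (force simp: image_iff)
    then show ?thesis using finite_subset by blast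
  qed
  ultimately have "card (S \<inter> {..x}) \<le> k - 1"
    using card_mono enumeration_card(2)[OF e k(1)] by metis
  then show False using k by simp
qed

context confining
begin

section \<open>Eigenvalues and the form on the complement of eigenfunctions\<close>

definition eigvals :: "real set" where "eigvals = {x. ev (complex_of_real x)}"

lemma ev_iff_eigvals: "ev z \<longleftrightarrow> (\<exists>x\<in>eigvals. z = complex_of_real x)"
  using ev_real(1)[of z] by (auto simp: eigvals_def) (metis complex_is_Real_iff Reals_cases)

lemma eigvals_ge: "x \<in> eigvals \<Longrightarrow> - M \<le> x"
  using ev_real(2)[of "complex_of_real x"] by (simp add: eigvals_def)

lemma eigvals_eigenfunction:
  assumes "x \<in> eigvals"
  obtains u u' where "dsol u u' (\<lambda>t. complex_of_real x * u t)" "sqnorm u = 1"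
proof -
  obtain u u' where u: "dsol u u' (\<lambda>t. complex_of_real x * u t)" "0 < sqnorm u"
    using assms by (auto simp: eigvals_def ev_def)
  define k where "k = complex_of_real (1 / sqrt (sqnorm u))"
  have "dsol (\<lambda>t. k * u t) (\<lambda>t. k * u' t) (\<lambda>t. of_real x * (k * u t))"
    using dsol_cmult[OF u(1), of k] by (simp add: mult.left_commute)
  moreover have "sqnorm (\<lambda>t. k * u t) = 1"
  proof -
    have "(norm k)\<^sup>2 = 1 / sqnorm u" using u(2) by (simp add: k_def norm_divide power_divide)
    then show ?thesis using u(2) unfolding sqnorm_cmult by simp
  qed
  ultimately show thesis using that by blast
qed

lemma eigenfunctions_orthogonal:
  assumes "dsol u u' (\<lambda>t. complex_of_real x * u t)" "dsol v v' (\<lambda>t. complex_of_real y * v t)" "x \<noteq> y"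
  shows "L2_inner u v = 0"
  using dsol_symmetric[OF assms(1,2)] assms(3) by (simp add: L2_inner_cmult_left L2_inner_cmult_right)

text \<open>Infinitely many eigenvalues below \<open>x\<close> lie in a bounded set and accumulate.
  Their normalised eigenfunctions would subconverge by compactness, although orthonormal functions
  have squared distance 2.\<close>

lemma finite_eigvals: "finite (eigvals \<inter> {..x})"
proof (rule ccontr)
  assume "infinite (eigvals \<inter> {..x})"
  then obtain f :: "nat \<Rightarrow> real" where f: "inj f" "range f \<subseteq> eigvals \<inter> {..x}"
    using infinite_countable_subset by blast
  have fE: "f n \<in> eigvals" "f n \<in> {- M..x}" for n
  proof -
    have "f n \<in> eigvals \<inter> {..x}" using f(2) by blast
    then show "f n \<in> eigvals" "f n \<in> {- M..x}" using eigvals_ge by auto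
  qed
  have "\<exists>u u'. dsol u u' (\<lambda>t. complex_of_real (f n) * u t) \<and> sqnorm u = 1" for n
    using eigvals_eigenfunction[OF fE(1)[of n]] by metis
  then obtain u u' where u: "\<And>n. dsol (u n) (u' n) (\<lambda>t. complex_of_real (f n) * u n t)" "\<And>n. sqnorm (u n) = 1"
    by metis
  have uL: "u n \<in> L2" for n using u by (auto simp: dsol_def)
  have "bounded (range f)" using fE(2) bounded_closed_interval by (metis bounded_subset image_subsetI)
  then obtain l r where r: "strict_mono r" "(f \<circ> r) \<longlonglongrightarrow> l"
    using bounded_imp_convergent_subsequence by blast
  define g where "g n t = complex_of_real (f (r n) - l) * u (r n) t" for n t
  have gL: "g n \<in> L2" for n unfolding g_def by (intro L2_cmult uL)
  have "(\<lambda>n. f (r n) - l) \<longlonglongrightarrow> 0" using r(2) by (intro LIM_zero) (simp add: o_def)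
  then have "(\<lambda>n. (norm (complex_of_real (f (r n) - l)))\<^sup>2 * 1) \<longlonglongrightarrow> (norm (complex_of_real 0))\<^sup>2 * 1"
    by (intro tendsto_intros)
  then have g0: "(\<lambda>n. sqnorm (\<lambda>x. g n x - 0)) \<longlonglongrightarrow> 0"
    by (simp add: g_def sqnorm_cmult u(2))
  have w: "dsol (u (r n)) (u' (r n)) (\<lambda>t. g n t + of_real l * u (r n) t)" for n
    using u(1)[of "r n"] by (simp add: g_def algebra_simps)
  obtain r' v v' where r': "strict_mono (r' :: nat \<Rightarrow> nat)" "dsol v v' (\<lambda>t. 0 + of_real l * v t)"
     and lim: "(\<lambda>n. sqnorm (\<lambda>x. u (r (r' n)) x - v x)) \<longlonglongrightarrow> 0"
    by (rule dsol_compactness[OF w _ gL L2_zero g0, of 1]) (simp_all add: u(2))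
  have vL: "v \<in> L2" using r' by (auto simp: dsol_def)
  have "\<forall>\<^sub>F n in sequentially. sqnorm (\<lambda>x. u (r (r' n)) x - v x) < 1 / 4"
    using lim by (intro order_tendstoD(2)) auto
  \<comment> \<open>With 1/4 the squared distance of two such eigenfunctions comes out below 2/4 +
    2/4 = 1, against the value 2.\<close>
  then obtain n where n: "\<And>k. n \<le> k \<Longrightarrow> sqnorm (\<lambda>x. u (r (r' k)) x - v x) < 1 / 4"
    unfolding eventually_sequentially by blast
  let ?a = "r (r' n)" and ?b = "r (r' (Suc n))"
  have ab: "f ?a \<noteq> f ?b" using f(1) r(1) r'(1) by (metis injD less_irrefl lessI strict_monoD)
  have "L2_inner (u ?a) (u ?b) = 0" by (rule eigenfunctions_orthogonal[OF u(1) u(1) ab])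
  then have "sqnorm (\<lambda>x. u ?a x - u ?b x) = 2" using sqnorm_diff_expand[OF uL uL, of ?a ?b] u(2) by simp
  moreover have "sqnorm (\<lambda>x. (u ?a x - v x) - (u ?b x - v x)) \<le> 2 * sqnorm (\<lambda>x. u ?a x - v x) + 2 * sqnorm (\<lambda>x. u ?b x - v x)"
    by (intro sqnorm_diff_le L2_diff uL vL)
  ultimately show False using n[of n] n[of "Suc n"] by simp
qed

text \<open>The space \<open>H\<close> of the overview. Orthogonality is demanded to every
  eigenfunction, so that no basis has to be chosen.\<close>

definition eig_orth :: "real \<Rightarrow> (real \<Rightarrow> complex) set" where
  "eig_orth \<Lambda> = {f \<in> L2. \<forall>x\<in>eigvals. x \<le> \<Lambda> \<longrightarrow> (\<forall>u u'. dsol u u' (\<lambda>t. complex_of_real x * u t) \<longrightarrow> L2_inner f u = 0)}"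

lemma energy_diff_expand:
  assumes "form_dom f f'" "form_dom w w'"
  shows "energy (\<lambda>x. f x - complex_of_real s * w x) (\<lambda>x. f' x - complex_of_real s * w' x) =
    energy f f' - 2 * s * Re (form w w' f f') + s\<^sup>2 * energy w w'"
proof -
  have e: "(norm (a - complex_of_real s * b))\<^sup>2 = (norm a)\<^sup>2 - 2 * s * Re (b * cnj a) + s\<^sup>2 * (norm b)\<^sup>2" for a b
    unfolding cmod_power2 by (simp add: power2_eq_square algebra_simps)
  have "energy (\<lambda>x. f x - complex_of_real s * w x) (\<lambda>x. f' x - complex_of_real s * w' x) =
    (\<integral>x. ((norm (f' x))\<^sup>2 + Q x * (norm (f x))\<^sup>2) - 2 * s * Re (w' x * cnj (f' x) + Qc x * (w x * cnj (f x)))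
      + s\<^sup>2 * ((norm (w' x))\<^sup>2 + Q x * (norm (w x))\<^sup>2) \<partial>lborel)"
    unfolding energy_def e by (intro Bochner_Integration.integral_cong) (auto simp: algebra_simps)
  also have "\<dots> = energy f f' - 2 * s * Re (form w w' f f') + s\<^sup>2 * energy w w'"
    using form_dom_energy_integrable(2)[OF assms(1)] form_dom_energy_integrable(2)[OF assms(2)] form_dom_integrable[OF assms(2,1)]
    unfolding energy_def form_def by (simp del: plus_complex.sel times_complex.sel)
  finally show ?thesis .
qed

lemma eig_orth_L2: "f \<in> eig_orth \<Lambda> \<Longrightarrow> f \<in> L2"
  by (simp add: eig_orth_def)

lemma eig_orth_cmult: "f \<in> eig_orth \<Lambda> \<Longrightarrow> (\<lambda>x. c * f x) \<in> eig_orth \<Lambda>"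
  by (auto simp: eig_orth_def L2_inner_cmult_left)

lemma eig_orth_diff: "f \<in> eig_orth \<Lambda> \<Longrightarrow> g \<in> eig_orth \<Lambda> \<Longrightarrow> (\<lambda>x. f x - g x) \<in> eig_orth \<Lambda>"
  by (auto simp: eig_orth_def L2_inner_diff_left dsol_def)

lemma eig_orth_closed:
  assumes f: "\<And>n::nat. f n \<in> eig_orth \<Lambda> \<and> f n \<in> L2" and v: "v \<in> L2" and lim: "(\<lambda>n. sqnorm (\<lambda>x. f n x - v x)) \<longlonglongrightarrow> 0"
  shows "v \<in> eig_orth \<Lambda>"
  unfolding eig_orth_def
proof (intro CollectI conjI v ballI impI allI)
  fix x u u' assume x: "x \<in> eigvals" "x \<le> \<Lambda>" "dsol u u' (\<lambda>t. complex_of_real x * u t)"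
  have "(\<lambda>n. L2_inner (f n) u) \<longlonglongrightarrow> L2_inner v u"
    using f v lim x by (intro L2_inner_tendsto) (auto simp: dsol_def)
  moreover have "L2_inner (f n) u = 0" for n using f[of n] x unfolding eig_orth_def by blast
  ultimately show "L2_inner v u = 0" using LIMSEQ_unique[of "\<lambda>n. 0" 0] by simp
qed

text \<open>Symmetry of \<open>T\<close> turns orthogonality of \<open>f\<close> to an eigenfunction
  with eigenvalue \<open>x\<close> into (z - x) times the inner product of \<open>w\<close> with it
  being 0.\<close>

lemma resolvent_eig_orth:
  assumes f: "f \<in> eig_orth \<Lambda>" and w: "dsol w w' (\<lambda>x. f x + complex_of_real z * w x)" and z: "z \<notin> eigvals"
  shows "w \<in> eig_orth \<Lambda>"
  unfolding eig_orth_def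
proof (intro CollectI conjI ballI impI allI)
  show wL: "w \<in> L2" using w by (simp add: dsol_def)
  fix x u u' assume x: "x \<in> eigvals" "x \<le> \<Lambda>" "dsol u u' (\<lambda>t. complex_of_real x * u t)"
  have uL: "u \<in> L2" using x by (simp add: dsol_def)
  have "L2_inner (\<lambda>t. f t + complex_of_real z * w t) u = of_real x * L2_inner w u"
    using dsol_symmetric[OF w x(3)] by (simp add: L2_inner_cmult_right)
  moreover have "L2_inner (\<lambda>t. f t + complex_of_real z * w t) u = L2_inner f u + of_real z * L2_inner w u"
    using L2_inner_add_left[OF eig_orth_L2[OF f] L2_cmult[OF wL] uL] by (simp add: L2_inner_cmult_left)
  moreover have "L2_inner f u = 0" using f x unfolding eig_orth_def by blast
  ultimately have "(of_real z - of_real x) * L2_inner w u = 0" by (simp add: algebra_simps)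
  moreover have "z \<noteq> x" using z x by auto
  ultimately show "L2_inner w u = 0" by simp
qed

text \<open>A lower bound \<open>z\<close> of the quadratic form on the complement of the eigenfunctions below \<open>\<Lambda>\<close> can be
  improved by a step that is uniform in \<open>z \<le> \<Lambda>\<close>: test the form with \<open>f - s (T - z)\<^sup>-\<^sup>1 f\<close>.\<close>

lemma form_bound_step:
  assumes C: "0 < C" "\<And>u u' h. dsol u u' h \<Longrightarrow> u \<in> eig_orth \<Lambda> \<Longrightarrow> sqnorm u \<le> C * sqnorm (\<lambda>x. h x - complex_of_real z * u x)"
    and z: "z \<notin> eigvals" and P: "\<And>f f'. form_dom f f' \<Longrightarrow> f \<in> eig_orth \<Lambda> \<Longrightarrow> z * sqnorm f \<le> energy f f'"
    and f: "form_dom f f'" "f \<in> eig_orth \<Lambda>"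
  shows "(z + 1 / sqrt C) * sqnorm f \<le> energy f f'"
proof -
  have nz: "\<not> ev (complex_of_real z)" using z by (simp add: eigvals_def)
  note fL = eig_orth_L2[OF f(2)]
  obtain w w' where w: "dsol w w' (\<lambda>x. f x + complex_of_real z * w x)"
    by (rule resolvent_solve[OF nz fL])
  have wH: "w \<in> eig_orth \<Lambda>" by (rule resolvent_eig_orth[OF f(2) w z])
  note wL = eig_orth_L2[OF wH]
  note wF = dsol_form_dom[OF w]
  \<comment> \<open>A step of length \<open>s\<close> raises the lower bound by at least 2s - s^2
    sqrt C; this is maximal at s = 1 / sqrt C, with the value 1 / sqrt C.\<close>
  define s where "s = 1 / sqrt C"
  have FDd: "form_dom (\<lambda>x. f x - complex_of_real s * w x) (\<lambda>x. f' x - complex_of_real s * w' x)"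
    by (intro form_dom_diff form_dom_cmult f wF)
  have "z * sqnorm (\<lambda>x. f x - complex_of_real s * w x) \<le> energy (\<lambda>x. f x - complex_of_real s * w x) (\<lambda>x. f' x - complex_of_real s * w' x)"
    by (rule P[OF FDd eig_orth_diff[OF f(2) eig_orth_cmult[OF wH]]])
  moreover have "sqnorm (\<lambda>x. f x - complex_of_real s * w x) = sqnorm f - 2 * s * Re (L2_inner w f) + s\<^sup>2 * sqnorm w"
    using sqnorm_diff_expand[OF fL L2_cmult[OF wL], of "complex_of_real s"] L2_inner_commute[of f w]
    by (simp add: L2_inner_cmult_right sqnorm_cmult)
  moreover have "form w w' f f' = of_real (sqnorm f) + of_real z * L2_inner w f"
    using dsol_form[OF w f(1)] L2_inner_add_left[OF fL L2_cmult[OF wL] fL] by (simp add: L2_inner_self L2_inner_cmult_left)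
  moreover have "complex_of_real (energy w w') = L2_inner f w + of_real z * of_real (sqnorm w)"
    using dsol_energy[OF w] L2_inner_add_left[OF fL L2_cmult[OF wL] wL] by (simp add: L2_inner_self L2_inner_cmult_left)
  then have "energy w w' = Re (L2_inner f w) + z * sqnorm w"
  proof -
    assume "complex_of_real (energy w w') = L2_inner f w + of_real z * of_real (sqnorm w)"
    then have "Re (complex_of_real (energy w w')) = Re (L2_inner f w + of_real z * of_real (sqnorm w))" by (rule arg_cong)
    then show ?thesis by simp
  qed
  \<comment> \<open>All terms carrying \<open>z\<close> times an inner product with \<open>w\<close>
    or \<open>sqnorm w\<close> cancel; what remains of the quadratic term is the inner product of
    \<open>f\<close> with its resolvent image \<open>w\<close>.\<close>
  ultimately have main: "0 \<le> energy f f' - z * sqnorm f - 2 * s * sqnorm f + s\<^sup>2 * Re (L2_inner f w)"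
    using energy_diff_expand[OF f(1) wF, of s] by (simp add: algebra_simps)
  have "sqnorm w \<le> C * sqnorm f" using C(2)[OF w wH] by simp
  then have "sqrt (sqnorm w) \<le> sqrt C * sqrt (sqnorm f)" using real_sqrt_le_mono real_sqrt_mult by metis
  then have "sqrt (sqnorm f) * sqrt (sqnorm w) \<le> sqrt (sqnorm f) * (sqrt C * sqrt (sqnorm f))" by (intro mult_left_mono) auto
  also have "\<dots> = sqrt C * sqnorm f" by simp
  finally have "Re (L2_inner f w) \<le> sqrt C * sqnorm f"
    using L2_Cauchy_Schwarz[OF fL wL] complex_Re_le_cmod[of "L2_inner f w"] by linarith
  then have "s\<^sup>2 * Re (L2_inner f w) \<le> s\<^sup>2 * (sqrt C * sqnorm f)" by (intro mult_left_mono) auto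
  also have "\<dots> = s * (s * sqrt C) * sqnorm f" by (simp add: power2_eq_square)
  also have "s * sqrt C = 1" using C(1) by (simp add: s_def)
  finally have "s\<^sup>2 * Re (L2_inner f w) \<le> s * sqnorm f" by simp
  then show ?thesis using main unfolding s_def[symmetric] by (simp add: algebra_simps)
qed

text \<open>The complement contains no eigenfunction with eigenvalue up to \<Lambda>, so the
  resolvent constant \<open>C\<close> is uniform over \<open>S\<close>. Starting from the trivial
  bound \<open>- M\<close>, finitely many steps of size \<open>\<kappa> / 2\<close> lead strictly
  past \<Lambda>.\<close>

lemma form_gap:
  obtains \<kappa> where "0 < \<kappa>" "\<And>f f'. form_dom f f' \<Longrightarrow> f \<in> eig_orth \<Lambda> \<Longrightarrow> (\<Lambda> + \<kappa>) * sqnorm f \<le> energy f f'"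
proof (cases "\<Lambda> < - M")
  case True
  show thesis
  proof (rule that[of "- M - \<Lambda>"])
    show "(\<Lambda> + (- M - \<Lambda>)) * sqnorm f \<le> energy f f'" if "form_dom f f'" for f f' using energy_ge[OF that] by simp
  qed (use True in simp)
next
  case False
  \<comment> \<open>The interval extends to \<open>- M - 1\<close> because the point at which a step
    is carried out may lie up to 1 below the bound reached so far.\<close>
  define S where "S = complex_of_real ` {- M - 1..\<Lambda>}"
  have S: "compact S" unfolding S_def by (intro compact_continuous_image continuous_intros) auto
  obtain C where C: "0 < C" "\<And>z u u' h. z \<in> S \<Longrightarrow> dsol u u' h \<Longrightarrow> u \<in> eig_orth \<Lambda> \<Longrightarrow> sqnorm u \<le> C * sqnorm (\<lambda>x. h x - z * u x)"
  proof (rule resolvent_bound_uniform[OF S, of "eig_orth \<Lambda>"])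
    show "sqnorm u = 0" if z: "z \<in> S" and u: "dsol u u' (\<lambda>x. z * u x)" and uH: "u \<in> eig_orth \<Lambda>" for z u u'
    proof (rule ccontr)
      assume "sqnorm u \<noteq> 0"
      then have "0 < sqnorm u" using sqnorm_nonneg[of u] by (metis less_eq_real_def)
      moreover obtain x where x: "z = complex_of_real x" "x \<le> \<Lambda>" using z by (auto simp: S_def)
      ultimately have "x \<in> eigvals" using u by (auto simp: eigvals_def ev_def)
      then have "L2_inner u u = 0" using uH u x unfolding eig_orth_def by blast
      then show False using \<open>sqnorm u \<noteq> 0\<close> by (simp add: L2_inner_self)
    qed
    show "(\<lambda>x. c * f x) \<in> eig_orth \<Lambda>" if "f \<in> eig_orth \<Lambda>" for c f using that by (rule eig_orth_cmult)
    show "v \<in> eig_orth \<Lambda>" if "\<And>n::nat. f n \<in> eig_orth \<Lambda> \<and> f n \<in> L2" "v \<in> L2" "(\<lambda>n. sqnorm (\<lambda>x. f n x - v x)) \<longlonglongrightarrow> 0" for f v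
      using that by (rule eig_orth_closed)
  qed blast
  define P where "P z \<longleftrightarrow> (\<forall>f f'. form_dom f f' \<longrightarrow> f \<in> eig_orth \<Lambda> \<longrightarrow> z * sqnorm f \<le> energy f f')" for z
  define \<kappa> where "\<kappa> = 1 / sqrt C"
  have \<kappa>: "0 < \<kappa>" using C(1) by (simp add: \<kappa>_def)
  have down: "P z'" if "P z" "z' \<le> z" for z z'
    using that unfolding P_def by (meson mult_right_mono sqnorm_nonneg order_trans)
  have step: "P (z + \<kappa> / 2)" if z: "P z" "- M \<le> z" "z \<le> \<Lambda>" for z
  proof -
    \<comment> \<open>The step needs a point that is not an eigenvalue. Retreating by at most
      \<open>\<kappa> / 2\<close> avoids the finitely many eigenvalues and still leaves a net gain
      of \<open>\<kappa> / 2\<close>.\<close>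
    have "infinite {z - min (\<kappa> / 2) 1..z}" using \<kappa> by (intro infinite_Icc) auto
    then have "infinite ({z - min (\<kappa> / 2) 1..z} - (eigvals \<inter> {..\<Lambda>}))" using finite_eigvals by (rule Diff_infinite_finite[rotated])
    then obtain z' where z': "z' \<in> {z - min (\<kappa> / 2) 1..z}" "z' \<notin> eigvals \<inter> {..\<Lambda>}"
      by (metis Diff_iff finite.emptyI ex_in_conv)
    have zE: "z' \<notin> eigvals" using z' z(3) by auto
    have zS: "complex_of_real z' \<in> S" unfolding S_def using z' z by (intro imageI) auto
    have "P (z' + \<kappa>)"
      unfolding P_def \<kappa>_def
    proof (intro allI impI)
      fix f f' assume f: "form_dom f f'" "f \<in> eig_orth \<Lambda>"
      show "(z' + 1 / sqrt C) * sqnorm f \<le> energy f f'"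
      proof (rule form_bound_step[OF C(1) C(2)[OF zS] zE _ f])
        show "z' * sqnorm f \<le> energy f f'" if "form_dom f f'" "f \<in> eig_orth \<Lambda>" for f f'
          using down[OF z(1), of z'] z' that by (auto simp: P_def)
      qed
    qed
    then show ?thesis by (rule down) (use z' in auto)
  qed
  have P0: "P (- M)" unfolding P_def using energy_ge by blast
  have ind: "(\<forall>k<n. - M + real k * (\<kappa> / 2) \<le> \<Lambda>) \<Longrightarrow> P (- M + real n * (\<kappa> / 2))" for n
  proof (induction n)
    case 0
    then show ?case using P0 by simp
  next
    case (Suc n)
    then have "P (- M + real n * (\<kappa> / 2) + \<kappa> / 2)" using \<kappa> by (intro step) auto
    moreover have "- M + real (Suc n) * (\<kappa> / 2) = - M + real n * (\<kappa> / 2) + \<kappa> / 2"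
      by (simp only: of_nat_Suc distrib_right mult_1 add.assoc add.commute add.left_commute)
    ultimately show ?case by (simp only:)
  qed
  obtain n0 where n0: "(\<Lambda> + M) / (\<kappa> / 2) < real n0" using reals_Archimedean2 by blast
  then have ex: "\<Lambda> < - M + real n0 * (\<kappa> / 2)" using \<kappa> by (simp add: field_simps)
  define n where "n = (LEAST n. \<Lambda> < - M + real n * (\<kappa> / 2))"
  have n: "\<Lambda> < - M + real n * (\<kappa> / 2)" unfolding n_def by (rule LeastI[of "\<lambda>n. \<Lambda> < - M + real n * (\<kappa> / 2)", OF ex])
  have "- M + real k * (\<kappa> / 2) \<le> \<Lambda>" if "k < n" for k
    using not_less_Least[OF that[unfolded n_def]] by simp
  then have Pn: "P (- M + real n * (\<kappa> / 2))" using ind by blast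
  show thesis
  proof (rule that)
    show "0 < - M + real n * (\<kappa> / 2) - \<Lambda>" using n by simp
    show "(\<Lambda> + (- M + real n * (\<kappa> / 2) - \<Lambda>)) * sqnorm f \<le> energy f f'" if "form_dom f f'" "f \<in> eig_orth \<Lambda>" for f f'
      using Pn that unfolding P_def by simp
  qed
qed

section \<open>Counting eigenvalues with trial functions and with zeros\<close>

text \<open>With more trial functions than eigenvalues up to \<Lambda>, some nontrivial combination
  is orthogonal to all those eigenfunctions. The form exceeds \<Lambda> there by
  \<open>form_gap\<close>, but is at most \<Lambda> on trial functions.\<close>

theorem card_eigvals_ge:
  fixes F :: "'i \<Rightarrow> real \<Rightarrow> complex"
  assumes I: "finite I" and F: "\<And>i. i \<in> I \<Longrightarrow> form_dom (F i) (F' i)"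
    and le: "\<And>c. (\<exists>i\<in>I. c i \<noteq> 0) \<Longrightarrow> 0 < sqnorm (\<lambda>x. \<Sum>i\<in>I. c i * F i x)"
      "\<And>c. energy (\<lambda>x. \<Sum>i\<in>I. c i * F i x) (\<lambda>x. \<Sum>i\<in>I. c i * F' i x) \<le> \<Lambda> * sqnorm (\<lambda>x. \<Sum>i\<in>I. c i * F i x)"
  shows "card I \<le> card (eigvals \<inter> {..\<Lambda>})"
proof (rule ccontr)
  assume "\<not> ?thesis"
  then have lt: "card (eigvals \<inter> {..\<Lambda>}) < card I" by simp
  have "\<forall>x\<in>eigvals. \<exists>u u'. dsol u u' (\<lambda>t. complex_of_real x * u t) \<and> sqnorm u = 1"
    using eigvals_eigenfunction by metis
  then obtain e e' where e: "\<And>x. x \<in> eigvals \<Longrightarrow> dsol (e x) (e' x) (\<lambda>t. complex_of_real x * e x t)" "\<And>x. x \<in> eigvals \<Longrightarrow> sqnorm (e x) = 1"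
    by metis
  obtain c where c: "\<exists>i\<in>I. c i \<noteq> 0" "\<forall>x\<in>eigvals \<inter> {..\<Lambda>}. (\<Sum>i\<in>I. L2_inner (F i) (e x) * c i) = 0"
    using nontrivial_kernel[OF finite_eigvals I lt, of "\<lambda>x i. L2_inner (F i) (e x)"] by blast
  define f where "f x = (\<Sum>i\<in>I. c i * F i x)" for x
  define f' where "f' x = (\<Sum>i\<in>I. c i * F' i x)" for x
  have f: "form_dom f f'" unfolding f_def f'_def by (intro form_dom_sum form_dom_cmult F)
  have FL: "F i \<in> L2" if "i \<in> I" for i using F[OF that] by (simp add: form_dom_def)
  have fL: "f \<in> L2" using f by (simp add: form_dom_def)
  have "f \<in> eig_orth \<Lambda>"
    unfolding eig_orth_def
  proof (intro CollectI conjI fL ballI impI allI)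
    fix x u u' assume x: "x \<in> eigvals" "x \<le> \<Lambda>" "dsol u u' (\<lambda>t. complex_of_real x * u t)"
    have "0 < sqnorm (e x)" using e(2)[OF x(1)] by simp
    then obtain k where k: "u = (\<lambda>t. k * e x t)" using ev_simple[OF e(1)[OF x(1)] _ x(3)] by blast
    have eL: "e x \<in> L2" using e(1)[OF x(1)] by (simp add: dsol_def)
    have "L2_inner f (e x) = (\<Sum>i\<in>I. L2_inner (\<lambda>t. c i * F i t) (e x))"
      unfolding f_def by (intro L2_inner_sum_left L2_cmult FL eL)
    also have "\<dots> = (\<Sum>i\<in>I. L2_inner (F i) (e x) * c i)" by (simp add: L2_inner_cmult_left mult.commute)
    also have "\<dots> = 0" using c(2) x by auto
    finally show "L2_inner f u = 0" by (simp add: k L2_inner_cmult_right)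
  qed
  obtain \<kappa> where \<kappa>: "0 < \<kappa>" "\<And>f f'. form_dom f f' \<Longrightarrow> f \<in> eig_orth \<Lambda> \<Longrightarrow> (\<Lambda> + \<kappa>) * sqnorm f \<le> energy f f'"
    using form_gap by blast
  have "(\<Lambda> + \<kappa>) * sqnorm f \<le> \<Lambda> * sqnorm f"
    using \<kappa>(2)[OF f \<open>f \<in> eig_orth \<Lambda>\<close>] le(2)[of c] unfolding f_def f'_def by linarith
  moreover have "0 < \<kappa> * sqnorm f" using \<kappa>(1) le(1)[OF c(1)] unfolding f_def by simp
  ultimately show False by (simp add: algebra_simps)
qed

lemma eigenfunction_sum:
  assumes X: "finite X" "X \<subseteq> eigvals" and e: "\<And>x. x \<in> X \<Longrightarrow> dsol (e x) (e' x) (\<lambda>t. complex_of_real x * e x t)" "\<And>x. x \<in> X \<Longrightarrow> sqnorm (e x) = 1"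
  shows "form_dom (\<lambda>t. \<Sum>x\<in>X. c x * e x t) (\<lambda>t. \<Sum>x\<in>X. c x * e' x t)"
    "sqnorm (\<lambda>t. \<Sum>x\<in>X. c x * e x t) = (\<Sum>x\<in>X. (norm (c x))\<^sup>2)"
    "energy (\<lambda>t. \<Sum>x\<in>X. c x * e x t) (\<lambda>t. \<Sum>x\<in>X. c x * e' x t) = (\<Sum>x\<in>X. x * (norm (c x))\<^sup>2)"
proof -
  have eL: "e x \<in> L2" if "x \<in> X" for x using e(1)[OF that] by (simp add: dsol_def)
  let ?f = "\<lambda>a t. \<Sum>x\<in>X. a x * e x t"
  have fL: "?f a \<in> L2" for a by (intro L2_sum L2_cmult eL)
  have orth: "L2_inner (e x) (e y) = (if x = y then 1 else 0)" if "x \<in> X" "y \<in> X" for x y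
    using that e eigenfunctions_orthogonal[OF e(1)[OF that(1)] e(1)[OF that(2)]] by (simp add: L2_inner_self)
  have ip: "L2_inner (?f a) (?f c) = (\<Sum>x\<in>X. a x * cnj (c x))" for a
  proof -
    have r: "L2_inner (e x) (?f c) = cnj (c x)" if x: "x \<in> X" for x
    proof -
      have "L2_inner (?f c) (e x) = (\<Sum>y\<in>X. c y * L2_inner (e y) (e x))"
        using L2_inner_sum_left[of X "\<lambda>y t. c y * e y t" "e x"] eL x by (auto simp: L2_inner_cmult_left)
      also have "\<dots> = (\<Sum>y\<in>X. if y = x then c y else 0)" using orth x by (intro sum.cong) auto
      also have "\<dots> = c x" using x X(1) by simp
      finally show ?thesis by (subst L2_inner_commute) simp
    qed
    have "L2_inner (?f a) (?f c) = (\<Sum>x\<in>X. a x * L2_inner (e x) (?f c))"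
      using L2_inner_sum_left[of X "\<lambda>y t. a y * e y t" "?f c"] eL fL by (auto simp: L2_inner_cmult_left)
    also have "\<dots> = (\<Sum>x\<in>X. a x * cnj (c x))" using r by (intro sum.cong) auto
    finally show ?thesis .
  qed
  have sq: "z * cnj z = complex_of_real ((norm z)\<^sup>2)" for z by (simp only: complex_norm_square)
  have "complex_of_real (sqnorm (?f c)) = of_real (\<Sum>x\<in>X. (norm (c x))\<^sup>2)"
    using ip[of c] unfolding L2_inner_self sq by simp
  then show "sqnorm (?f c) = (\<Sum>x\<in>X. (norm (c x))\<^sup>2)" by (simp only: of_real_eq_iff)
  have FDe: "form_dom (e x) (e' x)" if "x \<in> X" for x by (rule dsol_form_dom[OF e(1)[OF that]])
  show "form_dom (?f c) (\<lambda>t. \<Sum>x\<in>X. c x * e' x t)" by (intro form_dom_sum form_dom_cmult FDe)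
  have "dsol (\<lambda>t. \<Sum>x\<in>Y. c x * e x t) (\<lambda>t. \<Sum>x\<in>Y. c x * e' x t) (\<lambda>t. \<Sum>x\<in>Y. (complex_of_real x * c x) * e x t)"
    if "finite Y" "Y \<subseteq> X" for Y using that
  proof (induction Y rule: finite_induct)
    case empty
    have "sol Qc (\<lambda>x. 0) (\<lambda>x. 0) (\<lambda>x. 0)" by (simp add: sol_def has_ac_derivative_const)
    then show ?case by (simp add: dsol_def)
  next
    case (insert x Y)
    then have "dsol (\<lambda>t. c x * e x t + (\<Sum>x\<in>Y. c x * e x t)) (\<lambda>t. c x * e' x t + (\<Sum>x\<in>Y. c x * e' x t))
      (\<lambda>t. c x * (complex_of_real x * e x t) + (\<Sum>x\<in>Y. (complex_of_real x * c x) * e x t))"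
      by (intro dsol_add dsol_cmult e) auto
    then show ?case using insert.hyps by (simp add: mult_ac)
  qed
  from dsol_energy[OF this[OF X(1) order_refl]] ip[of "\<lambda>x. complex_of_real x * c x"]
  have "complex_of_real (energy (?f c) (\<lambda>t. \<Sum>x\<in>X. c x * e' x t)) = (\<Sum>x\<in>X. complex_of_real x * (c x * cnj (c x)))"
    by (simp add: mult.assoc)
  also have "\<dots> = of_real (\<Sum>x\<in>X. x * (norm (c x))\<^sup>2)" unfolding sq by simp
  finally show "energy (?f c) (\<lambda>t. \<Sum>x\<in>X. c x * e' x t) = (\<Sum>x\<in>X. x * (norm (c x))\<^sup>2)" by (simp only: of_real_eq_iff)
qed

text \<open>The codimension conditions of the min-max principle are taken to be zeros at the points
  of \<open>P\<close>. With more eigenvalues below \<Lambda> than points, some nontrivial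
  combination of eigenfunctions vanishes on \<open>P\<close>, and its energy is strictly below
  \<Lambda> times its mass.\<close>

theorem card_eigvals_le:
  assumes P: "finite P" and le: "\<And>f f'. form_dom f f' \<Longrightarrow> (\<And>p. p \<in> P \<Longrightarrow> f p = 0) \<Longrightarrow> \<Lambda> * sqnorm f \<le> energy f f'"
  shows "card (eigvals \<inter> {..<\<Lambda>}) \<le> card P"
proof (rule ccontr)
  assume "\<not> ?thesis"
  then have lt: "card P < card (eigvals \<inter> {..<\<Lambda>})" by simp
  let ?X = "eigvals \<inter> {..<\<Lambda>}"
  have X: "finite ?X" using finite_eigvals[of \<Lambda>] by (rule rev_finite_subset) auto
  have "\<forall>x\<in>eigvals. \<exists>u u'. dsol u u' (\<lambda>t. complex_of_real x * u t) \<and> sqnorm u = 1"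
    using eigvals_eigenfunction by metis
  then obtain e e' where e: "\<And>x. x \<in> eigvals \<Longrightarrow> dsol (e x) (e' x) (\<lambda>t. complex_of_real x * e x t)" "\<And>x. x \<in> eigvals \<Longrightarrow> sqnorm (e x) = 1"
    by metis
  obtain c where c: "\<exists>x\<in>?X. c x \<noteq> 0" "\<forall>p\<in>P. (\<Sum>x\<in>?X. e x p * c x) = 0"
    using nontrivial_kernel[OF P X lt, of "\<lambda>p x. e x p"] by blast
  define f where "f t = (\<Sum>x\<in>?X. c x * e x t)" for t
  define f' where "f' t = (\<Sum>x\<in>?X. c x * e' x t)" for t
  have f: "form_dom f f'" and N: "sqnorm f = (\<Sum>x\<in>?X. (norm (c x))\<^sup>2)" and E: "energy f f' = (\<Sum>x\<in>?X. x * (norm (c x))\<^sup>2)"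
    unfolding f_def f'_def using eigenfunction_sum[OF X _ e, of c] by auto
  have "\<Lambda> * sqnorm f \<le> energy f f'"
    by (rule le[OF f]) (use c(2) in \<open>auto simp: f_def mult.commute\<close>)
  then have "(\<Sum>x\<in>?X. \<Lambda> * (norm (c x))\<^sup>2) \<le> (\<Sum>x\<in>?X. x * (norm (c x))\<^sup>2)"
    unfolding N E by (simp add: sum_distrib_left)
  moreover have "(\<Sum>x\<in>?X. x * (norm (c x))\<^sup>2) < (\<Sum>x\<in>?X. \<Lambda> * (norm (c x))\<^sup>2)"
  proof (rule sum_strict_mono_ex1[OF X])
    show "\<forall>x\<in>?X. x * (norm (c x))\<^sup>2 \<le> \<Lambda> * (norm (c x))\<^sup>2" by (auto intro!: mult_right_mono)
    show "\<exists>x\<in>?X. x * (norm (c x))\<^sup>2 < \<Lambda> * (norm (c x))\<^sup>2" using c(1) by (auto intro!: bexI mult_strict_right_mono)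
  qed
  ultimately show False by simp
qed

end

text \<open>The eigenfunctions of \<open>Q\<close> up to \<open>x\<close> serve as trial functions
  for \<open>Q'\<close>: a bounded difference of potentials preserves the form domain and raises the
  energy by at most \<open>K\<close> times the mass.\<close>

theorem card_eigvals_compare:
  assumes "confining Q M m" "confining Q' M' m'" and K: "\<And>x. \<bar>Q' x - Q x\<bar> \<le> K"
  shows "card (confining.eigvals Q \<inter> {..x}) \<le> card (confining.eigvals Q' \<inter> {..x + K})"
proof -
  interpret A: confining Q M m by fact
  interpret B: confining Q' M' m' by fact
  let ?X = "A.eigvals \<inter> {..x}"
  have X: "finite ?X" by (rule A.finite_eigvals)
  have "\<forall>x\<in>A.eigvals. \<exists>u u'. A.dsol u u' (\<lambda>t. complex_of_real x * u t) \<and> sqnorm u = 1"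
    using A.eigvals_eigenfunction by metis
  then obtain e e' where e: "\<And>x. x \<in> A.eigvals \<Longrightarrow> A.dsol (e x) (e' x) (\<lambda>t. complex_of_real x * e x t)" "\<And>x. x \<in> A.eigvals \<Longrightarrow> sqnorm (e x) = 1"
    by metis
  note sum = A.eigenfunction_sum[OF X _ e]
  have form_dom: "B.form_dom f f' \<and> B.energy f f' \<le> A.energy f f' + K * sqnorm f" if f: "A.form_dom f f'" for f f'
  proof
    note [measurable] = A.form_dom_measurable[OF f]
    have L: "integrable lborel (\<lambda>x. (norm (f x))\<^sup>2)" "integrable lborel (\<lambda>x. (norm (f' x))\<^sup>2)" "integrable lborel (\<lambda>x. \<bar>Q x\<bar> * (norm (f x))\<^sup>2)"
      using f by (auto simp: A.form_dom_def intro: L2_integrable_square)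
    have "integrable lborel (\<lambda>x. \<bar>Q' x\<bar> * (norm (f x))\<^sup>2)"
    proof (rule Bochner_Integration.integrable_bound)
      show "integrable lborel (\<lambda>x. \<bar>Q x\<bar> * (norm (f x))\<^sup>2 + K * (norm (f x))\<^sup>2)" using L by auto
      show "AE x in lborel. norm (\<bar>Q' x\<bar> * (norm (f x))\<^sup>2) \<le> norm (\<bar>Q x\<bar> * (norm (f x))\<^sup>2 + K * (norm (f x))\<^sup>2)"
      proof (rule AE_I2)
        fix x
        have "\<bar>Q' x\<bar> * (norm (f x))\<^sup>2 \<le> (\<bar>Q x\<bar> + K) * (norm (f x))\<^sup>2"
          using K[of x] by (intro mult_right_mono) auto
        then show "norm (\<bar>Q' x\<bar> * (norm (f x))\<^sup>2) \<le> norm (\<bar>Q x\<bar> * (norm (f x))\<^sup>2 + K * (norm (f x))\<^sup>2)"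
          by (simp add: distrib_right)
      qed
    qed measurable
    then show fB: "B.form_dom f f'" using f by (simp add: A.form_dom_def B.form_dom_def)
    have "B.energy f f' \<le> (\<integral>x. ((norm (f' x))\<^sup>2 + Q x * (norm (f x))\<^sup>2) + K * (norm (f x))\<^sup>2 \<partial>lborel)"
      unfolding B.energy_def
    proof (intro integral_mono B.form_dom_energy_integrable[OF fB] Bochner_Integration.integrable_add A.form_dom_energy_integrable[OF f] integrable_mult_right L)
      fix x
      have "Q' x * (norm (f x))\<^sup>2 \<le> (Q x + K) * (norm (f x))\<^sup>2" using K[of x] by (intro mult_right_mono) auto
      then show "(norm (f' x))\<^sup>2 + Q' x * (norm (f x))\<^sup>2 \<le> (norm (f' x))\<^sup>2 + Q x * (norm (f x))\<^sup>2 + K * (norm (f x))\<^sup>2"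
        by (simp add: algebra_simps)
    qed
    also have "\<dots> = A.energy f f' + K * sqnorm f" using A.form_dom_energy_integrable[OF f] L by (simp add: A.energy_def sqnorm_def)
    finally show "B.energy f f' \<le> A.energy f f' + K * sqnorm f" .
  qed
  show ?thesis
  proof (rule B.card_eigvals_ge[OF X, where F = e and F' = e'])
    show "B.form_dom (e y) (e' y)" if "y \<in> ?X" for y using form_dom[OF A.dsol_form_dom[OF e(1)]] that by blast
    fix c :: "real \<Rightarrow> complex"
    have N: "sqnorm (\<lambda>t. \<Sum>x\<in>?X. c x * e x t) = (\<Sum>x\<in>?X. (norm (c x))\<^sup>2)" using sum(2)[of c] by auto
    show "0 < sqnorm (\<lambda>t. \<Sum>x\<in>?X. c x * e x t)" if "\<exists>i\<in>?X. c i \<noteq> 0"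
      unfolding N using that X by (auto intro!: sum_pos2)
    have "A.energy (\<lambda>t. \<Sum>x\<in>?X. c x * e x t) (\<lambda>t. \<Sum>x\<in>?X. c x * e' x t) = (\<Sum>x\<in>?X. x * (norm (c x))\<^sup>2)"
      using sum(3)[of c] by auto
    also have "\<dots> \<le> (\<Sum>y\<in>?X. x * (norm (c y))\<^sup>2)" by (intro sum_mono mult_right_mono) auto
    also have "\<dots> = x * sqnorm (\<lambda>t. \<Sum>x\<in>?X. c x * e x t)" unfolding N by (simp add: sum_distrib_left)
    finally show "B.energy (\<lambda>t. \<Sum>x\<in>?X. c x * e x t) (\<lambda>t. \<Sum>x\<in>?X. c x * e' x t) \<le> (x + K) * sqnorm (\<lambda>t. \<Sum>x\<in>?X. c x * e x t)"
      using form_dom[OF sum(1)[of c]] by (auto simp: algebra_simps)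
  qed
qed

section \<open>Counting eigenvalues by cells\<close>

lemma ac_on_cong_AE:
  assumes "ac_on a b u v" "v \<in> borel_measurable borel" "w \<in> borel_measurable borel"
    and "AE x in lborel. x \<in> {a..b} \<longrightarrow> v x = w x"
  shows "ac_on a b u w"
proof -
  have m: "v \<in> borel_measurable lborel" "w \<in> borel_measurable lborel" using assms(2,3) by auto
  have ae: "AE x\<in>{a..t} in lborel. v x = w x" if "t \<in> {a..b}" for t
    using assms(4) by eventually_elim (use that in auto)
  have "(LINT x:{a..t}|lborel. v x) = (LINT x:{a..t}|lborel. w x)" if "t \<in> {a..b}" for t
    using set_lebesgue_integral_cong_AE[OF _ m ae[OF that]] by auto
  moreover have "set_integrable lborel {a..b} v = set_integrable lborel {a..b} w"
    using set_integrable_cong_AE[OF m assms(4)] by auto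
  ultimately show ?thesis using assms(1) unfolding ac_on_def by simp
qed

text \<open>The function \<open>k cot (k (x - a) + \<eta>)\<close> solves the Riccati equation \<open>\<phi>' = - k\<^sup>2 - \<phi>\<^sup>2\<close>; completing
  the square \<open>\<bar>f' - \<phi> f\<bar>\<^sup>2\<close> gives Wirtinger's inequality.\<close>

lemma wirtinger:
  fixes f :: "real \<Rightarrow> complex"
  assumes ab: "a \<le> b" and k: "0 \<le> k" "k * (b - a) < pi"
    and f: "ac_on a b f f'" "f a = 0" "f b = 0"
    and i: "set_integrable lborel {a..b} (\<lambda>x. (norm (f' x))\<^sup>2)"
  shows "k\<^sup>2 * (LINT x:{a..b}|lborel. (norm (f x))\<^sup>2) \<le> (LINT x:{a..b}|lborel. (norm (f' x))\<^sup>2)"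
proof -
  \<comment> \<open>Centres the argument of the cotangent: on [a,b] it runs over an interval of
    length k(b - a) < pi with midpoint pi/2, away from the poles.\<close>
  define \<eta> where "\<eta> = (pi - k * (b - a)) / 2"
  define \<phi> where "\<phi> x = k * cot (k * (x - a) + \<eta>)" for x
  have rng: "0 < k * (x - a) + \<eta>" "k * (x - a) + \<eta> < pi" if "x \<in> {a..b}" for x
  proof -
    have "0 \<le> k * (x - a)" "k * (x - a) \<le> k * (b - a)" using that k by (auto intro: mult_left_mono)
    then show "0 < k * (x - a) + \<eta>" "k * (x - a) + \<eta> < pi" using k(2) unfolding \<eta>_def by argo+
  qed
  have sn: "sin (k * (x - a) + \<eta>) \<noteq> 0" if "x \<in> {a..b}" for x
    using sin_gt_zero[OF rng[OF that]] by simp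
  have d: "(\<phi> has_vector_derivative (- k\<^sup>2 - (\<phi> x)\<^sup>2)) (at x within {a..b})" if x: "x \<in> {a..b}" for x
  proof -
    let ?s = "sin (k * (x - a) + \<eta>)" and ?c = "cos (k * (x - a) + \<eta>)"
    have "(\<phi> has_real_derivative (k * (- inverse (?s\<^sup>2) * k))) (at x)"
    proof -
      have "((\<lambda>x. k * (x - a) + \<eta>) has_real_derivative k) (at x)" by (auto intro!: derivative_eq_intros)
      from DERIV_cmult[OF DERIV_chain2[OF DERIV_cot[OF sn[OF x]] this]] show ?thesis unfolding \<phi>_def .
    qed
    moreover have "k * (- inverse (?s\<^sup>2) * k) = - k\<^sup>2 - (\<phi> x)\<^sup>2"
    proof -
      have "(?c / ?s)\<^sup>2 = inverse (?s\<^sup>2) - 1"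
        using sn[OF x] by (simp add: power_divide cos_squared_eq diff_divide_distrib inverse_eq_divide)
      then have "(\<phi> x)\<^sup>2 = k\<^sup>2 * (inverse (?s\<^sup>2) - 1)"
        by (simp only: \<phi>_def cot_def power_mult_distrib)
      then show ?thesis by (simp only: power2_eq_square right_diff_distrib) simp
    qed
    ultimately show ?thesis
      using has_real_derivative_iff_has_vector_derivative has_vector_derivative_at_within by metis
  qed
  have c\<phi>: "continuous_on {a..b} \<phi>"
    unfolding \<phi>_def cot_def using sn by (intro continuous_intros) auto
  have \<phi>: "ac_on a b \<phi> (\<lambda>x. - k\<^sup>2 - (\<phi> x)\<^sup>2)"
    by (rule ac_on_C1[OF d]) (auto intro!: continuous_intros c\<phi>)
  have "ac_on a b (\<lambda>x. complex_of_real (\<phi> x) * (f x * cnj (f x)))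
     (\<lambda>x. complex_of_real (- k\<^sup>2 - (\<phi> x)\<^sup>2) * (f x * cnj (f x)) + complex_of_real (\<phi> x) * (f' x * cnj (f x) + f x * cnj (f' x)))"
    by (intro ac_on_mult ac_on_of_real ac_on_cnj \<phi> f)
  from ac_on_Re[OF this]
  have ac: "ac_on a b (\<lambda>x. \<phi> x * (norm (f x))\<^sup>2) (\<lambda>x. (- k\<^sup>2 - (\<phi> x)\<^sup>2) * (norm (f x))\<^sup>2 + 2 * \<phi> x * Re (f' x * cnj (f x)))"
  proof (rule ac_on_cong)
    fix x
    have sq: "f x * cnj (f x) = of_real ((norm (f x))\<^sup>2)" by (simp only: complex_norm_square)
    show "Re (complex_of_real (\<phi> x) * (f x * cnj (f x))) = \<phi> x * (norm (f x))\<^sup>2"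
      unfolding sq by (simp del: of_real_power)
    have "Re (complex_of_real (\<phi> x) * (f' x * cnj (f x) + f x * cnj (f' x))) = 2 * \<phi> x * Re (f' x * cnj (f x))"
      by (simp add: algebra_simps)
    then show "Re (complex_of_real (- k\<^sup>2 - (\<phi> x)\<^sup>2) * (f x * cnj (f x)) + complex_of_real (\<phi> x) * (f' x * cnj (f x) + f x * cnj (f' x)))
        = (- k\<^sup>2 - (\<phi> x)\<^sup>2) * (norm (f x))\<^sup>2 + 2 * \<phi> x * Re (f' x * cnj (f x))"
      unfolding sq plus_complex.simps(1) by (simp only: Re_complex_of_real of_real_mult[symmetric])
  qed
  have if2: "set_integrable lborel {a..b} (\<lambda>x. (norm (f x))\<^sup>2)"
    unfolding set_integrable_def by (intro borel_integrable_compact continuous_intros ac_on_continuous[OF f(1)]) auto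
  \<comment> \<open>The boundary terms of \<phi>|f|^2 vanish because \<open>f\<close> does at both
    ends.\<close>
  have "0 = (LINT x:{a..b}|lborel. (- k\<^sup>2 - (\<phi> x)\<^sup>2) * (norm (f x))\<^sup>2 + 2 * \<phi> x * Re (f' x * cnj (f x)))"
    using ac_on_integral[OF ac ab] f by simp
  also have "\<dots> \<le> (LINT x:{a..b}|lborel. (norm (f' x))\<^sup>2 - k\<^sup>2 * (norm (f x))\<^sup>2)"
  proof (rule set_integral_mono[OF ac_on_integrable[OF ac]])
    show "set_integrable lborel {a..b} (\<lambda>x. (norm (f' x))\<^sup>2 - k\<^sup>2 * (norm (f x))\<^sup>2)"
      using i if2 by auto
    fix x
    have "0 \<le> (norm (f' x - complex_of_real (\<phi> x) * f x))\<^sup>2" by simp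
    also have "\<dots> = (norm (f' x))\<^sup>2 - 2 * \<phi> x * Re (f' x * cnj (f x)) + (\<phi> x)\<^sup>2 * (norm (f x))\<^sup>2"
      unfolding cmod_power2 by (simp add: power2_eq_square algebra_simps)
    finally show "(- k\<^sup>2 - (\<phi> x)\<^sup>2) * (norm (f x))\<^sup>2 + 2 * \<phi> x * Re (f' x * cnj (f x)) \<le> (norm (f' x))\<^sup>2 - k\<^sup>2 * (norm (f x))\<^sup>2"
      by (simp add: left_diff_distrib)
  qed
  also have "\<dots> = (LINT x:{a..b}|lborel. (norm (f' x))\<^sup>2) - k\<^sup>2 * (LINT x:{a..b}|lborel. (norm (f x))\<^sup>2)"
    using i if2 by simp
  finally show ?thesis by simp
qed

context confining
begin

definition form_density :: "real \<Rightarrow> (real \<Rightarrow> complex) \<Rightarrow> (real \<Rightarrow> complex) \<Rightarrow> real \<Rightarrow> real" where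
  "form_density \<Lambda> f f' x = (norm (f' x))\<^sup>2 + Q x * (norm (f x))\<^sup>2 - \<Lambda> * (norm (f x))\<^sup>2"

lemma form_density_integrable: "form_dom f f' \<Longrightarrow> integrable lborel (form_density \<Lambda> f f')"
  unfolding form_density_def[abs_def]
  by (intro Bochner_Integration.integrable_diff integrable_mult_right form_dom_energy_integrable(2) L2_integrable_square)
    (auto simp: form_dom_def)

lemma form_density_set_integrable: "form_dom f f' \<Longrightarrow> set_integrable lborel {a..b::real} (form_density \<Lambda> f f')"
  unfolding set_integrable_def by (intro integrable_mult_indicator form_density_integrable) auto

lemma integral_form_density: "form_dom f f' \<Longrightarrow> (\<integral>x. form_density \<Lambda> f f' x \<partial>lborel) = energy f f' - \<Lambda> * sqnorm f"
  unfolding form_density_def using form_dom_energy_integrable(2)[of f f']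
  by (simp add: energy_def sqnorm_def form_dom_def L2_integrable_square)

text \<open>\<open>npts \<Lambda> a b y\<close>: imposing at most \<open>y\<close> zeros makes the form minus \<open>\<Lambda>\<close> nonnegative on \<open>[a, b]\<close>.
  \<open>ncells \<Lambda> a b y\<close>: at least \<open>y\<close> disjoint cells in \<open>[a, b]\<close> each support a sine on which the form
  is at most \<open>\<Lambda>\<close>. Both are additive in the interval, which replaces Dirichlet-Neumann bracketing.\<close>

definition npts :: "real \<Rightarrow> real \<Rightarrow> real \<Rightarrow> real \<Rightarrow> bool" where
  "npts \<Lambda> a b y \<longleftrightarrow> (\<exists>P. finite P \<and> real (card P) \<le> y \<and>
    (\<forall>f f'. form_dom f f' \<longrightarrow> (\<forall>p\<in>P. f p = 0) \<longrightarrow> 0 \<le> (LINT x:{a..b}|lborel. form_density \<Lambda> f f' x)))"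

definition ncells :: "real \<Rightarrow> real \<Rightarrow> real \<Rightarrow> real \<Rightarrow> bool" where
  "ncells \<Lambda> A B y \<longleftrightarrow> (\<exists>S. finite S \<and> y \<le> real (card S) \<and>
    (\<forall>p\<in>S. A \<le> fst p \<and> fst p < snd p \<and> snd p \<le> B \<and>
       (\<forall>x\<in>{fst p<..<snd p}. Q x + (pi / (snd p - fst p))\<^sup>2 \<le> \<Lambda>)) \<and>
    (\<forall>p\<in>S. \<forall>p'\<in>S. p \<noteq> p' \<longrightarrow> snd p \<le> fst p' \<or> snd p' \<le> fst p))"

lemma npts_refl: "npts \<Lambda> a a 0"
proof -
  have e: "(LINT x:{a..a}|lborel. g x) = 0" for g :: "real \<Rightarrow> real"
  proof -
    have "(\<lambda>x. indicator {a..a} x *\<^sub>R g x) = (\<lambda>x. indicator {a..a} x *\<^sub>R g a)"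
      by (auto simp: indicator_def)
    then show ?thesis by (simp add: set_lebesgue_integral_def)
  qed
  show ?thesis unfolding npts_def by (intro exI[of _ "{}"]) (simp add: e del: atLeastAtMost_singleton)
qed

lemma ncells_refl: "ncells \<Lambda> a a 0"
  unfolding ncells_def by (intro exI[of _ "{}"]) simp

lemma npts_add:
  assumes "npts \<Lambda> a b y" "npts \<Lambda> b c z" "a \<le> b" "b \<le> c"
  shows "npts \<Lambda> a c (y + z)"
proof -
  obtain P where P: "finite P" "real (card P) \<le> y" "\<And>f f'. form_dom f f' \<Longrightarrow> (\<forall>p\<in>P. f p = 0) \<Longrightarrow> 0 \<le> (LINT x:{a..b}|lborel. form_density \<Lambda> f f' x)"
    using assms(1) unfolding npts_def by blast
  obtain R where R: "finite R" "real (card R) \<le> z" "\<And>f f'. form_dom f f' \<Longrightarrow> (\<forall>p\<in>R. f p = 0) \<Longrightarrow> 0 \<le> (LINT x:{b..c}|lborel. form_density \<Lambda> f f' x)"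
    using assms(2) unfolding npts_def by blast
  show ?thesis
    unfolding npts_def
  proof (intro exI[of _ "P \<union> R"] conjI allI impI)
    show "real (card (P \<union> R)) \<le> y + z" using card_Un_le[of P R] P R by linarith
    fix f f' assume f: "form_dom f f'" "\<forall>p\<in>P \<union> R. f p = 0"
    show "0 \<le> (LINT x:{a..c}|lborel. form_density \<Lambda> f f' x)"
      using set_integral_Icc_split[OF form_density_set_integrable[OF f(1)] assms(3,4), of \<Lambda>] P(3)[OF f(1)] R(3)[OF f(1)] f(2) by simp
  qed (use P R in auto)
qed

lemma ncells_add:
  assumes "ncells \<Lambda> A B y" "ncells \<Lambda> B C z" "A \<le> B" "B \<le> C"
  shows "ncells \<Lambda> A C (y + z)"
proof -
  let ?ok = "\<lambda>A B p. A \<le> fst p \<and> fst p < snd p \<and> snd p \<le> B \<and> (\<forall>x\<in>{fst p<..<snd p}. Q x + (pi / (snd p - fst p))\<^sup>2 \<le> \<Lambda>)"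
  let ?dj = "\<lambda>S. \<forall>p\<in>S. \<forall>p'\<in>S. p \<noteq> p' \<longrightarrow> snd p \<le> fst p' \<or> snd p' \<le> fst (p::real\<times>real)"
  obtain S where S: "finite S" "y \<le> real (card S)" "\<forall>p\<in>S. ?ok A B p" "?dj S"
    using assms(1) unfolding ncells_def by blast
  obtain R where R: "finite R" "z \<le> real (card R)" "\<forall>p\<in>R. ?ok B C p" "?dj R"
    using assms(2) unfolding ncells_def by blast
  have sr: "snd p \<le> fst r" if "p \<in> S" "r \<in> R" for p r using S(3) R(3) that by force
  have "S \<inter> R = {}" using S(3) R(3) by force
  then have "card (S \<union> R) = card S + card R" by (rule card_Un_disjoint[OF S(1) R(1)])
  then have "y + z \<le> real (card (S \<union> R))" using S(2) R(2) by simp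
  moreover have "\<forall>p\<in>S \<union> R. ?ok A C p" using S(3) R(3) assms(3,4) by force
  moreover have "?dj (S \<union> R)" using S(4) R(4) sr by blast
  ultimately show ?thesis unfolding ncells_def using S(1) R(1) by blast
qed

lemma npts_cell:
  assumes ab: "a \<le> b" and k: "0 \<le> k" "k * (b - a) < pi" and v: "\<And>x. x \<in> {a..b} \<Longrightarrow> \<Lambda> - k\<^sup>2 \<le> Q x"
    and f: "form_dom f f'" "f a = 0" "f b = 0"
  shows "0 \<le> (LINT x:{a..b}|lborel. form_density \<Lambda> f f' x)"
proof -
  have F: "has_ac_derivative f f'" "f \<in> L2" "f' \<in> L2" using f(1) by (auto simp: form_dom_def)
  have i: "set_integrable lborel {a..b} (\<lambda>x. (norm (f' x))\<^sup>2)" "set_integrable lborel {a..b} (\<lambda>x. (norm (f x))\<^sup>2)"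
    unfolding set_integrable_def by (intro integrable_mult_indicator L2_integrable_square F; simp)+
  have "0 \<le> (LINT x:{a..b}|lborel. (norm (f' x))\<^sup>2) - k\<^sup>2 * (LINT x:{a..b}|lborel. (norm (f x))\<^sup>2)"
    using wirtinger[OF ab k has_ac_derivativeD[OF F(1)] f(2,3) i(1)] by simp
  also have "\<dots> = (LINT x:{a..b}|lborel. (norm (f' x))\<^sup>2 - k\<^sup>2 * (norm (f x))\<^sup>2)" using i by simp
  also have "\<dots> \<le> (LINT x:{a..b}|lborel. form_density \<Lambda> f f' x)"
  proof (rule set_integral_mono[OF _ form_density_set_integrable[OF f(1)]])
    show "set_integrable lborel {a..b} (\<lambda>x. (norm (f' x))\<^sup>2 - k\<^sup>2 * (norm (f x))\<^sup>2)" using i by auto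
    fix x assume "x \<in> {a..b}"
    then have "(\<Lambda> - k\<^sup>2) * (norm (f x))\<^sup>2 \<le> Q x * (norm (f x))\<^sup>2" by (intro mult_right_mono v) auto
    then show "(norm (f' x))\<^sup>2 - k\<^sup>2 * (norm (f x))\<^sup>2 \<le> form_density \<Lambda> f f' x"
      by (simp add: form_density_def algebra_simps)
  qed
  finally show ?thesis .
qed

text \<open>Equal subdivision into n cells and zeros at all n + 1 division points. The summand 2
  pays for rounding up and for the additional end point.\<close>

lemma npts_interval:
  assumes ab: "a \<le> b" and k: "0 \<le> k" and v: "\<And>x. x \<in> {a..b} \<Longrightarrow> \<Lambda> - k\<^sup>2 \<le> Q x"
  shows "npts \<Lambda> a b (k * (b - a) / pi + 2)"
proof -
  \<comment> \<open>The floor plus 1, rather than the ceiling: the cell length must satisfy k l < pi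
    strictly, also when k(b - a)/pi is an integer.\<close>
  define n where "n = nat \<lfloor>k * (b - a) / pi\<rfloor> + 1"
  define l where "l = (b - a) / real n"
  have y0: "0 \<le> k * (b - a) / pi" using ab k by simp
  have n0: "0 < n" by (simp add: n_def)
  have ny: "k * (b - a) / pi < real n" "real n \<le> k * (b - a) / pi + 1" using y0 unfolding n_def by linarith+
  have l0: "0 \<le> l" using ab by (simp add: l_def)
  have "k * (b - a) < real n * pi" using ny(1) by (simp add: field_simps)
  then have kl: "k * l < pi" using n0 by (simp add: l_def field_simps)
  have nl: "real n * l = b - a" using n0 by (simp add: l_def)
  have ge: "0 \<le> (LINT x:{a..a + real j * l}|lborel. form_density \<Lambda> f f' x)"
    if "j \<le> n" and f: "form_dom f f'" "\<forall>p\<in>(\<lambda>i. a + real i * l) ` {..n}. f p = 0" for j f f'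
    using that(1)
  proof (induction j)
    case 0
    then show ?case using npts_cell[of a a k \<Lambda> f f'] k v f pi_gt_zero ab by force
  next
    case (Suc j)
    have le: "a + real j * l \<le> a + real (Suc j) * l" using l0 by (simp add: algebra_simps)
    have lb: "a + real (Suc j) * l \<le> b"
    proof -
      have "real (Suc j) * l \<le> real n * l" using Suc.prems l0 by (intro mult_right_mono) auto
      then show ?thesis using nl by simp
    qed
    have aj: "a \<le> a + real j * l" using l0 by simp
    have "0 \<le> (LINT x:{a + real j * l..a + real (Suc j) * l}|lborel. form_density \<Lambda> f f' x)"
    proof (rule npts_cell[OF le k _ _ f(1)])
      show "k * (a + real (Suc j) * l - (a + real j * l)) < pi" using kl by (simp add: algebra_simps)
      show "\<Lambda> - k\<^sup>2 \<le> Q x" if "x \<in> {a + real j * l..a + real (Suc j) * l}" for x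
        using that aj lb by (intro v) auto
      show "f (a + real j * l) = 0" "f (a + real (Suc j) * l) = 0"
        using f(2) Suc.prems by (auto simp del: of_nat_Suc)
    qed
    then show ?case
      using set_integral_Icc_split[OF form_density_set_integrable[OF f(1)] aj le, of \<Lambda>] Suc by simp
  qed
  show ?thesis
    unfolding npts_def
  proof (intro exI[of _ "(\<lambda>i. a + real i * l) ` {..n}"] conjI allI impI)
    have "card ((\<lambda>i. a + real i * l) ` {..n}) \<le> card {..n}" by (rule card_image_le) simp
    then show "real (card ((\<lambda>i. a + real i * l) ` {..n})) \<le> k * (b - a) / pi + 2" using ny(2) by simp
    show "0 \<le> (LINT x:{a..b}|lborel. form_density \<Lambda> f f' x)" if "form_dom f f'" "\<forall>p\<in>(\<lambda>i. a + real i * l) ` {..n}. f p = 0" for f f'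
      using ge[OF order_refl that] nl by simp
  qed simp
qed

text \<open>Rounding down makes each cell at least pi/k long, so that its lowest sine has frequency
  at most \<open>k\<close>; the loss is at most one cell.\<close>

lemma ncells_interval:
  assumes ab: "A \<le> B" and k: "0 \<le> k" and v: "\<And>x. x \<in> {A..B} \<Longrightarrow> Q x + k\<^sup>2 \<le> \<Lambda>"
  shows "ncells \<Lambda> A B (k * (B - A) / pi - 1)"
proof -
  define n where "n = nat \<lfloor>k * (B - A) / pi\<rfloor>"
  have y0: "0 \<le> k * (B - A) / pi" using ab k by simp
  have ny: "real n \<le> k * (B - A) / pi" "k * (B - A) / pi - 1 \<le> real n" using y0 unfolding n_def by linarith+
  show ?thesis
  proof (cases "n = 0")
    case True
    then show ?thesis unfolding ncells_def using ny by (intro exI[of _ "{}"]) auto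
  next
    case False
    define l where "l = (B - A) / real n"
    have nl: "real n * l = B - A" using False by (simp add: l_def)
    have "0 < k * (B - A)" using ny(1) False pi_gt_zero by (smt (verit) divide_nonpos_pos of_nat_0_less_iff gr0I)
    then have l0: "0 < l" using False ab by (auto simp: l_def zero_less_mult_iff)
    have "pi * real n \<le> k * (B - A)" using ny(1) by (simp add: field_simps)
    then have "pi \<le> k * l" using False by (simp add: l_def field_simps)
    then have pl: "(pi / l)\<^sup>2 \<le> k\<^sup>2" using l0 by (intro power_mono) (auto simp: field_simps)
    define c where "c i = (A + real i * l, A + real (Suc i) * l)" for i
    have inj: "inj_on c {..<n}" using l0 by (auto simp: inj_on_def c_def)
    have mono: "A + real i * l \<le> A + real j * l" if "i \<le> j" for i j
      using that l0 by (auto intro!: mult_right_mono)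
    have AB: "A \<le> A + real i * l" "i \<le> n \<Longrightarrow> A + real i * l \<le> B" for i
      using mono[of i n] nl l0 by auto
    have dj: "snd (c i) \<le> fst (c j) \<or> snd (c j) \<le> fst (c i)" if "i \<noteq> j" for i j
    proof (cases "i < j")
      case True
      then show ?thesis using mono[of "Suc i" j] by (simp add: c_def del: of_nat_Suc)
    next
      case False
      then show ?thesis using mono[of "Suc j" i] that by (simp add: c_def del: of_nat_Suc)
    qed
    show ?thesis
      unfolding ncells_def
    proof (intro exI[of _ "c ` {..<n}"] conjI ballI)
      show "k * (B - A) / pi - 1 \<le> real (card (c ` {..<n}))" using ny(2) card_image[OF inj] by simp
      fix p assume "p \<in> c ` {..<n}"
      then obtain i where i: "i < n" "p = c i" by blast
      have len: "snd p - fst p = l" by (simp add: i c_def algebra_simps)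
      show "A \<le> fst p" "snd p \<le> B" using AB(1)[of i] AB(2)[of "Suc i"] i by (simp_all add: c_def)
      show "fst p < snd p" using len l0 by simp
      fix x assume x: "x \<in> {fst p<..<snd p}"
      then have "Q x + k\<^sup>2 \<le> \<Lambda>" using \<open>A \<le> fst p\<close> \<open>snd p \<le> B\<close> by (intro v) auto
      then show "Q x + (pi / (snd p - fst p))\<^sup>2 \<le> \<Lambda>" unfolding len using pl by simp
    next
      fix p p' assume "p \<in> c ` {..<n}" "p' \<in> c ` {..<n}"
      then obtain i j where ij: "p = c i" "p' = c j" by blast
      show "p \<noteq> p' \<longrightarrow> snd p \<le> fst p' \<or> snd p' \<le> fst p"
        unfolding ij using dj[of i j] by (cases "i = j") auto
    qed simp
  qed
qed

text \<open>Outside \<open>{-R..R}\<close> the density of the form minus \<Lambda> is nonnegative by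
  itself, so zeros are required only for the inner interval.\<close>

theorem card_eigvals_le_npts:
  assumes "npts \<Lambda> (- R) R y" "0 \<le> R" and out: "\<And>x. R \<le> \<bar>x\<bar> \<Longrightarrow> \<Lambda> \<le> Q x"
  shows "real (card (eigvals \<inter> {..<\<Lambda>})) \<le> y"
proof -
  obtain P where P: "finite P" "real (card P) \<le> y" "\<And>f f'. form_dom f f' \<Longrightarrow> (\<forall>p\<in>P. f p = 0) \<Longrightarrow> 0 \<le> (LINT x:{-R..R}|lborel. form_density \<Lambda> f f' x)"
    using assms(1) unfolding npts_def by blast
  have "card (eigvals \<inter> {..<\<Lambda>}) \<le> card P"
  proof (rule card_eigvals_le[OF P(1)])
    fix f f' assume f: "form_dom f f'" "\<And>p. p \<in> P \<Longrightarrow> f p = 0"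
    have "0 \<le> (LINT x:{-R..R}|lborel. form_density \<Lambda> f f' x)" using P(3)[OF f(1)] f(2) by blast
    also have "\<dots> \<le> (\<integral>x. form_density \<Lambda> f f' x \<partial>lborel)"
      unfolding set_lebesgue_integral_def
    proof (intro integral_mono form_density_integrable[OF f(1)] integrable_mult_indicator)
      fix x
      show "indicat_real {-R..R} x *\<^sub>R form_density \<Lambda> f f' x \<le> form_density \<Lambda> f f' x"
      proof (cases "x \<in> {-R..R}")
        case False
        then have "\<Lambda> * (norm (f x))\<^sup>2 \<le> Q x * (norm (f x))\<^sup>2" by (intro mult_right_mono out) auto
        then have "0 \<le> form_density \<Lambda> f f' x" using zero_le_power2[of "norm (f' x)"] unfolding form_density_def by linarith
        then show ?thesis using False by simp
      qed simp
    qed auto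
    also have "\<dots> = energy f f' - \<Lambda> * sqnorm f" by (rule integral_form_density[OF f(1)])
    finally show "\<Lambda> * sqnorm f \<le> energy f f'" by simp
  qed
  then show ?thesis using P(2) by linarith
qed

section \<open>Sine functions on cells as trial functions\<close>

definition sincell :: "real \<times> real \<Rightarrow> real \<Rightarrow> complex" where
  "sincell p x = (if fst p < x \<and> x < snd p then complex_of_real (sin (pi / (snd p - fst p) * (x - fst p))) else 0)"

definition sincell' :: "real \<times> real \<Rightarrow> real \<Rightarrow> complex" where
  "sincell' p x = (if fst p < x \<and> x < snd p then complex_of_real (pi / (snd p - fst p) * cos (pi / (snd p - fst p) * (x - fst p))) else 0)"

text \<open>With k = pi/length, the function k sin cos vanishes at both ends of the cell, so k^2
  cos^2 and k^2 sin^2 have equal integrals. Hence the energy minus \<Lambda> times the mass is at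
  most the integral of (Q + k^2 - \<Lambda>) sin^2.\<close>

lemma sincell_form_dom:
  assumes ab: "fst p < snd p"
  shows "form_dom (sincell p) (sincell' p)" "0 < sqnorm (sincell p)" 
    and "(\<And>x. x \<in> {fst p<..<snd p} \<Longrightarrow> Q x + (pi / (snd p - fst p))\<^sup>2 \<le> \<Lambda>) \<Longrightarrow> energy (sincell p) (sincell' p) \<le> \<Lambda> * sqnorm (sincell p)"
proof -
  define a b k where "a = fst p" and "b = snd p" and "k = pi / (snd p - fst p)"
  have ab: "a < b" using assms by (simp add: a_def b_def)
  have kb: "k * (b - a) = pi" using ab by (simp add: k_def a_def b_def)
  have s: "sincell p x = (if a < x \<and> x < b then complex_of_real (sin (k * (x - a))) else 0)" for x
    by (simp add: sincell_def a_def b_def k_def)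
  have s': "sincell' p x = (if a < x \<and> x < b then complex_of_real (k * cos (k * (x - a))) else 0)" for x
    by (simp add: sincell'_def a_def b_def k_def)
  have m[measurable]: "sincell p \<in> borel_measurable borel" "sincell' p \<in> borel_measurable borel"
    unfolding s[abs_def] s'[abs_def] by measurable
  have mid: "ac_on a b (sincell p) (sincell' p)"
  proof (rule ac_on_cong_AE)
    have "ac_on a b (\<lambda>x. sin (k * (x - a))) (\<lambda>x. k * cos (k * (x - a)))"
      by (rule ac_on_C1) (auto intro!: derivative_eq_intros continuous_intros simp: has_real_derivative_iff_has_vector_derivative[symmetric])
    from ac_on_of_real[OF this] show "ac_on a b (sincell p) (\<lambda>x. complex_of_real (k * cos (k * (x - a))))"
    proof (rule ac_on_cong)
      fix x assume "x \<in> {a..b}"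
      then consider "x = a" | "x = b" | "a < x" "x < b" by fastforce
      then show "complex_of_real (sin (k * (x - a))) = sincell p x"
        using kb by cases (auto simp: s)
    qed simp
    have "AE x in lborel. x \<noteq> a" "AE x in lborel. x \<noteq> b" by (rule AE_lborel_singleton)+
    then show "AE x in lborel. x \<in> {a..b} \<longrightarrow> complex_of_real (k * cos (k * (x - a))) = sincell' p x"
      by eventually_elim (auto simp: s')
    show "(\<lambda>x. complex_of_real (k * cos (k * (x - a)))) \<in> borel_measurable borel" by measurable
  qed (rule m)
  have ac: "has_ac_derivative (sincell p) (sincell' p)"
  proof (rule has_ac_derivativeI)
    fix c d :: real
    have l: "ac_on (min a c) a (sincell p) (sincell' p)"
      by (rule ac_on_cong[OF ac_on_const[of _ _ 0]]) (auto simp: s s')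
    have r: "ac_on b (max b d) (sincell p) (sincell' p)"
      by (rule ac_on_cong[OF ac_on_const[of _ _ 0]]) (auto simp: s s')
    have "ac_on (min a c) (max b d) (sincell p) (sincell' p)"
      using ab by (intro ac_on_join[OF ac_on_join[OF l mid] r]) auto
    then show "ac_on c d (sincell p) (sincell' p)" by (rule ac_on_subinterval) auto
  qed
  have ii: "integrable lborel (indicat_real {a..b})"
    by (rule integrable_real_indicator) (auto simp: emeasure_lborel_Icc_eq)
  have sL: "sincell p \<in> L2"
    by (rule L2_bound[OF m(1) ii]) (auto simp: s indicator_def power_le_one_iff abs_square_le_1)
  have sL': "sincell' p \<in> L2"
  proof (rule L2_bound[OF m(2) integrable_mult_right[OF ii, of "k\<^sup>2"]])
    show "(norm (sincell' p x))\<^sup>2 \<le> k\<^sup>2 * indicat_real {a..b} x" for x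
    proof -
      have "(cos (k * (x - a)))\<^sup>2 \<le> 1" by (simp add: abs_square_le_1)
      then have "k\<^sup>2 * (cos (k * (x - a)))\<^sup>2 \<le> k\<^sup>2 * 1" by (rule mult_left_mono) simp
      then show ?thesis by (auto simp: s' indicator_def power_mult_distrib norm_mult)
    qed
  qed
  have Qi: "integrable lborel (\<lambda>x. \<bar>Q x\<bar> * (norm (sincell p x))\<^sup>2)"
  proof (rule Bochner_Integration.integrable_bound)
    show "integrable lborel (\<lambda>x. m (max \<bar>a\<bar> \<bar>b\<bar>) * indicat_real {a..b} x)" using ii by auto
    show "AE x in lborel. norm (\<bar>Q x\<bar> * (norm (sincell p x))\<^sup>2) \<le> norm (m (max \<bar>a\<bar> \<bar>b\<bar>) * indicat_real {a..b} x)"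
    proof (rule AE_I2)
      fix x
      show "norm (\<bar>Q x\<bar> * (norm (sincell p x))\<^sup>2) \<le> norm (m (max \<bar>a\<bar> \<bar>b\<bar>) * indicat_real {a..b} x)"
      proof (cases "a < x \<and> x < b")
        case True
        have "\<bar>x\<bar> \<le> max \<bar>a\<bar> \<bar>b\<bar>" using True by arith
        then have "\<bar>Q x\<bar> \<le> m (max \<bar>a\<bar> \<bar>b\<bar>)" using Q_le[of x] m_mono[of "\<bar>x\<bar>" "max \<bar>a\<bar> \<bar>b\<bar>"] by simp
        moreover have "(norm (sincell p x))\<^sup>2 \<le> 1" using True by (simp add: s abs_square_le_1)
        ultimately have "\<bar>Q x\<bar> * (norm (sincell p x))\<^sup>2 \<le> m (max \<bar>a\<bar> \<bar>b\<bar>) * 1" by (intro mult_mono) auto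
        then show ?thesis using True by (simp add: abs_mult)
      qed (auto simp: s)
    qed
  qed measurable
  show form_dom: "form_dom (sincell p) (sincell' p)" using ac sL sL' Qi by (simp add: form_dom_def)
  show "0 < sqnorm (sincell p)"
  proof (rule ccontr)
    assume "\<not> 0 < sqnorm (sincell p)"
    then have "sqnorm (sincell p) = 0" using sqnorm_nonneg[of "sincell p"] by (metis less_eq_real_def)
    then have "AE x in lborel. sincell p x = 0" using sqnorm_eq_0_iff[OF sL] by simp
    from continuous_AE_eq_0[OF this has_ac_derivative_continuous[OF ac], of "(a + b) / 2"]
    have "sin (k * ((a + b) / 2 - a)) = 0" using ab by (simp add: s)
    moreover have "k * ((a + b) / 2 - a) = pi / 2" using kb by (simp add: field_simps)
    ultimately show False by simp
  qed
  assume le: "\<And>x. x \<in> {fst p<..<snd p} \<Longrightarrow> Q x + (pi / (snd p - fst p))\<^sup>2 \<le> \<Lambda>"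
  have le': "Q x + k\<^sup>2 \<le> \<Lambda>" if "a < x" "x < b" for x
    using le[of x] that by (simp add: a_def b_def k_def)
  have ac2: "ac_on a b (\<lambda>x. k * sin (k * (x - a)) * cos (k * (x - a))) (\<lambda>x. k\<^sup>2 * (cos (k * (x - a)))\<^sup>2 - k\<^sup>2 * (sin (k * (x - a)))\<^sup>2)"
    by (rule ac_on_C1) (auto intro!: derivative_eq_intros continuous_intros simp: has_real_derivative_iff_has_vector_derivative[symmetric] power2_eq_square algebra_simps)
  have "energy (sincell p) (sincell' p) - \<Lambda> * sqnorm (sincell p) = (\<integral>x. form_density \<Lambda> (sincell p) (sincell' p) x \<partial>lborel)"
    using integral_form_density[OF form_dom] by simp
  also have "\<dots> \<le> (\<integral>x. indicator {a..b} x *\<^sub>R (k\<^sup>2 * (cos (k * (x - a)))\<^sup>2 - k\<^sup>2 * (sin (k * (x - a)))\<^sup>2) \<partial>lborel)"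
  proof (rule integral_mono_AE[OF form_density_integrable[OF form_dom]])
    show "integrable lborel (\<lambda>x. indicator {a..b} x *\<^sub>R (k\<^sup>2 * (cos (k * (x - a)))\<^sup>2 - k\<^sup>2 * (sin (k * (x - a)))\<^sup>2))"
      using ac_on_integrable[OF ac2] by (simp only: set_integrable_def)
    have "AE x in lborel. x \<noteq> a" "AE x in lborel. x \<noteq> b" by (rule AE_lborel_singleton)+
    then show "AE x in lborel. form_density \<Lambda> (sincell p) (sincell' p) x \<le> indicator {a..b} x *\<^sub>R (k\<^sup>2 * (cos (k * (x - a)))\<^sup>2 - k\<^sup>2 * (sin (k * (x - a)))\<^sup>2)"
    proof eventually_elim
      case (elim x)
      show ?case
      proof (cases "a < x \<and> x < b")
        case True
        have "(Q x + k\<^sup>2) * (sin (k * (x - a)))\<^sup>2 \<le> \<Lambda> * (sin (k * (x - a)))\<^sup>2"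
          using True by (intro mult_right_mono le') auto
        then show ?thesis using True by (simp add: form_density_def s s' norm_mult power_mult_distrib algebra_simps)
      next
        case False
        then show ?thesis using elim by (auto simp: form_density_def s s' indicator_def)
      qed
    qed
  qed
  also have "\<dots> = 0"
    using ac_on_integral[OF ac2] ab kb by (simp add: set_lebesgue_integral_def)
  finally show "energy (sincell p) (sincell' p) \<le> \<Lambda> * sqnorm (sincell p)" by simp
qed

lemma norm_sum_single:
  fixes c g :: "'i \<Rightarrow> complex"
  assumes "finite S" "\<And>p p'. p \<in> S \<Longrightarrow> p' \<in> S \<Longrightarrow> g p \<noteq> 0 \<Longrightarrow> g p' \<noteq> 0 \<Longrightarrow> p = p'"
  shows "(norm (\<Sum>p\<in>S. c p * g p))\<^sup>2 = (\<Sum>p\<in>S. (norm (c p))\<^sup>2 * (norm (g p))\<^sup>2)"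
proof (cases "\<exists>p\<in>S. g p \<noteq> 0")
  case True
  then obtain p where p: "p \<in> S" "g p \<noteq> 0" by blast
  then have z: "g p' = 0" if "p' \<in> S - {p}" for p' using assms(2) that by blast
  have "(\<Sum>p\<in>S. c p * g p) = c p * g p" using z assms(1) p(1) by (simp add: sum.remove)
  moreover have "(\<Sum>p\<in>S. (norm (c p))\<^sup>2 * (norm (g p))\<^sup>2) = (norm (c p))\<^sup>2 * (norm (g p))\<^sup>2"
    using z assms(1) p(1) by (simp add: sum.remove)
  ultimately show ?thesis by (simp add: norm_mult power_mult_distrib)
qed simp

text \<open>At every point at most one of the sine functions is nonzero. Mass and energy are
  therefore diagonal on their span, and the bounds for the single cells add up.\<close>

theorem card_eigvals_ge_ncells:
  assumes "ncells \<Lambda> A B y"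
  shows "y \<le> real (card (eigvals \<inter> {..\<Lambda>}))"
proof -
  obtain S where S: "finite S" "y \<le> real (card S)" 
    "\<And>p. p \<in> S \<Longrightarrow> fst p < snd p" "\<And>p x. p \<in> S \<Longrightarrow> x \<in> {fst p<..<snd p} \<Longrightarrow> Q x + (pi / (snd p - fst p))\<^sup>2 \<le> \<Lambda>"
    "\<And>p p'. p \<in> S \<Longrightarrow> p' \<in> S \<Longrightarrow> p \<noteq> p' \<Longrightarrow> snd p \<le> fst p' \<or> snd p' \<le> fst p"
    using assms unfolding ncells_def by blast
  have "card S \<le> card (eigvals \<inter> {..\<Lambda>})"
  proof (rule card_eigvals_ge[OF S(1), where F = sincell and F' = sincell'])
    show F: "form_dom (sincell p) (sincell' p)" if "p \<in> S" for p by (rule sincell_form_dom(1)[OF S(3)[OF that]])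
    fix c :: "real \<times> real \<Rightarrow> complex"
    let ?f = "\<lambda>x. \<Sum>p\<in>S. c p * sincell p x" and ?f' = "\<lambda>x. \<Sum>p\<in>S. c p * sincell' p x"
    have n: "(norm (?f x))\<^sup>2 = (\<Sum>p\<in>S. (norm (c p))\<^sup>2 * (norm (sincell p x))\<^sup>2)" for x
      by (rule norm_sum_single[OF S(1)]) (use S(5) in \<open>force simp: sincell_def split: if_splits\<close>)
    have n': "(norm (?f' x))\<^sup>2 = (\<Sum>p\<in>S. (norm (c p))\<^sup>2 * (norm (sincell' p x))\<^sup>2)" for x
      by (rule norm_sum_single[OF S(1)]) (use S(5) in \<open>force simp: sincell'_def split: if_splits\<close>)
    have L: "integrable lborel (\<lambda>x. (norm (sincell p x))\<^sup>2)" "integrable lborel (\<lambda>x. (norm (sincell' p x))\<^sup>2 + Q x * (norm (sincell p x))\<^sup>2)"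
      if "p \<in> S" for p using F[OF that] form_dom_energy_integrable(2)[OF F[OF that]] by (auto simp: form_dom_def intro: L2_integrable_square)
    have N: "sqnorm ?f = (\<Sum>p\<in>S. (norm (c p))\<^sup>2 * sqnorm (sincell p))"
      unfolding sqnorm_def n using L by (simp add: Bochner_Integration.integral_sum)
    have "energy ?f ?f' = (\<integral>x. (\<Sum>p\<in>S. (norm (c p))\<^sup>2 * ((norm (sincell' p x))\<^sup>2 + Q x * (norm (sincell p x))\<^sup>2)) \<partial>lborel)"
      unfolding energy_def n n' by (intro Bochner_Integration.integral_cong) (auto simp: sum_distrib_left sum.distrib distrib_left mult_ac)
    also have "\<dots> = (\<Sum>p\<in>S. (norm (c p))\<^sup>2 * energy (sincell p) (sincell' p))"
      unfolding energy_def using L(2) by (simp add: Bochner_Integration.integral_sum)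
    also have "\<dots> \<le> (\<Sum>p\<in>S. (norm (c p))\<^sup>2 * (\<Lambda> * sqnorm (sincell p)))"
      using S(3,4) by (intro sum_mono mult_left_mono sincell_form_dom(3)) auto
    also have "\<dots> = \<Lambda> * sqnorm ?f" unfolding N by (simp add: sum_distrib_left mult_ac)
    finally show "energy ?f ?f' \<le> \<Lambda> * sqnorm ?f" .
    show "0 < sqnorm ?f" if ex: "\<exists>p\<in>S. c p \<noteq> 0"
    proof -
      obtain p where p: "p \<in> S" "c p \<noteq> 0" using ex by blast
      show ?thesis unfolding N using p sincell_form_dom(2)[OF S(3)] by (intro sum_pos2[OF S(1) p(1)]) auto
    qed
  qed
  then show ?thesis using S(2) by linarith
qed

end

section \<open>Weyl asymptotics and spreading of eigenfunctions\<close>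

lemma confining_powr:
  fixes \<beta> B :: real and q :: "real \<Rightarrow> real"
  assumes \<beta>: "0 < \<beta>" and q: "q \<in> borel_measurable borel" "\<And>x. \<bar>q x\<bar> \<le> B"
  shows "confining (\<lambda>x. \<bar>x\<bar> powr \<beta> + \<alpha> * q x) (\<bar>\<alpha>\<bar> * B) (\<lambda>t. \<bar>t\<bar> powr \<beta> + \<bar>\<alpha>\<bar> * B + 1)"
proof
  have B: "0 \<le> B" using q(2)[of 0] by linarith
  have aq: "\<bar>\<alpha> * q x\<bar> \<le> \<bar>\<alpha>\<bar> * B" for x unfolding abs_mult by (intro mult_left_mono q) simp
  show "(\<lambda>x. \<bar>x\<bar> powr \<beta> + \<alpha> * q x) \<in> borel_measurable borel" using q(1) by measurable
  show "0 \<le> \<bar>\<alpha>\<bar> * B" using B by simp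
  show "- (\<bar>\<alpha>\<bar> * B) \<le> \<bar>x\<bar> powr \<beta> + \<alpha> * q x" for x using aq[of x] powr_ge_zero[of "\<bar>x\<bar>" \<beta>] by linarith
  show "\<bar>\<bar>x\<bar> powr \<beta> + \<alpha> * q x\<bar> \<le> \<bar>\<bar>x\<bar>\<bar> powr \<beta> + \<bar>\<alpha>\<bar> * B + 1" for x
    using aq[of x] powr_ge_zero[of "\<bar>x\<bar>" \<beta>] unfolding abs_abs by linarith
  show "\<bar>s\<bar> powr \<beta> + \<bar>\<alpha>\<bar> * B + 1 \<le> \<bar>t\<bar> powr \<beta> + \<bar>\<alpha>\<bar> * B + 1" if "0 \<le> s" "s \<le> t" for s t
    using that \<beta> by (simp add: powr_mono2)
  show "1 \<le> \<bar>t\<bar> powr \<beta> + \<bar>\<alpha>\<bar> * B + 1" for t using B by simp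
  show "continuous_on UNIV (\<lambda>t. \<bar>t\<bar> powr \<beta> + \<bar>\<alpha>\<bar> * B + 1)"
    using \<beta> by (intro continuous_intros continuous_on_powr') auto
  fix K :: real
  define L where "L = max 0 (K + \<bar>\<alpha>\<bar> * B)"
  show "\<exists>X\<ge>0. \<forall>x. X \<le> \<bar>x\<bar> \<longrightarrow> K \<le> \<bar>x\<bar> powr \<beta> + \<alpha> * q x"
  proof (intro exI[of _ "L powr (1 / \<beta>)"] conjI allI impI)
    fix x assume "L powr (1 / \<beta>) \<le> \<bar>x\<bar>"
    then have "(L powr (1 / \<beta>)) powr \<beta> \<le> \<bar>x\<bar> powr \<beta>" using \<beta> by (intro powr_mono2) auto
    moreover have "(L powr (1 / \<beta>)) powr \<beta> = L" using \<beta> by (simp add: powr_powr L_def)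
    ultimately show "K \<le> \<bar>x\<bar> powr \<beta> + \<alpha> * q x" using aq[of x] by (simp add: L_def)
  qed simp
qed

lemma confining_powr_0: "0 < \<beta> \<Longrightarrow> confining (\<lambda>x. \<bar>x\<bar> powr \<beta>) 0 (\<lambda>t. \<bar>t\<bar> powr \<beta> + 1)"
  using confining_powr[of \<beta> "\<lambda>_. 0" 0 0] by simp

section \<open>Weyl bounds for the unperturbed potential\<close>

text \<open>The left Riemann sum of sqrt(1 - t^\<beta>) on [0,1]. The integrand decreases from 1 to
  0, so this is an upper sum, and subtracting 1/n gives the right, hence lower, sum.\<close>

definition riemann_sum :: "real \<Rightarrow> nat \<Rightarrow> real" where
  "riemann_sum \<beta> n = (\<Sum>i<n. sqrt (1 - (real i / real n) powr \<beta>)) / real n"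

lemma powr_grid:
  fixes \<Lambda> \<beta> :: real
  assumes "0 < \<beta>" "0 < \<Lambda>" "0 < n"
  shows "(real i * (\<Lambda> powr (1 / \<beta>)) / real n) powr \<beta> = \<Lambda> * (real i / real n) powr \<beta>"
proof -
  have "real i * (\<Lambda> powr (1 / \<beta>)) / real n = (real i / real n) * \<Lambda> powr (1 / \<beta>)" by simp
  then show ?thesis using assms by (simp only: powr_mult powr_powr) (simp add: powr_mult powr_powr)
qed

context
  fixes \<beta> \<Lambda> :: real and n :: nat
  assumes \<beta>: "0 < \<beta>" and \<Lambda>: "0 < \<Lambda>" and n: "0 < n"
begin

interpretation confining "\<lambda>x. \<bar>x\<bar> powr \<beta>" 0 "\<lambda>t. \<bar>t\<bar> powr \<beta> + 1"
  by (rule confining_powr_0[OF \<beta>])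

text \<open>Equidistant points up to the turning point \<Lambda>^(1/\<beta>). By homogeneity the
  potential at the i-th point is \<Lambda> times a number independent of \<Lambda>, so one value of
  n serves all \<Lambda>.\<close>

definition "grid i = real i * (\<Lambda> powr (1 / \<beta>)) / real n" for i :: nat

text \<open>The local wave number, the square root of \<Lambda> minus the potential at the i-th grid
  point.\<close>

definition "wave i = sqrt \<Lambda> * sqrt (1 - (real i / real n) powr \<beta>)" for i :: nat

lemma grid_0: "grid 0 = 0" by (simp add: grid_def)

lemma grid_nonneg: "0 \<le> grid i" by (simp add: grid_def)

lemma grid_Suc: "grid (Suc i) - grid i = \<Lambda> powr (1 / \<beta>) / real n"
  by (simp add: grid_def algebra_simps add_divide_distrib)

lemma grid_mono: "grid i \<le> grid (Suc i)"
  using grid_Suc[of i] by (metis diff_ge_0_iff_ge divide_nonneg_nonneg of_nat_0_le_iff powr_ge_zero)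

lemma grid_n: "grid n = \<Lambda> powr (1 / \<beta>)" using n by (simp add: grid_def)

lemma wave_square: "i \<le> n \<Longrightarrow> (wave i)\<^sup>2 = \<Lambda> - (grid i) powr \<beta>"
  and wave_nonneg: "i \<le> n \<Longrightarrow> 0 \<le> wave i"
proof -
  assume i: "i \<le> n"
  have "(real i / real n) powr \<beta> \<le> 1 powr \<beta>" using i \<beta> n by (intro powr_mono2) auto
  then have le: "(real i / real n) powr \<beta> \<le> 1" by simp
  then show "(wave i)\<^sup>2 = \<Lambda> - (grid i) powr \<beta>"
    using \<Lambda> unfolding grid_def powr_grid[OF \<beta> \<Lambda> n] by (simp add: wave_def power_mult_distrib algebra_simps)
  show "0 \<le> wave i" using le \<Lambda> by (simp add: wave_def)
qed

text \<open>The potential increases with |x|, so on each piece the wave number at the inner end is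
  an upper bound.\<close>

lemma npts_grid:
  assumes "j \<le> n"
  shows "npts \<Lambda> 0 (grid j) (\<Sum>i<j. wave i * (\<Lambda> powr (1 / \<beta>) / real n) / pi + 2)"
    and "npts \<Lambda> (- grid j) 0 (\<Sum>i<j. wave i * (\<Lambda> powr (1 / \<beta>) / real n) / pi + 2)"
  using assms
proof (induction j)
  case 0
  { case 1 show ?case using npts_refl[of \<Lambda> 0] by (simp add: grid_0) }
  { case 2 show ?case using npts_refl[of \<Lambda> 0] by (simp add: grid_0) }
next
  case (Suc j)
  have q: "\<Lambda> - (wave j)\<^sup>2 \<le> \<bar>x\<bar> powr \<beta>" if "j \<le> n" "grid j \<le> \<bar>x\<bar>" for x
    unfolding wave_square[OF that(1)] using that(2) grid_nonneg[of j] \<beta> by (simp add: powr_mono2)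
  { case 1
    have "npts \<Lambda> (grid j) (grid (Suc j)) (wave j * (grid (Suc j) - grid j) / pi + 2)"
      by (rule npts_interval[OF grid_mono wave_nonneg q]) (use 1 grid_nonneg[of j] in auto)
    from npts_add[OF Suc.IH(1) this grid_nonneg grid_mono] show ?case
      using 1 by (simp add: grid_Suc) }
  { case 2
    have "npts \<Lambda> (- grid (Suc j)) (- grid j) (wave j * (- grid j - - grid (Suc j)) / pi + 2)"
      by (rule npts_interval[OF _ wave_nonneg q]) (use 2 grid_nonneg[of j] grid_mono[of j] in auto)
    then have "npts \<Lambda> (- grid (Suc j)) (- grid j) (wave j * (grid (Suc j) - grid j) / pi + 2)" by simp
    from npts_add[OF this Suc.IH(2)] show ?case
      using 2 grid_nonneg[of j] grid_mono[of j] by (simp add: grid_Suc add.commute) }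
qed

text \<open>The counterpart with the wave number at the outer end of each piece, which is a lower
  bound.\<close>

lemma ncells_grid:
  assumes "j \<le> n"
  shows "ncells \<Lambda> 0 (grid j) (\<Sum>i<j. wave (Suc i) * (\<Lambda> powr (1 / \<beta>) / real n) / pi - 1)"
    and "ncells \<Lambda> (- grid j) 0 (\<Sum>i<j. wave (Suc i) * (\<Lambda> powr (1 / \<beta>) / real n) / pi - 1)"
  using assms
proof (induction j)
  case 0
  { case 1 show ?case using ncells_refl[of \<Lambda> 0] by (simp add: grid_0) }
  { case 2 show ?case using ncells_refl[of \<Lambda> 0] by (simp add: grid_0) }
next
  case (Suc j)
  have q: "\<bar>x\<bar> powr \<beta> + (wave (Suc j))\<^sup>2 \<le> \<Lambda>" if "Suc j \<le> n" "\<bar>x\<bar> \<le> grid (Suc j)" for x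
    unfolding wave_square[OF that(1)] using that(2) \<beta> by (simp add: powr_mono2)
  { case 1
    have "ncells \<Lambda> (grid j) (grid (Suc j)) (wave (Suc j) * (grid (Suc j) - grid j) / pi - 1)"
      by (rule ncells_interval[OF grid_mono wave_nonneg q]) (use 1 grid_nonneg[of j] in auto)
    from ncells_add[OF Suc.IH(1) this grid_nonneg grid_mono] show ?case
      using 1 by (simp add: grid_Suc) }
  { case 2
    have "ncells \<Lambda> (- grid (Suc j)) (- grid j) (wave (Suc j) * (- grid j - - grid (Suc j)) / pi - 1)"
      by (rule ncells_interval[OF _ wave_nonneg q]) (use 2 grid_nonneg[of j] grid_mono[of j] in auto)
    then have "ncells \<Lambda> (- grid (Suc j)) (- grid j) (wave (Suc j) * (grid (Suc j) - grid j) / pi - 1)" by simp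
    from ncells_add[OF this Suc.IH(2)] show ?case
      using 2 grid_nonneg[of j] grid_mono[of j] by (simp add: grid_Suc add.commute) }
qed

lemma sqrt_powr_mult: "sqrt \<Lambda> * \<Lambda> powr (1 / \<beta>) = \<Lambda> powr (1 / 2 + 1 / \<beta>)"
  using \<Lambda> by (simp add: powr_add powr_half_sqrt)

lemma wave_sum: "(\<Sum>i<n. wave i * (\<Lambda> powr (1 / \<beta>) / real n) / pi) = \<Lambda> powr (1 / 2 + 1 / \<beta>) * riemann_sum \<beta> n / pi"
proof -
  have "(\<Sum>i<n. wave i * (\<Lambda> powr (1 / \<beta>) / real n) / pi) =
     (\<Sum>i<n. (sqrt \<Lambda> * \<Lambda> powr (1 / \<beta>)) / pi * (sqrt (1 - (real i / real n) powr \<beta>) / real n))"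
    by (intro sum.cong) (auto simp: wave_def mult_ac)
  then show ?thesis unfolding sqrt_powr_mult riemann_sum_def by (simp add: sum_distrib_left[symmetric] sum_divide_distrib[symmetric])
qed

text \<open>Rounding costs 2 on each of the 2n pieces, whence \<open>4 * real n\<close>; beyond the
  turning point the potential is at least \<Lambda>.\<close>

theorem weyl_upper: "real (card (eigvals \<inter> {..<\<Lambda>})) \<le> 2 / pi * \<Lambda> powr (1 / 2 + 1 / \<beta>) * riemann_sum \<beta> n + 4 * real n"
proof -
  have "npts \<Lambda> (- grid n) (grid n) ((\<Sum>i<n. wave i * (\<Lambda> powr (1 / \<beta>) / real n) / pi + 2) + (\<Sum>i<n. wave i * (\<Lambda> powr (1 / \<beta>) / real n) / pi + 2))"
    by (rule npts_add[OF npts_grid(2) npts_grid(1)]) (use grid_nonneg in auto)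
  moreover have "\<Lambda> \<le> \<bar>x\<bar> powr \<beta>" if "grid n \<le> \<bar>x\<bar>" for x
  proof -
    have "(\<Lambda> powr (1 / \<beta>)) powr \<beta> \<le> \<bar>x\<bar> powr \<beta>" using that unfolding grid_n using \<beta> by (intro powr_mono2) auto
    then show ?thesis using \<beta> \<Lambda> by (simp add: powr_powr)
  qed
  ultimately have "real (card (eigvals \<inter> {..<\<Lambda>})) \<le> (\<Sum>i<n. wave i * (\<Lambda> powr (1 / \<beta>) / real n) / pi + 2) + (\<Sum>i<n. wave i * (\<Lambda> powr (1 / \<beta>) / real n) / pi + 2)"
    by (intro card_eigvals_le_npts[OF _ grid_nonneg])
  then show ?thesis unfolding sum.distrib wave_sum by (simp add: mult_ac)
qed

theorem weyl_lower: "2 / pi * \<Lambda> powr (1 / 2 + 1 / \<beta>) * (riemann_sum \<beta> n - 1 / real n) - 2 * real n \<le> real (card (eigvals \<inter> {..\<Lambda>}))"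
proof -
  \<comment> \<open>Reindexing from outer to inner ends of the pieces; the boundary term comes from
    the wave number at 0, since the one at the turning point is 0. It is the source of
    \<open>1 / real n\<close>.\<close>
  have sh: "(\<Sum>i<j. g (Suc i)) = (\<Sum>i<j. g i) + g j - g 0" for g :: "nat \<Rightarrow> real" and j
    by (induction j) auto
  have w0: "wave 0 = sqrt \<Lambda>" "wave n = 0" using n by (simp_all add: wave_def)
  have "(\<Sum>i<n. wave (Suc i) * (\<Lambda> powr (1 / \<beta>) / real n) / pi) =
     \<Lambda> powr (1 / 2 + 1 / \<beta>) * riemann_sum \<beta> n / pi - (sqrt \<Lambda> * \<Lambda> powr (1 / \<beta>)) / real n / pi"
    unfolding sh[of "\<lambda>i. wave i * (\<Lambda> powr (1 / \<beta>) / real n) / pi"] wave_sum w0 by simp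
  then have s: "(\<Sum>i<n. wave (Suc i) * (\<Lambda> powr (1 / \<beta>) / real n) / pi) = \<Lambda> powr (1 / 2 + 1 / \<beta>) * (riemann_sum \<beta> n - 1 / real n) / pi"
    unfolding sqrt_powr_mult by (simp add: right_diff_distrib diff_divide_distrib)
  have "ncells \<Lambda> (- grid n) (grid n) ((\<Sum>i<n. wave (Suc i) * (\<Lambda> powr (1 / \<beta>) / real n) / pi - 1) + (\<Sum>i<n. wave (Suc i) * (\<Lambda> powr (1 / \<beta>) / real n) / pi - 1))"
    by (rule ncells_add[OF ncells_grid(2) ncells_grid(1)]) (use grid_nonneg in auto)
  from card_eigvals_ge_ncells[OF this] show ?thesis unfolding sum_subtractf s by (simp add: mult_ac)
qed

end

section \<open>Local mass of eigenfunctions\<close>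

lemma Re_of_real_mult: "Re (complex_of_real r * z) = r * Re z"
  by simp

lemma ac_on_norm_square:
  fixes f :: "real \<Rightarrow> complex"
  assumes "ac_on a b f f'"
  shows "ac_on a b (\<lambda>x. (norm (f x))\<^sup>2) (\<lambda>x. 2 * Re (f' x * cnj (f x)))"
proof -
  from ac_on_Re[OF ac_on_mult[OF assms ac_on_cnj[OF assms]]]
  show ?thesis
  proof (rule ac_on_cong)
    fix x
    have "f x * cnj (f x) = of_real ((norm (f x))\<^sup>2)" by (simp only: complex_norm_square)
    then show "Re (f x * cnj (f x)) = (norm (f x))\<^sup>2" by (simp only: Re_complex_of_real)
  qed (simp add: algebra_simps)
qed

text \<open>In the allowed region the energy
  \<open>\<bar>u'\<bar>\<^sup>2 + (\<Lambda> - V) \<bar>u\<bar>\<^sup>2\<close> decreases, whereas its quotient by \<open>\<Lambda> - V\<close> increases; so the mass of \<open>u\<close> is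
  spread over an interval whose length is comparable to the turning point \<open>\<Lambda>\<^sup>1\<^sup>/\<^sup>\<beta>\<close>.\<close>

lemma eigenfunction_spread:
  fixes \<beta> \<Lambda> R :: real and u :: "real \<Rightarrow> complex"
  assumes \<beta>: "0 < \<beta>" and R: "1 \<le> R" and \<Lambda>: "128 \<le> \<Lambda>" "2 * (4 * R) powr \<beta> \<le> \<Lambda>"
    and u: "has_ac_derivative u u'" "has_ac_derivative u' (\<lambda>x. complex_of_real (w x - \<Lambda>) * u x)"
    and w: "\<And>x. R \<le> x \<Longrightarrow> w x = x powr \<beta>" and uL: "u \<in> L2"
  shows "(norm (u R))\<^sup>2 + (norm (u' R))\<^sup>2 / \<Lambda> \<le> 8 * (\<Lambda> / 2) powr (- 1 / \<beta>) * sqnorm u"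
proof -
  \<comment> \<open>The point where the potential reaches \<Lambda>/2: on [R, Y] the difference
    \<Lambda> - V stays between \<Lambda>/2 and \<Lambda>, and \<open>Y\<close> is a fixed fraction
    of the turning point.\<close>
  define Y where "Y = (\<Lambda> / 2) powr (1 / \<beta>)"
  have Yb: "Y powr \<beta> = \<Lambda> / 2" using \<beta> \<Lambda> by (simp add: Y_def powr_powr)
  have RY: "4 * R \<le> Y"
  proof -
    have "((4 * R) powr \<beta>) powr (1 / \<beta>) \<le> (\<Lambda> / 2) powr (1 / \<beta>)" using \<Lambda> \<beta> by (intro powr_mono2) auto
    then show ?thesis using \<beta> R by (simp add: powr_powr Y_def)
  qed
  have Y1: "1 \<le> Y" "R \<le> Y" using RY R by auto
  define V where "V x = x powr \<beta>" for x :: real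
  define V' where "V' x = \<beta> * x powr (\<beta> - 1)" for x :: real
  have V: "0 \<le> V x" "V x \<le> \<Lambda> / 2" if "x \<in> {R..Y}" for x
  proof -
    have "V x \<le> Y powr \<beta>" unfolding V_def using that R \<beta> by (intro powr_mono2) auto
    then show "V x \<le> \<Lambda> / 2" using Yb by simp
  qed (simp add: V_def)
  have V'0: "0 \<le> V' x" for x using \<beta> by (simp add: V'_def)
  have dV: "(V has_real_derivative V' x) (at x)" if "x \<in> {R..Y}" for x
    unfolding V_def V'_def using that R by (auto intro!: derivative_eq_intros)
  have cV: "continuous_on {R..Y} V" "continuous_on {R..Y} V'"
    unfolding V_def V'_def using R by (auto intro!: continuous_intros)
  have acL: "ac_on R Y (\<lambda>x. \<Lambda> - V x) (\<lambda>x. - V' x)"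
  proof (rule ac_on_C1)
    fix x assume "x \<in> {R..Y}"
    from dV[OF this] have "((\<lambda>x. \<Lambda> - V x) has_real_derivative - V' x) (at x)" by (auto intro!: derivative_eq_intros)
    then show "((\<lambda>x. \<Lambda> - V x) has_vector_derivative - V' x) (at x within {R..Y})"
      using has_real_derivative_iff_has_vector_derivative has_vector_derivative_at_within by metis
  qed (intro continuous_intros cV)
  have acI: "ac_on R Y (\<lambda>x. inverse (\<Lambda> - V x)) (\<lambda>x. V' x * (inverse (\<Lambda> - V x))\<^sup>2)"
  proof (rule ac_on_C1)
    fix x assume x: "x \<in> {R..Y}"
    have ne: "\<Lambda> - V x \<noteq> 0" using V(2)[OF x] \<Lambda> by auto
    from dV[OF x] ne have "((\<lambda>x. inverse (\<Lambda> - V x)) has_real_derivative V' x * (inverse (\<Lambda> - V x))\<^sup>2) (at x)"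
      by (auto intro!: derivative_eq_intros simp: power2_eq_square)
    then show "((\<lambda>x. inverse (\<Lambda> - V x)) has_vector_derivative V' x * (inverse (\<Lambda> - V x))\<^sup>2) (at x within {R..Y})"
      using has_real_derivative_iff_has_vector_derivative has_vector_derivative_at_within by metis
  next
    have "\<Lambda> - V x \<noteq> 0" if "x \<in> {R..Y}" for x using V(2)[OF that] \<Lambda> by auto
    then show "continuous_on {R..Y} (\<lambda>x. V' x * (inverse (\<Lambda> - V x))\<^sup>2)" by (intro continuous_intros cV) auto
  qed
  define \<Phi> where "\<Phi> x = Re (u' x * cnj (u x))" for x
  define E where "E x = (norm (u' x))\<^sup>2 + (\<Lambda> - V x) * (norm (u x))\<^sup>2" for x
  have ac1: "ac_on R Y (\<lambda>x. (norm (u x))\<^sup>2) (\<lambda>x. 2 * \<Phi> x)"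
    unfolding \<Phi>_def by (rule ac_on_norm_square[OF has_ac_derivativeD[OF u(1)]])
  have ac2: "ac_on R Y (\<lambda>x. (norm (u' x))\<^sup>2) (\<lambda>x. - 2 * (\<Lambda> - V x) * \<Phi> x)"
  proof (rule ac_on_cong[OF ac_on_norm_square[OF has_ac_derivativeD[OF u(2)]]])
    fix x assume "x \<in> {R..Y}"
    then have "w x = V x" using w[of x] by (simp add: V_def)
    then have "Re (complex_of_real (w x - \<Lambda>) * u x * cnj (u' x)) = (V x - \<Lambda>) * Re (u x * cnj (u' x))"
      by (simp only: mult.assoc Re_of_real_mult)
    also have "Re (u x * cnj (u' x)) = \<Phi> x" by (simp add: \<Phi>_def algebra_simps)
    finally show "2 * Re (complex_of_real (w x - \<Lambda>) * u x * cnj (u' x)) = - 2 * (\<Lambda> - V x) * \<Phi> x"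
      by (simp add: algebra_simps)
  qed simp
  have acE: "ac_on R Y E (\<lambda>x. - V' x * (norm (u x))\<^sup>2)"
    using ac_on_add[OF ac2 ac_on_mult[OF acL ac1]] unfolding E_def[abs_def] by (rule ac_on_cong) (auto simp: algebra_simps)
  define G where "G x = inverse (\<Lambda> - V x) * E x" for x
  have acG: "ac_on R Y G (\<lambda>x. V' x * (inverse (\<Lambda> - V x))\<^sup>2 * (norm (u' x))\<^sup>2)"
    using ac_on_mult[OF acI acE] unfolding G_def[abs_def]
  proof (rule ac_on_cong)
    fix x assume x: "x \<in> {R..Y}"
    have ne: "\<Lambda> - V x \<noteq> 0" using V(2)[OF x] \<Lambda> by auto
    define i where "i = inverse (\<Lambda> - V x)"
    have i: "i * (\<Lambda> - V x) = 1" using ne by (simp add: i_def)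
    have "V' x * i\<^sup>2 * E x + i * (- V' x * (norm (u x))\<^sup>2) = V' x * i\<^sup>2 * (norm (u' x))\<^sup>2 + V' x * i * (norm (u x))\<^sup>2 * (i * (\<Lambda> - V x) - 1)"
      by (simp add: E_def power2_eq_square algebra_simps)
    then show "V' x * (inverse (\<Lambda> - V x))\<^sup>2 * E x + inverse (\<Lambda> - V x) * (- V' x * (norm (u x))\<^sup>2) = V' x * (inverse (\<Lambda> - V x))\<^sup>2 * (norm (u' x))\<^sup>2"
      using i by (simp add: i_def)
  qed simp
  have E0: "0 \<le> E x" if "x \<in> {R..Y}" for x using V[OF that] \<Lambda> by (auto simp: E_def)
  have EG: "E x = (\<Lambda> - V x) * G x" if "x \<in> {R..Y}" for x using V(2)[OF that] \<Lambda> by (simp add: G_def)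
  have G0: "0 \<le> G x" if "x \<in> {R..Y}" for x using E0[OF that] V(2)[OF that] \<Lambda> by (simp add: G_def)
  have Rin: "R \<in> {R..Y}" "Y \<in> {R..Y}" using Y1 by auto
  have Gm: "G R \<le> G x" if "x \<in> {R..Y}" for x
    by (rule ac_on_mono[OF ac_on_subinterval[OF acG]]) (use that V'0 in auto)
  have Em: "E x \<le> E R" if "x \<in> {R..Y}" for x
  proof -
    have "- E R \<le> - E x"
      by (rule ac_on_mono[OF ac_on_subinterval[OF ac_on_minus[OF acE]]]) (use that V'0 in auto)
    then show ?thesis by simp
  qed
  have ER: "E R \<le> \<Lambda> * G R" unfolding EG[OF Rin(1)] using G0[OF Rin(1)] V(1)[OF Rin(1)] by (intro mult_right_mono) auto
  \<comment> \<open>From \<Lambda> \<ge> 128 follows \<Lambda> - V \<ge> 64, so 16|u'||u| \<le> E.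
    The factor Y \<ge> 1 is inserted to give this boundary term the scale of the main term, into
    which it is absorbed.\<close>
  have \<Phi>E: "\<bar>\<Phi> x\<bar> \<le> \<Lambda> * Y / 16 * G R" if x: "x \<in> {R..Y}" for x
  proof -
    have "\<bar>\<Phi> x\<bar> \<le> norm (u' x) * norm (u x)" using abs_Re_le_cmod[of "u' x * cnj (u x)"] by (simp add: \<Phi>_def norm_mult)
    moreover have "8 * (2 * (norm (u' x) * norm (u x))) \<le> E x"
    proof -
      have "0 \<le> (norm (u' x) - 8 * norm (u x))\<^sup>2" by simp
      also have "\<dots> = (norm (u' x))\<^sup>2 + 64 * (norm (u x))\<^sup>2 - 8 * (2 * (norm (u' x) * norm (u x)))"
        by (simp add: power2_eq_square algebra_simps)
      also have "64 * (norm (u x))\<^sup>2 \<le> (\<Lambda> - V x) * (norm (u x))\<^sup>2" using V(2)[OF x] \<Lambda> by (intro mult_right_mono) auto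
      finally show ?thesis unfolding E_def by simp
    qed
    moreover have "E x \<le> \<Lambda> * G R" using Em[OF x] ER by simp
    ultimately have "\<bar>\<Phi> x\<bar> \<le> \<Lambda> * G R / 16" by linarith
    also have "\<dots> \<le> \<Lambda> * G R / 16 * Y"
      using mult_left_mono[OF Y1(1), of "\<Lambda> * G R / 16"] G0[OF Rin(1)] \<Lambda> by simp
    finally show ?thesis by (simp add: mult_ac)
  qed
  have iu: "set_integrable lborel {R..Y} (\<lambda>x. (norm (u x))\<^sup>2)"
    unfolding set_integrable_def by (intro borel_integrable_compact continuous_intros continuous_on_subset[OF has_ac_derivative_continuous[OF u(1)]]) auto
  have ac\<Phi>: "ac_on R Y \<Phi> (\<lambda>x. (norm (u' x))\<^sup>2 - (\<Lambda> - V x) * (norm (u x))\<^sup>2)"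
    using ac_on_Re[OF ac_on_mult[OF has_ac_derivativeD[OF u(2)] ac_on_cnj[OF has_ac_derivativeD[OF u(1)]]]]
    unfolding \<Phi>_def[abs_def]
  proof (rule ac_on_cong)
    fix x assume "x \<in> {R..Y}"
    then have wV: "w x = V x" using w[of x] by (simp add: V_def)
    have eq: "complex_of_real (w x - \<Lambda>) * u x * cnj (u x) + u' x * cnj (u' x) =
       complex_of_real (w x - \<Lambda>) * of_real ((norm (u x))\<^sup>2) + of_real ((norm (u' x))\<^sup>2)"
      by (simp only: mult.assoc complex_norm_square)
    show "Re (complex_of_real (w x - \<Lambda>) * u x * cnj (u x) + u' x * cnj (u' x)) =
       (norm (u' x))\<^sup>2 - (\<Lambda> - V x) * (norm (u x))\<^sup>2"
      unfolding eq unfolding wV plus_complex.simps(1) Re_of_real_mult Re_complex_of_real by (simp add: algebra_simps)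
  qed simp
  have cE: "continuous_on {R..Y} E" by (rule ac_on_continuous[OF acE])
  have iE: "set_integrable lborel {R..Y} E"
    unfolding set_integrable_def by (intro borel_integrable_compact cE) auto
  let ?I = "LINT x:{R..Y}|lborel. (norm (u x))\<^sup>2"
  have iLu: "set_integrable lborel {R..Y} (\<lambda>x. 2 * \<Lambda> * (norm (u x))\<^sup>2 + ((norm (u' x))\<^sup>2 - (\<Lambda> - V x) * (norm (u x))\<^sup>2))"
    using iu ac_on_integrable[OF ac\<Phi>] by (intro set_integral_add(1)) auto
  have "(Y - R) * (\<Lambda> / 2 * G R) = (LINT x:{R..Y}|lborel. \<Lambda> / 2 * G R)"
    using Y1 by (simp add: set_lebesgue_integral_def)
  also have "\<dots> \<le> (LINT x:{R..Y}|lborel. 2 * \<Lambda> * (norm (u x))\<^sup>2 + ((norm (u' x))\<^sup>2 - (\<Lambda> - V x) * (norm (u x))\<^sup>2))"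
  proof (rule set_integral_mono[OF _ iLu])
    show "set_integrable lborel {R..Y} (\<lambda>x. \<Lambda> / 2 * G R)"
      unfolding set_integrable_def by (intro borel_integrable_compact) auto
    fix x assume x: "x \<in> {R..Y}"
    have "\<Lambda> / 2 * G R \<le> (\<Lambda> - V x) * G x"
      using V(2)[OF x] Gm[OF x] G0[OF Rin(1)] \<Lambda> by (intro mult_mono) auto
    also have "\<dots> = (norm (u' x))\<^sup>2 + (\<Lambda> - V x) * (norm (u x))\<^sup>2" using EG[OF x] by (simp add: E_def)
    \<comment> \<open>Virial identity: E = 2(\<Lambda> - V)|u|^2 + \<Phi>', which trades the kinetic
      part of the energy for mass and boundary terms.\<close>
    also have "\<dots> \<le> 2 * \<Lambda> * (norm (u x))\<^sup>2 + ((norm (u' x))\<^sup>2 - (\<Lambda> - V x) * (norm (u x))\<^sup>2)"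
    proof -
      have "0 \<le> V x * (norm (u x))\<^sup>2" using V(1)[OF x] by simp
      then show ?thesis by (simp add: algebra_simps)
    qed
    finally show "\<Lambda> / 2 * G R \<le> 2 * \<Lambda> * (norm (u x))\<^sup>2 + ((norm (u' x))\<^sup>2 - (\<Lambda> - V x) * (norm (u x))\<^sup>2)" .
  qed
  also have "\<dots> = 2 * \<Lambda> * ?I + (\<Phi> Y - \<Phi> R)"
    using iu ac_on_integrable[OF ac\<Phi>] ac_on_integral[OF ac\<Phi> Y1(2)] by (subst set_integral_add(2)) auto
  also have "\<dots> \<le> 2 * \<Lambda> * ?I + 2 * (\<Lambda> * Y / 16 * G R)" using \<Phi>E[OF Rin(1)] \<Phi>E[OF Rin(2)] by linarith
  finally have main: "(Y - R) * (\<Lambda> / 2 * G R) \<le> 2 * \<Lambda> * ?I + 2 * (\<Lambda> * Y / 16 * G R)" .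
  \<comment> \<open>R \<le> Y/4 gives 3/8 \<Lambda> Y G(R) on the left; moving the boundary term 1/8
    \<Lambda> Y G(R) over leaves 1/4, whence the constant 8.\<close>
  have "3 / 4 * Y * (\<Lambda> / 2 * G R) \<le> (Y - R) * (\<Lambda> / 2 * G R)"
    using RY G0[OF Rin(1)] \<Lambda> by (intro mult_right_mono) auto
  with main have "\<Lambda> * (Y * G R) \<le> \<Lambda> * (8 * ?I)" by (simp add: algebra_simps)
  then have YG: "Y * G R \<le> 8 * ?I" using \<Lambda> by simp
  have "?I \<le> sqnorm u"
    unfolding set_lebesgue_integral_def sqnorm_def
    by (intro integral_mono L2_integrable_square[OF uL] integrable_mult_indicator) (auto simp: indicator_def)
  with YG have YG': "Y * G R \<le> 8 * sqnorm u" by linarith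
  have "(norm (u R))\<^sup>2 + (norm (u' R))\<^sup>2 / \<Lambda> \<le> G R"
  proof -
    have "(norm (u' R))\<^sup>2 / \<Lambda> \<le> (norm (u' R))\<^sup>2 / (\<Lambda> - V R)"
      using V[OF Rin(1)] \<Lambda> by (intro divide_left_mono mult_pos_pos) auto
    moreover have "G R = (norm (u R))\<^sup>2 + (norm (u' R))\<^sup>2 / (\<Lambda> - V R)"
      using V[OF Rin(1)] \<Lambda> by (simp add: G_def E_def field_simps)
    ultimately show ?thesis by simp
  qed
  also have "G R \<le> 8 * sqnorm u / Y" using YG' Y1 by (simp add: pos_le_divide_eq mult.commute)
  also have "8 * sqnorm u / Y = 8 * (\<Lambda> / 2) powr (- 1 / \<beta>) * sqnorm u"
    by (simp add: Y_def powr_minus_divide)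
  finally show ?thesis .
qed

text \<open>On the support of \<open>q\<close> the energy \<open>\<bar>u'\<bar>\<^sup>2 + \<Lambda> \<bar>u\<bar>\<^sup>2\<close> varies by a bounded factor (Gronwall).\<close>

lemma eigenfunction_local_mass:
  fixes \<beta> \<Lambda> R K :: real and u :: "real \<Rightarrow> complex"
  assumes \<beta>: "0 < \<beta>" and R: "1 \<le> R" and \<Lambda>: "128 \<le> \<Lambda>" "2 * (4 * R) powr \<beta> \<le> \<Lambda>"
    and u: "has_ac_derivative u u'" "has_ac_derivative u' (\<lambda>x. complex_of_real (w x - \<Lambda>) * u x)"
    and w: "\<And>x. R \<le> x \<Longrightarrow> w x = x powr \<beta>" "\<And>x. x \<in> {-R..R} \<Longrightarrow> \<bar>w x\<bar> \<le> K" and uL: "u \<in> L2"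
  shows "(LINT x:{-R..R}|lborel. (norm (u x))\<^sup>2) \<le> 16 * R * exp (2 * K * R) * (\<Lambda> / 2) powr (- 1 / \<beta>) * sqnorm u"
proof -
  have K: "0 \<le> K" using w(2)[of 0] R by auto
  define \<Phi> where "\<Phi> x = Re (u' x * cnj (u x))" for x
  define e where "e x = (norm (u' x))\<^sup>2 + \<Lambda> * (norm (u x))\<^sup>2" for x
  have ac1: "ac_on (-R) R (\<lambda>x. (norm (u x))\<^sup>2) (\<lambda>x. 2 * \<Phi> x)"
    unfolding \<Phi>_def by (rule ac_on_norm_square[OF has_ac_derivativeD[OF u(1)]])
  have ac2: "ac_on (-R) R (\<lambda>x. (norm (u' x))\<^sup>2) (\<lambda>x. 2 * (w x - \<Lambda>) * \<Phi> x)"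
  proof (rule ac_on_cong[OF ac_on_norm_square[OF has_ac_derivativeD[OF u(2)]]])
    fix x
    have "Re (complex_of_real (w x - \<Lambda>) * u x * cnj (u' x)) = (w x - \<Lambda>) * Re (u x * cnj (u' x))"
      by (simp only: mult.assoc Re_of_real_mult)
    also have "Re (u x * cnj (u' x)) = \<Phi> x" by (simp add: \<Phi>_def algebra_simps)
    finally show "2 * Re (complex_of_real (w x - \<Lambda>) * u x * cnj (u' x)) = 2 * (w x - \<Lambda>) * \<Phi> x" by simp
  qed simp
  have ace: "ac_on (-R) R e (\<lambda>x. 2 * w x * \<Phi> x)"
    using ac_on_add[OF ac2 ac_on_cmult[OF ac1, of \<Lambda>]] unfolding e_def[abs_def] by (rule ac_on_cong) (auto simp: algebra_simps)
  \<comment> \<open>Gronwall by an integrating factor: since 2|\<Phi>| \<le> e, the derivative of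
    \<open>e\<close> is at least -K e, so \<open>e x * exp (K * x)\<close> increases and is
    controlled by its value at \<open>R\<close>.\<close>
  have acx: "ac_on (-R) R (\<lambda>x. exp (K * x)) (\<lambda>x. K * exp (K * x))"
    by (rule ac_on_C1) (auto intro!: derivative_eq_intros continuous_intros simp: has_real_derivative_iff_has_vector_derivative[symmetric])
  have ac: "ac_on (-R) R (\<lambda>x. e x * exp (K * x)) (\<lambda>x. 2 * w x * \<Phi> x * exp (K * x) + e x * (K * exp (K * x)))"
    by (rule ac_on_mult[OF ace acx])
  have e_le: "e x \<le> e R * exp (2 * K * R)" if x: "x \<in> {-R..R}" for x
  proof -
    have "e x * exp (K * x) \<le> e R * exp (K * R)"
    proof (rule ac_on_mono[OF ac_on_subinterval[OF ac]])
      fix y assume y: "y \<in> {x..R}"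
      have "2 * \<bar>\<Phi> y\<bar> \<le> e y"
      proof -
        have "\<bar>\<Phi> y\<bar> \<le> norm (u' y) * norm (u y)" using abs_Re_le_cmod[of "u' y * cnj (u y)"] by (simp add: \<Phi>_def norm_mult)
        moreover have "2 * (norm (u' y) * norm (u y)) \<le> (norm (u' y))\<^sup>2 + 1 * (norm (u y))\<^sup>2"
          using sum_squares_bound[of "norm (u' y)" "norm (u y)"] by simp
        moreover have "1 * (norm (u y))\<^sup>2 \<le> \<Lambda> * (norm (u y))\<^sup>2" using \<Lambda> by (intro mult_right_mono) auto
        ultimately show ?thesis unfolding e_def by linarith
      qed
      then have "\<bar>w y\<bar> * (2 * \<bar>\<Phi> y\<bar>) \<le> K * e y" using w(2)[of y] y x K by (intro mult_mono) auto
      moreover have "\<bar>2 * w y * \<Phi> y\<bar> = \<bar>w y\<bar> * (2 * \<bar>\<Phi> y\<bar>)" by (simp add: abs_mult)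
      ultimately have "0 \<le> 2 * w y * \<Phi> y + K * e y" using abs_ge_minus_self[of "2 * w y * \<Phi> y"] by linarith
      then have "0 \<le> (2 * w y * \<Phi> y + K * e y) * exp (K * y)" by (intro mult_nonneg_nonneg) auto
      then show "0 \<le> 2 * w y * \<Phi> y * exp (K * y) + e y * (K * exp (K * y))" by (simp add: algebra_simps)
    qed (use x in auto)
    then have "e x \<le> e R * exp (K * R) * exp (- (K * x))"
      by (simp add: exp_minus field_simps)
    also have "\<dots> = e R * exp (K * (R - x))" by (simp add: exp_add[symmetric] mult.assoc algebra_simps)
    also have "\<dots> \<le> e R * exp (2 * K * R)"
    proof -
      have "K * (R - x) \<le> K * (2 * R)" using x K by (intro mult_left_mono) auto
      moreover have "0 \<le> e R" using \<Lambda> by (simp add: e_def)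
      ultimately show ?thesis by (intro mult_left_mono) auto
    qed
    finally show ?thesis .
  qed
  \<comment> \<open>Dividing the energy at \<open>R\<close> by \<Lambda> gives exactly the
    combination of |u|^2 and |u'|^2 / \<Lambda> that \<open>eigenfunction_spread\<close>
    bounds.\<close>
  let ?c = "e R * exp (2 * K * R) / \<Lambda>"
  have "(LINT x:{-R..R}|lborel. (norm (u x))\<^sup>2) \<le> (LINT x:{-R..R}|lborel. ?c)"
  proof (rule set_integral_mono)
    show "set_integrable lborel {-R..R} (\<lambda>x. (norm (u x))\<^sup>2)"
      unfolding set_integrable_def by (intro borel_integrable_compact continuous_intros continuous_on_subset[OF has_ac_derivative_continuous[OF u(1)]]) auto
    show "set_integrable lborel {-R..R} (\<lambda>x. ?c)"
      unfolding set_integrable_def by (intro borel_integrable_compact) auto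
    fix x assume "x \<in> {-R..R}"
    from e_le[OF this] have "\<Lambda> * (norm (u x))\<^sup>2 \<le> e R * exp (2 * K * R)"
      using zero_le_power2[of "norm (u' x)"] unfolding e_def[of x] by linarith
    then show "(norm (u x))\<^sup>2 \<le> ?c" using \<Lambda> by (simp add: pos_le_divide_eq mult.commute)
  qed
  also have "\<dots> = 2 * R * ?c" using R by (simp add: set_lebesgue_integral_def)
  also have "\<dots> = 2 * R * exp (2 * K * R) * ((norm (u R))\<^sup>2 + (norm (u' R))\<^sup>2 / \<Lambda>)"
    using \<Lambda> by (simp add: e_def field_simps)
  also have "\<dots> \<le> 2 * R * exp (2 * K * R) * (8 * (\<Lambda> / 2) powr (- 1 / \<beta>) * sqnorm u)"
    using eigenfunction_spread[OF \<beta> R \<Lambda> u w(1) uL] R by (intro mult_left_mono) auto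
  finally show ?thesis by (simp add: mult_ac)
qed

section \<open>Perturbation by a compactly supported potential\<close>

lemma hoelder_on_continuous:
  assumes \<gamma>: "0 < \<gamma>" and h: "hoelder_on \<gamma> I q"
  shows "continuous_on I q"
proof -
  obtain C where C: "\<And>x y. x \<in> I \<Longrightarrow> y \<in> I \<Longrightarrow> \<bar>q x - q y\<bar> \<le> C * \<bar>x - y\<bar> powr \<gamma>"
    using h unfolding hoelder_on_def by blast
  show ?thesis
  proof (rule continuous_onI)
    fix x e :: real assume x: "x \<in> I" and e: "0 < e"
    \<comment> \<open>Solves (|C| + 1) d^\<gamma> = e; the 1 is added because the Hoelder constant
      \<open>C\<close> may be 0 or negative.\<close>
    define d where "d = (e / (\<bar>C\<bar> + 1)) powr (1 / \<gamma>)"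
    have p: "0 < e / (\<bar>C\<bar> + 1)" using e by simp
    have "dist (q y) (q x) \<le> e" if y: "y \<in> I" "dist y x < d" for y
    proof -
      have "\<bar>y - x\<bar> powr \<gamma> \<le> d powr \<gamma>" using y \<gamma> by (intro powr_mono2) (auto simp: dist_real_def)
      also have "d powr \<gamma> = e / (\<bar>C\<bar> + 1)" using \<gamma> p e by (simp add: d_def powr_powr)
      finally have "(\<bar>C\<bar> + 1) * \<bar>y - x\<bar> powr \<gamma> \<le> e" by (simp add: pos_le_divide_eq mult.commute)
      moreover have "\<bar>q y - q x\<bar> \<le> (\<bar>C\<bar> + 1) * \<bar>y - x\<bar> powr \<gamma>"
        by (rule order_trans[OF C[OF y(1) x]], rule mult_right_mono) auto
      ultimately show ?thesis by (simp add: dist_real_def)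
    qed
    moreover have "0 < d" unfolding d_def powr_gt_zero using p by (rule less_imp_neq[THEN not_sym])
    ultimately show "\<exists>d>0. \<forall>x'\<in>I. dist x' x < d \<longrightarrow> dist (q x') (q x) \<le> e" by blast
  qed
qed

lemma hoelder_on_bounded:
  assumes \<gamma>: "0 < \<gamma>" and h: "hoelder_on \<gamma> I q" and I: "bounded I"
  shows "bounded (q ` I)"
proof (cases "I = {}")
  case False
  then obtain z where z: "z \<in> I" by blast
  obtain C where C: "\<And>x y. x \<in> I \<Longrightarrow> y \<in> I \<Longrightarrow> \<bar>q x - q y\<bar> \<le> C * \<bar>x - y\<bar> powr \<gamma>"
    using h unfolding hoelder_on_def by blast
  obtain b where b: "\<And>x. x \<in> I \<Longrightarrow> \<bar>x\<bar> \<le> b" using I by (auto simp: bounded_iff)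
  have "\<bar>q x\<bar> \<le> \<bar>q z\<bar> + \<bar>C\<bar> * (2 * b) powr \<gamma>" if x: "x \<in> I" for x
  proof -
    have "\<bar>x - z\<bar> \<le> 2 * b" using b[OF x] b[OF z] by linarith
    then have "\<bar>x - z\<bar> powr \<gamma> \<le> (2 * b) powr \<gamma>" using \<gamma> by (intro powr_mono2) auto
    then have "\<bar>C\<bar> * \<bar>x - z\<bar> powr \<gamma> \<le> \<bar>C\<bar> * (2 * b) powr \<gamma>" by (intro mult_left_mono) auto
    moreover have "C * \<bar>x - z\<bar> powr \<gamma> \<le> \<bar>C\<bar> * \<bar>x - z\<bar> powr \<gamma>" by (intro mult_right_mono) auto
    ultimately show ?thesis using C[OF x z] by linarith
  qed
  then show ?thesis by (auto simp: bounded_iff)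
qed simp

lemma zero_outside_supp: "x \<notin> supp q \<Longrightarrow> q x = 0"
  using subsetD[OF closure_subset, of x "{x. q x \<noteq> 0}"] unfolding supp_def by auto

lemma piecewise_hoelder_bounded:
  assumes "compact (supp q)" "piecewise_hoelder q"
  shows "bounded (range q)"
proof -
  obtain P where P: "finite P" "partition_on (supp q) P" "\<And>I. I \<in> P \<Longrightarrow> \<exists>\<gamma>>0. hoelder_on \<gamma> I q"
    using assms(2) unfolding piecewise_hoelder_def by blast
  have U: "\<Union>P = supp q" using P(2) by (simp add: partition_on_def)
  have "bounded (q ` I)" if I: "I \<in> P" for I
  proof -
    have "bounded I" using U I compact_imp_bounded[OF assms(1)] bounded_subset by blast
    then show ?thesis using P(3)[OF I] hoelder_on_bounded by blast
  qed
  then have "bounded (\<Union>I\<in>P. q ` I)" using P(1) by (intro bounded_UN) auto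
  then have "bounded (insert 0 (\<Union>I\<in>P. q ` I))" by simp
  moreover have "range q \<subseteq> insert 0 (\<Union>I\<in>P. q ` I)"
  proof (rule image_subsetI)
    fix x
    show "q x \<in> insert 0 (\<Union>I\<in>P. q ` I)"
      using U zero_outside_supp[of x q] by (cases "x \<in> supp q") auto
  qed
  ultimately show ?thesis by (rule bounded_subset)
qed

text \<open>The pieces are intervals, hence Borel sets, and \<open>q\<close> is the finite sum of
  its continuous restrictions to them.\<close>

lemma piecewise_hoelder_measurable:
  assumes "piecewise_hoelder q"
  shows "q \<in> borel_measurable borel"
proof -
  obtain P where P: "finite P" "partition_on (supp q) P" "\<And>I. I \<in> P \<Longrightarrow> is_interval I \<and> (\<exists>\<gamma>>0. hoelder_on \<gamma> I q)"
    using assms unfolding piecewise_hoelder_def by blast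
  have U: "\<Union>P = supp q" and D: "disjoint P" using P(2) by (simp_all add: partition_on_def)
  have "(\<lambda>x. indicator I x *\<^sub>R q x) \<in> borel_measurable borel" if I: "I \<in> P" for I
  proof -
    have "I \<in> sets borel" using P(3)[OF I] by (simp add: real_interval_borel_measurable)
    then show ?thesis
      using P(3)[OF I] hoelder_on_continuous by (intro borel_measurable_continuous_on_indicator) auto
  qed
  then have "(\<lambda>x. \<Sum>I\<in>P. indicator I x *\<^sub>R q x) \<in> borel_measurable borel" by (intro borel_measurable_sum) auto
  moreover have "(\<Sum>I\<in>P. indicator I x *\<^sub>R q x) = q x" for x
  proof (cases "x \<in> supp q")
    case True
    then obtain I where I: "I \<in> P" "x \<in> I" using U by blast
    then have "x \<notin> J" if "J \<in> P - {I}" for J using D that unfolding disjoint_def by blast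
    then have "(\<Sum>J\<in>P - {I}. indicator J x *\<^sub>R q x) = 0" by (intro sum.neutral) auto
    then show ?thesis using sum.remove[OF P(1) I(1), of "\<lambda>J. indicator J x *\<^sub>R q x"] I(2) by simp
  next
    case False
    then show ?thesis by (simp add: zero_outside_supp)
  qed
  ultimately show ?thesis by simp
qed

lemma filterlim_powr_at_top:
  fixes x :: "nat \<Rightarrow> real"
  assumes "filterlim x at_top sequentially" "0 < p"
  shows "filterlim (\<lambda>k. x k powr p) at_top sequentially"
  unfolding filterlim_at_top
proof
  fix Z :: real
  have "\<forall>\<^sub>F k in sequentially. (max Z 1) powr (1 / p) \<le> x k" using assms(1) unfolding filterlim_at_top by blast
  then show "\<forall>\<^sub>F k in sequentially. Z \<le> x k powr p"
  proof eventually_elim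
    case (elim k)
    then have "((max Z 1) powr (1 / p)) powr p \<le> x k powr p" using assms(2) by (intro powr_mono2) auto
    then show ?case using assms(2) by (simp add: powr_powr)
  qed
qed

lemma filterlim_real_powr_at_top: "0 < p \<Longrightarrow> filterlim (\<lambda>k. real k powr p) at_top sequentially"
  by (rule filterlim_powr_at_top[OF filterlim_real_sequentially])

section \<open>Spectrum as a discrete sequence of simple eigenvalues\<close>

text \<open>Isolation comes from the finiteness of the eigenvalues below any bound. A strictly
  increasing enumeration repeats nothing, which agrees with all eigenvalues being simple.\<close>

lemma confining_discrete_spectrum:
  assumes "confining Q M m"
  shows "has_discrete_spectrum (schroedinger Q)"
    and "strict_mono_on {1..} e \<Longrightarrow> e ` {1..} = confining.eigvals Q \<Longrightarrow> enumerates_spectrum (schroedinger Q) e"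
proof -
  interpret confining Q M m by fact
  have S: "L2_spectrum T = complex_of_real ` eigvals" unfolding L2_spectrum_eq using ev_iff_eigvals by auto
  show "has_discrete_spectrum T"
    unfolding has_discrete_spectrum_def
  proof (intro ballI conjI)
    fix z assume z: "z \<in> L2_spectrum T"
    then show "\<exists>n>0. has_multiplicity T z n" using ev_multiplicity[of z] by (auto simp: L2_spectrum_eq intro!: exI[of _ 1])
    define F where "F = complex_of_real ` (eigvals \<inter> {..Re z + 1}) - {z}"
    have "finite F" unfolding F_def using finite_eigvals by simp
    then have op: "open (ball z 1 - F)" by (intro open_Diff finite_imp_closed) auto
    have "x \<le> Re z + 1" if "complex_of_real x \<in> ball z 1" for x
      using that abs_Re_le_cmod[of "z - complex_of_real x"] by (simp add: dist_norm)
    then have "(ball z 1 - F) \<inter> L2_spectrum T = {z}" using z unfolding S F_def by auto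
    with z op show "z isolated_in L2_spectrum T" unfolding isolated_in_def by blast
  qed
  assume e: "strict_mono_on {1..} e" "e ` {1..} = eigvals"
  have inj: "inj_on e {1..}" by (rule strict_mono_on_imp_inj_on[OF e(1)])
  show "enumerates_spectrum T e"
    unfolding enumerates_spectrum_def
  proof (intro conjI allI impI)
    show "L2_spectrum T = (\<lambda>k. complex_of_real (e k)) ` {1..}"
      unfolding S e(2)[symmetric] by (simp add: image_image)
    fix k :: nat assume k: "1 \<le> k"
    then have s: "{j \<in> {1..}. e j = e k} = {k}" using inj by (auto dest: inj_onD)
    show "finite {j \<in> {1..}. e j = e k}" unfolding s by simp
    have "e k \<in> eigvals" using e(2) k by auto
    then show "has_multiplicity T (complex_of_real (e k)) (card {j \<in> {1..}. e j = e k})"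
      unfolding s using ev_multiplicity by (simp add: eigvals_def)
  qed
qed

section \<open>Weyl's law along the family of couplings\<close>

locale power_family =
  fixes \<beta> B R :: real and q :: "real \<Rightarrow> real"
  assumes \<beta>: "0 < \<beta>" and R: "1 \<le> R" and q_measurable: "q \<in> borel_measurable borel"
    and q_le: "\<bar>q x\<bar> \<le> B" and q_outside: "R \<le> \<bar>x\<bar> \<Longrightarrow> q x = 0"
begin

abbreviation "pot \<alpha> \<equiv> (\<lambda>x. \<bar>x\<bar> powr \<beta> + \<alpha> * q x)"
abbreviation "eigvals_of \<alpha> \<equiv> confining.eigvals (pot \<alpha>)"
abbreviation "eigen \<alpha> x u u' \<equiv> confining.dsol (pot \<alpha>) u u' (\<lambda>t. complex_of_real x * u t)"

lemma B_nonneg: "0 \<le> B" using q_le[of 0] by linarith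

lemma conf: "confining (pot \<alpha>) (\<bar>\<alpha>\<bar> * B) (\<lambda>t. \<bar>t\<bar> powr \<beta> + \<bar>\<alpha>\<bar> * B + 1)"
  by (rule confining_powr[OF \<beta> q_measurable q_le])

lemma pot_0: "pot 0 = (\<lambda>x. \<bar>x\<bar> powr \<beta>)" by simp

lemma card_eigvals_of_compare: "card (eigvals_of \<alpha> \<inter> {..x}) \<le> card (eigvals_of \<alpha>' \<inter> {..x + B * \<bar>\<alpha>' - \<alpha>\<bar>})"
proof (rule card_eigvals_compare[OF conf conf])
  fix x
  have "pot \<alpha>' x - pot \<alpha> x = (\<alpha>' - \<alpha>) * q x" by (simp add: algebra_simps)
  then show "\<bar>pot \<alpha>' x - pot \<alpha> x\<bar> \<le> B * \<bar>\<alpha>' - \<alpha>\<bar>"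
    using mult_left_mono[OF q_le[of x], of "\<bar>\<alpha>' - \<alpha>\<bar>"] by (simp add: abs_mult mult.commute)
qed

lemma riemann_sum_2: "riemann_sum \<beta> 2 - 1 / real 2 = sqrt (1 - (1 / 2) powr \<beta>) / 2"
  using \<beta> by (simp add: riemann_sum_def lessThan_nat_numeral lessThan_Suc numeral_2_eq_2 add_divide_distrib)

text \<open>The grid with n = 2 is the coarsest whose right Riemann sum is positive; for n = 1 it is
  0. It serves wherever some positive Weyl lower bound is enough.\<close>

lemma riemann_sum_2_pos: "0 < riemann_sum \<beta> 2 - 1 / real 2"
proof -
  have "(1 / 2) powr \<beta> < 1 powr \<beta>" using \<beta> by (intro powr_less_mono2) auto
  then show ?thesis unfolding riemann_sum_2 by simp
qed

text \<open>Weyl's lower bound at \<alpha> = 0 produces arbitrarily many eigenvalues, and the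
  comparison of counts carries them over to every coupling.\<close>

lemma infinite_eigvals_of: "infinite (eigvals_of \<alpha>)"
proof
  assume fin: "finite (eigvals_of \<alpha>)"
  define p where "p = 1 / 2 + 1 / \<beta>"
  have p: "0 < p" using \<beta> by (simp add: p_def add_pos_pos)
  define c where "c = 2 / pi * (riemann_sum \<beta> 2 - 1 / real 2)"
  have c: "0 < c" using riemann_sum_2_pos by (simp add: c_def)
  define N where "N = real (card (eigvals_of \<alpha>))"
  \<comment> \<open>Chosen such that the leading Weyl term equals N + 5; as rounding loses 4, at
    least N + 1 eigenvalues result.\<close>
  define \<Lambda> where "\<Lambda> = ((N + 5) / c) powr (1 / p)"
  have \<Lambda>: "0 < \<Lambda>" using c by (simp add: \<Lambda>_def N_def)
  have "\<Lambda> powr p = (N + 5) / c" using p c by (simp add: \<Lambda>_def powr_powr N_def)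
  then have "N + 5 = c * \<Lambda> powr p" using c by simp
  also have "\<dots> = 2 / pi * \<Lambda> powr (1 / 2 + 1 / \<beta>) * (riemann_sum \<beta> 2 - 1 / real 2)"
    by (simp only: c_def p_def mult_ac)
  also have "\<dots> \<le> real (card (eigvals_of 0 \<inter> {..\<Lambda>})) + 4"
    using weyl_lower[OF \<beta> \<Lambda>, of 2] unfolding pot_0 by linarith
  also have "real (card (eigvals_of 0 \<inter> {..\<Lambda>})) \<le> real (card (eigvals_of \<alpha> \<inter> {..\<Lambda> + B * \<bar>\<alpha> - 0\<bar>}))"
    using card_eigvals_of_compare[of 0 \<Lambda> \<alpha>] by (simp only: of_nat_le_iff)
  also have "\<dots> \<le> N" unfolding N_def using fin by (simp add: card_mono)
  finally show False by simp
qed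

context
  fixes e :: "real \<Rightarrow> nat \<Rightarrow> real"
  assumes e_mono: "\<And>\<alpha>. strict_mono_on {1..} (e \<alpha>)" and e_range: "\<And>\<alpha>. e \<alpha> ` {1..} = eigvals_of \<alpha>"
begin

text \<open>The crude O(1) bound. It gives (i) for all couplings and the continuity of eigenvalues
  that the refined estimate starts from.\<close>

lemma e_compare:
  assumes k: "1 \<le> k"
  shows "\<bar>e \<alpha> k - e \<alpha>' k\<bar> \<le> B * \<bar>\<alpha> - \<alpha>'\<bar>"
proof -
  have "e \<alpha> k \<le> e \<alpha>' k + B * \<bar>\<alpha> - \<alpha>'\<bar>" for \<alpha> \<alpha>'
  proof (rule enumeration_le[OF e_mono e_range k])
    show "k \<le> card (eigvals_of \<alpha> \<inter> {..e \<alpha>' k + B * \<bar>\<alpha> - \<alpha>'\<bar>})"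
      using card_eigvals_of_compare[of \<alpha>' "e \<alpha>' k" \<alpha>] enumeration_card(1)[OF e_mono e_range k, of \<alpha>'] by simp
  qed
  from this[of \<alpha> \<alpha>'] this[of \<alpha>' \<alpha>] show ?thesis by (simp add: abs_le_iff abs_minus_commute)
qed

lemma e_at_top: "filterlim (e 0) at_top sequentially"
  unfolding filterlim_at_top
proof
  fix Z :: real
  have fin: "finite (eigvals_of 0 \<inter> {..Z})" by (rule confining.finite_eigvals[OF conf])
  show "\<forall>\<^sub>F k in sequentially. Z \<le> e 0 k"
    using eventually_gt_at_top[of "card (eigvals_of 0 \<inter> {..Z})"]
  proof eventually_elim
    case (elim k)
    then have k: "1 \<le> k" by simp
    show ?case
    proof (rule ccontr)
      assume "\<not> Z \<le> e 0 k"
      then have "card (eigvals_of 0 \<inter> {..e 0 k}) \<le> card (eigvals_of 0 \<inter> {..Z})" using fin by (intro card_mono) auto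
      then show False using enumeration_card(1)[OF e_mono e_range k, of 0] elim by simp
    qed
  qed
qed

text \<open>The Weyl exponent: 1/2 from the wave number and 1/\<beta> from the length of the allowed
  region.\<close>

definition "p = 1 / 2 + 1 / \<beta>"

lemma p_pos: "0 < p" using \<beta> by (simp add: p_def add_pos_pos)

text \<open>With y = 2/pi times the p-th power of the eigenvalue, the rounding errors 2n and 4n + 1
  are at most y/n as soon as y \<ge> 5n^2.\<close>

lemma e_ratio_bounds:
  assumes n: "0 < n"
  shows "\<forall>\<^sub>F k in sequentially. riemann_sum \<beta> n - 2 / real n \<le> real k / (2 / pi * e 0 k powr p) \<and>
     real k / (2 / pi * e 0 k powr p) \<le> riemann_sum \<beta> n + 1 / real n"
proof -
  have "filterlim (\<lambda>k. 2 / pi * e 0 k powr p) at_top sequentially"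
    by (rule filterlim_tendsto_pos_mult_at_top[OF tendsto_const _ filterlim_powr_at_top[OF e_at_top p_pos]]) simp
  then have "\<forall>\<^sub>F k in sequentially. 5 * real n * real n \<le> 2 / pi * e 0 k powr p"
    unfolding filterlim_at_top by blast
  moreover have "\<forall>\<^sub>F k in sequentially. 1 \<le> e 0 k" using e_at_top unfolding filterlim_at_top by blast
  ultimately show ?thesis
    using eventually_ge_at_top[of 1]
  proof eventually_elim
    case (elim k)
    define y where "y = 2 / pi * e 0 k powr p"
    define r where "r = riemann_sum \<beta> n"
    define N where "N = real n"
    have N: "1 \<le> N" using n by (simp add: N_def)
    have y: "5 * N * N \<le> y" using elim(1) by (simp add: y_def N_def)
    have "1 * 1 \<le> N * N" using N by (intro mult_mono) auto
    then have y0: "0 < y" using y by linarith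
    have e0: "0 < e 0 k" using elim by simp
    have u: "real k - 1 \<le> y * r + 4 * N"
      using weyl_upper[OF \<beta> e0 n] enumeration_card(2)[OF e_mono e_range elim(3), of 0] elim(3)
      by (simp add: y_def r_def N_def p_def pot_0)
    have l: "y * (r - 1 / N) - 2 * N \<le> real k"
      using weyl_lower[OF \<beta> e0 n] enumeration_card(1)[OF e_mono e_range elim(3), of 0]
      by (simp add: y_def r_def N_def p_def pot_0)
    have yN: "5 * N \<le> y * (1 / N)" using y N by (simp add: pos_le_divide_eq)
    have "y * (r - 2 / N) = y * (r - 1 / N) - y * (1 / N)" by (simp add: algebra_simps)
    then have "y * (r - 2 / N) \<le> real k" using l yN N by linarith
    moreover have "y * (r + 1 / N) = y * r + y * (1 / N)" by (rule distrib_left)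
    then have "real k \<le> y * (r + 1 / N)" using u yN N by linarith
    ultimately show ?case
      using y0 unfolding y_def[symmetric] r_def[symmetric] N_def[symmetric]
      by (simp add: pos_le_divide_eq pos_divide_le_eq mult.commute)
  qed
qed

text \<open>Each n confines the ratio eventually to a window of width 3/n. This makes it a Cauchy
  sequence without identifying the limit of the Riemann sums; positivity of the limit comes from n =
  2.\<close>

lemma e_weyl: obtains \<kappa> where "0 < \<kappa>" "(\<lambda>k. real k / e 0 k powr p) \<longlonglongrightarrow> \<kappa>"
proof -
  define r where "r k = real k / (2 / pi * e 0 k powr p)" for k
  have "Cauchy r"
  proof (rule metric_CauchyI)
    fix \<epsilon> :: real assume \<epsilon>: "0 < \<epsilon>"
    obtain n :: nat where n: "3 / \<epsilon> < real n" using reals_Archimedean2 by blast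
    have n0: "0 < n" using n \<epsilon> by (metis divide_pos_pos gr0I less_asym of_nat_0 zero_less_numeral)
    have n3: "3 / real n < \<epsilon>" using n \<epsilon> n0 by (simp add: field_simps)
    obtain N where N: "\<And>k. N \<le> k \<Longrightarrow> riemann_sum \<beta> n - 2 / real n \<le> r k \<and> r k \<le> riemann_sum \<beta> n + 1 / real n"
      using e_ratio_bounds[OF n0] unfolding eventually_sequentially r_def by blast
    show "\<exists>M. \<forall>m\<ge>M. \<forall>k\<ge>M. dist (r m) (r k) < \<epsilon>"
    proof (intro exI[of _ N] allI impI)
      fix m k assume "N \<le> m" "N \<le> k"
      then have "\<bar>r m - r k\<bar> \<le> 1 / real n + 2 / real n" using N[of m] N[of k] by linarith
      also have "\<dots> < \<epsilon>" using n3 by (simp add: add_divide_distrib[symmetric])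
      finally show "dist (r m) (r k) < \<epsilon>" by (simp add: dist_real_def)
    qed
  qed
  then obtain L where L: "r \<longlonglongrightarrow> L" using Cauchy_convergent_iff convergentD by blast
  have "0 < L"
  proof -
    define c where "c = riemann_sum \<beta> 2 - 1 / real 2"
    have c: "0 < c" using riemann_sum_2_pos by (simp add: c_def)
    have "filterlim (\<lambda>k. 2 / pi * e 0 k powr p) at_top sequentially"
      by (rule filterlim_tendsto_pos_mult_at_top[OF tendsto_const _ filterlim_powr_at_top[OF e_at_top p_pos]]) simp
    then have "\<forall>\<^sub>F k in sequentially. 8 / c \<le> 2 / pi * e 0 k powr p" unfolding filterlim_at_top by blast
    moreover have "\<forall>\<^sub>F k in sequentially. 1 \<le> e 0 k" using e_at_top unfolding filterlim_at_top by blast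
    ultimately have "\<forall>\<^sub>F k in sequentially. c / 2 \<le> r k"
      using eventually_ge_at_top[of 1]
    proof eventually_elim
      case (elim k)
      define y where "y = 2 / pi * e 0 k powr p"
      have y: "8 / c \<le> y" using elim(1) by (simp add: y_def)
      then have y0: "0 < y" using c by (metis divide_pos_pos less_le_trans zero_less_numeral)
      have e0: "0 < e 0 k" using elim by simp
      have "y * c - 4 \<le> real k"
        using weyl_lower[OF \<beta> e0, of 2] enumeration_card(1)[OF e_mono e_range elim(3), of 0]
        by (simp add: y_def c_def p_def pot_0)
      moreover have "8 \<le> y * c" using y c by (simp add: pos_divide_le_eq)
      \<comment> \<open>For y \<ge> 8/c the rounding loss 4 is at most half of the main
        term.\<close>
      ultimately have "c / 2 * y \<le> real k" by (simp add: mult.commute)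
      then show ?case using y0 unfolding r_def y_def[symmetric] by (simp add: pos_le_divide_eq)
    qed
    then have "c / 2 \<le> L" by (intro tendsto_lowerbound[OF L]) auto
    then show ?thesis using c by simp
  qed
  moreover have "(\<lambda>k. 2 / pi * r k) \<longlonglongrightarrow> 2 / pi * L" by (intro tendsto_intros L)
  moreover have "(\<lambda>k. 2 / pi * r k) = (\<lambda>k. real k / e 0 k powr p)" by (simp add: r_def fun_eq_iff)
  ultimately show thesis using that[of "2 / pi * L"] by simp
qed

definition "\<tau> = 1 / p"

lemma \<tau>_pos: "0 < \<tau>" using p_pos by (simp add: \<tau>_def)

text \<open>Inverting Weyl's law gives \<alpha> = 0; for other couplings the eigenvalues differ by a
  bounded amount, which is negligible against k^\<tau>. Hence \<open>c\<close> is the same for all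
  \<alpha>.\<close>

lemma e_asymptotics: obtains c where "0 < c" "\<And>\<alpha>. (\<lambda>k. e \<alpha> k / real k powr \<tau>) \<longlonglongrightarrow> c"
proof -
  obtain \<kappa> where \<kappa>: "0 < \<kappa>" "(\<lambda>k. real k / e 0 k powr p) \<longlonglongrightarrow> \<kappa>" by (rule e_weyl)
  have "(\<lambda>k. (real k / e 0 k powr p) powr (- \<tau>)) \<longlonglongrightarrow> \<kappa> powr (- \<tau>)"
    by (intro tendsto_powr \<kappa> tendsto_const) (use \<kappa> in auto)
  moreover have "\<forall>\<^sub>F k in sequentially. 1 \<le> e 0 k" using e_at_top unfolding filterlim_at_top by blast
  then have "\<forall>\<^sub>F k in sequentially. (real k / e 0 k powr p) powr (- \<tau>) = e 0 k / real k powr \<tau>"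
    using eventually_ge_at_top[of 1]
  proof eventually_elim
    case (elim k)
    have "(e 0 k powr p) powr \<tau> = e 0 k" using elim p_pos by (simp add: powr_powr \<tau>_def)
    then show ?case using elim by (simp add: powr_minus powr_divide)
  qed
  ultimately have lim0: "(\<lambda>k. e 0 k / real k powr \<tau>) \<longlonglongrightarrow> \<kappa> powr (- \<tau>)"
    by (rule Lim_transform_eventually)
  have "(\<lambda>k. e \<alpha> k / real k powr \<tau>) \<longlonglongrightarrow> \<kappa> powr (- \<tau>)" for \<alpha>
  proof -
    have "(\<lambda>k. (e \<alpha> k - e 0 k) / real k powr \<tau>) \<longlonglongrightarrow> 0"
    proof (rule Lim_null_comparison)
      show "\<forall>\<^sub>F k in sequentially. norm ((e \<alpha> k - e 0 k) / real k powr \<tau>) \<le> (B * \<bar>\<alpha>\<bar>) / real k powr \<tau>"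
        using eventually_ge_at_top[of 1]
      proof eventually_elim
        case (elim k)
        then show ?case using e_compare[of k \<alpha> 0] by (simp add: divide_right_mono)
      qed
      show "(\<lambda>k. (B * \<bar>\<alpha>\<bar>) / real k powr \<tau>) \<longlonglongrightarrow> 0"
        by (rule tendsto_divide_0[OF tendsto_const filterlim_at_top_imp_at_infinity[OF filterlim_real_powr_at_top[OF \<tau>_pos]]])
    qed
    from tendsto_add[OF this lim0] show ?thesis by (simp add: add_divide_distrib[symmetric])
  qed
  then show thesis using that[of "\<kappa> powr (- \<tau>)"] \<kappa>(1) by simp
qed

section \<open>Lipschitz dependence on the coupling\<close>

text \<open>\<open>q\<close> vanishes off \<open>{-R..R}\<close>, where |u v| is at most half of
  |u|^2 + |v|^2; so only local masses enter the perturbation term.\<close>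

lemma overlap_bound:
  assumes u: "u \<in> L2" "(LINT x:{-R..R}|lborel. (norm (u x))\<^sup>2) \<le> D" and v: "v \<in> L2" "(LINT x:{-R..R}|lborel. (norm (v x))\<^sup>2) \<le> D"
  shows "norm (L2_inner (\<lambda>x. complex_of_real (q x) * u x) v) \<le> B * D"
proof -
  have i: "set_integrable lborel {-R..R} (\<lambda>x. (norm (w x))\<^sup>2)" if "w \<in> L2" for w
    unfolding set_integrable_def by (intro integrable_mult_indicator L2_integrable_square that) auto
  have qu: "(\<lambda>x. complex_of_real (q x) * u x) \<in> L2"
    by (rule L2_mult_bounded[OF u(1), where B = B]) (use q_measurable q_le in auto)
  have "norm (L2_inner (\<lambda>x. complex_of_real (q x) * u x) v) \<le> (\<integral>x. norm ((complex_of_real (q x) * u x) * cnj (v x)) \<partial>lborel)"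
    unfolding L2_inner_def by (rule integral_norm_bound)
  also have "\<dots> \<le> (\<integral>x. indicator {-R..R} x *\<^sub>R (B / 2 * ((norm (u x))\<^sup>2 + (norm (v x))\<^sup>2)) \<partial>lborel)"
  proof (rule integral_mono)
    show "integrable lborel (\<lambda>x. norm ((complex_of_real (q x) * u x) * cnj (v x)))"
      by (intro integrable_norm L2_inner_integrable qu v)
    show "integrable lborel (\<lambda>x. indicator {-R..R} x *\<^sub>R (B / 2 * ((norm (u x))\<^sup>2 + (norm (v x))\<^sup>2)))"
      by (intro integrable_mult_indicator integrable_mult_right Bochner_Integration.integrable_add L2_integrable_square u v) auto
    fix x
    show "norm ((complex_of_real (q x) * u x) * cnj (v x)) \<le> indicator {-R..R} x *\<^sub>R (B / 2 * ((norm (u x))\<^sup>2 + (norm (v x))\<^sup>2))"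
    proof (cases "x \<in> {-R..R}")
      case True
      have "2 * (norm (u x) * norm (v x)) \<le> (norm (u x))\<^sup>2 + (norm (v x))\<^sup>2"
        using sum_squares_bound[of "norm (u x)" "norm (v x)"] by simp
      then have "\<bar>q x\<bar> * (2 * (norm (u x) * norm (v x))) \<le> B * ((norm (u x))\<^sup>2 + (norm (v x))\<^sup>2)"
        using q_le[of x] B_nonneg by (intro mult_mono) auto
      then show ?thesis using True by (simp add: norm_mult mult_ac)
    next
      case False
      then have "q x = 0" by (intro q_outside) auto
      then show ?thesis using False by simp
    qed
  qed
  also have "\<dots> = B / 2 * ((LINT x:{-R..R}|lborel. (norm (u x))\<^sup>2) + (LINT x:{-R..R}|lborel. (norm (v x))\<^sup>2))"
    using set_integral_add(2)[OF i[OF u(1)] i[OF v(1)]] 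
      set_integral_mult_right[of lborel "{-R..R}" "B / 2" "\<lambda>x. (norm (u x))\<^sup>2 + (norm (v x))\<^sup>2"]
    unfolding set_lebesgue_integral_def by simp
  also have "\<dots> \<le> B / 2 * (D + D)" using u(2) v(2) B_nonneg by (intro mult_left_mono add_mono) auto
  finally show ?thesis by simp
qed

text \<open>\<open>(\<lambda>\<^sub>k(\<alpha>) - \<lambda>\<^sub>k(\<alpha>\<^sub>0)) \<langle>\<psi>\<^sub>\<alpha>, \<psi>\<rangle> = (\<alpha> - \<alpha>\<^sub>0) \<langle>q \<psi>\<^sub>\<alpha>, \<psi>\<rangle>\<close>, where the overlap \<open>\<langle>\<psi>\<^sub>\<alpha>, \<psi>\<rangle>\<close> of the normalised
  eigenfunctions tends to \<open>1\<close> if \<open>\<psi>\<close> is chosen as a limit point of the \<open>\<psi>\<^sub>\<alpha>\<close>.\<close>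

lemma e_locally_lipschitz:
  assumes k: "1 \<le> k" and D: "\<And>\<alpha> u u'. \<bar>\<alpha>\<bar> \<le> A \<Longrightarrow> eigen \<alpha> (e \<alpha> k) u u' \<Longrightarrow> sqnorm u = 1 \<Longrightarrow> (LINT x:{-R..R}|lborel. (norm (u x))\<^sup>2) \<le> D"
    and \<alpha>0: "\<bar>\<alpha>0\<bar> \<le> A"
  shows "\<exists>\<delta>>0. \<forall>\<alpha>. \<bar>\<alpha>\<bar> \<le> A \<longrightarrow> \<bar>\<alpha> - \<alpha>0\<bar> < \<delta> \<longrightarrow> \<bar>e \<alpha> k - e \<alpha>0 k\<bar> \<le> 2 * B * D * \<bar>\<alpha> - \<alpha>0\<bar>"
proof (rule ccontr)
  assume "\<not> ?thesis"
  then have "\<exists>\<alpha>. \<bar>\<alpha>\<bar> \<le> A \<and> \<bar>\<alpha> - \<alpha>0\<bar> < 1 / real (Suc n) \<and> 2 * B * D * \<bar>\<alpha> - \<alpha>0\<bar> < \<bar>e \<alpha> k - e \<alpha>0 k\<bar>" for n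
    by (metis not_le of_nat_0_less_iff zero_less_Suc zero_less_divide_1_iff)
  then obtain a where a: "\<And>n. \<bar>a n\<bar> \<le> A" "\<And>n. \<bar>a n - \<alpha>0\<bar> < 1 / real (Suc n)" "\<And>n. 2 * B * D * \<bar>a n - \<alpha>0\<bar> < \<bar>e (a n) k - e \<alpha>0 k\<bar>"
    by metis
  interpret C: confining "pot \<alpha>0" "\<bar>\<alpha>0\<bar> * B" "\<lambda>t. \<bar>t\<bar> powr \<beta> + \<bar>\<alpha>0\<bar> * B + 1" by (rule conf)
  define z where "z = complex_of_real (e \<alpha>0 k)"
  have "\<exists>u u'. eigen (a n) (e (a n) k) u u' \<and> sqnorm u = 1" for n
  proof -
    have "e (a n) k \<in> eigvals_of (a n)" using e_range[of "a n"] k by auto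
    then show ?thesis using confining.eigvals_eigenfunction[OF conf] by metis
  qed
  then obtain u u' where u: "\<And>n. eigen (a n) (e (a n) k) (u n) (u' n)" "\<And>n. sqnorm (u n) = 1" by metis
  have uL: "u n \<in> L2" and us: "has_ac_derivative (u n) (u' n)"
    "has_ac_derivative (u' n) (\<lambda>x. complex_of_real (pot (a n) x) * u n x - complex_of_real (e (a n) k) * u n x)" for n
    using u(1)[of n] by (simp_all add: confining.dsol_def[OF conf] sol_def)
  have qL: "(\<lambda>x. complex_of_real (q x) * u n x) \<in> L2" for n
    by (rule L2_mult_bounded[OF uL, where B = B]) (use q_measurable q_le in auto)
  have qN: "sqnorm (\<lambda>x. complex_of_real (q x) * u n x) \<le> B\<^sup>2" for n
  proof -
    have "sqnorm (\<lambda>x. complex_of_real (q x) * u n x) \<le> (\<integral>x. B\<^sup>2 * (norm (u n x))\<^sup>2 \<partial>lborel)"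
      unfolding sqnorm_def
    proof (intro integral_mono L2_integrable_square qL integrable_mult_right uL)
      fix x
      have "\<bar>q x\<bar>\<^sup>2 \<le> B\<^sup>2" using q_le[of x] by (intro power_mono) auto
      then show "(norm (complex_of_real (q x) * u n x))\<^sup>2 \<le> B\<^sup>2 * (norm (u n x))\<^sup>2"
        by (simp add: norm_mult power_mult_distrib mult_right_mono)
    qed
    also have "\<dots> = B\<^sup>2" using u(2)[of n] by (simp add: sqnorm_def)
    finally show ?thesis .
  qed
  \<comment> \<open>The eigenvalue equation at \<open>a n\<close> rewritten at
    \<open>\<alpha>0\<close>: \<open>g n\<close> is the residual. It tends to 0 since the
    eigenvalues move by at most \<open>B\<close> times the change of coupling.\<close>
  define g where "g n x = complex_of_real (e (a n) k - e \<alpha>0 k) * u n x - complex_of_real (a n - \<alpha>0) * (complex_of_real (q x) * u n x)" for n x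
  have gL: "g n \<in> L2" for n unfolding g_def by (intro L2_diff L2_cmult uL qL)
  have w: "C.dsol (u n) (u' n) (\<lambda>x. g n x + z * u n x)" for n
  proof -
    have "(\<lambda>x. complex_of_real (pot (a n) x) * u n x - complex_of_real (e (a n) k) * u n x) =
      (\<lambda>x. complex_of_real (pot \<alpha>0 x) * u n x - (g n x + z * u n x))"
      by (simp add: g_def z_def fun_eq_iff algebra_simps)
    then show ?thesis using us[of n] uL[of n] gL[of n] by (auto simp: C.dsol_def sol_def)
  qed
  have g0: "(\<lambda>n. sqnorm (\<lambda>x. g n x - 0)) \<longlonglongrightarrow> 0"
  proof (rule tendsto_sandwich[where f = "\<lambda>n. 0"])
    show "\<forall>\<^sub>F n in sequentially. sqnorm (\<lambda>x. g n x - 0) \<le> 4 * B\<^sup>2 * (1 / real (Suc n))\<^sup>2"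
    proof (intro always_eventually allI)
      fix n
      have d: "\<bar>a n - \<alpha>0\<bar>\<^sup>2 \<le> (1 / real (Suc n))\<^sup>2" using a(2)[of n] by (intro power_mono) auto
      have "sqnorm (g n) \<le> 2 * sqnorm (\<lambda>x. complex_of_real (e (a n) k - e \<alpha>0 k) * u n x) + 2 * sqnorm (\<lambda>x. complex_of_real (a n - \<alpha>0) * (complex_of_real (q x) * u n x))"
        unfolding g_def by (intro sqnorm_diff_le L2_cmult uL qL)
      also have "\<dots> = 2 * \<bar>e (a n) k - e \<alpha>0 k\<bar>\<^sup>2 + 2 * (\<bar>a n - \<alpha>0\<bar>\<^sup>2 * sqnorm (\<lambda>x. complex_of_real (q x) * u n x))"
        unfolding sqnorm_cmult u(2) norm_of_real by simp
      also have "\<dots> \<le> 2 * (B * \<bar>a n - \<alpha>0\<bar>)\<^sup>2 + 2 * (\<bar>a n - \<alpha>0\<bar>\<^sup>2 * B\<^sup>2)"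
        using e_compare[OF k, of "a n" \<alpha>0] qN[of n] by (intro add_mono mult_left_mono power_mono) auto
      also have "\<dots> = 4 * B\<^sup>2 * \<bar>a n - \<alpha>0\<bar>\<^sup>2" by (simp add: power_mult_distrib)
      also have "\<dots> \<le> 4 * B\<^sup>2 * (1 / real (Suc n))\<^sup>2" using d by (intro mult_left_mono) auto
      finally show "sqnorm (\<lambda>x. g n x - 0) \<le> 4 * B\<^sup>2 * (1 / real (Suc n))\<^sup>2" by simp
    qed
    have "(\<lambda>n. 1 / real (Suc n)) \<longlonglongrightarrow> 0" using LIMSEQ_inverse_real_of_nat by (simp add: inverse_eq_divide)
    then have "(\<lambda>n. 4 * B\<^sup>2 * (1 / real (Suc n))\<^sup>2) \<longlonglongrightarrow> 4 * B\<^sup>2 * 0\<^sup>2" by (intro tendsto_intros)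
    then show "(\<lambda>n. 4 * B\<^sup>2 * (1 / real (Suc n))\<^sup>2) \<longlonglongrightarrow> 0" by simp
  qed auto
  obtain r v v' where r: "strict_mono (r :: nat \<Rightarrow> nat)" "C.dsol v v' (\<lambda>x. 0 + z * v x)" "(\<lambda>n. sqnorm (\<lambda>x. u (r n) x - v x)) \<longlonglongrightarrow> 0"
    by (rule C.dsol_compactness[OF w _ gL L2_zero g0, of 1]) (simp_all add: u(2))
  have v: "C.dsol v v' (\<lambda>x. z * v x)" using r(2) by simp
  have vL: "v \<in> L2" using v by (simp add: C.dsol_def)
  have lim: "(\<lambda>n. L2_inner (u (r n)) v) \<longlonglongrightarrow> of_real (sqnorm v)"
    using L2_inner_tendsto[OF uL vL vL r(3)] by (simp add: L2_inner_self)
  \<comment> \<open>Norm convergence of unit vectors forces the limit \<open>v\<close> to be a unit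
    vector, so it is a normalised eigenfunction at \<open>\<alpha>0\<close> and subject to the mass
    bound \<open>D\<close>.\<close>
  have "(\<lambda>n. sqnorm (\<lambda>x. u (r n) x - v x)) = (\<lambda>n. 1 - 2 * Re (L2_inner (u (r n)) v) + sqnorm v)"
    using sqnorm_diff_expand[OF uL vL] u(2) by simp
  moreover have "(\<lambda>n. 1 - 2 * Re (L2_inner (u (r n)) v) + sqnorm v) \<longlonglongrightarrow> 1 - 2 * Re (of_real (sqnorm v)) + sqnorm v"
    by (intro tendsto_intros lim)
  ultimately have "1 - 2 * Re (of_real (sqnorm v)) + sqnorm v = 0" using r(3) LIMSEQ_unique by fastforce
  then have v1: "sqnorm v = 1" by simp
  have "(\<lambda>n. norm (L2_inner (u (r n)) v)) \<longlonglongrightarrow> 1" using tendsto_norm[OF lim] v1 by simp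
  then have "\<forall>\<^sub>F n in sequentially. 1 / 2 < norm (L2_inner (u (r n)) v)" by (intro order_tendstoD(1)) auto
  \<comment> \<open>An overlap above 1/2 is enough; dividing by it is the origin of the factor 2 in
    the Lipschitz constant.\<close>
  then obtain n where n: "1 / 2 < norm (L2_inner (u (r n)) v)" by (auto simp: eventually_sequentially)
  let ?a = "a (r n)" and ?u = "u (r n)"
  \<comment> \<open>By symmetry the residual is orthogonal to \<open>v\<close>, which is the
    difference formula for the two eigenvalues.\<close>
  have "L2_inner (\<lambda>x. g (r n) x + z * ?u x) v = L2_inner ?u (\<lambda>x. z * v x)" by (rule C.dsol_symmetric[OF w v])
  then have "L2_inner (g (r n)) v = 0"
    using L2_inner_add_left[OF gL[of "r n"] L2_cmult[OF uL[of "r n"]] vL]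
    by (simp add: L2_inner_cmult_left L2_inner_cmult_right z_def)
  moreover have "L2_inner (g (r n)) v = complex_of_real (e ?a k - e \<alpha>0 k) * L2_inner ?u v - complex_of_real (?a - \<alpha>0) * L2_inner (\<lambda>x. complex_of_real (q x) * ?u x) v"
    unfolding g_def L2_inner_diff_left[OF L2_cmult[OF uL] L2_cmult[OF qL] vL] L2_inner_cmult_left[symmetric] by simp
  ultimately have "norm (complex_of_real (e ?a k - e \<alpha>0 k) * L2_inner ?u v) = norm (complex_of_real (?a - \<alpha>0) * L2_inner (\<lambda>x. complex_of_real (q x) * ?u x) v)"
    by simp
  then have eq: "\<bar>e ?a k - e \<alpha>0 k\<bar> * norm (L2_inner ?u v) = \<bar>?a - \<alpha>0\<bar> * norm (L2_inner (\<lambda>x. complex_of_real (q x) * ?u x) v)"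
    unfolding norm_mult norm_of_real .
  have "norm (L2_inner (\<lambda>x. complex_of_real (q x) * ?u x) v) \<le> B * D"
  proof (rule overlap_bound[OF uL _ vL])
    show "(LINT x:{-R..R}|lborel. (norm (?u x))\<^sup>2) \<le> D" by (rule D[OF a(1) u])
    show "(LINT x:{-R..R}|lborel. (norm (v x))\<^sup>2) \<le> D" using D[OF \<alpha>0 _ v1, of v'] v by (simp add: z_def)
  qed
  then have "\<bar>?a - \<alpha>0\<bar> * norm (L2_inner (\<lambda>x. complex_of_real (q x) * ?u x) v) \<le> \<bar>?a - \<alpha>0\<bar> * (B * D)"
    by (intro mult_left_mono) auto
  moreover have "\<bar>e ?a k - e \<alpha>0 k\<bar> * (1 / 2) \<le> \<bar>e ?a k - e \<alpha>0 k\<bar> * norm (L2_inner ?u v)"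
    using n by (intro mult_left_mono) auto
  ultimately have "\<bar>e ?a k - e \<alpha>0 k\<bar> \<le> 2 * B * D * \<bar>?a - \<alpha>0\<bar>" using eq by (simp add: mult_ac)
  then show False using a(3)[of "r n"] by simp
qed

text \<open>The bisection principle \<open>Bolzano\<close>: the estimate is additive over adjacent
  intervals and holds on all short intervals around each point, with one and the same
  constant.\<close>

lemma e_lipschitz:
  assumes k: "1 \<le> k" and D: "\<And>\<alpha> u u'. \<bar>\<alpha>\<bar> \<le> A \<Longrightarrow> eigen \<alpha> (e \<alpha> k) u u' \<Longrightarrow> sqnorm u = 1 \<Longrightarrow> (LINT x:{-R..R}|lborel. (norm (u x))\<^sup>2) \<le> D"
    and ab: "a \<le> b" "- A \<le> a" "b \<le> A"
  shows "\<bar>e b k - e a k\<bar> \<le> 2 * B * D * (b - a)"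
proof -
  let ?P = "\<lambda>a b. - A \<le> a \<longrightarrow> b \<le> A \<longrightarrow> \<bar>e b k - e a k\<bar> \<le> 2 * B * D * (b - a)"
  have "?P a b"
    using ab(1)
  proof (rule Bolzano)
    fix a b c :: real assume 1: "?P a b" "?P b c" "a \<le> b" "b \<le> c"
    show "?P a c"
    proof (intro impI)
      assume "- A \<le> a" "c \<le> A"
      then have "\<bar>e b k - e a k\<bar> \<le> 2 * B * D * (b - a)" "\<bar>e c k - e b k\<bar> \<le> 2 * B * D * (c - b)" using 1 by auto
      then have "\<bar>e c k - e a k\<bar> \<le> 2 * B * D * (b - a) + 2 * B * D * (c - b)" by linarith
      then show "\<bar>e c k - e a k\<bar> \<le> 2 * B * D * (c - a)" by (simp add: algebra_simps)
    qed
  next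
    fix x assume "a \<le> x" "x \<le> b"
    then have xA: "\<bar>x\<bar> \<le> A" using ab by auto
    have "\<exists>\<delta>>0. \<forall>\<alpha>. \<bar>\<alpha>\<bar> \<le> A \<longrightarrow> \<bar>\<alpha> - x\<bar> < \<delta> \<longrightarrow> \<bar>e \<alpha> k - e x k\<bar> \<le> 2 * B * D * \<bar>\<alpha> - x\<bar>"
      by (rule e_locally_lipschitz[OF k _ xA], rule D)
    then obtain \<delta> where \<delta>: "0 < \<delta>" "\<And>\<alpha>. \<bar>\<alpha>\<bar> \<le> A \<Longrightarrow> \<bar>\<alpha> - x\<bar> < \<delta> \<Longrightarrow> \<bar>e \<alpha> k - e x k\<bar> \<le> 2 * B * D * \<bar>\<alpha> - x\<bar>"
      by blast
    show "\<exists>d>0. \<forall>a b. a \<le> x \<and> x \<le> b \<and> b - a < d \<longrightarrow> ?P a b"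
    proof (intro exI[of _ \<delta>] conjI allI impI \<delta>(1))
      \<comment> \<open>The local estimate compares only with the value at \<open>x\<close>, so the
        interval is split there.\<close>
      fix c d assume *: "c \<le> x \<and> x \<le> d \<and> d - c < \<delta>" "- A \<le> c" "d \<le> A"
      have "\<bar>e c k - e x k\<bar> \<le> 2 * B * D * \<bar>c - x\<bar>" "\<bar>e d k - e x k\<bar> \<le> 2 * B * D * \<bar>d - x\<bar>"
        using * xA by (intro \<delta>(2); linarith)+
      then have "\<bar>e d k - e c k\<bar> \<le> 2 * B * D * \<bar>c - x\<bar> + 2 * B * D * \<bar>d - x\<bar>" by linarith
      also have "\<dots> = 2 * B * D * (d - c)" using * by (simp add: algebra_simps)
      finally show "\<bar>e d k - e c k\<bar> \<le> 2 * B * D * (d - c)" .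
    qed
  qed
  then show ?thesis using ab by blast
qed

text \<open>For large k all eigenvalues \<open>e a k\<close> with |a| \<le> |\<alpha>| are at least
  half of \<open>e 0 k\<close>, so one local mass bound \<open>D\<close>, expressed by
  \<open>e 0 k\<close>, serves the whole path from 0 to \<alpha>.\<close>

lemma e_perturbation:
  obtains C where "\<forall>\<^sub>F k in sequentially. \<bar>e \<alpha> k - e 0 k\<bar> \<le> C * e 0 k powr (- 1 / \<beta>)"
proof -
  define A where "A = \<bar>\<alpha>\<bar>"
  define K where "K = R powr \<beta> + A * B"
  define C0 where "C0 = 16 * R * exp (2 * K * R)"
  have C0: "0 \<le> C0" using R by (simp add: C0_def)
  \<comment> \<open>The first entry makes the O(1) shift at most half of \<open>e 0 k\<close>; the
    second, doubled accordingly, secures both thresholds of \<open>eigenfunction_local_mass\<close>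
    for all couplings involved.\<close>
  define Z where "Z = max (2 * A * B) (2 * max 128 (2 * (4 * R) powr \<beta>))"
  have "\<forall>\<^sub>F k in sequentially. Z \<le> e 0 k" using e_at_top unfolding filterlim_at_top by blast
  then have "\<forall>\<^sub>F k in sequentially. \<bar>e \<alpha> k - e 0 k\<bar> \<le> (2 * B * (C0 * (1 / 4) powr (- 1 / \<beta>)) * A) * e 0 k powr (- 1 / \<beta>)"
    using eventually_ge_at_top[of 1]
  proof eventually_elim
    case (elim k)
    have x: "2 * A * B \<le> e 0 k" "256 \<le> e 0 k" "4 * (4 * R) powr \<beta> \<le> e 0 k" using elim(1) by (auto simp: Z_def)
    define D where "D = C0 * (e 0 k / 4) powr (- 1 / \<beta>)"
    have D: "(LINT x:{-R..R}|lborel. (norm (u x))\<^sup>2) \<le> D" if a: "\<bar>a\<bar> \<le> A" and u: "eigen a (e a k) u u'" and u1: "sqnorm u = 1" for a u u'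
    proof -
      have "B * \<bar>a\<bar> \<le> B * A" using a B_nonneg by (intro mult_left_mono)
      moreover have "2 * (B * A) \<le> e 0 k" using x(1) by (simp add: mult_ac)
      moreover have "\<bar>e a k - e 0 k\<bar> \<le> B * \<bar>a\<bar>" using e_compare[OF elim(2), of a 0] by simp
      ultimately have ea: "e 0 k / 2 \<le> e a k" by linarith
      have L: "128 \<le> e a k" "2 * (4 * R) powr \<beta> \<le> e a k" using ea x by auto
      have us: "has_ac_derivative u u'" "has_ac_derivative u' (\<lambda>x. complex_of_real (pot a x) * u x - complex_of_real (e a k) * u x)" "u \<in> L2"
        using u by (simp_all add: confining.dsol_def[OF conf] sol_def)
      have us2: "has_ac_derivative u' (\<lambda>x. complex_of_real (pot a x - e a k) * u x)"
        using us(2) by (simp only: of_real_diff left_diff_distrib)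
      have "(LINT x:{-R..R}|lborel. (norm (u x))\<^sup>2) \<le> 16 * R * exp (2 * K * R) * (e a k / 2) powr (- 1 / \<beta>) * sqnorm u"
      proof (rule eigenfunction_local_mass[OF \<beta> R L us(1) us2 _ _ us(3)])
        show "pot a x = x powr \<beta>" if "R \<le> x" for x using that R q_outside[of x] by simp
        show "\<bar>pot a x\<bar> \<le> K" if "x \<in> {-R..R}" for x
        proof -
          have "\<bar>x\<bar> powr \<beta> \<le> R powr \<beta>" using that \<beta> by (intro powr_mono2) auto
          moreover have "\<bar>a * q x\<bar> \<le> A * B" unfolding abs_mult using a q_le[of x] by (intro mult_mono) (auto simp: A_def)
          moreover have "\<bar>pot a x\<bar> \<le> \<bar>x\<bar> powr \<beta> + \<bar>a * q x\<bar>" using abs_triangle_ineq[of "\<bar>x\<bar> powr \<beta>" "a * q x"] by simp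
          ultimately show ?thesis unfolding K_def by linarith
        qed
      qed
      also have "\<dots> = C0 * (e a k / 2) powr (- 1 / \<beta>)" by (simp add: C0_def u1)
      also have "\<dots> \<le> D"
        unfolding D_def using ea x \<beta> C0 by (intro mult_left_mono powr_mono2') auto
      finally show ?thesis .
    qed
    have "\<bar>e \<alpha> k - e 0 k\<bar> \<le> 2 * B * D * \<bar>\<alpha>\<bar>"
    proof (cases "0 \<le> \<alpha>")
      case True
      have "\<bar>e \<alpha> k - e 0 k\<bar> \<le> 2 * B * D * (\<alpha> - 0)"
      proof (rule e_lipschitz[OF elim(2), where A = A])
        show "(LINT x:{-R..R}|lborel. (norm (u x))\<^sup>2) \<le> D"
          if "\<bar>a\<bar> \<le> A" "eigen a (e a k) u u'" "sqnorm u = 1" for a u u' using that by (rule D)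
      qed (use True in \<open>auto simp: A_def\<close>)
      then show ?thesis using True by simp
    next
      case False
      have "\<bar>e 0 k - e \<alpha> k\<bar> \<le> 2 * B * D * (0 - \<alpha>)"
      proof (rule e_lipschitz[OF elim(2), where A = A])
        show "(LINT x:{-R..R}|lborel. (norm (u x))\<^sup>2) \<le> D"
          if "\<bar>a\<bar> \<le> A" "eigen a (e a k) u u'" "sqnorm u = 1" for a u u' using that by (rule D)
      qed (use False in \<open>auto simp: A_def\<close>)
      then show ?thesis using False by (simp add: abs_minus_commute)
    qed
    moreover have "D = C0 * (1 / 4) powr (- 1 / \<beta>) * e 0 k powr (- 1 / \<beta>)"
      using powr_mult[of "1 / 4" "e 0 k" "- 1 / \<beta>"] by (simp add: D_def)
    ultimately show ?case by (simp add: A_def mult_ac)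
  qed
  then show thesis by (rule that)
qed

section \<open>Asymptotic statements\<close>

lemma e_small_o: "\<exists>c \<tau>. c > 0 \<and> \<tau> > 0 \<and> (\<forall>\<alpha>. (\<lambda>k. e \<alpha> k - c * real k powr \<tau>) \<in> o(\<lambda>k. real k powr \<tau>))"
proof -
  obtain c where c: "0 < c" "\<And>\<alpha>. (\<lambda>k. e \<alpha> k / real k powr \<tau>) \<longlonglongrightarrow> c" using e_asymptotics by blast
  have "(\<lambda>k. e \<alpha> k - c * real k powr \<tau>) \<in> o(\<lambda>k. real k powr \<tau>)" for \<alpha>
  proof (rule smalloI_tendsto)
    show nz: "\<forall>\<^sub>F k in sequentially. real k powr \<tau> \<noteq> 0" using eventually_gt_at_top[of 0] by eventually_elim simp
    have "(\<lambda>k. e \<alpha> k / real k powr \<tau> - c) \<longlonglongrightarrow> 0" using c(2) by (rule LIM_zero)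
    then show "(\<lambda>k. (e \<alpha> k - c * real k powr \<tau>) / real k powr \<tau>) \<longlonglongrightarrow> 0"
      by (rule Lim_transform_eventually) (use nz in \<open>eventually_elim, simp add: diff_divide_distrib\<close>)
  qed
  then show ?thesis using c(1) \<tau>_pos by blast
qed

lemma e_big_O: "\<exists>\<epsilon>>0. (\<lambda>k. e \<alpha> k / e 0 k - 1) \<in> O(\<lambda>k. real k powr (- 1 - \<epsilon>))"
proof -
  obtain c where c: "0 < c" "\<And>\<alpha>. (\<lambda>k. e \<alpha> k / real k powr \<tau>) \<longlonglongrightarrow> c" using e_asymptotics by blast
  obtain C where C: "\<forall>\<^sub>F k in sequentially. \<bar>e \<alpha> k - e 0 k\<bar> \<le> C * e 0 k powr (- 1 / \<beta>)"
    by (rule e_perturbation)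
  have lo: "\<forall>\<^sub>F k in sequentially. c / 2 < e 0 k / real k powr \<tau>"
    using c by (intro order_tendstoD(1)[OF c(2)]) auto
  \<comment> \<open>Here \<tau> p = 1, and 1 + 1/\<beta> exceeds \<open>p\<close> by the 1/2 that
    stems from the wave number; this surplus is what becomes \<epsilon> = \<tau>/2.\<close>
  have ex: "\<tau> * (1 + 1 / \<beta>) = 1 + \<tau> / 2"
  proof -
    have "1 + 1 / \<beta> = p + 1 / 2" by (simp add: p_def)
    moreover have "\<tau> * (p + 1 / 2) = 1 + \<tau> / 2" using p_pos by (simp add: \<tau>_def distrib_left)
    ultimately show ?thesis by (simp only:)
  qed
  have "\<forall>\<^sub>F k in sequentially. norm (e \<alpha> k / e 0 k - 1) \<le> (\<bar>C\<bar> * (c / 2) powr (- (1 + 1 / \<beta>))) * norm (real k powr (- 1 - \<tau> / 2))"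
    using C lo eventually_gt_at_top[of 0]
  proof eventually_elim
    case (elim k)
    have kp: "0 < real k powr \<tau>" using elim by simp
    have ge: "c / 2 * real k powr \<tau> \<le> e 0 k" using elim(2) kp by (simp add: pos_less_divide_eq)
    have pos: "0 < c / 2 * real k powr \<tau>" using c kp by simp
    have e0: "0 < e 0 k" using ge pos by linarith
    have "norm (e \<alpha> k / e 0 k - 1) = \<bar>e \<alpha> k - e 0 k\<bar> / e 0 k" using e0 by (simp add: field_simps)
    also have "\<dots> \<le> \<bar>C\<bar> * e 0 k powr (- 1 / \<beta>) / e 0 k"
    proof -
      have "C * e 0 k powr (- 1 / \<beta>) \<le> \<bar>C\<bar> * e 0 k powr (- 1 / \<beta>)" by (intro mult_right_mono) auto
      with elim(1) have "\<bar>e \<alpha> k - e 0 k\<bar> \<le> \<bar>C\<bar> * e 0 k powr (- 1 / \<beta>)" by (rule order_trans)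
      then show ?thesis using e0 by (intro divide_right_mono) auto
    qed
    also have "\<dots> = \<bar>C\<bar> * e 0 k powr (- (1 + 1 / \<beta>))"
    proof -
      have "- (1 + 1 / \<beta>) = - 1 / \<beta> - 1" by simp
      then have "e 0 k powr (- (1 + 1 / \<beta>)) = e 0 k powr (- 1 / \<beta>) / e 0 k"
        using e0 by (simp only: powr_diff powr_one)
      then show ?thesis by (simp only: times_divide_eq_right)
    qed
    also have "\<dots> \<le> \<bar>C\<bar> * (c / 2 * real k powr \<tau>) powr (- (1 + 1 / \<beta>))"
    proof -
      have "0 \<le> 1 / \<beta>" using \<beta> by simp
      then have "- (1 + 1 / \<beta>) \<le> 0" by linarith
      then show ?thesis using ge pos by (intro mult_left_mono powr_mono2') auto
    qed
    also have "(c / 2 * real k powr \<tau>) powr (- (1 + 1 / \<beta>)) = (c / 2) powr (- (1 + 1 / \<beta>)) * real k powr (\<tau> * (- (1 + 1 / \<beta>)))"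
      unfolding powr_mult powr_powr ..
    also have "\<tau> * (- (1 + 1 / \<beta>)) = - 1 - \<tau> / 2" using ex by (simp only: mult_minus_right)
    finally show ?case by (simp add: mult.assoc)
  qed
  then have "(\<lambda>k. e \<alpha> k / e 0 k - 1) \<in> O(\<lambda>k. real k powr (- 1 - \<tau> / 2))" by (rule bigoI)
  then show ?thesis using \<tau>_pos by (intro exI[of _ "\<tau> / 2"]) auto
qed

end

end

theorem corollary2p4:
  fixes \<beta> :: real and q :: "real \<Rightarrow> real"
  assumes "\<beta> > 0"
    and "compact (supp q)"
    and "piecewise_hoelder q"
  shows "bounded (range q) \<and> compact (supp q) \<and>
    (\<exists>ev :: real \<Rightarrow> nat \<Rightarrow> real. \<forall>\<alpha>.
       self_adjoint (T_op \<beta> q \<alpha>) \<and>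
       bounded_from_below (T_op \<beta> q \<alpha>) \<and>
       has_discrete_spectrum (T_op \<beta> q \<alpha>) \<and>
       enumerates_spectrum (T_op \<beta> q \<alpha>) (ev \<alpha>) \<and>
       strict_mono_on {1..} (ev \<alpha>) \<and>
       (\<exists>c \<tau>. c > 0 \<and> \<tau> > 0 \<and>
          (\<lambda>k. ev \<alpha> k - c * real k powr \<tau>) \<in> o(\<lambda>k. real k powr \<tau>)) \<and>
       (\<exists>\<epsilon>>0. (\<lambda>k. ev \<alpha> k / ev 0 k - 1) \<in> O(\<lambda>k. real k powr (- 1 - \<epsilon>))))"
proof (intro conjI)
  show b: "bounded (range q)" by (rule piecewise_hoelder_bounded[OF assms(2,3)])
  show "compact (supp q)" by fact
  obtain B where B: "\<And>x. \<bar>q x\<bar> \<le> B" using b by (auto simp: bounded_iff)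
  obtain r where r: "\<And>x. x \<in> supp q \<Longrightarrow> \<bar>x\<bar> \<le> r"
    using compact_imp_bounded[OF assms(2)] by (auto simp: bounded_iff)
  \<comment> \<open>The radius \<open>\<bar>r\<bar> + 1\<close> is at least 1 and lies strictly
    outside the support, so \<open>q\<close> vanishes already where |x| equals it.\<close>
  interpret power_family \<beta> B "\<bar>r\<bar> + 1" q
  proof
    show "q x = 0" if "\<bar>r\<bar> + 1 \<le> \<bar>x\<bar>" for x using that r[of x] by (intro zero_outside_supp) auto
    show "q \<in> borel_measurable borel" by (rule piecewise_hoelder_measurable[OF assms(3)])
    show "\<bar>q x\<bar> \<le> B" for x by (rule B)
  qed (use assms(1) in simp_all)
  have "\<exists>e :: nat \<Rightarrow> real. strict_mono_on {1..} e \<and> e ` {1..} = eigvals_of \<alpha>" for \<alpha>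
  proof -
    obtain e :: "nat \<Rightarrow> real" where "strict_mono_on {1..} e" "e ` {1..} = eigvals_of \<alpha>"
      by (rule enumerate_discrete[OF infinite_eigvals_of confining.finite_eigvals[OF conf]])
    then show ?thesis by blast
  qed
  \<comment> \<open>One enumeration is fixed for each coupling simultaneously; its value at \<alpha>
    = 0 is the denominator in (ii).\<close>
  then obtain e :: "real \<Rightarrow> nat \<Rightarrow> real" where e: "\<And>\<alpha>. strict_mono_on {1..} (e \<alpha>)" "\<And>\<alpha>. e \<alpha> ` {1..} = eigvals_of \<alpha>" by metis
  have T: "T_op \<beta> q \<alpha> = schroedinger (pot \<alpha>)" for \<alpha> by (simp add: T_op_def)
  show "\<exists>ev :: real \<Rightarrow> nat \<Rightarrow> real. \<forall>\<alpha>.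
       self_adjoint (T_op \<beta> q \<alpha>) \<and>
       bounded_from_below (T_op \<beta> q \<alpha>) \<and>
       has_discrete_spectrum (T_op \<beta> q \<alpha>) \<and>
       enumerates_spectrum (T_op \<beta> q \<alpha>) (ev \<alpha>) \<and>
       strict_mono_on {1..} (ev \<alpha>) \<and>
       (\<exists>c \<tau>. c > 0 \<and> \<tau> > 0 \<and>
          (\<lambda>k. ev \<alpha> k - c * real k powr \<tau>) \<in> o(\<lambda>k. real k powr \<tau>)) \<and>
       (\<exists>\<epsilon>>0. (\<lambda>k. ev \<alpha> k / ev 0 k - 1) \<in> O(\<lambda>k. real k powr (- 1 - \<epsilon>)))"
  proof (intro exI[of _ e] allI conjI)
    fix \<alpha>
    show "self_adjoint (T_op \<beta> q \<alpha>)" unfolding T by (rule confining.T_self_adjoint[OF conf])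
    show "bounded_from_below (T_op \<beta> q \<alpha>)" unfolding T by (rule confining.T_bounded_from_below[OF conf])
    show "has_discrete_spectrum (T_op \<beta> q \<alpha>)" unfolding T by (rule confining_discrete_spectrum(1)[OF conf])
    show "enumerates_spectrum (T_op \<beta> q \<alpha>) (e \<alpha>)" unfolding T by (rule confining_discrete_spectrum(2)[OF conf e])
    show "strict_mono_on {1..} (e \<alpha>)" by (rule e)
    show "\<exists>c \<tau>. c > 0 \<and> \<tau> > 0 \<and> (\<lambda>k. e \<alpha> k - c * real k powr \<tau>) \<in> o(\<lambda>k. real k powr \<tau>)"
      using e_small_o[OF e] by blast
    show "\<exists>\<epsilon>>0. (\<lambda>k. e \<alpha> k / e 0 k - 1) \<in> O(\<lambda>k. real k powr (- 1 - \<epsilon>))"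
      by (rule e_big_O[OF e])
  qed
qed

end
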